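(* Let $0<m\le n$ be fixed integers with $(m,n)\neq(1,1),(1,2)$. Among all Monge equations $\mathcal{E}$ $$y^{(m)}=F\bigl(x,y,y',\dots,y^{(m-1)},z,z',\dots,z^{(n)}\bigr)$$ of orders $(m,n)$ with $F_{z^{(n)}z^{(n)}}\ne0$, the most symmetric ones (those for which $\dim\operatorname{sym}(\mathcal{E})$ attains its maximal value) are (locally) internally equivalent to the equation $$y^{(m)}=\bigl(z^{(n)}\bigr)^2 .$$ The dimension of the symmetry algebra $\operatorname{sym}(\mathcal{E})$ of this last equation equals $2n+5$ for $m=1$, $n>2$ and equals $2n+4$ for $m>1$.
   Context: Here $y=y(x)$, $z=z(x)$ are unknown functions and $F$ is a smooth function; all considerations are local. A Monge equation of orders $(m,n)$ is viewed as the manifold $\mathcal{E}$ of dimension $m+n+2$ with coordinates $(x,y=y_0,y_1,\dots,y_{m-1},z=z_0,z_1,\dots,z_n)$ (where $y_i,z_j$ stand for $y^{(i)},z^{(j)}$), equipped with the rank 2 distribution $\Delta=\langle \mathcal{D}_x,\partial_{z_n}\rangle$, where $$\mathcal{D}_x=\partial_x+\sum_{i=0}^{m-2}y_{i+1}\partial_{y_i}+F\,\partial_{y_{m-1}}+\sum_{j=0}^{n-1}z_{j+1}\partial_{z_j}.$$ The algebra $\operatorname{sym}(\mathcal{E})$ is the Lie algebra of (local) infinitesimal internal symmetries, i.e. vector fields on $\mathcal{E}$ whose flow preserves $\Delta$. Two equations are internally equivalent if there is a (local) diffeomorphism between the corresponding manifolds $\mathcal{E},\mathcal{E}'$ carrying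 $\Delta$ to $\Delta'$. The condition $F_{z^{(n)}z^{(n)}}\neq0$ is required at every point. *)

theory Defs
  imports "HOL-Analysis.Analysis" "HOL-Library.Extended_Nat"
begin

section \<open>Smooth maps, vector fields and distributions\<close>

definition dir_deriv ::
  "'a \<Rightarrow> ('a::euclidean_space \<Rightarrow> 'b::real_normed_vector) \<Rightarrow> 'a \<Rightarrow> 'b"
  where "dir_deriv v f = (\<lambda>q. frechet_derivative f (at q) v)"

primrec Ck_on ::
  "nat \<Rightarrow> 'a set \<Rightarrow> ('a::euclidean_space \<Rightarrow> 'b::real_normed_vector) \<Rightarrow> bool"
where
  "Ck_on 0 U f \<longleftrightarrow> continuous_on U f"
| "Ck_on (Suc k) U f \<longleftrightarrow> (\<forall>q\<in>U. f differentiable at q) \<and> (\<forall>v. Ck_on k U (dir_deriv v f))"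

definition smooth_on ::
  "'a set \<Rightarrow> ('a::euclidean_space \<Rightarrow> 'b::real_normed_vector) \<Rightarrow> bool"
  where "smooth_on U f \<longleftrightarrow> (\<forall>k. Ck_on k U f)"

definition diffeomorphism ::
  "'a::euclidean_space set \<Rightarrow> 'a set \<Rightarrow> ('a \<Rightarrow> 'a) \<Rightarrow> ('a \<Rightarrow> 'a) \<Rightarrow> bool"
  where "diffeomorphism V V' f g \<longleftrightarrow>
    open V \<and> open V' \<and> homeomorphism V V' f g \<and> smooth_on V f \<and> smooth_on V' g"

text \<open>A distribution is a map assigning to each point a linear subspace of the tangent space.\<close>

definition carries_distribution ::
  "('a::euclidean_space \<Rightarrow> 'a) \<Rightarrow> 'a set \<Rightarrow> ('a \<Rightarrow> 'a set) \<Rightarrow> ('a \<Rightarrow> 'a set) \<Rightarrow> bool"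
  where "carries_distribution f V \<Delta> \<Delta>' \<longleftrightarrow>
    (\<forall>q\<in>V. frechet_derivative f (at q) ` \<Delta> q = \<Delta>' (f q))"

text \<open>The germ at \<open>p\<close> of the distribution \<open>\<Delta>\<close> on \<open>U\<close> is equivalent to a germ,
  at some point of \<open>U'\<close>, of the distribution \<open>\<Delta>'\<close>.\<close>

definition locally_equivalent_at ::
  "'a::euclidean_space \<Rightarrow> 'a set \<Rightarrow> ('a \<Rightarrow> 'a set) \<Rightarrow> 'a set \<Rightarrow> ('a \<Rightarrow> 'a set) \<Rightarrow> bool"
  where "locally_equivalent_at p U \<Delta> U' \<Delta>' \<longleftrightarrow>
    (\<exists>V V' f g. p \<in> V \<and> V \<subseteq> U \<and> V' \<subseteq> U' \<and> diffeomorphism V V' f g \<and>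
       carries_distribution f V \<Delta> \<Delta>')"

section \<open>Infinitesimal symmetries\<close>

definition local_flow ::
  "('a::euclidean_space \<Rightarrow> 'a) \<Rightarrow> 'a set \<Rightarrow> 'a set \<Rightarrow> real \<Rightarrow> (real \<Rightarrow> 'a \<Rightarrow> 'a) \<Rightarrow> bool"
  where "local_flow X V W \<epsilon> \<phi> \<longleftrightarrow>
    smooth_on ({-\<epsilon><..<\<epsilon>} \<times> W) (\<lambda>(t, q). \<phi> t q) \<and>
    (\<forall>q\<in>W. \<phi> 0 q = q \<and>
       (\<forall>t\<in>{-\<epsilon><..<\<epsilon>}. \<phi> t q \<in> V \<and>
          ((\<lambda>s. \<phi> s q) has_vector_derivative X (\<phi> t q)) (at t)))"

text \<open>Local flows of smooth vector fields exist and are unique, so it does not matter that the flow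
  is existentially quantified here.\<close>

definition flow_preserves ::
  "('a::euclidean_space \<Rightarrow> 'a) \<Rightarrow> 'a set \<Rightarrow> ('a \<Rightarrow> 'a set) \<Rightarrow> bool"
  where "flow_preserves X V \<Delta> \<longleftrightarrow>
    (\<forall>p\<in>V. \<exists>W \<epsilon> \<phi>. open W \<and> p \<in> W \<and> W \<subseteq> V \<and> \<epsilon> > 0 \<and> local_flow X V W \<epsilon> \<phi> \<and>
       (\<forall>t\<in>{-\<epsilon><..<\<epsilon>}. carries_distribution (\<phi> t) W \<Delta> \<Delta>))"

definition local_symmetries ::
  "'a::euclidean_space set \<Rightarrow> ('a \<Rightarrow> 'a set) \<Rightarrow> 'a \<Rightarrow> ('a \<Rightarrow> 'a) set"
  where "local_symmetries U \<Delta> p =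
    {X. \<exists>V. open V \<and> p \<in> V \<and> V \<subseteq> U \<and> smooth_on V X \<and> flow_preserves X V \<Delta>}"

text \<open>Linear independence of the germs at \<open>p\<close> of the vector fields \<open>X 0, \<dots>, X (k - 1)\<close>.\<close>

definition independent_germs ::
  "'a::euclidean_space \<Rightarrow> nat \<Rightarrow> (nat \<Rightarrow> 'a \<Rightarrow> 'a) \<Rightarrow> bool"
  where "independent_germs p k X \<longleftrightarrow>
    (\<forall>c :: nat \<Rightarrow> real. (\<forall>\<^sub>F q in nhds p. (\<Sum>i<k. c i *\<^sub>R X i q) = 0) \<longrightarrow> (\<forall>i<k. c i = 0))"

text \<open>The dimension of the space of germs at \<open>p\<close> of infinitesimal symmetries, as the supremum of
  the lengths of linearly independent families; it is \<open>\<infinity>\<close> if that space is infinite-dimensional.\<close>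

definition sym_dim ::
  "'a::euclidean_space set \<Rightarrow> ('a \<Rightarrow> 'a set) \<Rightarrow> 'a \<Rightarrow> enat"
  where "sym_dim U \<Delta> p =
    Sup {enat k | k. \<exists>X. (\<forall>i<k. X i \<in> local_symmetries U \<Delta> p) \<and> independent_germs p k X}"

section \<open>Monge equations\<close>

text \<open>The space with coordinates \<open>(x, y\<^sub>0, \<dots>, y\<^sub>m\<^sub>-\<^sub>1, z\<^sub>0, \<dots>, z\<^sub>n)\<close> is a Euclidean space of dimension
  \<open>m + n + 2\<close> whose standard basis is listed, in this order of the coordinates, as
  \<open>e 0, \<dots>, e (m + n + 1)\<close>.\<close>

definition jet_frame :: "nat \<Rightarrow> nat \<Rightarrow> (nat \<Rightarrow> 'a::euclidean_space) \<Rightarrow> bool"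
  where "jet_frame m n e \<longleftrightarrow> bij_betw e {..<m + n + 2} Basis"

definition d_x :: "(nat \<Rightarrow> 'a) \<Rightarrow> 'a::euclidean_space"
  where "d_x e = e 0"

definition d_y :: "(nat \<Rightarrow> 'a) \<Rightarrow> nat \<Rightarrow> 'a::euclidean_space"
  where "d_y e i = e (1 + i)"

definition d_z :: "nat \<Rightarrow> (nat \<Rightarrow> 'a) \<Rightarrow> nat \<Rightarrow> 'a::euclidean_space"
  where "d_z m e j = e (1 + m + j)"

definition coord_y :: "(nat \<Rightarrow> 'a) \<Rightarrow> nat \<Rightarrow> 'a::euclidean_space \<Rightarrow> real"
  where "coord_y e i p = p \<bullet> d_y e i"

definition coord_z :: "nat \<Rightarrow> (nat \<Rightarrow> 'a) \<Rightarrow> nat \<Rightarrow> 'a::euclidean_space \<Rightarrow> real"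
  where "coord_z m e j p = p \<bullet> d_z m e j"

definition total_derivative ::
  "nat \<Rightarrow> nat \<Rightarrow> (nat \<Rightarrow> 'a) \<Rightarrow> ('a \<Rightarrow> real) \<Rightarrow> 'a::euclidean_space \<Rightarrow> 'a"
  where "total_derivative m n e F p =
    d_x e + (\<Sum>i<m - 1. coord_y e (i + 1) p *\<^sub>R d_y e i) + F p *\<^sub>R d_y e (m - 1)
      + (\<Sum>j<n. coord_z m e (j + 1) p *\<^sub>R d_z m e j)"

definition monge_distribution ::
  "nat \<Rightarrow> nat \<Rightarrow> (nat \<Rightarrow> 'a) \<Rightarrow> ('a \<Rightarrow> real) \<Rightarrow> 'a::euclidean_space \<Rightarrow> 'a set"
  where "monge_distribution m n e F p = span {total_derivative m n e F p, d_z m e n}"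

text \<open>The right-hand side \<open>F\<close> is given on an open set \<open>U\<close>.\<close>

definition monge_equation ::
  "nat \<Rightarrow> nat \<Rightarrow> (nat \<Rightarrow> 'a) \<Rightarrow> 'a::euclidean_space set \<Rightarrow> ('a \<Rightarrow> real) \<Rightarrow> bool"
  where "monge_equation m n e U F \<longleftrightarrow>
    open U \<and> smooth_on U F \<and>
    (\<forall>q\<in>U. dir_deriv (d_z m e n) (dir_deriv (d_z m e n) F) q \<noteq> 0)"

definition monge_sym_dim ::
  "nat \<Rightarrow> nat \<Rightarrow> (nat \<Rightarrow> 'a) \<Rightarrow> 'a::euclidean_space set \<Rightarrow> ('a \<Rightarrow> real) \<Rightarrow> 'a \<Rightarrow> enat"
  where "monge_sym_dim m n e U F p = sym_dim U (monge_distribution m n e F) p"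

text \<open>All notions are local: a Monge equation is considered near a point \<open>p\<close> of its domain.\<close>

definition most_symmetric_at ::
  "nat \<Rightarrow> nat \<Rightarrow> (nat \<Rightarrow> 'a) \<Rightarrow> 'a::euclidean_space set \<Rightarrow> ('a \<Rightarrow> real) \<Rightarrow> 'a \<Rightarrow> bool"
  where "most_symmetric_at m n e U F p \<longleftrightarrow>
    monge_equation m n e U F \<and> p \<in> U \<and>
    (\<forall>U' F' p'. monge_equation m n e U' F' \<and> p' \<in> U' \<longrightarrow>
       monge_sym_dim m n e U' F' p' \<le> monge_sym_dim m n e U F p)"

definition internally_equivalent_at ::
  "nat \<Rightarrow> nat \<Rightarrow> (nat \<Rightarrow> 'a) \<Rightarrow> 'a::euclidean_space \<Rightarrow> 'a set \<Rightarrow> ('a \<Rightarrow> real)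
     \<Rightarrow> 'a set \<Rightarrow> ('a \<Rightarrow> real) \<Rightarrow> bool"
  where "internally_equivalent_at m n e p U F U' F' \<longleftrightarrow>
    locally_equivalent_at p U (monge_distribution m n e F) U' (monge_distribution m n e F')"

text \<open>The right-hand side of \<open>y\<^sup>(\<^sup>m\<^sup>) = (z\<^sup>(\<^sup>n\<^sup>))\<^sup>2\<close>.\<close>

definition model_rhs :: "nat \<Rightarrow> nat \<Rightarrow> (nat \<Rightarrow> 'a) \<Rightarrow> 'a::euclidean_space \<Rightarrow> real"
  where "model_rhs m n e p = (coord_z m e n p)\<^sup>2"

end

theory Submission
  imports Defs "HOL-Library.Function_Algebras"
begin

text \<open>Evaluate the components of a symmetry, and their derivatives along the frame obtained from \<open>\<D>\<^sub>x\<close>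
  and \<open>\<partial>\<^sub>z\<^sub>n\<close> by brackets, as functionals on the symmetry algebra, filtered by order minus weight. Up to lower
  order they satisfy the determining equations of the model, which express every functional through
  \<open>2n + 4\<close> of them (one more if \<open>m = 1\<close>). So a symmetry solves a closed linear system in these unknowns along the
  frame, which bounds the dimension.

  If the bound is attained, some symmetry in the isotropy at the base point induces the grading, and the
  eigenspaces of its adjoint action contain symmetries \<open>RT\<close>, \<open>RZ\<close> that extend the two horizontal directions and
  generate exactly the nilpotent algebra of the model. These form a frame with constant structure whose dual
  forms are integrated by the Poincare lemma to coordinates that carry the distribution to that of the
  model. The model itself attains the bound through explicit symmetries with explicit flows.\<close>

section \<open>Calculus of smooth maps\<close>

text \<open>Brackets of the adapted frame are controlled only modulo lower weight, so identities
  between functionals are read modulo lower degree. New relations have two sources: the chains end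
  (\<open>W (n + 1) = 0\<close>, \<open>Y (m + 1) = 0\<close>), and some values can be computed by
  two routes. The count \<open>2n + 4\<close> is made of \<open>m + n + 2\<close> components, the
  two weights \<open>T \<tau>\<close> and \<open>Z \<zeta>\<close>, and \<open>n - m\<close>
  derivatives of \<open>\<zeta>\<close> along \<open>T\<close>; the next such derivative is killed
  by \<open>W (n + 1) = 0\<close>. For \<open>m = 1\<close> a projective parameter survives as well.
  At (1,2) the relations degenerate: a coefficient to be inverted is (n^2 - 4) / 2, and y' = (z'')^2
  has the exceptional algebra of dimension 14. In the case of equality no curvature is computed. The
  grading element acts by minus the weight, so an eigenvector with no room in its weight must be
  zero, and this forces the brackets of \<open>RT\<close> and \<open>RZ\<close>. These fields are
  symmetries: they relate to the distribution as right-invariant fields on a group do to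
  left-invariant ones. Hence coordinates are first adapted to the symmetries, and the contact
  relations need a further uniqueness argument.\<close>

lemma has_derivative_cong_open:
  assumes "open U" "q \<in> U" "\<And>x. x \<in> U \<Longrightarrow> f x = g x"
  shows "(f has_derivative D) (at q) \<longleftrightarrow> (g has_derivative D) (at q)"
  using assms has_derivative_transform_within_open[of f D q UNIV U g]
    has_derivative_transform_within_open[of g D q UNIV U f] by auto

lemma frechet_derivative_cong_open:
  assumes "open U" "q \<in> U" "\<And>x. x \<in> U \<Longrightarrow> f x = g x"
  shows "frechet_derivative f (at q) = frechet_derivative g (at q)"
  unfolding frechet_derivative_def using has_derivative_cong_open[OF assms] by simp

lemma dir_deriv_eq: "(f has_derivative D) (at q) \<Longrightarrow> dir_deriv v f q = D v"
  unfolding dir_deriv_def using frechet_derivative_at by metis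

lemma frechet_derivative_linear: "f differentiable (at q) \<Longrightarrow> linear (frechet_derivative f (at q))"
  using frechet_derivative_works has_derivative_linear by blast

lemma Ck_on_cong:
  assumes "open U" "\<And>x. x \<in> U \<Longrightarrow> f x = g x" "Ck_on k U f"
  shows "Ck_on k U g"
  using assms(2,3)
proof (induction k arbitrary: f g)
  case 0
  thus ?case by (auto cong: continuous_on_cong)
next
  case (Suc k)
  have "g differentiable at q" if "q \<in> U" for q
  proof -
    have "f differentiable at q" using Suc.prems(2) that by simp
    then obtain D where "(f has_derivative D) (at q)"
      unfolding differentiable_def by blast
    hence "(g has_derivative D) (at q)"
      by (rule has_derivative_transform_within_open[OF _ assms(1) that]) (rule Suc.prems(1))
    thus ?thesis by (auto simp: differentiable_def)
  qed
  moreover have "Ck_on k U (dir_deriv v g)" for v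
  proof (rule Suc.IH[of "dir_deriv v f"])
    show "dir_deriv v f x = dir_deriv v g x" if "x \<in> U" for x
      using frechet_derivative_cong_open[OF assms(1) that, of f g] Suc.prems(1) by (simp add: dir_deriv_def)
  qed (use Suc.prems(2) in simp)
  ultimately show ?case by simp
qed

lemma Ck_on_subset: "Ck_on k U f \<Longrightarrow> V \<subseteq> U \<Longrightarrow> Ck_on k V f"
  by (induction k arbitrary: f) (auto intro: continuous_on_subset)

lemma Ck_on_SucD: "Ck_on (Suc k) U f \<Longrightarrow> Ck_on k U f"
proof (induction k arbitrary: f)
  case 0
  thus ?case
    by (auto intro!: continuous_at_imp_continuous_on differentiable_imp_continuous_within)
next
  case (Suc k)
  thus ?case by (simp only: Ck_on.simps(2)) blast
qed

lemma dir_deriv_const: "dir_deriv v (\<lambda>q. c) = (\<lambda>q. 0)"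
  by (rule ext) (simp add: dir_deriv_eq[OF has_derivative_const])

lemma Ck_on_const: "Ck_on k U (\<lambda>q. c)"
  by (induction k arbitrary: c) (auto simp: dir_deriv_const)

lemma Ck_on_linear:
  assumes "bounded_linear f" shows "Ck_on k U f"
proof (cases k)
  case 0
  thus ?thesis using assms by (simp add: linear_continuous_on)
next
  case (Suc j)
  have "dir_deriv v f = (\<lambda>q. f v)" for v
    by (rule ext) (rule dir_deriv_eq[OF bounded_linear_imp_has_derivative[OF assms]])
  thus ?thesis using Suc assms
    by (auto simp: Ck_on_const bounded_linear_imp_differentiable)
qed

lemma Ck_on_add:
  assumes "open U" "Ck_on k U f" "Ck_on k U g"
  shows "Ck_on k U (\<lambda>q. f q + g q)"
  using assms(2,3)
proof (induction k arbitrary: f g)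
  case 0
  thus ?case by (auto intro: continuous_intros)
next
  case (Suc k)
  have "Ck_on k U (dir_deriv v (\<lambda>q. f q + g q))" for v
  proof (rule Ck_on_cong[OF assms(1) _ Suc.IH[of "dir_deriv v f" "dir_deriv v g"]])
    fix q assume "q \<in> U"
    hence "(f has_derivative frechet_derivative f (at q)) (at q)"
      "(g has_derivative frechet_derivative g (at q)) (at q)"
      using Suc.prems by (auto simp: frechet_derivative_works)
    from dir_deriv_eq[OF has_derivative_add[OF this], of v]
    show "dir_deriv v f q + dir_deriv v g q = dir_deriv v (\<lambda>q. f q + g q) q"
      by (simp add: dir_deriv_def)
  qed (use Suc.prems in auto)
  thus ?case using Suc.prems by auto
qed

lemma Ck_on_bilinear:
  assumes "bounded_bilinear prd" "open U" "Ck_on k U f" "Ck_on k U g"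
  shows "Ck_on k U (\<lambda>q. prd (f q) (g q))"
  using assms(3,4)
proof (induction k arbitrary: f g)
  case 0
  thus ?case by (auto intro: bounded_bilinear.continuous_on[OF assms(1)])
next
  case (Suc k)
  have d: "((\<lambda>q. prd (f q) (g q)) has_derivative
      (\<lambda>h. prd (f q) (frechet_derivative g (at q) h) + prd (frechet_derivative f (at q) h) (g q))) (at q)"
    if "q \<in> U" for q
    using Suc.prems that
    by (intro bounded_bilinear.FDERIV[OF assms(1)]) (auto simp: frechet_derivative_works)
  have "Ck_on k U (dir_deriv v (\<lambda>q. prd (f q) (g q)))" for v
  proof (rule Ck_on_cong[OF assms(2)])
    show "prd (f q) (dir_deriv v g q) + prd (dir_deriv v f q) (g q)
        = dir_deriv v (\<lambda>q. prd (f q) (g q)) q" if "q \<in> U" for q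
      using dir_deriv_eq[OF d[OF that], of v] by (simp add: dir_deriv_def)
    show "Ck_on k U (\<lambda>q. prd (f q) (dir_deriv v g q) + prd (dir_deriv v f q) (g q))"
      using Suc.prems by (intro Ck_on_add assms(2) Suc.IH) (auto intro: Ck_on_SucD)
  qed
  moreover have "(\<lambda>q. prd (f q) (g q)) differentiable at q" if "q \<in> U" for q
    using d[OF that] by (auto simp: differentiable_def)
  ultimately show ?case by auto
qed

lemma Ck_on_sum:
  assumes "open U" "\<And>i. i \<in> I \<Longrightarrow> Ck_on k U (f i)"
  shows "Ck_on k U (\<lambda>q. \<Sum>i\<in>I. f i q)"
  using assms(2) by (induction I rule: infinite_finite_induct) (auto intro: Ck_on_const Ck_on_add assms(1))

lemma frechet_derivative_Basis:
  fixes h :: "'a::euclidean_space \<Rightarrow> 'b::real_normed_vector"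
  assumes "h differentiable (at q)"
  shows "frechet_derivative h (at q) v = (\<Sum>b\<in>Basis. (v \<bullet> b) *\<^sub>R dir_deriv b h q)"
proof -
  have l: "linear (frechet_derivative h (at q))" by (rule frechet_derivative_linear[OF assms])
  have "frechet_derivative h (at q) v = frechet_derivative h (at q) (\<Sum>b\<in>Basis. (v \<bullet> b) *\<^sub>R b)"
    by (simp add: euclidean_representation)
  also have "\<dots> = (\<Sum>b\<in>Basis. (v \<bullet> b) *\<^sub>R dir_deriv b h q)"
    by (simp add: linear_sum[OF l] linear_cmul[OF l] dir_deriv_def)
  finally show ?thesis .
qed

text \<open>\<open>Ck_on\<close> recurses through derivatives in fixed directions, so the chain rule
  is expanded in the standard basis: the inner derivative enters as scalar coefficients of such
  derivatives of \<open>h\<close>.\<close>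

lemma Ck_on_compose:
  fixes h :: "'b::euclidean_space \<Rightarrow> 'c::real_normed_vector" and g :: "'a::euclidean_space \<Rightarrow> 'b"
  assumes "open U" "open V" "\<And>q. q \<in> U \<Longrightarrow> g q \<in> V" "Ck_on k V h" "Ck_on k U g"
  shows "Ck_on k U (\<lambda>q. h (g q))"
  using assms(4,5)
proof (induction k arbitrary: h)
  case 0
  thus ?case using assms(3) continuous_on_compose2[of V h U g] by auto
next
  case (Suc k)
  have d: "((\<lambda>q. h (g q)) has_derivative
      (\<lambda>v. frechet_derivative h (at (g q)) (frechet_derivative g (at q) v))) (at q)"
    if "q \<in> U" for q
    using Suc.prems that assms(3)[OF that]
    by (intro has_derivative_compose[of g _ q UNIV h]) (auto simp: frechet_derivative_works)
  have "Ck_on k U (dir_deriv v (\<lambda>q. h (g q)))" for v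
  proof (rule Ck_on_cong[OF assms(1)])
    show "(\<Sum>b\<in>Basis. (dir_deriv v g q \<bullet> b) *\<^sub>R dir_deriv b h (g q))
        = dir_deriv v (\<lambda>q. h (g q)) q" if "q \<in> U" for q
      using dir_deriv_eq[OF d[OF that], of v] Suc.prems assms(3)[OF that]
      by (simp add: dir_deriv_def[of v g] frechet_derivative_Basis[of h])
    show "Ck_on k U (\<lambda>q. \<Sum>b\<in>Basis. (dir_deriv v g q \<bullet> b) *\<^sub>R dir_deriv b h (g q))"
      using Suc.prems assms
      by (intro Ck_on_sum Ck_on_bilinear[OF bounded_bilinear_scaleR] Ck_on_bilinear[OF bounded_bilinear_inner]
          Ck_on_const Suc.IH) (auto intro: Ck_on_SucD)
  qed
  moreover have "(\<lambda>q. h (g q)) differentiable at q" if "q \<in> U" for q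
    using d[OF that] by (auto simp: differentiable_def)
  ultimately show ?case by auto
qed

lemma Ck_on_inverse:
  fixes f :: "'a::euclidean_space \<Rightarrow> real"
  assumes "open U" "Ck_on k U f" "\<And>q. q \<in> U \<Longrightarrow> f q \<noteq> 0"
  shows "Ck_on k U (\<lambda>q. inverse (f q))"
  using assms(2)
proof (induction k)
  case 0
  thus ?case using assms(3) by (auto intro: continuous_intros)
next
  case (Suc k)
  have d: "((\<lambda>q. inverse (f q)) has_derivative
      (\<lambda>h. - (inverse (f q) * frechet_derivative f (at q) h * inverse (f q)))) (at q)"
    if "q \<in> U" for q
    using Suc.prems that assms(3)[OF that]
    by (intro Deriv.has_derivative_inverse) (auto simp: frechet_derivative_works)
  have ik: "Ck_on k U (\<lambda>q. inverse (f q))" using Suc Ck_on_SucD by blast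
  have "Ck_on k U (dir_deriv v (\<lambda>q. inverse (f q)))" for v
  proof (rule Ck_on_cong[OF assms(1)])
    show "(-1) * (inverse (f q) * dir_deriv v f q * inverse (f q))
        = dir_deriv v (\<lambda>q. inverse (f q)) q" if "q \<in> U" for q
      using dir_deriv_eq[OF d[OF that], of v] by (simp add: dir_deriv_def)
    show "Ck_on k U (\<lambda>q. (-1) * (inverse (f q) * dir_deriv v f q * inverse (f q)))"
      using Suc.prems ik
      by (intro Ck_on_bilinear[OF bounded_bilinear_mult] Ck_on_const assms(1)) auto
  qed
  moreover have "(\<lambda>q. inverse (f q)) differentiable at q" if "q \<in> U" for q
    using d[OF that] by (auto simp: differentiable_def)
  ultimately show ?case by auto
qed

section \<open>Smoothness of all orders\<close>

named_theorems smooth_intros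

lemma smooth_on_cong: "open U \<Longrightarrow> (\<And>x. x \<in> U \<Longrightarrow> f x = g x) \<Longrightarrow> smooth_on U f \<Longrightarrow> smooth_on U g"
  unfolding smooth_on_def using Ck_on_cong by blast

lemma smooth_on_subset: "smooth_on U f \<Longrightarrow> V \<subseteq> U \<Longrightarrow> smooth_on V f"
  unfolding smooth_on_def using Ck_on_subset by blast

lemma smooth_on_differentiable: "smooth_on U f \<Longrightarrow> q \<in> U \<Longrightarrow> f differentiable (at q)"
  unfolding smooth_on_def by (drule spec[of _ "Suc 0"]) simp

lemma smooth_on_has_derivative:
  "smooth_on U f \<Longrightarrow> q \<in> U \<Longrightarrow> (f has_derivative frechet_derivative f (at q)) (at q)"
  by (drule (1) smooth_on_differentiable) (simp add: frechet_derivative_works)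

lemma smooth_on_continuous: "smooth_on U f \<Longrightarrow> continuous_on U f"
  unfolding smooth_on_def by (drule spec[of _ 0]) simp

lemma smooth_on_dir_deriv [smooth_intros]: "smooth_on U f \<Longrightarrow> smooth_on U (dir_deriv v f)"
  unfolding smooth_on_def
proof
  fix k assume "\<forall>k. Ck_on k U f"
  hence "Ck_on (Suc k) U f" ..
  thus "Ck_on k U (dir_deriv v f)" by simp
qed

lemma smooth_onI_dir_deriv:
  "(\<And>q. q \<in> U \<Longrightarrow> f differentiable (at q)) \<Longrightarrow> (\<And>v. smooth_on U (dir_deriv v f)) \<Longrightarrow> smooth_on U f"
  unfolding smooth_on_def
proof
  fix k assume d: "\<And>q. q \<in> U \<Longrightarrow> f differentiable (at q)" "\<And>v. \<forall>k. Ck_on k U (dir_deriv v f)"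
  have "Ck_on (Suc k) U f" using d by auto
  thus "Ck_on k U f" by (rule Ck_on_SucD)
qed

lemma smooth_on_const [smooth_intros]: "smooth_on U (\<lambda>q. c)"
  by (simp add: smooth_on_def Ck_on_const)

lemma smooth_on_linear: "bounded_linear f \<Longrightarrow> smooth_on U f"
  by (simp add: smooth_on_def Ck_on_linear)

lemma smooth_on_id [smooth_intros]: "smooth_on U (\<lambda>q. q)"
  by (simp add: smooth_on_linear bounded_linear_ident)

lemma smooth_on_add [smooth_intros]:
  "open U \<Longrightarrow> smooth_on U f \<Longrightarrow> smooth_on U g \<Longrightarrow> smooth_on U (\<lambda>q. f q + g q)"
  by (simp add: smooth_on_def Ck_on_add)

lemma smooth_on_sum [smooth_intros]:
  "open U \<Longrightarrow> (\<And>i. i \<in> I \<Longrightarrow> smooth_on U (f i)) \<Longrightarrow> smooth_on U (\<lambda>q. \<Sum>i\<in>I. f i q)"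
  by (simp add: smooth_on_def Ck_on_sum)

lemma smooth_on_scaleR [smooth_intros]:
  "open U \<Longrightarrow> smooth_on U f \<Longrightarrow> smooth_on U g \<Longrightarrow> smooth_on U (\<lambda>q. f q *\<^sub>R g q)"
  by (simp add: smooth_on_def Ck_on_bilinear[OF bounded_bilinear_scaleR])

lemma smooth_on_inner [smooth_intros]:
  "open U \<Longrightarrow> smooth_on U f \<Longrightarrow> smooth_on U g \<Longrightarrow> smooth_on U (\<lambda>q. f q \<bullet> g q)"
  by (simp add: smooth_on_def Ck_on_bilinear[OF bounded_bilinear_inner])

lemma smooth_on_mult [smooth_intros]:
  fixes f g :: "'a::euclidean_space \<Rightarrow> real"
  shows "open U \<Longrightarrow> smooth_on U f \<Longrightarrow> smooth_on U g \<Longrightarrow> smooth_on U (\<lambda>q. f q * g q)"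
  by (simp add: smooth_on_def Ck_on_bilinear[OF bounded_bilinear_mult])

lemma smooth_on_minus [smooth_intros]:
  assumes "open U" "smooth_on U f" shows "smooth_on U (\<lambda>q. - f q)"
  using smooth_on_scaleR[OF assms(1) smooth_on_const[of U "-1"] assms(2)] by simp

lemma smooth_on_diff [smooth_intros]:
  assumes "open U" "smooth_on U f" "smooth_on U g" shows "smooth_on U (\<lambda>q. f q - g q)"
  using smooth_on_add[OF assms(1,2) smooth_on_minus[OF assms(1,3)]] by simp

lemma smooth_on_power [smooth_intros]:
  fixes f :: "'a::euclidean_space \<Rightarrow> real"
  shows "open U \<Longrightarrow> smooth_on U f \<Longrightarrow> smooth_on U (\<lambda>q. f q ^ k)"
  by (induction k) (auto intro: smooth_intros)

lemma smooth_on_inverse [smooth_intros]: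
  fixes f :: "'a::euclidean_space \<Rightarrow> real"
  shows "open U \<Longrightarrow> smooth_on U f \<Longrightarrow> (\<And>q. q \<in> U \<Longrightarrow> f q \<noteq> 0) \<Longrightarrow> smooth_on U (\<lambda>q. inverse (f q))"
  by (simp add: smooth_on_def Ck_on_inverse)

lemma smooth_on_divide [smooth_intros]:
  fixes f :: "'a::euclidean_space \<Rightarrow> real"
  shows "open U \<Longrightarrow> smooth_on U f \<Longrightarrow> smooth_on U g \<Longrightarrow> (\<And>q. q \<in> U \<Longrightarrow> g q \<noteq> 0) \<Longrightarrow> smooth_on U (\<lambda>q. f q / g q)"
  unfolding divide_inverse by (intro smooth_intros)

lemma smooth_on_compose:
  fixes h :: "'b::euclidean_space \<Rightarrow> 'c::real_normed_vector" and g :: "'a::euclidean_space \<Rightarrow> 'b"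
  shows "open U \<Longrightarrow> open V \<Longrightarrow> (\<And>q. q \<in> U \<Longrightarrow> g q \<in> V) \<Longrightarrow> smooth_on V h \<Longrightarrow> smooth_on U g
    \<Longrightarrow> smooth_on U (\<lambda>q. h (g q))"
  using Ck_on_compose unfolding smooth_on_def by blast

section \<open>Vector fields\<close>

definition lie_deriv :: "('a::euclidean_space \<Rightarrow> 'a) \<Rightarrow> ('a \<Rightarrow> 'b::real_normed_vector) \<Rightarrow> 'a \<Rightarrow> 'b"
  where "lie_deriv X f = (\<lambda>q. frechet_derivative f (at q) (X q))"

definition lie_bracket :: "('a::euclidean_space \<Rightarrow> 'a) \<Rightarrow> ('a \<Rightarrow> 'a) \<Rightarrow> 'a \<Rightarrow> 'a"
  where "lie_bracket X Y = (\<lambda>q. lie_deriv X Y q - lie_deriv Y X q)"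

lemma lie_deriv_eq: "(f has_derivative D) (at q) \<Longrightarrow> lie_deriv X f q = D (X q)"
  unfolding lie_deriv_def using frechet_derivative_at by metis

lemma lie_deriv_cong:
  "open U \<Longrightarrow> q \<in> U \<Longrightarrow> (\<And>x. x \<in> U \<Longrightarrow> f x = g x) \<Longrightarrow> X q = Y q \<Longrightarrow> lie_deriv X f q = lie_deriv Y g q"
  unfolding lie_deriv_def using frechet_derivative_cong_open[of U q f g] by simp

lemma lie_bracket_cong:
  "open U \<Longrightarrow> q \<in> U \<Longrightarrow> (\<And>x. x \<in> U \<Longrightarrow> X x = X' x) \<Longrightarrow> (\<And>x. x \<in> U \<Longrightarrow> Y x = Y' x)
    \<Longrightarrow> lie_bracket X Y q = lie_bracket X' Y' q"
  unfolding lie_bracket_def using lie_deriv_cong[of U q Y Y' X X'] lie_deriv_cong[of U q X X' Y Y'] by simp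

lemma lie_deriv_Basis:
  "smooth_on U f \<Longrightarrow> q \<in> U \<Longrightarrow> lie_deriv X f q = (\<Sum>b\<in>Basis. (X q \<bullet> b) *\<^sub>R dir_deriv b f q)"
  unfolding lie_deriv_def by (rule frechet_derivative_Basis) (rule smooth_on_differentiable)

lemma smooth_on_lie_deriv [smooth_intros]:
  assumes "open U" "smooth_on U X" "smooth_on U f" shows "smooth_on U (lie_deriv X f)"
proof (rule smooth_on_cong[OF assms(1)])
  show "smooth_on U (\<lambda>q. \<Sum>b\<in>Basis. (X q \<bullet> b) *\<^sub>R dir_deriv b f q)"
    using assms by (intro smooth_intros)
qed (simp add: lie_deriv_Basis[OF assms(3)])

lemma smooth_on_lie_bracket [smooth_intros]:
  "open U \<Longrightarrow> smooth_on U X \<Longrightarrow> smooth_on U Y \<Longrightarrow> smooth_on U (lie_bracket X Y)"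
  unfolding lie_bracket_def by (intro smooth_intros)

context
  fixes U :: "'a::euclidean_space set"
begin

lemma lie_deriv_const [simp]: "lie_deriv X (\<lambda>q. c) = (\<lambda>q. 0)"
  by (rule ext) (simp add: lie_deriv_eq[OF has_derivative_const])

lemma lie_deriv_add:
  "smooth_on U f \<Longrightarrow> smooth_on U g \<Longrightarrow> q \<in> U \<Longrightarrow> lie_deriv X (\<lambda>q. f q + g q) q = lie_deriv X f q + lie_deriv X g q"
  by (subst lie_deriv_eq[OF has_derivative_add[OF smooth_on_has_derivative smooth_on_has_derivative]])
    (auto simp: lie_deriv_def)

lemma lie_deriv_diff:
  "smooth_on U f \<Longrightarrow> smooth_on U g \<Longrightarrow> q \<in> U \<Longrightarrow> lie_deriv X (\<lambda>q. f q - g q) q = lie_deriv X f q - lie_deriv X g q"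
  by (subst lie_deriv_eq[OF has_derivative_diff[OF smooth_on_has_derivative smooth_on_has_derivative]])
    (auto simp: lie_deriv_def)

lemma lie_deriv_bilinear:
  assumes "bounded_bilinear prd"
  shows "smooth_on U f \<Longrightarrow> smooth_on U g \<Longrightarrow> q \<in> U
    \<Longrightarrow> lie_deriv X (\<lambda>q. prd (f q) (g q)) q = prd (f q) (lie_deriv X g q) + prd (lie_deriv X f q) (g q)"
  by (subst lie_deriv_eq[OF bounded_bilinear.FDERIV[OF assms smooth_on_has_derivative smooth_on_has_derivative]])
    (auto simp: lie_deriv_def)

lemmas lie_deriv_scaleR = lie_deriv_bilinear[OF bounded_bilinear_scaleR]
lemmas lie_deriv_mult = lie_deriv_bilinear[OF bounded_bilinear_mult]
lemmas lie_deriv_inner = lie_deriv_bilinear[OF bounded_bilinear_inner]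

lemma lie_deriv_sum:
  "(\<And>i. i \<in> I \<Longrightarrow> smooth_on U (f i)) \<Longrightarrow> q \<in> U
    \<Longrightarrow> lie_deriv X (\<lambda>q. \<Sum>i\<in>I. f i q) q = (\<Sum>i\<in>I. lie_deriv X (f i) q)"
  by (subst lie_deriv_eq[OF has_derivative_sum[OF smooth_on_has_derivative]])
    (auto simp: lie_deriv_def)

lemma lie_deriv_left_add:
  "smooth_on U f \<Longrightarrow> q \<in> U \<Longrightarrow> lie_deriv (\<lambda>q. X q + Y q) f q = lie_deriv X f q + lie_deriv Y f q"
  unfolding lie_deriv_def by (simp add: linear_add[OF frechet_derivative_linear[OF smooth_on_differentiable]])

lemma lie_deriv_left_scaleR:
  "smooth_on U f \<Longrightarrow> q \<in> U \<Longrightarrow> lie_deriv (\<lambda>q. s q *\<^sub>R X q) f q = s q *\<^sub>R lie_deriv X f q"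
  unfolding lie_deriv_def by (simp add: linear_cmul[OF frechet_derivative_linear[OF smooth_on_differentiable]])

lemma lie_deriv_left_sum:
  "smooth_on U f \<Longrightarrow> q \<in> U \<Longrightarrow> lie_deriv (\<lambda>q. \<Sum>i\<in>I. X i q) f q = (\<Sum>i\<in>I. lie_deriv (X i) f q)"
  unfolding lie_deriv_def by (simp add: linear_sum[OF frechet_derivative_linear[OF smooth_on_differentiable]])

text \<open>A Lie derivative sees only the value of the field at the point, so an expansion valid at
  the single point \<open>q\<close>, with constant coefficients, suffices.\<close>

lemma lie_deriv_left_at:
  assumes "smooth_on U f" "q \<in> U" "X q = (\<Sum>i\<in>I. c i *\<^sub>R Y i q)"
  shows "lie_deriv X f q = (\<Sum>i\<in>I. c i *\<^sub>R lie_deriv (Y i) f q)"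
proof -
  have l: "linear (frechet_derivative f (at q))"
    by (rule frechet_derivative_linear[OF smooth_on_differentiable[OF assms(1,2)]])
  show ?thesis unfolding lie_deriv_def assms(3) by (simp add: linear_sum[OF l] linear_cmul[OF l])
qed

end

section \<open>Mixed partial derivatives, commutators and the Jacobi identity\<close>

lemma line_has_real_derivative:
  fixes f :: "'a::euclidean_space \<Rightarrow> real"
  assumes "f differentiable (at (p + t *\<^sub>R u))"
  shows "((\<lambda>t. f (p + t *\<^sub>R u)) has_real_derivative dir_deriv u f (p + t *\<^sub>R u)) (at t)"
proof -
  have "((\<lambda>t. p + t *\<^sub>R u) has_derivative (\<lambda>h. h *\<^sub>R u)) (at t)"
    by (auto intro!: derivative_eq_intros)
  from has_derivative_compose[OF this, of f "frechet_derivative f (at (p + t *\<^sub>R u))"] assms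
  have "((\<lambda>t. f (p + t *\<^sub>R u)) has_derivative
      (\<lambda>h. frechet_derivative f (at (p + t *\<^sub>R u)) (h *\<^sub>R u))) (at t)"
    by (simp add: frechet_derivative_works)
  thus ?thesis
    using frechet_derivative_linear[OF assms]
    by (simp add: has_field_derivative_def linear_cmul dir_deriv_def mult.commute[of _ "frechet_derivative _ _ _"]
        cong: if_cong)
qed

text \<open>Two applications of the mean value theorem: in direction \<open>u\<close> to the
  difference of \<open>f\<close> across \<open>v\<close>, then in direction \<open>v\<close>. The
  left side is symmetric in \<open>u\<close> and \<open>v\<close>, which gives the symmetry of
  second derivatives.\<close>

lemma second_difference:
  fixes f :: "'a::euclidean_space \<Rightarrow> real"
  assumes "0 < s" and near: "\<And>a b. 0 \<le> a \<Longrightarrow> a \<le> s \<Longrightarrow> 0 \<le> b \<Longrightarrow> b \<le> s \<Longrightarrow> q + a *\<^sub>R u + b *\<^sub>R v \<in> U"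
    and "smooth_on U f"
  shows "\<exists>a b. 0 \<le> a \<and> a \<le> s \<and> 0 \<le> b \<and> b \<le> s \<and>
    f (q + s *\<^sub>R u + s *\<^sub>R v) - f (q + s *\<^sub>R u) - f (q + s *\<^sub>R v) + f q
      = s\<^sup>2 * dir_deriv v (dir_deriv u f) (q + a *\<^sub>R u + b *\<^sub>R v)"
proof -
  have df: "f differentiable (at (q + a *\<^sub>R u + b *\<^sub>R v))"
    "dir_deriv u f differentiable (at (q + a *\<^sub>R u + b *\<^sub>R v))"
    if "0 \<le> a" "a \<le> s" "0 \<le> b" "b \<le> s" for a b
    using near[OF that] assms(3) smooth_on_dir_deriv[OF assms(3), of u]
    by (auto intro: smooth_on_differentiable)
  let ?\<phi> = "\<lambda>x. f (q + s *\<^sub>R v + x *\<^sub>R u) - f (q + x *\<^sub>R u)"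
  have "\<exists>z>0. z < s \<and> ?\<phi> s - ?\<phi> 0 = (s - 0) *
      (dir_deriv u f (q + s *\<^sub>R v + z *\<^sub>R u) - dir_deriv u f (q + z *\<^sub>R u))"
  proof (rule MVT2[OF assms(1)])
    fix x assume "0 \<le> x" "x \<le> s"
    thus "(?\<phi> has_real_derivative dir_deriv u f (q + s *\<^sub>R v + x *\<^sub>R u) - dir_deriv u f (q + x *\<^sub>R u)) (at x)"
      using df(1)[of x s] df(1)[of x 0] assms(1)
      by (intro DERIV_diff line_has_real_derivative) (auto simp: algebra_simps)
  qed
  then obtain a where a: "0 < a" "a < s" "?\<phi> s - ?\<phi> 0 = s *
      (dir_deriv u f (q + s *\<^sub>R v + a *\<^sub>R u) - dir_deriv u f (q + a *\<^sub>R u))" by auto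
  let ?\<psi> = "\<lambda>y. dir_deriv u f (q + a *\<^sub>R u + y *\<^sub>R v)"
  have "\<exists>z>0. z < s \<and> ?\<psi> s - ?\<psi> 0 = (s - 0) * dir_deriv v (dir_deriv u f) (q + a *\<^sub>R u + z *\<^sub>R v)"
    using a df(2) by (intro MVT2[OF assms(1)] line_has_real_derivative) auto
  then obtain b where b: "0 < b" "b < s" "?\<psi> s - ?\<psi> 0 = s * dir_deriv v (dir_deriv u f) (q + a *\<^sub>R u + b *\<^sub>R v)"
    by auto
  have "q + s *\<^sub>R v + a *\<^sub>R u = q + a *\<^sub>R u + s *\<^sub>R v" "q + s *\<^sub>R v + s *\<^sub>R u = q + s *\<^sub>R u + s *\<^sub>R v"
    by (auto simp: algebra_simps)
  hence "f (q + s *\<^sub>R u + s *\<^sub>R v) - f (q + s *\<^sub>R u) - f (q + s *\<^sub>R v) + f q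
      = s\<^sup>2 * dir_deriv v (dir_deriv u f) (q + a *\<^sub>R u + b *\<^sub>R v)"
    using a(3) b(3) by (simp add: power2_eq_square algebra_simps)
  thus ?thesis using a b by (intro exI[of _ a] exI[of _ b]) auto
qed

lemma dir_deriv_commute_real:
  fixes f :: "'a::euclidean_space \<Rightarrow> real"
  assumes "open U" "q \<in> U" "smooth_on U f"
  shows "dir_deriv u (dir_deriv v f) q = dir_deriv v (dir_deriv u f) q"
proof (rule ccontr)
  let ?g = "dir_deriv u (dir_deriv v f)" and ?h = "dir_deriv v (dir_deriv u f)"
  assume ne: "?g q \<noteq> ?h q"
  define e where "e = \<bar>?g q - ?h q\<bar> / 2"
  have e: "e > 0" using ne by (simp add: e_def)
  have sg: "smooth_on U ?g" "smooth_on U ?h" by (intro smooth_intros assms)+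
  have "isCont ?g q" "isCont ?h q"
    using smooth_on_continuous[OF sg(1)] smooth_on_continuous[OF sg(2)] assms
    by (auto simp: continuous_on_eq_continuous_at)
  then obtain d1 d2 where d: "d1 > 0" "d2 > 0" "\<And>x. dist x q < d1 \<Longrightarrow> \<bar>?g x - ?g q\<bar> < e"
    "\<And>x. dist x q < d2 \<Longrightarrow> \<bar>?h x - ?h q\<bar> < e"
    using e unfolding continuous_at_eps_delta dist_real_def by metis
  obtain d3 where d3: "d3 > 0" "ball q d3 \<subseteq> U" using assms openE by blast
  \<comment> \<open>Inside radius \<open>r\<close> both mixed derivatives move by less than half of
    their supposed gap; \<open>s\<close> is so small that the parallelogram with sides
    \<open>s u\<close> and \<open>s v\<close> stays inside.\<close>
  define r where "r = min d1 (min d2 d3)"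
  define D where "D = norm u + norm v + 1"
  define s where "s = r / D / 2"
  have r: "r > 0" using d d3 by (simp add: r_def)
  have nn: "D > 0" by (simp add: add_nonneg_pos D_def)
  have s: "s > 0" using r nn by (simp add: s_def)
  have near: "dist (q + a *\<^sub>R u + b *\<^sub>R v) q < r" if "0 \<le> a" "a \<le> s" "0 \<le> b" "b \<le> s" for a b
  proof -
    have "dist (q + a *\<^sub>R u + b *\<^sub>R v) q = norm (a *\<^sub>R u + b *\<^sub>R v)" by (simp add: dist_norm)
    also have "\<dots> \<le> a * norm u + b * norm v"
      using that norm_triangle_ineq[of "a *\<^sub>R u" "b *\<^sub>R v"] by simp
    also have "\<dots> \<le> s * norm u + s * norm v"
      using that by (intro add_mono mult_right_mono) auto
    also have "\<dots> < s * D" using s by (simp add: algebra_simps D_def)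
    also have "\<dots> = r / 2" using nn by (simp add: s_def)
    also have "\<dots> < r" using r by simp
    finally show ?thesis .
  qed
  have inU: "q + a *\<^sub>R u + b *\<^sub>R v \<in> U" if "0 \<le> a" "a \<le> s" "0 \<le> b" "b \<le> s" for a b
    using near[OF that] d3 by (auto simp: r_def dist_commute)
  have inU': "q + a *\<^sub>R v + b *\<^sub>R u \<in> U" if "0 \<le> a" "a \<le> s" "0 \<le> b" "b \<le> s" for a b
    using inU[of b a] that by (simp add: algebra_simps)
  obtain a b where ab: "0 \<le> a" "a \<le> s" "0 \<le> b" "b \<le> s"
    "f (q + s *\<^sub>R u + s *\<^sub>R v) - f (q + s *\<^sub>R u) - f (q + s *\<^sub>R v) + f q = s\<^sup>2 * ?h (q + a *\<^sub>R u + b *\<^sub>R v)"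
    using second_difference[OF s inU assms(3)] by blast
  obtain a' b' where ab': "0 \<le> a'" "a' \<le> s" "0 \<le> b'" "b' \<le> s"
    "f (q + s *\<^sub>R v + s *\<^sub>R u) - f (q + s *\<^sub>R v) - f (q + s *\<^sub>R u) + f q = s\<^sup>2 * ?g (q + a' *\<^sub>R v + b' *\<^sub>R u)"
    using second_difference[OF s inU' assms(3)] by blast
  have sw: "q + s *\<^sub>R v + s *\<^sub>R u = q + s *\<^sub>R u + s *\<^sub>R v" by (simp add: algebra_simps)
  have "s\<^sup>2 * ?h (q + a *\<^sub>R u + b *\<^sub>R v) = s\<^sup>2 * ?g (q + a' *\<^sub>R v + b' *\<^sub>R u)"
    using ab(5) ab'(5)[unfolded sw] by linarith
  moreover have "q + a' *\<^sub>R v + b' *\<^sub>R u = q + b' *\<^sub>R u + a' *\<^sub>R v" by (simp add: algebra_simps)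
  ultimately have eq: "?h (q + a *\<^sub>R u + b *\<^sub>R v) = ?g (q + b' *\<^sub>R u + a' *\<^sub>R v)"
    using s by simp
  have "\<bar>?h (q + a *\<^sub>R u + b *\<^sub>R v) - ?h q\<bar> < e" "\<bar>?g (q + b' *\<^sub>R u + a' *\<^sub>R v) - ?g q\<bar> < e"
    using d(3,4) near[of a b] near[of b' a'] ab ab' by (auto simp: r_def)
  moreover have "2 * e = \<bar>?g q - ?h q\<bar>" by (simp add: e_def)
  ultimately show False using eq by (smt (verit))
qed

lemma dir_deriv_inner:
  assumes "f differentiable (at q)" shows "dir_deriv v (\<lambda>q. f q \<bullet> b) q = dir_deriv v f q \<bullet> b"
  using dir_deriv_eq[OF has_derivative_inner_left[OF assms[unfolded frechet_derivative_works]], of v b]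
  by (simp add: dir_deriv_def)

lemma dir_deriv_commute:
  fixes f :: "'a::euclidean_space \<Rightarrow> 'b::euclidean_space"
  assumes "open U" "q \<in> U" "smooth_on U f"
  shows "dir_deriv u (dir_deriv v f) q = dir_deriv v (dir_deriv u f) q"
proof (rule euclidean_eqI)
  fix b :: 'b assume "b \<in> Basis"
  have s: "smooth_on U (\<lambda>q. f q \<bullet> b)" by (intro smooth_intros assms)
  have e: "dir_deriv u (dir_deriv v f) q \<bullet> b = dir_deriv u (dir_deriv v (\<lambda>q. f q \<bullet> b)) q" for u v
  proof -
    have "dir_deriv u (dir_deriv v (\<lambda>q. f q \<bullet> b)) q = dir_deriv u (\<lambda>q. dir_deriv v f q \<bullet> b) q"
      unfolding dir_deriv_def[of u]
      using frechet_derivative_cong_open[OF assms(1,2), of "dir_deriv v (\<lambda>q. f q \<bullet> b)" "\<lambda>q. dir_deriv v f q \<bullet> b"]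
        dir_deriv_inner[OF smooth_on_differentiable[OF assms(3)]] by simp
    thus ?thesis
      using dir_deriv_inner[OF smooth_on_differentiable[OF smooth_on_dir_deriv[OF assms(3)] assms(2)]] by simp
  qed
  show "dir_deriv u (dir_deriv v f) q \<bullet> b = dir_deriv v (dir_deriv u f) q \<bullet> b"
    unfolding e by (rule dir_deriv_commute_real[OF assms(1,2) s])
qed

text \<open>In the standard basis the terms with second derivatives of \<open>f\<close> are
  symmetric in \<open>X\<close> and \<open>Y\<close> by \<open>dir_deriv_commute\<close> and cancel;
  the rest is the derivative along the bracket.\<close>

lemma lie_deriv_lie_bracket:
  fixes f :: "'a::euclidean_space \<Rightarrow> 'b::euclidean_space"
  assumes U: "open U" "q \<in> U" and s: "smooth_on U X" "smooth_on U Y" "smooth_on U f"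
  shows "lie_deriv (lie_bracket X Y) f q = lie_deriv X (lie_deriv Y f) q - lie_deriv Y (lie_deriv X f) q"
proof -
  have e: "lie_deriv X (lie_deriv Y f) q = (\<Sum>b\<in>Basis. (lie_deriv X Y q \<bullet> b) *\<^sub>R dir_deriv b f q)
     + (\<Sum>b\<in>Basis. \<Sum>c\<in>Basis. ((Y q \<bullet> b) * (X q \<bullet> c)) *\<^sub>R dir_deriv c (dir_deriv b f) q)"
    if "smooth_on U X" "smooth_on U Y" for X Y
  proof -
    have "lie_deriv X (lie_deriv Y f) q = lie_deriv X (\<lambda>q. \<Sum>b\<in>Basis. (Y q \<bullet> b) *\<^sub>R dir_deriv b f q) q"
      by (rule lie_deriv_cong[OF U]) (auto simp: lie_deriv_Basis[OF s(3)])
    also have "\<dots> = (\<Sum>b\<in>Basis. lie_deriv X (\<lambda>q. (Y q \<bullet> b) *\<^sub>R dir_deriv b f q) q)"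
      by (subst lie_deriv_sum[OF _ U(2)]) (auto intro!: smooth_intros s U that)
    also have "\<dots> = (\<Sum>b\<in>Basis. (Y q \<bullet> b) *\<^sub>R lie_deriv X (dir_deriv b f) q + (lie_deriv X Y q \<bullet> b) *\<^sub>R dir_deriv b f q)"
    proof (rule sum.cong[OF refl])
      fix b :: 'a
      have "lie_deriv X (\<lambda>q. Y q \<bullet> b) q = lie_deriv X Y q \<bullet> b"
        using lie_deriv_inner[OF that(2) smooth_on_const U(2), of X b] by simp
      thus "lie_deriv X (\<lambda>q. (Y q \<bullet> b) *\<^sub>R dir_deriv b f q) q
          = (Y q \<bullet> b) *\<^sub>R lie_deriv X (dir_deriv b f) q + (lie_deriv X Y q \<bullet> b) *\<^sub>R dir_deriv b f q"
        using that by (subst lie_deriv_scaleR[OF _ _ U(2)]) (auto intro!: smooth_intros s U)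
    qed
    also have "\<dots> = (\<Sum>b\<in>Basis. (Y q \<bullet> b) *\<^sub>R lie_deriv X (dir_deriv b f) q) + (\<Sum>b\<in>Basis. (lie_deriv X Y q \<bullet> b) *\<^sub>R dir_deriv b f q)"
      by (simp add: sum.distrib)
    also have "(\<Sum>b\<in>Basis. (Y q \<bullet> b) *\<^sub>R lie_deriv X (dir_deriv b f) q)
       = (\<Sum>b\<in>Basis. \<Sum>c\<in>Basis. ((Y q \<bullet> b) * (X q \<bullet> c)) *\<^sub>R dir_deriv c (dir_deriv b f) q)"
      by (simp add: lie_deriv_Basis[OF smooth_on_dir_deriv[OF s(3)] U(2)] scaleR_sum_right)
    finally show ?thesis by simp
  qed
  have sym: "(\<Sum>b\<in>Basis. \<Sum>c\<in>Basis. ((X q \<bullet> b) * (Y q \<bullet> c)) *\<^sub>R dir_deriv c (dir_deriv b f) q)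
      = (\<Sum>b\<in>Basis. \<Sum>c\<in>Basis. ((Y q \<bullet> b) * (X q \<bullet> c)) *\<^sub>R dir_deriv c (dir_deriv b f) q)"
    by (subst sum.swap) (intro sum.cong refl, simp add: dir_deriv_commute[OF U s(3)] mult.commute)
  have "lie_deriv X (lie_deriv Y f) q - lie_deriv Y (lie_deriv X f) q
      = (\<Sum>b\<in>Basis. (lie_bracket X Y q \<bullet> b) *\<^sub>R dir_deriv b f q)"
    unfolding e[OF s(1,2)] e[OF s(2,1)] sym
    by (simp add: lie_bracket_def inner_diff_left scaleR_diff_left sum_subtractf)
  thus ?thesis by (simp add: lie_deriv_Basis[OF s(3) U(2)])
qed

lemma lie_bracket_anti: "lie_bracket X Y q = - lie_bracket Y X q"
  by (simp add: lie_bracket_def)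

lemma lie_bracket_same [simp]: "lie_bracket X X q = 0"
  by (simp add: lie_bracket_def)

lemma lie_bracket_add_left:
  assumes "open U" "q \<in> U" "smooth_on U X" "smooth_on U Y" "smooth_on U Z"
  shows "lie_bracket (\<lambda>q. X q + Y q) Z q = lie_bracket X Z q + lie_bracket Y Z q"
  using assms by (simp add: lie_bracket_def lie_deriv_add[where U = U] lie_deriv_left_add[where U = U] algebra_simps)

lemma lie_bracket_add_right:
  assumes "open U" "q \<in> U" "smooth_on U X" "smooth_on U Y" "smooth_on U Z"
  shows "lie_bracket Z (\<lambda>q. X q + Y q) q = lie_bracket Z X q + lie_bracket Z Y q"
  using assms by (simp add: lie_bracket_def lie_deriv_add[where U = U] lie_deriv_left_add[where U = U] algebra_simps)

lemma lie_bracket_scaleR_right: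
  assumes "open U" "q \<in> U" "smooth_on U s" "smooth_on U X" "smooth_on U Z"
  shows "lie_bracket Z (\<lambda>q. s q *\<^sub>R X q) q = s q *\<^sub>R lie_bracket Z X q + lie_deriv Z s q *\<^sub>R X q"
  using assms by (simp add: lie_bracket_def lie_deriv_scaleR[where U = U] lie_deriv_left_scaleR[where U = U] algebra_simps)

lemma lie_bracket_scaleR_left:
  assumes "open U" "q \<in> U" "smooth_on U s" "smooth_on U X" "smooth_on U Z"
  shows "lie_bracket (\<lambda>q. s q *\<^sub>R X q) Z q = s q *\<^sub>R lie_bracket X Z q - lie_deriv Z s q *\<^sub>R X q"
  using assms by (simp add: lie_bracket_def lie_deriv_scaleR[where U = U] lie_deriv_left_scaleR[where U = U] algebra_simps)

lemma lie_bracket_sum_right: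
  assumes "open U" "q \<in> U" "\<And>i. i \<in> I \<Longrightarrow> smooth_on U (X i)" "smooth_on U Z"
  shows "lie_bracket Z (\<lambda>q. \<Sum>i\<in>I. X i q) q = (\<Sum>i\<in>I. lie_bracket Z (X i) q)"
  using assms by (simp add: lie_bracket_def lie_deriv_sum[where U = U] lie_deriv_left_sum[where U = U] sum_subtractf)

lemma lie_bracket_sum_scaleR_right:
  assumes "open U" "q \<in> U" "\<And>i. i \<in> I \<Longrightarrow> smooth_on U (s i)" "\<And>i. i \<in> I \<Longrightarrow> smooth_on U (X i)" "smooth_on U Z"
  shows "lie_bracket Z (\<lambda>q. \<Sum>i\<in>I. s i q *\<^sub>R X i q) q
    = (\<Sum>i\<in>I. s i q *\<^sub>R lie_bracket Z (X i) q + lie_deriv Z (s i) q *\<^sub>R X i q)"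
  using assms by (subst lie_bracket_sum_right[OF assms(1,2)])
    (auto intro!: smooth_intros sum.cong simp: lie_bracket_scaleR_right)

text \<open>\<open>lie_deriv_lie_bracket\<close> also applies to vector-valued functions, in
  particular to the coordinate maps of vector fields; after that the identity is formal.\<close>

lemma lie_bracket_jacobi:
  assumes U: "open U" "q \<in> U" and s: "smooth_on U X" "smooth_on U Y" "smooth_on U Z"
  shows "lie_bracket X (lie_bracket Y Z) q = lie_bracket (lie_bracket X Y) Z q + lie_bracket Y (lie_bracket X Z) q"
proof -
  have d: "lie_deriv A (lie_bracket B C) q = lie_deriv A (lie_deriv B C) q - lie_deriv A (lie_deriv C B) q"
    if "smooth_on U B" "smooth_on U C" for A B C :: "'a \<Rightarrow> 'a"
    unfolding lie_bracket_def by (rule lie_deriv_diff[OF _ _ U(2)]) (intro smooth_intros U that)+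
  show ?thesis
    unfolding lie_bracket_def[of _ "lie_bracket _ _"] lie_bracket_def[of "lie_bracket _ _"]
    using s by (simp add: d lie_deriv_lie_bracket[OF U])
qed

section \<open>Smooth frames, closed forms and linear systems\<close>

text \<open>A product rule in which \<open>g\<close> is merely continuous: as \<open>f\<close>
  vanishes at \<open>x\<close>, the variation of \<open>g\<close> contributes only a term of higher
  order. It serves to differentiate an inverse matrix before its differentiability is known.\<close>

lemma has_derivative_scaleR_vanishing:
  fixes f :: "'a::real_normed_vector \<Rightarrow> real" and g :: "'a \<Rightarrow> 'b::real_normed_vector"
  assumes f: "(f has_derivative f') (at x)" and f0: "f x = 0" and g: "isCont g x"
  shows "((\<lambda>y. f y *\<^sub>R g y) has_derivative (\<lambda>h. f' h *\<^sub>R g x)) (at x)"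
proof -
  have 1: "((\<lambda>y. f y *\<^sub>R g x) has_derivative (\<lambda>h. f' h *\<^sub>R g x)) (at x)"
    using f by (rule has_derivative_scaleR_left)
  have 2: "((\<lambda>y. f y *\<^sub>R (g y - g x)) has_derivative (\<lambda>h. 0)) (at x)"
  proof (subst has_derivative_at, intro conjI)
    obtain K where K: "\<And>h. norm (f' h) \<le> norm h * K"
      using bounded_linear.bounded[OF has_derivative_bounded_linear[OF f]] by blast
    have lim1: "((\<lambda>h. norm (f (x + h) - f x - f' h) / norm h) \<longlongrightarrow> 0) (at 0)"
      using f by (simp add: has_derivative_at)
    have lim2: "((\<lambda>h. norm (g (x + h) - g x)) \<longlongrightarrow> 0) (at 0)"
      using g unfolding isCont_iff by (intro tendsto_norm_zero LIM_zero)
    have "((\<lambda>h. (norm (f (x + h) - f x - f' h) / norm h + K) * norm (g (x + h) - g x)) \<longlongrightarrow> (0 + K) * 0) (at 0)"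
      by (intro tendsto_intros lim1 lim2)
    hence lim: "((\<lambda>h. (norm (f (x + h) - f x - f' h) / norm h + K) * norm (g (x + h) - g x)) \<longlongrightarrow> 0) (at 0)"
      by simp
    show "(\<lambda>h. norm (f (x + h) *\<^sub>R (g (x + h) - g x) - f x *\<^sub>R (g x - g x) - 0) / norm h) \<midarrow>0\<rightarrow> 0"
    proof (rule Lim_null_comparison[OF _ lim])
      show "\<forall>\<^sub>F h in at 0. norm (norm (f (x + h) *\<^sub>R (g (x + h) - g x) - f x *\<^sub>R (g x - g x) - 0) / norm h)
          \<le> (norm (f (x + h) - f x - f' h) / norm h + K) * norm (g (x + h) - g x)"
      proof (rule eventually_at_topological[THEN iffD2], intro exI[of _ UNIV] conjI ballI impI)
        fix h :: 'a assume h: "h \<noteq> 0"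
        have "\<bar>f (x + h)\<bar> \<le> norm (f (x + h) - f x - f' h) + norm (f' h)" using f0 by simp
        also have "\<dots> \<le> norm (f (x + h) - f x - f' h) + norm h * K" using K by simp
        finally have "\<bar>f (x + h)\<bar> / norm h \<le> norm (f (x + h) - f x - f' h) / norm h + K"
          using h by (simp add: divide_simps mult.commute)
        hence "\<bar>f (x + h)\<bar> / norm h * norm (g (x + h) - g x)
            \<le> (norm (f (x + h) - f x - f' h) / norm h + K) * norm (g (x + h) - g x)"
          by (rule mult_right_mono) simp
        thus "norm (norm (f (x + h) *\<^sub>R (g (x + h) - g x) - f x *\<^sub>R (g x - g x) - 0) / norm h)
          \<le> (norm (f (x + h) - f x - f' h) / norm h + K) * norm (g (x + h) - g x)" by simp
      qed auto
    qed
  qed simp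
  from has_derivative_add[OF 1 2] show ?thesis by (simp add: algebra_simps)
qed

text \<open>Everything comes from the resolvent identity \<open>diffN\<close>. It gives continuity
  of \<open>N\<close>, then its derivative; the formula for the derivative involves only
  \<open>N\<close> and the derivatives of \<open>A\<close>, so each class \<open>Ck_on k\<close> of
  \<open>N\<close> yields the next one.\<close>

lemma smooth_on_linear_inverse:
  fixes A N :: "'a::euclidean_space \<Rightarrow> 'b::euclidean_space \<Rightarrow> 'b"
  assumes U: "open U" and lin: "\<And>q. q \<in> U \<Longrightarrow> linear (A q)" and sm: "\<And>x. smooth_on U (\<lambda>q. A q x)"
    and inv: "\<And>q x. q \<in> U \<Longrightarrow> N q (A q x) = x" "\<And>q x. q \<in> U \<Longrightarrow> A q (N q x) = x"
  shows "smooth_on U (\<lambda>q. N q y)"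
proof -
  have linN: "linear (N q)" if "q \<in> U" for q
  proof (rule linearI)
    show "N q (a + b) = N q a + N q b" for a b
      using inv[OF that] linear_add[OF lin[OF that], of "N q a" "N q b"] by metis
    show "N q (c *\<^sub>R a) = c *\<^sub>R N q a" for c a
      using inv[OF that] linear_cmul[OF lin[OF that], of c "N q a"] by metis
  qed
  have diffN: "N q y - N q0 y = N q (A q0 (N q0 y) - A q (N q0 y))" if "q \<in> U" "q0 \<in> U" for q q0 y
    using inv[OF that(1)] inv[OF that(2)] by (simp add: linear_diff[OF linN[OF that(1)]])
  have Nexp: "N q w = (\<Sum>c\<in>Basis. (w \<bullet> c) *\<^sub>R N q c)" if "q \<in> U" for q w
  proof -
    have "N q w = N q (\<Sum>c\<in>Basis. (w \<bullet> c) *\<^sub>R c)" by (simp add: euclidean_representation)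
    thus ?thesis by (simp add: linear_sum[OF linN[OF that]] linear_cmul[OF linN[OF that]])
  qed
  have Aexp: "A q w = (\<Sum>c\<in>Basis. (w \<bullet> c) *\<^sub>R A q c)" if "q \<in> U" for q w
  proof -
    have "A q w = A q (\<Sum>c\<in>Basis. (w \<bullet> c) *\<^sub>R c)" by (simp add: euclidean_representation)
    thus ?thesis by (simp add: linear_sum[OF lin[OF that]] linear_cmul[OF lin[OF that]])
  qed
  have cont: "isCont (\<lambda>q. N q y) q0" if q0: "q0 \<in> U" for q0 y
  proof -
    have "inj (A q0)" by (rule inj_on_inverseI) (rule inv(1)[OF q0])
    then obtain B where B: "B > 0" "\<And>x. B * norm x \<le> norm (A q0 x)"
      using linear_inj_bounded_below_pos[OF lin[OF q0]] by blast
    define \<sigma> where "\<sigma> = (\<lambda>q. \<Sum>c\<in>Basis. norm (A q c - A q0 c))"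
    have cA: "isCont (\<lambda>q. A q x) q0" for x
      using smooth_on_continuous[OF sm] U q0 by (simp add: continuous_on_eq_continuous_at)
    have "isCont \<sigma> q0" unfolding \<sigma>_def by (intro continuous_intros cA)
    hence "(\<sigma> \<longlongrightarrow> 0) (at q0)" by (simp add: isCont_def \<sigma>_def)
    hence ev: "\<forall>\<^sub>F q in at q0. \<sigma> q < B / 2" using B by (intro order_tendstoD) auto
    have evU: "\<forall>\<^sub>F q in at q0. q \<in> U" using U q0 by (simp add: eventually_at_topological) blast
    have sb: "norm (A q x - A q0 x) \<le> \<sigma> q * norm x" if "q \<in> U" for q x
    proof -
      have "A q x - A q0 x = (\<Sum>c\<in>Basis. (x \<bullet> c) *\<^sub>R (A q c - A q0 c))"
        unfolding Aexp[OF that, of x] Aexp[OF q0, of x] by (simp add: sum_subtractf scaleR_diff_right)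
      also have "norm \<dots> \<le> (\<Sum>c\<in>Basis. norm x * norm (A q c - A q0 c))"
        by (intro sum_norm_le) (auto intro!: mult_right_mono Basis_le_norm)
      finally show ?thesis by (simp add: \<sigma>_def sum_distrib_left mult.commute)
    qed
    have nb: "norm (N q w) \<le> 2 / B * norm w" if "q \<in> U" "\<sigma> q < B / 2" for q w
    proof -
      have "B * norm (N q w) \<le> norm (A q0 (N q w))" by (rule B)
      also have "\<dots> \<le> norm (A q (N q w)) + norm (A q (N q w) - A q0 (N q w))"
        using norm_triangle_ineq4[of "A q (N q w)" "A q (N q w) - A q0 (N q w)"] by simp
      also have "\<dots> \<le> norm w + B / 2 * norm (N q w)"
        using sb[OF that(1), of "N q w"] that(2) inv[OF that(1)] mult_right_mono[of "\<sigma> q" "B/2" "norm (N q w)"] by fastforce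
      finally show ?thesis using B by (simp add: field_simps)
    qed
    have lim: "((\<lambda>q. 2 / B * norm (A q0 (N q0 y) - A q (N q0 y))) \<longlongrightarrow> 0) (at q0)"
      using cA[of "N q0 y"] unfolding isCont_def
      by (intro tendsto_mult_right_zero tendsto_norm_zero) (auto intro!: tendsto_eq_intros)
    have "((\<lambda>q. N q y - N q0 y) \<longlongrightarrow> 0) (at q0)"
    proof (rule Lim_null_comparison[OF _ lim], rule eventually_mono[OF eventually_conj[OF ev evU]])
      fix q assume "\<sigma> q < B / 2 \<and> q \<in> U"
      thus "norm (N q y - N q0 y) \<le> 2 / B * norm (A q0 (N q0 y) - A q (N q0 y))"
        using diffN[OF _ q0, of q y] nb[of q] by simp
    qed
    thus ?thesis unfolding isCont_def by (subst Lim_null)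
  qed
  have der: "((\<lambda>q. N q y) has_derivative
     (\<lambda>h. \<Sum>c\<in>Basis. (- (frechet_derivative (\<lambda>q. A q (N q0 y)) (at q0) h \<bullet> c)) *\<^sub>R N q0 c)) (at q0)"
    if q0: "q0 \<in> U" for q0 y
  proof -
    let ?n = "N q0 y"
    have d0: "((\<lambda>q. A q ?n) has_derivative frechet_derivative (\<lambda>q. A q ?n) (at q0)) (at q0)"
      by (rule smooth_on_has_derivative[OF sm q0])
    have "((\<lambda>q. (A q0 ?n - A q ?n) \<bullet> c) has_derivative (\<lambda>h. - (frechet_derivative (\<lambda>q. A q ?n) (at q0) h \<bullet> c))) (at q0)" for c
      using d0 by (auto intro!: derivative_eq_intros)
    hence "((\<lambda>q. \<Sum>c\<in>Basis. ((A q0 ?n - A q ?n) \<bullet> c) *\<^sub>R N q c) has_derivative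
      (\<lambda>h. \<Sum>c\<in>Basis. (- (frechet_derivative (\<lambda>q. A q ?n) (at q0) h \<bullet> c)) *\<^sub>R N q0 c)) (at q0)"
      by (intro has_derivative_sum has_derivative_scaleR_vanishing cont[OF q0]) auto
    from has_derivative_add[OF has_derivative_const[of ?n] this]
    have "((\<lambda>q. ?n + (\<Sum>c\<in>Basis. ((A q0 ?n - A q ?n) \<bullet> c) *\<^sub>R N q c)) has_derivative
      (\<lambda>h. \<Sum>c\<in>Basis. (- (frechet_derivative (\<lambda>q. A q ?n) (at q0) h \<bullet> c)) *\<^sub>R N q0 c)) (at q0)"
      by simp
    thus ?thesis
    proof (rule has_derivative_transform_within_open[OF _ U q0])
      fix q assume "q \<in> U"
      thus "?n + (\<Sum>c\<in>Basis. ((A q0 ?n - A q ?n) \<bullet> c) *\<^sub>R N q c) = N q y"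
        using diffN[OF _ q0, of q y] Nexp[of q "A q0 ?n - A q ?n"] by (simp add: algebra_simps)
    qed
  qed
  have dirA: "dir_deriv v (\<lambda>q. A q x) q = (\<Sum>b\<in>Basis. (x \<bullet> b) *\<^sub>R dir_deriv v (\<lambda>q. A q b) q)" if "q \<in> U" for q v x
  proof -
    have "((\<lambda>q. \<Sum>b\<in>Basis. (x \<bullet> b) *\<^sub>R A q b) has_derivative
        (\<lambda>h. \<Sum>b\<in>Basis. (x \<bullet> b) *\<^sub>R frechet_derivative (\<lambda>q. A q b) (at q) h)) (at q)"
      by (intro has_derivative_sum has_derivative_scaleR_right smooth_on_has_derivative[OF sm that])
    hence "((\<lambda>q. A q x) has_derivative
        (\<lambda>h. \<Sum>b\<in>Basis. (x \<bullet> b) *\<^sub>R frechet_derivative (\<lambda>q. A q b) (at q) h)) (at q)"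
      by (rule has_derivative_transform_within_open[OF _ U that]) (simp add: Aexp[symmetric])
    from dir_deriv_eq[OF this, of v] show ?thesis by (simp add: dir_deriv_def)
  qed
  have "Ck_on k U (\<lambda>q. N q y)" for k y
  proof (induction k arbitrary: y)
    case 0
    thus ?case using cont U by (simp add: continuous_on_eq_continuous_at)
  next
    case (Suc k)
    have "Ck_on k U (dir_deriv v (\<lambda>q. N q y))" for v
    proof (rule Ck_on_cong[OF U])
      show "(\<Sum>c\<in>Basis. (- 1 * (\<Sum>b\<in>Basis. (N q y \<bullet> b) *\<^sub>R (dir_deriv v (\<lambda>q. A q b) q \<bullet> c))) *\<^sub>R N q c)
          = dir_deriv v (\<lambda>q. N q y) q" if "q \<in> U" for q
        using dirA[OF that, of v "N q y"]
        unfolding dir_deriv_eq[OF der[OF that], of v] dir_deriv_def[of v "\<lambda>x. A x (N q y)"]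
        by (simp add: inner_sum_left)
      have "Ck_on k U (dir_deriv v (\<lambda>q. A q b))" for b
        using smooth_on_dir_deriv[OF sm] by (simp add: smooth_on_def)
      thus "Ck_on k U (\<lambda>q. \<Sum>c\<in>Basis. (- 1 * (\<Sum>b\<in>Basis. (N q y \<bullet> b) *\<^sub>R (dir_deriv v (\<lambda>q. A q b) q \<bullet> c))) *\<^sub>R N q c)"
        by (intro Ck_on_sum Ck_on_bilinear[OF bounded_bilinear_scaleR] Ck_on_bilinear[OF bounded_bilinear_inner]
            Ck_on_bilinear[OF bounded_bilinear_mult] Ck_on_const Suc.IH U)
    qed
    moreover have "(\<lambda>q. N q y) differentiable at q" if "q \<in> U" for q
      using der[OF that] by (auto simp: differentiable_def)
    ultimately show ?case by simp
  qed
  thus ?thesis by (simp add: smooth_on_def)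
qed

text \<open>The primitive is the integral of \<open>\<omega>\<close> along the segments from
  \<open>p\<close>. Closedness turns the derivative of the integrand into the
  \<open>t\<close>-derivative of \<open>t *\<^sub>R \<omega> (p + t *\<^sub>R (x - p))\<close>,
  which integrates to \<open>\<omega> x\<close>.\<close>

lemma poincare_ball:
  fixes \<omega> :: "'a::euclidean_space \<Rightarrow> 'a"
  assumes r: "r > 0" and sm: "smooth_on (ball p r) \<omega>"
    and closed: "\<And>q u v. q \<in> ball p r \<Longrightarrow> dir_deriv u \<omega> q \<bullet> v = dir_deriv v \<omega> q \<bullet> u"
  shows "\<exists>f. smooth_on (ball p r) f \<and> f p = 0 \<and>
    (\<forall>q\<in>ball p r. (f has_derivative (\<lambda>v. \<omega> q \<bullet> v)) (at q))"
proof -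
  let ?U = "ball p r"
  have inU: "p + t *\<^sub>R (x - p) \<in> ?U" if "x \<in> ?U" "0 \<le> t" "t \<le> 1" for x t
  proof -
    have "norm (t *\<^sub>R (x - p)) \<le> 1 * norm (x - p)" using that mult_left_le_one_le[of "norm (x - p)" t] by simp
    thus ?thesis using that by (simp add: dist_norm norm_minus_commute)
  qed
  define G where "G = (\<lambda>x t. t *\<^sub>R frechet_derivative \<omega> (at (p + t *\<^sub>R (x - p))) (x - p) + \<omega> (p + t *\<^sub>R (x - p)))"
  define f where "f = (\<lambda>x. integral (cbox 0 1) (\<lambda>t::real. \<omega> (p + t *\<^sub>R (x - p)) \<bullet> (x - p)))"
  have dline: "((\<lambda>x. p + t *\<^sub>R (x - p)) has_derivative (\<lambda>h. t *\<^sub>R h)) (at x within S)" for t x S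
    by (auto intro!: derivative_eq_intros)
  have fx: "((\<lambda>x. \<omega> (p + t *\<^sub>R (x - p)) \<bullet> (x - p)) has_derivative
      blinfun_apply (blinfun_inner_right (G x t))) (at x within ?U)" if x: "x \<in> ?U" and t: "t \<in> cbox 0 1" for x t
  proof -
    have t': "0 \<le> t" "t \<le> 1" using t by auto
    let ?y = "p + t *\<^sub>R (x - p)"
    have y: "?y \<in> ?U" by (rule inU[OF x t'])
    have lin: "linear (frechet_derivative \<omega> (at ?y))"
      by (rule frechet_derivative_linear[OF smooth_on_differentiable[OF sm y]])
    have "((\<lambda>x. \<omega> (p + t *\<^sub>R (x - p))) has_derivative (\<lambda>h. frechet_derivative \<omega> (at ?y) (t *\<^sub>R h))) (at x within ?U)"
      by (rule has_derivative_compose[OF dline smooth_on_has_derivative[OF sm y]])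
    from has_derivative_inner[OF this has_derivative_diff[OF has_derivative_ident has_derivative_const]]
    have d1: "((\<lambda>x. \<omega> (p + t *\<^sub>R (x - p)) \<bullet> (x - p)) has_derivative
      (\<lambda>h. \<omega> ?y \<bullet> h + frechet_derivative \<omega> (at ?y) (t *\<^sub>R h) \<bullet> (x - p))) (at x within ?U)" by simp
    have d2: "frechet_derivative \<omega> (at ?y) (t *\<^sub>R h) \<bullet> (x - p)
        = t * (frechet_derivative \<omega> (at ?y) (x - p) \<bullet> h)" for h
      using closed[OF y, of h "x - p"] by (simp add: dir_deriv_def linear_cmul[OF lin])
    show ?thesis
      by (rule has_derivative_eq_rhs[OF d1]) (simp add: fun_eq_iff G_def inner_add_left d2)
  qed
  have contline: "continuous_on (?U \<times> cbox 0 1) (\<lambda>(x, t). p + t *\<^sub>R (x - p))"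
    unfolding split_def by (intro continuous_intros)
  have cw: "continuous_on (?U \<times> cbox 0 1) (\<lambda>(x, t). h (p + t *\<^sub>R (x - p)))"
    if "smooth_on ?U h" for h :: "'a \<Rightarrow> 'a"
  proof -
    have "continuous_on (?U \<times> cbox 0 1) (h \<circ> (\<lambda>(x, t). p + t *\<^sub>R (x - p)))"
      by (rule continuous_on_compose[OF contline continuous_on_subset[OF smooth_on_continuous[OF that]]])
        (use inU in auto)
    thus ?thesis by (simp add: o_def split_def)
  qed
  have Gexp: "G x t = t *\<^sub>R (\<Sum>b\<in>Basis. ((x - p) \<bullet> b) *\<^sub>R dir_deriv b \<omega> (p + t *\<^sub>R (x - p))) + \<omega> (p + t *\<^sub>R (x - p))"
    if "x \<in> ?U" "t \<in> cbox 0 1" for x t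
    using inU[OF that(1)] that(2) by (simp add: G_def frechet_derivative_Basis[OF smooth_on_differentiable[OF sm]])
  have contG: "continuous_on (?U \<times> cbox 0 1) (\<lambda>(x, t). G x t)"
  proof (rule continuous_on_cong[THEN iffD1])
    show "continuous_on (?U \<times> cbox 0 1) (\<lambda>z. snd z *\<^sub>R (\<Sum>b\<in>Basis. ((fst z - p) \<bullet> b) *\<^sub>R
        (\<lambda>(x, t). dir_deriv b \<omega> (p + t *\<^sub>R (x - p))) z) + (\<lambda>(x, t). \<omega> (p + t *\<^sub>R (x - p))) z)"
      by (intro continuous_intros cw smooth_on_dir_deriv sm)
  qed (auto simp: Gexp)
  have contG1: "continuous_on (cbox 0 1) (G x)" if "x \<in> ?U" for x
  proof -
    have "continuous_on (cbox 0 1) ((\<lambda>(x, t). G x t) \<circ> (\<lambda>t. (x, t)))"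
      by (rule continuous_on_compose[OF _ continuous_on_subset[OF contG]])
        (use that in \<open>auto intro!: continuous_intros\<close>)
    thus ?thesis by (simp add: o_def)
  qed
  have int: "(\<lambda>t. \<omega> (p + t *\<^sub>R (x - p)) \<bullet> (x - p)) integrable_on cbox 0 1" if "x \<in> ?U" for x
  proof (rule integrable_continuous, intro continuous_intros)
    have "continuous_on (cbox 0 1) ((\<lambda>(x, t). \<omega> (p + t *\<^sub>R (x - p))) \<circ> (\<lambda>t. (x, t)))"
      by (rule continuous_on_compose[OF _ continuous_on_subset[OF cw[OF sm]]])
        (use that in \<open>auto intro!: continuous_intros\<close>)
    thus "continuous_on (cbox 0 1) (\<lambda>t. \<omega> (p + t *\<^sub>R (x - p)))" by (simp add: o_def)
  qed
  have intG: "(G x has_integral \<omega> x) (cbox 0 1)" if x: "x \<in> ?U" for x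
  proof -
    have "(G x has_integral (1 *\<^sub>R \<omega> (p + 1 *\<^sub>R (x - p)) - 0 *\<^sub>R \<omega> (p + 0 *\<^sub>R (x - p)))) {0..1}"
    proof (rule fundamental_theorem_of_calculus)
      fix t :: real assume t: "t \<in> {0..1}"
      hence y: "p + t *\<^sub>R (x - p) \<in> ?U" using inU[OF x] by auto
      have "((\<lambda>t. p + t *\<^sub>R (x - p)) has_vector_derivative (x - p)) (at t within {0..1})"
        by (auto intro!: derivative_eq_intros)
      from vector_derivative_diff_chain_within[OF this has_derivative_at_withinI[OF smooth_on_has_derivative[OF sm y]]]
      have "((\<lambda>t. \<omega> (p + t *\<^sub>R (x - p))) has_vector_derivative
         frechet_derivative \<omega> (at (p + t *\<^sub>R (x - p))) (x - p)) (at t within {0..1})" by (simp add: o_def)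
      from has_vector_derivative_scaleR[OF DERIV_ident this]
      show "((\<lambda>t. t *\<^sub>R \<omega> (p + t *\<^sub>R (x - p))) has_vector_derivative G x t) (at t within {0..1})"
        by (simp add: G_def add.commute)
    qed simp
    thus ?thesis by simp
  qed
  have df: "(f has_derivative (\<lambda>v. \<omega> q \<bullet> v)) (at q)" if q: "q \<in> ?U" for q
  proof -
    have "continuous_on (?U \<times> cbox 0 1) (\<lambda>z. blinfun_inner_right ((\<lambda>(x, t). G x t) z))"
      by (intro continuous_intros contG)
    hence c: "continuous_on (?U \<times> cbox 0 1) (\<lambda>(x, t). blinfun_inner_right (G x t))"
      by (simp add: split_def)
    have "(f has_derivative blinfun_apply (integral (cbox 0 1) (\<lambda>t. blinfun_inner_right (G q t)))) (at q within ?U)"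
      unfolding f_def by (rule leibniz_rule[OF fx int c q convex_ball])
    moreover have "integral (cbox 0 1) (\<lambda>t. blinfun_inner_right (G q t)) = blinfun_inner_right (\<omega> q)"
      using has_integral_linear[OF intG[OF q] bounded_linear_blinfun_inner_right]
      by (simp add: o_def integral_unique)
    ultimately show ?thesis using at_within_open[OF q] by simp
  qed
  have "smooth_on ?U f"
  proof (rule smooth_onI_dir_deriv)
    show "f differentiable at q" if "q \<in> ?U" for q using df[OF that] by (auto simp: differentiable_def)
    show "smooth_on ?U (dir_deriv v f)" for v
      by (rule smooth_on_cong[of _ "\<lambda>q. \<omega> q \<bullet> v"]) (auto simp: dir_deriv_eq[OF df] intro!: smooth_intros sm)
  qed
  moreover have "f p = 0" by (simp add: f_def)
  ultimately show ?thesis using df by blast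
qed

section \<open>Frames, dual coframes, and closed forms prescribed on a frame\<close>

text \<open>One-forms are represented by vectors through the inner product; \<open>eps\<close> is
  the coframe dual to \<open>E\<close>.\<close>

definition smooth_frame :: "'a::euclidean_space set \<Rightarrow> 'i set \<Rightarrow> ('i \<Rightarrow> 'a \<Rightarrow> 'a) \<Rightarrow> ('i \<Rightarrow> 'a \<Rightarrow> 'a) \<Rightarrow> bool"
  where "smooth_frame U I E eps \<longleftrightarrow> open U \<and> finite I \<and> (\<forall>c\<in>I. smooth_on U (E c) \<and> smooth_on U (eps c)) \<and>
    (\<forall>q\<in>U. \<forall>v. (\<Sum>c\<in>I. (eps c q \<bullet> v) *\<^sub>R E c q) = v) \<and>
    (\<forall>q\<in>U. \<forall>c\<in>I. \<forall>d\<in>I. eps c q \<bullet> E d q = (if c = d then 1 else 0))"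

text \<open>Indexing the standard basis by \<open>I\<close> turns the question whether a family is a
  basis into injectivity of one endomorphism.\<close>

lemma frame_matrix:
  fixes v :: "'i \<Rightarrow> 'a::euclidean_space"
  assumes \<beta>: "bij_betw \<beta> I (Basis :: 'a set)"
  defines "A \<equiv> \<lambda>x. \<Sum>c\<in>I. (x \<bullet> \<beta> c) *\<^sub>R v c"
  shows "linear A" "d \<in> I \<Longrightarrow> A (\<beta> d) = v d" "span (v ` I) = UNIV \<longleftrightarrow> inj A"
proof -
  have I: "finite I" using bij_betw_finite[OF \<beta>] by simp
  show lin: "linear A"
    unfolding A_def by (intro linear_compose_sum ballI linearI) (auto simp: algebra_simps inner_add_left)
  show A\<beta>: "A (\<beta> d) = v d" if "d \<in> I" for d
  proof -
    have "A (\<beta> d) = (\<Sum>c\<in>I. if c = d then v c else 0)"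
      unfolding A_def using that bij_betwE[OF \<beta>] bij_betw_imp_inj_on[OF \<beta>]
      by (intro sum.cong refl) (simp add: inner_Basis inj_on_eq_iff)
    thus ?thesis using that I by simp
  qed
  have "range A = span (v ` I)"
  proof
    show "range A \<subseteq> span (v ` I)" by (auto simp: A_def intro!: span_sum intro: span_scale span_base)
    have "v ` I \<subseteq> range A" using A\<beta>[symmetric] by auto
    thus "span (v ` I) \<subseteq> range A"
      by (rule span_minimal) (use lin linear_subspace_image subspace_UNIV in blast)
  qed
  thus "span (v ` I) = UNIV \<longleftrightarrow> inj A"
    using linear_injective_imp_surjective[OF lin] linear_surjective_imp_injective[OF lin] by auto
qed

lemma smooth_frame_exists:
  fixes E :: "'i \<Rightarrow> 'a::euclidean_space \<Rightarrow> 'a"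
  assumes "open U" "finite I" "card I = DIM('a)" "\<And>c. c \<in> I \<Longrightarrow> smooth_on U (E c)"
    and span: "\<And>q. q \<in> U \<Longrightarrow> span ((\<lambda>c. E c q) ` I) = UNIV"
  shows "\<exists>eps. smooth_frame U I E eps"
proof -
  obtain \<beta> where \<beta>: "bij_betw \<beta> I (Basis :: 'a set)"
    using finite_same_card_bij[of I "Basis::'a set"] assms by auto
  note m = frame_matrix[OF \<beta>]
  have orth: "\<beta> c \<bullet> \<beta> d = (if c = d then 1 else 0)" if "c \<in> I" "d \<in> I" for c d
    using that bij_betwE[OF \<beta>] bij_betw_imp_inj_on[OF \<beta>] by (simp add: inner_Basis inj_on_eq_iff)
  define A where "A = (\<lambda>q x. \<Sum>c\<in>I. (x \<bullet> \<beta> c) *\<^sub>R E c q)"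
  define N where "N = (\<lambda>q. inv (A q))"
  have lin: "linear (A q)" for q unfolding A_def by (rule m)
  have A\<beta>: "A q (\<beta> d) = E d q" if "d \<in> I" for q d unfolding A_def by (rule m(2)[OF that, of "\<lambda>c. E c q"])
  have inj: "inj (A q)" if "q \<in> U" for q using m(3)[of "\<lambda>c. E c q"] span[OF that] by (simp add: A_def)
  have surj: "surj (A q)" if "q \<in> U" for q
    by (rule linear_injective_imp_surjective[OF lin inj[OF that] refl])
  have inv: "N q (A q x) = x" "A q (N q x) = x" if "q \<in> U" for q x
    using inj[OF that] surj[OF that] by (auto simp: N_def surj_f_inv_f)
  have linN: "linear (N q)" if "q \<in> U" for q
    unfolding N_def using inj_linear_imp_inv_linear[OF lin inj[OF that]] .
  have smN: "smooth_on U (\<lambda>q. N q y)" for y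
    by (rule smooth_on_linear_inverse[OF assms(1) lin _ inv]) (auto simp: A_def intro!: smooth_intros assms)
  \<comment> \<open>The vector representing the linear form
    \<open>\<lambda>v. N q v \<bullet> \<beta> c\<close>, that is, a row of the inverse
    matrix.\<close>
  define eps where "eps = (\<lambda>c q. \<Sum>b\<in>Basis. (N q b \<bullet> \<beta> c) *\<^sub>R b)"
  have eps: "eps c q \<bullet> v = N q v \<bullet> \<beta> c" if "q \<in> U" for c q v
  proof -
    have "N q v = (\<Sum>b\<in>Basis. (v \<bullet> b) *\<^sub>R N q b)"
      using linear_sum[OF linN[OF that], of "\<lambda>b. (v \<bullet> b) *\<^sub>R b" Basis] linear_cmul[OF linN[OF that]]
      by (simp add: euclidean_representation)
    thus ?thesis
      by (simp add: eps_def inner_sum_left inner_commute[of v] mult.commute)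
  qed
  have "smooth_frame U I E eps"
    unfolding smooth_frame_def
  proof (intro conjI ballI allI)
    show "smooth_on U (eps c)" for c unfolding eps_def by (intro smooth_intros smN assms)
    show "(\<Sum>c\<in>I. (eps c q \<bullet> v) *\<^sub>R E c q) = v" if "q \<in> U" for q v
      using inv(2)[OF that, of v] by (simp add: eps[OF that] A_def)
    show "eps c q \<bullet> E d q = (if c = d then 1 else 0)" if "q \<in> U" "c \<in> I" "d \<in> I" for q c d
      using inv(1)[OF that(1), of "\<beta> d"] A\<beta>[OF that(3), of q] orth[OF that(3,2)] by (simp add: eps[OF that(1)])
  qed (use assms in auto)
  thus ?thesis by blast
qed

text \<open>Being a basis is an open condition: at \<open>p\<close> the matrix is bounded below by
  some \<open>B\<close>, and nearby matrices differ from it by less than \<open>B\<close> in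
  norm.\<close>

lemma frame_spans_near:
  fixes E :: "'i \<Rightarrow> 'a::euclidean_space \<Rightarrow> 'a"
  assumes U: "open U" "p \<in> U" and "finite I" "card I = DIM('a)" "\<And>c. c \<in> I \<Longrightarrow> smooth_on U (E c)"
    and span: "span ((\<lambda>c. E c p) ` I) = UNIV"
  shows "\<exists>r>0. ball p r \<subseteq> U \<and> (\<forall>q\<in>ball p r. span ((\<lambda>c. E c q) ` I) = UNIV)"
proof -
  obtain \<beta> where \<beta>: "bij_betw \<beta> I (Basis :: 'a set)"
    using finite_same_card_bij[of I "Basis::'a set"] assms by auto
  note m = frame_matrix[OF \<beta>]
  define A where "A = (\<lambda>q x. \<Sum>c\<in>I. (x \<bullet> \<beta> c) *\<^sub>R E c q)"
  have lin: "linear (A q)" for q unfolding A_def by (rule m)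
  have "inj (A p)" using m(3)[of "\<lambda>c. E c p"] span by (simp add: A_def)
  then obtain B where B: "B > 0" "\<And>x. B * norm x \<le> norm (A p x)"
    using linear_inj_bounded_below_pos[OF lin] by blast
  define \<sigma> where "\<sigma> = (\<lambda>q. \<Sum>c\<in>I. norm (E c q - E c p))"
  have "isCont \<sigma> p"
    unfolding \<sigma>_def using smooth_on_continuous[OF assms(5)] U
    by (auto intro!: continuous_intros simp: continuous_on_eq_continuous_at)
  hence "(\<sigma> \<longlongrightarrow> 0) (at p)" by (simp add: isCont_def \<sigma>_def)
  hence "\<forall>\<^sub>F q in at p. \<sigma> q < B" using B by (intro order_tendstoD) auto
  then obtain d where d: "d > 0" "\<And>q. q \<noteq> p \<Longrightarrow> dist q p < d \<Longrightarrow> \<sigma> q < B"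
    unfolding eventually_at by blast
  have \<sigma>: "\<sigma> q < B" if "dist q p < d" for q
    using d(2)[of q] that B by (cases "q = p") (auto simp: \<sigma>_def)
  obtain d' where d': "d' > 0" "ball p d' \<subseteq> U" using U openE by blast
  have "span ((\<lambda>c. E c q) ` I) = UNIV" if "dist q p < d" for q
  proof -
    have "inj (A q)"
    proof (rule linear_injective_0[OF lin, THEN iffD2], intro allI impI)
      fix x assume x: "A q x = 0"
      have "A p x = (\<Sum>c\<in>I. (x \<bullet> \<beta> c) *\<^sub>R (E c p - E c q))"
        using x by (simp add: A_def scaleR_diff_right sum_subtractf)
      also have "norm \<dots> \<le> (\<Sum>c\<in>I. norm x * norm (E c q - E c p))"
        using \<beta> by (intro sum_norm_le) (auto intro!: mult_right_mono Basis_le_norm simp: norm_minus_commute bij_betw_def)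
      also have "\<dots> = norm x * \<sigma> q" by (simp add: \<sigma>_def sum_distrib_left)
      finally have "B * norm x \<le> \<sigma> q * norm x" using B(2)[of x] by (simp add: mult.commute)
      thus "x = 0" using \<sigma>[OF that] by (cases "x = 0") auto
    qed
    thus ?thesis using m(3)[of "\<lambda>c. E c q"] by (simp add: A_def)
  qed
  thus ?thesis using d d' by (intro exI[of _ "min d d'"]) (auto simp: dist_commute)
qed

text \<open>The values \<open>g c\<close> on the frame define a one-form, and \<open>compat\<close>
  says that its exterior derivative vanishes on all pairs of frame fields.\<close>

lemma frame_poincare:
  fixes R \<rho> :: "'i \<Rightarrow> 'a::euclidean_space \<Rightarrow> 'a"
  assumes r: "r > 0" and fr: "smooth_frame (ball p r) I R \<rho>"
    and sg: "\<And>c. c \<in> I \<Longrightarrow> smooth_on (ball p r) (g c)"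
    and compat: "\<And>c d q. c \<in> I \<Longrightarrow> d \<in> I \<Longrightarrow> q \<in> ball p r \<Longrightarrow>
      lie_deriv (R c) (g d) q - lie_deriv (R d) (g c) q = (\<Sum>k\<in>I. (\<rho> k q \<bullet> lie_bracket (R c) (R d) q) * g k q)"
  shows "\<exists>f. smooth_on (ball p r) f \<and> f p = 0 \<and> (\<forall>q\<in>ball p r. \<forall>c\<in>I. lie_deriv (R c) f q = g c q)"
proof -
  let ?U = "ball p r"
  have U: "open ?U" by simp
  have fin: "finite I" and sR: "\<And>c. c \<in> I \<Longrightarrow> smooth_on ?U (R c)" and s\<rho>: "\<And>c. c \<in> I \<Longrightarrow> smooth_on ?U (\<rho> c)"
    and rep: "\<And>q v. q \<in> ?U \<Longrightarrow> (\<Sum>c\<in>I. (\<rho> c q \<bullet> v) *\<^sub>R R c q) = v"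
    and dual: "\<And>q c d. q \<in> ?U \<Longrightarrow> c \<in> I \<Longrightarrow> d \<in> I \<Longrightarrow> \<rho> c q \<bullet> R d q = (if c = d then 1 else 0)"
    using fr unfolding smooth_frame_def by auto
  define \<omega> where "\<omega> = (\<lambda>q. \<Sum>c\<in>I. g c q *\<^sub>R \<rho> c q)"
  have s\<omega>: "smooth_on ?U \<omega>" unfolding \<omega>_def by (intro smooth_intros sg s\<rho>) auto
  have \<omega>R: "\<omega> q \<bullet> R d q = g d q" if "q \<in> ?U" "d \<in> I" for q d
  proof -
    have "\<omega> q \<bullet> R d q = (\<Sum>c\<in>I. if c = d then g c q else 0)"
      unfolding \<omega>_def inner_sum_left using that by (intro sum.cong refl) (auto simp: dual)
    thus ?thesis using that fin by simp
  qed
  have base: "dir_deriv (R c q) \<omega> q \<bullet> R d q = dir_deriv (R d q) \<omega> q \<bullet> R c q" if "c \<in> I" "d \<in> I" "q \<in> ?U" for c d q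
  proof -
    have e: "lie_deriv (R c) (g d) q = \<omega> q \<bullet> lie_deriv (R c) (R d) q + dir_deriv (R c q) \<omega> q \<bullet> R d q"
      if "c \<in> I" "d \<in> I" for c d
    proof -
      have "lie_deriv (R c) (g d) q = lie_deriv (R c) (\<lambda>q. \<omega> q \<bullet> R d q) q"
        by (rule lie_deriv_cong[OF U \<open>q \<in> ?U\<close>]) (auto simp: \<omega>R that)
      also have "\<dots> = \<omega> q \<bullet> lie_deriv (R c) (R d) q + lie_deriv (R c) \<omega> q \<bullet> R d q"
        by (rule lie_deriv_inner[OF s\<omega> sR[OF that(2)] \<open>q \<in> ?U\<close>])
      finally show ?thesis by (simp add: lie_deriv_def[of _ \<omega>] dir_deriv_def)
    qed
    have "(\<Sum>k\<in>I. (\<rho> k q \<bullet> lie_bracket (R c) (R d) q) * g k q) = \<omega> q \<bullet> lie_bracket (R c) (R d) q"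
      by (simp add: \<omega>_def inner_sum_left mult.commute)
    hence "dir_deriv (R c q) \<omega> q \<bullet> R d q - dir_deriv (R d q) \<omega> q \<bullet> R c q = 0"
      using compat[OF that] e[OF that(1,2)] e[OF that(2,1)] by (simp add: lie_bracket_def inner_diff_right)
    thus ?thesis by simp
  qed
  have closed: "dir_deriv u \<omega> q \<bullet> v = dir_deriv v \<omega> q \<bullet> u" if q: "q \<in> ?U" for q u v
  proof -
    have lin: "linear (\<lambda>u. dir_deriv u \<omega> q)"
      unfolding dir_deriv_def using frechet_derivative_linear[OF smooth_on_differentiable[OF s\<omega> q]] .
    have e: "dir_deriv u \<omega> q \<bullet> v = (\<Sum>d\<in>I. \<Sum>c\<in>I. (\<rho> d q \<bullet> v) * ((\<rho> c q \<bullet> u) * (dir_deriv (R c q) \<omega> q \<bullet> R d q)))" for u v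
    proof -
      have "dir_deriv u \<omega> q = dir_deriv (\<Sum>c\<in>I. (\<rho> c q \<bullet> u) *\<^sub>R R c q) \<omega> q" by (simp add: rep[OF q])
      also have "\<dots> = (\<Sum>c\<in>I. (\<rho> c q \<bullet> u) *\<^sub>R dir_deriv (R c q) \<omega> q)"
        by (simp add: linear_sum[OF lin] linear_cmul[OF lin])
      finally have "dir_deriv u \<omega> q \<bullet> v = (\<Sum>c\<in>I. (\<rho> c q \<bullet> u) *\<^sub>R dir_deriv (R c q) \<omega> q) \<bullet> (\<Sum>d\<in>I. (\<rho> d q \<bullet> v) *\<^sub>R R d q)"
        by (simp add: rep[OF q])
      thus ?thesis by (simp add: inner_sum_left inner_sum_right sum_distrib_left mult.assoc)
    qed
    show ?thesis
      unfolding e[of u v] e[of v u]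
      by (subst sum.swap) (intro sum.cong refl, simp add: base[OF _ _ q] mult.commute mult.left_commute)
  qed
  obtain f where f: "smooth_on ?U f" "f p = 0" "\<And>q. q \<in> ?U \<Longrightarrow> (f has_derivative (\<lambda>v. \<omega> q \<bullet> v)) (at q)"
    using poincare_ball[OF r s\<omega> closed] by blast
  have "\<forall>q\<in>?U. \<forall>c\<in>I. lie_deriv (R c) f q = g c q"
    using \<omega>R by (auto simp: lie_deriv_eq[OF f(3)])
  thus ?thesis using f by blast
qed

section \<open>Uniqueness for linear first-order systems, and smooth inverse functions\<close>

text \<open>A substitute for a Gronwall estimate: on a small closed ball the sum \<open>S\<close>
  attains its maximum, and the mean value inequality bounds that maximum by half of itself.\<close>

lemma linear_system_vanish_near:
  fixes g :: "'j \<Rightarrow> 'a::euclidean_space \<Rightarrow> real"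
  assumes J: "finite J" and r: "r > 0" and g: "\<And>j q. j \<in> J \<Longrightarrow> q \<in> ball p r \<Longrightarrow> g j differentiable (at q)"
    and C: "\<And>j q v. j \<in> J \<Longrightarrow> q \<in> ball p r \<Longrightarrow>
      \<bar>frechet_derivative (g j) (at q) v\<bar> \<le> C * norm v * (\<Sum>k\<in>J. \<bar>g k q\<bar>)"
    and z: "\<And>j. j \<in> J \<Longrightarrow> g j p = 0"
  shows "\<exists>s>0. \<forall>q\<in>ball p s. \<forall>j\<in>J. g j q = 0"
proof -
  define K where "K = 2 * (card J + 1) * (\<bar>C\<bar> + 1)"
  have K: "K > 0" by (simp add: K_def)
  define s where "s = min (r / 2) (1 / K)"
  have s: "s > 0" "s < r" "s * K \<le> 1" using r K by (auto simp: s_def min_def field_simps)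
  define S where "S = (\<lambda>q. \<Sum>k\<in>J. \<bar>g k q\<bar>)"
  have sub: "cball p s \<subseteq> ball p r" using s by auto
  have "continuous_on (cball p s) (g j)" if "j \<in> J" for j
    using g[OF that] sub by (auto intro!: continuous_at_imp_continuous_on differentiable_imp_continuous_within)
  hence "continuous_on (cball p s) S" unfolding S_def by (intro continuous_intros) 
  then obtain x where x: "x \<in> cball p s" "\<And>y. y \<in> cball p s \<Longrightarrow> S y \<le> S x"
    using continuous_attains_sup[of "cball p s" S] s by auto
  have S0: "S y \<ge> 0" for y by (simp add: S_def sum_nonneg)
  have gx: "\<bar>g j x\<bar> \<le> (\<bar>C\<bar> * S x) * s" if j: "j \<in> J" for j
  proof -
    have "norm (g j x - g j p) \<le> (\<bar>C\<bar> * S x) * norm (x - p)"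
    proof (rule differentiable_bound[of "cball p s" _ "\<lambda>q. frechet_derivative (g j) (at q)"])
      show "(g j has_derivative frechet_derivative (g j) (at q)) (at q within cball p s)" if "q \<in> cball p s" for q
      proof -
        have "g j differentiable (at q)" using g[OF j] sub that by blast
        thus ?thesis
          using has_derivative_at_withinI frechet_derivative_works by blast
      qed
      show "onorm (frechet_derivative (g j) (at q)) \<le> \<bar>C\<bar> * S x" if q: "q \<in> cball p s" for q
      proof (rule onorm_bound)
        show "0 \<le> \<bar>C\<bar> * S x" using S0 by simp
        fix v
        have "\<bar>frechet_derivative (g j) (at q) v\<bar> \<le> C * norm v * S q"
          using C[OF j, of q v] sub q by (auto simp: S_def)
        also have "\<dots> \<le> \<bar>C\<bar> * norm v * S x"
          using x(2)[OF q] S0[of q] by (intro mult_mono) (auto intro!: mult_right_mono)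
        finally show "norm (frechet_derivative (g j) (at q) v) \<le> \<bar>C\<bar> * S x * norm v"
          by (simp add: mult_ac)
      qed
    qed (use x s in auto)
    also have "\<dots> \<le> (\<bar>C\<bar> * S x) * s"
      using x(1) S0 by (intro mult_left_mono) (auto simp: dist_norm norm_minus_commute)
    finally show ?thesis using z[OF j] by simp
  qed
  have "S x \<le> (\<Sum>k\<in>J. (\<bar>C\<bar> * S x) * s)" by (subst S_def) (rule sum_mono, rule gx)
  also have "\<dots> = (card J * \<bar>C\<bar> * s) * S x" by simp
  also have "\<dots> \<le> (1 / 2) * S x"
  proof (rule mult_right_mono[OF _ S0])
    have "card J * \<bar>C\<bar> \<le> K / 2" by (simp add: K_def algebra_simps)
    hence "card J * \<bar>C\<bar> * s \<le> K / 2 * s" using s by (intro mult_right_mono) auto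
    also have "K / 2 * s \<le> 1 / 2" using s by (simp add: mult.commute)
    finally show "card J * \<bar>C\<bar> * s \<le> 1 / 2" .
  qed
  finally have "S x = 0" using S0[of x] by simp
  hence "S q = 0" if "q \<in> cball p s" for q using x(2)[OF that] S0[of q] by simp
  hence "\<forall>q\<in>ball p s. \<forall>j\<in>J. g j q = 0"
    using J unfolding S_def by (auto simp: sum_nonneg_eq_0_iff)
  thus ?thesis using s by blast
qed

text \<open>The common zero set of the unknowns is closed by continuity and open by
  \<open>linear_system_vanish_near\<close>. On a compact ball the frame turns bounds along the
  fields \<open>E c\<close> into a bound on the full derivative.\<close>

lemma frame_system_unique:
  fixes g :: "'j \<Rightarrow> 'a::euclidean_space \<Rightarrow> real"
  assumes fr: "smooth_frame U I E eps" and conn: "connected U" and p: "p \<in> U" and J: "finite J"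
    and g: "\<And>j. j \<in> J \<Longrightarrow> smooth_on U (g j)"
    and A: "\<And>c j k. c \<in> I \<Longrightarrow> j \<in> J \<Longrightarrow> k \<in> J \<Longrightarrow> continuous_on U (A c j k)"
    and sys: "\<And>c j q. c \<in> I \<Longrightarrow> j \<in> J \<Longrightarrow> q \<in> U \<Longrightarrow> lie_deriv (E c) (g j) q = (\<Sum>k\<in>J. A c j k q * g k q)"
    and z: "\<And>j. j \<in> J \<Longrightarrow> g j p = 0"
    and q: "q \<in> U" "j \<in> J"
  shows "g j q = 0"
proof -
  have U: "open U" and fin: "finite I" and sE: "\<And>c. c \<in> I \<Longrightarrow> smooth_on U (eps c)"
    and rep: "\<And>q v. q \<in> U \<Longrightarrow> (\<Sum>c\<in>I. (eps c q \<bullet> v) *\<^sub>R E c q) = v"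
    using fr unfolding smooth_frame_def by auto
  define Z where "Z = {q\<in>U. \<forall>j\<in>J. g j q = 0}"
  have "Z = {q\<in>U. (\<Sum>j\<in>J. \<bar>g j q\<bar>) \<in> {0}}"
    using J by (auto simp: Z_def sum_nonneg_eq_0_iff)
  moreover have "continuous_on U (\<lambda>q. \<Sum>j\<in>J. \<bar>g j q\<bar>)"
    using g by (intro continuous_intros smooth_on_continuous)
  ultimately have clo: "closedin (top_of_set U) Z"
    using continuous_closedin_preimage[of U "\<lambda>q. \<Sum>j\<in>J. \<bar>g j q\<bar>" "{0}"]
    by (simp add: vimage_def Int_def)
  have "open Z"
  proof (rule openI)
    fix q0 assume "q0 \<in> Z"
    hence q0: "q0 \<in> U" "\<And>j. j \<in> J \<Longrightarrow> g j q0 = 0" by (auto simp: Z_def)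
    obtain r where r: "r > 0" "cball q0 r \<subseteq> U" using U q0 open_contains_cball by blast
    have bd: "\<exists>K. \<forall>q\<in>cball q0 r. norm (h q) \<le> K" if "continuous_on U h" for h :: "'a \<Rightarrow> real"
      using compact_imp_bounded[OF compact_continuous_image[OF continuous_on_subset[OF that r(2)] compact_cball]]
      by (auto simp: bounded_iff)
    have "continuous_on U (\<lambda>q. \<Sum>c\<in>I. norm (eps c q))"
      by (intro continuous_intros smooth_on_continuous sE)
    then obtain K1 where "\<forall>q\<in>cball q0 r. norm (\<Sum>c\<in>I. norm (eps c q)) \<le> K1" using bd by blast
    hence K1: "(\<Sum>c\<in>I. norm (eps c q)) \<le> K1" if "q \<in> cball q0 r" for q
      using that abs_le_D1[of _ K1] unfolding real_norm_def by blast
    have "continuous_on U (\<lambda>q. \<Sum>c\<in>I. \<Sum>j\<in>J. \<Sum>k\<in>J. \<bar>A c j k q\<bar>)"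
      by (intro continuous_intros A)
    then obtain K2 where "\<forall>q\<in>cball q0 r. norm (\<Sum>c\<in>I. \<Sum>j\<in>J. \<Sum>k\<in>J. \<bar>A c j k q\<bar>) \<le> K2" using bd by blast
    hence K2: "(\<Sum>c\<in>I. \<Sum>j\<in>J. \<Sum>k\<in>J. \<bar>A c j k q\<bar>) \<le> K2" if "q \<in> cball q0 r" for q
      using that abs_le_D1[of _ K2] unfolding real_norm_def by blast
    have A2: "\<bar>A c j k q\<bar> \<le> K2" if "q \<in> cball q0 r" "c \<in> I" "j \<in> J" "k \<in> J" for c j k q
    proof -
      have "\<bar>A c j k q\<bar> \<le> (\<Sum>k\<in>J. \<bar>A c j k q\<bar>)" using that J by (intro member_le_sum) auto
      also have "\<dots> \<le> (\<Sum>j\<in>J. \<Sum>k\<in>J. \<bar>A c j k q\<bar>)"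
        using that J by (intro member_le_sum[of j J "\<lambda>j. \<Sum>k\<in>J. \<bar>A c j k q\<bar>"]) (auto intro: sum_nonneg)
      also have "\<dots> \<le> (\<Sum>c\<in>I. \<Sum>j\<in>J. \<Sum>k\<in>J. \<bar>A c j k q\<bar>)"
        using that fin by (intro member_le_sum[of c I "\<lambda>c. \<Sum>j\<in>J. \<Sum>k\<in>J. \<bar>A c j k q\<bar>"]) (auto intro: sum_nonneg)
      also have "\<dots> \<le> K2" using K2 that by blast
      finally show ?thesis .
    qed
    have "\<exists>s>0. \<forall>q\<in>ball q0 s. \<forall>j\<in>J. g j q = 0"
    proof (rule linear_system_vanish_near[OF J r(1), where C = "K1 * K2"])
      fix j q assume j: "j \<in> J" and q: "q \<in> ball q0 r"
      have qU: "q \<in> U" using q r by (meson ball_subset_cball subsetD)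
      show "g j differentiable at q" by (rule smooth_on_differentiable[OF g[OF j] qU])
      fix v
      let ?S = "\<Sum>k\<in>J. \<bar>g k q\<bar>"
      have lin: "linear (frechet_derivative (g j) (at q))"
        by (rule frechet_derivative_linear[OF smooth_on_differentiable[OF g[OF j] qU]])
      have S: "?S \<ge> 0" by (simp add: sum_nonneg)
      have qc: "q \<in> cball q0 r" using q by auto
      have E: "\<bar>lie_deriv (E c) (g j) q\<bar> \<le> K2 * ?S" if "c \<in> I" for c
      proof -
        have "\<bar>lie_deriv (E c) (g j) q\<bar> \<le> (\<Sum>k\<in>J. \<bar>A c j k q * g k q\<bar>)"
          unfolding sys[OF that j qU] by (rule sum_abs)
        also have "\<dots> \<le> (\<Sum>k\<in>J. K2 * \<bar>g k q\<bar>)"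
          using A2[OF qc that j] by (intro sum_mono) (auto simp: abs_mult intro!: mult_right_mono)
        finally show ?thesis by (simp add: sum_distrib_left)
      qed
      have K2: "0 \<le> K2" if "c \<in> I" for c
        using A2[OF qc that j j] by (smt (verit))
      have "frechet_derivative (g j) (at q) v = frechet_derivative (g j) (at q) (\<Sum>c\<in>I. (eps c q \<bullet> v) *\<^sub>R E c q)"
        by (simp add: rep[OF qU])
      also have "\<dots> = (\<Sum>c\<in>I. (eps c q \<bullet> v) * lie_deriv (E c) (g j) q)"
        by (simp add: linear_sum[OF lin] linear_cmul[OF lin] lie_deriv_def)
      finally have "\<bar>frechet_derivative (g j) (at q) v\<bar> \<le> (\<Sum>c\<in>I. \<bar>(eps c q \<bullet> v) * lie_deriv (E c) (g j) q\<bar>)"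
        by (metis sum_abs)
      also have "\<dots> \<le> (\<Sum>c\<in>I. (norm (eps c q) * norm v) * (K2 * ?S))"
        using E Cauchy_Schwarz_ineq2 by (intro sum_mono) (auto simp: abs_mult intro!: mult_mono)
      also have "\<dots> = (\<Sum>c\<in>I. norm (eps c q)) * (norm v * (K2 * ?S))"
        by (simp only: sum_distrib_right mult.assoc)
      also have "\<dots> \<le> K1 * (norm v * (K2 * ?S))"
      proof (cases "I = {}")
        case True
        hence "v = 0" using rep[OF qU, of v] by simp
        thus ?thesis by simp
      next
        case False
        thus ?thesis using K1[OF qc] K2 S by (intro mult_right_mono) auto
      qed
      finally show "\<bar>frechet_derivative (g j) (at q) v\<bar> \<le> K1 * K2 * norm v * ?S"
        by (simp add: mult_ac)
    qed (use q0 in auto)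
    then obtain s where s: "s > 0" "\<And>q j. q \<in> ball q0 s \<Longrightarrow> j \<in> J \<Longrightarrow> g j q = 0" by blast
    have "ball q0 (min r s) \<subseteq> Z"
      using s(2) r(2) by (auto simp: Z_def subset_iff)
    thus "\<exists>e>0. ball q0 e \<subseteq> Z" using r s by (intro exI[of _ "min r s"]) auto
  qed
  hence "openin (top_of_set U) Z" by (simp add: open_subset Z_def)
  hence "Z = U" using conn clo p z unfolding connected_clopen by (auto simp: Z_def)
  thus ?thesis using q by (auto simp: Z_def)
qed

text \<open>The differentiable inverse is bootstrapped: its derivative at \<open>y\<close> is
  \<open>N (g y)\<close> with \<open>N\<close> smooth, so each order of differentiability of
  \<open>g\<close> gives the next.\<close>

lemma smooth_inverse_function:
  fixes f :: "'a::euclidean_space \<Rightarrow> 'a"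
  assumes U: "open U" "p \<in> U" and sm: "smooth_on U f" and inj: "inj (frechet_derivative f (at p))"
  shows "\<exists>V V' g. p \<in> V \<and> V \<subseteq> U \<and> diffeomorphism V V' f g \<and> (\<forall>q\<in>V. inj (frechet_derivative f (at q)))"
proof -
  define f' where "f' = (\<lambda>x. Blinfun (frechet_derivative f (at x)))"
  have bl: "bounded_linear (frechet_derivative f (at x))" if "x \<in> U" for x
    using smooth_on_has_derivative[OF sm that] by (rule has_derivative_bounded_linear)
  have f': "blinfun_apply (f' x) = frechet_derivative f (at x)" if "x \<in> U" for x
    using bounded_linear_Blinfun_apply[OF bl[OF that]] by (simp add: f'_def)
  have der: "(f has_derivative blinfun_apply (f' x)) (at x)" if "x \<in> U" for x
    using smooth_on_has_derivative[OF sm that] f'[OF that] by simp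
  have cont: "continuous_on U f'"
  proof (rule continuous_on_blinfun_componentwise)
    fix i :: 'a
    have "continuous_on U (dir_deriv i f)" by (intro smooth_on_continuous smooth_on_dir_deriv sm)
    thus "continuous_on U (\<lambda>x. blinfun_apply (f' x) i)"
      by (rule continuous_on_eq) (simp add: f' dir_deriv_def)
  qed
  obtain h where h: "linear h" "h \<circ> frechet_derivative f (at p) = id"
    using linear_injective_left_inverse[OF bounded_linear.linear[OF bl[OF U(2)]] inj] by blast
  have "Blinfun h o\<^sub>L f' p = id_blinfun"
    using h f'[OF U(2)] bounded_linear_Blinfun_apply[of h]
    by (intro blinfun_eqI) (simp add: linear_conv_bounded_linear fun_eq_iff)
  note ift = inverse_function_theorem[of U f f' p "Blinfun h", OF U(1) der cont U(2) this]
  obtain U' V g g' where V: "open U'" "U' \<subseteq> U" "p \<in> U'" "open V" "f p \<in> V" "homeomorphism U' V f g"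
    "\<And>y. y \<in> V \<Longrightarrow> (g has_derivative g' y) (at y)" "\<And>y. y \<in> V \<Longrightarrow> g' y = inv (blinfun_apply (f' (g y)))"
    "\<And>y. y \<in> V \<Longrightarrow> bij (blinfun_apply (f' (g y)))"
    by (rule ift, assumption, rule that)
  have gV: "g y \<in> U'" if "y \<in> V" for y using V(6) that by (auto simp: homeomorphism_def)
  have bij: "bij (frechet_derivative f (at q))" if q: "q \<in> U'" for q
  proof -
    have "f q \<in> V" "g (f q) = q" using V(6) q by (auto simp: homeomorphism_def)
    thus ?thesis using V(9)[of "f q"] f'[of q] V(2) q by auto
  qed
  define N where "N = (\<lambda>q. inv (frechet_derivative f (at q)))"
  have smN: "smooth_on U' (\<lambda>q. N q v)" for v
  proof (rule smooth_on_linear_inverse[OF V(1), where A = "\<lambda>q. frechet_derivative f (at q)"])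
    show "linear (frechet_derivative f (at q))" if "q \<in> U'" for q
      using bl V(2) that by (auto intro: bounded_linear.linear)
    show "smooth_on U' (\<lambda>q. frechet_derivative f (at q) x)" for x
      using smooth_on_subset[OF smooth_on_dir_deriv[OF sm, of x] V(2)] by (simp add: dir_deriv_def)
  qed (use bij in \<open>auto simp: N_def bij_def surj_f_inv_f\<close>)
  have dg: "dir_deriv v g y = N (g y) v" if "y \<in> V" for y v
    using dir_deriv_eq[OF V(7)[OF that]] V(8)[OF that] f'[of "g y"] gV[OF that] V(2) by (auto simp: N_def)
  have "Ck_on k V g" for k
  proof (induction k)
    case 0
    thus ?case using V(6) by (simp add: homeomorphism_def)
  next
    case (Suc k)
    have "Ck_on k V (\<lambda>y. N (g y) v)" for v
      using smN[of v] by (intro Ck_on_compose[OF V(4,1) gV _ Suc]) (auto simp: smooth_on_def)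
    hence "Ck_on k V (dir_deriv v g)" for v
      by (rule Ck_on_cong[OF V(4), rotated]) (simp add: dg)
    thus ?case using V(7) by (auto simp: differentiable_def)
  qed
  hence "diffeomorphism U' V f g"
    using V smooth_on_subset[OF sm V(2)] by (simp add: diffeomorphism_def smooth_on_def)
  thus ?thesis using V bij by (intro exI[of _ U'] exI[of _ V] exI[of _ g]) (auto simp: bij_def)
qed

section \<open>The symbol of a Monge equation\<close>

text \<open>Functionals of symmetries and vector fields both become real vector spaces, so that
  \<open>subspace\<close>, \<open>span\<close> and \<open>independent\<close> apply to
  either.\<close>

instantiation "fun" :: (type, real_vector) real_vector
begin

definition scaleR_fun_def: "c *\<^sub>R f = (\<lambda>x. c *\<^sub>R f x)"

instance
  by standard (auto simp: scaleR_fun_def fun_eq_iff algebra_simps)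

end

lemma scaleR_fun_apply: "(c *\<^sub>R f) x = c *\<^sub>R f x"
  by (simp add: scaleR_fun_def)

text \<open>An operator that raises the filtration by \<open>w\<close>. Linearity is asked for on
  the levels only: the derivations to be inserted are linear only on functionals that are smooth in
  the point.\<close>

definition filt_op :: "(int \<Rightarrow> 'f::real_vector set) \<Rightarrow> ('f \<Rightarrow> 'f) \<Rightarrow> int \<Rightarrow> bool"
  where "filt_op M P w \<longleftrightarrow> (\<forall>k. \<forall>\<Phi>\<in>M k. P \<Phi> \<in> M (k + w)) \<and>
    (\<forall>k. \<forall>\<Phi>\<in>M k. \<forall>\<Psi>\<in>M k. P (\<Phi> + \<Psi>) = P \<Phi> + P \<Psi>) \<and>
    (\<forall>k. \<forall>\<Phi>\<in>M k. \<forall>c. P (c *\<^sub>R \<Phi>) = c *\<^sub>R P \<Phi>)"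

lemmas pw = fun_eq_iff plus_fun_apply minus_apply uminus_apply scaleR_fun_apply zero_fun_apply

text \<open>The elements of \<open>M k\<close> model functionals on pairs of a symmetry and a point, \<open>T\<close>, \<open>W i\<close>, \<open>Y i\<close> are the
  derivatives along the frame, and \<open>\<tau>\<close>, \<open>\<omega> i\<close>, \<open>ups i\<close> the components of the symmetry in the frame. The weight
  of a frame field is its depth in the derived flag, and all relations hold up to lower weight.\<close>

locale monge_symbol =
  fixes M :: "int \<Rightarrow> ('x \<Rightarrow> real) set" and T :: "('x \<Rightarrow> real) \<Rightarrow> ('x \<Rightarrow> real)"
    and W Y :: "nat \<Rightarrow> ('x \<Rightarrow> real) \<Rightarrow> ('x \<Rightarrow> real)"
    and \<tau> :: "'x \<Rightarrow> real" and \<omega> ups :: "nat \<Rightarrow> 'x \<Rightarrow> real" and m n :: nat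
  assumes mn: "1 \<le> m" "m \<le> n" "2 \<le> n" "m = 1 \<Longrightarrow> 3 \<le> n"
    and subM: "subspace (M k)" and monoM: "M k \<subseteq> M (k + 1)"
    and opT: "filt_op M T 1" and opW: "filt_op M (W i) (int i + 1)" and opY: "filt_op M (Y i) (int i + 2)"
    and WT: "\<Phi> \<in> M k \<Longrightarrow> W i (T \<Phi>) - T (W i \<Phi>) - W (Suc i) \<Phi> \<in> M (k + int i + 1)"
    and ZW: "\<Phi> \<in> M k \<Longrightarrow> 1 \<le> i \<Longrightarrow> W 0 (W i \<Phi>) - W i (W 0 \<Phi>) - Y i \<Phi> \<in> M (k + int i + 1)"
    and YT: "\<Phi> \<in> M k \<Longrightarrow> 1 \<le> i \<Longrightarrow> Y i (T \<Phi>) - T (Y i \<Phi>) - Y (Suc i) \<Phi> \<in> M (k + int i + 2)"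
    and ZY: "\<Phi> \<in> M k \<Longrightarrow> 1 \<le> i \<Longrightarrow> W 0 (Y i \<Phi>) - Y i (W 0 \<Phi>) \<in> M (k + int i + 2)"
    and Wn: "n < i \<Longrightarrow> W i \<Phi> = 0" and Ym: "m < i \<Longrightarrow> Y i \<Phi> = 0"
    and \<tau>M: "\<tau> \<in> M (- 1)" and \<omega>M: "i \<le> n \<Longrightarrow> \<omega> i \<in> M (- int i - 1)"
    and upsM: "i \<le> m \<Longrightarrow> ups i \<in> M (- int i - 2)" and ups0: "ups 0 = 0"
    and T\<omega>: "i < n \<Longrightarrow> T (\<omega> (Suc i)) - \<omega> i \<in> M (- int i - 2)"
    and Tups: "i < m \<Longrightarrow> T (ups (Suc i)) - ups i \<in> M (- int i - 3)"
    and Z\<omega>1: "W 0 (\<omega> 1) + \<tau> \<in> M (- 2)"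
    and Z\<omega>: "2 \<le> i \<Longrightarrow> i \<le> n \<Longrightarrow> W 0 (\<omega> i) \<in> M (- int i - 1)"
    and Zups: "1 \<le> i \<Longrightarrow> i \<le> m \<Longrightarrow> W 0 (ups i) + \<omega> i \<in> M (- int i - 2)"
begin

declare uminus_apply [simp del] minus_apply [simp del] plus_fun_apply [simp del] zero_fun_apply [simp del]

abbreviation "Z \<equiv> W 0"
abbreviation "\<zeta> \<equiv> \<omega> 0"

lemma M_mono: "k \<le> l \<Longrightarrow> \<Phi> \<in> M k \<Longrightarrow> \<Phi> \<in> M l"
  by (induction rule: int_ge_induct) (use monoM in auto)

lemma M_0 [simp]: "0 \<in> M k" using subM subspace_0 by blast
lemma M_add: "x \<in> M k \<Longrightarrow> y \<in> M k \<Longrightarrow> x + y \<in> M k" using subM subspace_add by blast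
lemma M_scale: "x \<in> M k \<Longrightarrow> c *\<^sub>R x \<in> M k" using subM subspace_scale by blast
lemma M_minus: "x \<in> M k \<Longrightarrow> - x \<in> M k" using M_scale[of x k "-1"] by simp

lemma M_lin1: "x \<in> M k \<Longrightarrow> z = a *\<^sub>R x \<Longrightarrow> z \<in> M k" using M_scale by simp
lemma M_lin2: "x \<in> M k \<Longrightarrow> y \<in> M k \<Longrightarrow> z = a *\<^sub>R x + b *\<^sub>R y \<Longrightarrow> z \<in> M k"
  using M_scale M_add by simp
lemma M_lin3: "x \<in> M k \<Longrightarrow> y \<in> M k \<Longrightarrow> v \<in> M k \<Longrightarrow> z = a *\<^sub>R x + b *\<^sub>R y + c *\<^sub>R v \<Longrightarrow> z \<in> M k"
  using M_scale M_add by simp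

lemma op_M: "filt_op M P w \<Longrightarrow> x \<in> M k \<Longrightarrow> P x \<in> M (k + w)"
  by (simp add: filt_op_def)
lemma op_add: "filt_op M P w \<Longrightarrow> x \<in> M k \<Longrightarrow> y \<in> M k \<Longrightarrow> P (x + y) = P x + P y"
  by (auto simp: filt_op_def)
lemma op_scale: "filt_op M P w \<Longrightarrow> x \<in> M k \<Longrightarrow> P (c *\<^sub>R x) = c *\<^sub>R P x"
  by (auto simp: filt_op_def)
lemma op_0: "filt_op M P w \<Longrightarrow> P 0 = 0"
  using op_scale[of P w 0 0 0] by simp
lemma op_minus: "filt_op M P w \<Longrightarrow> x \<in> M k \<Longrightarrow> P (- x) = - P x"
  using op_scale[of P w x k "-1"] by simp
lemma op_diff: "filt_op M P w \<Longrightarrow> x \<in> M k \<Longrightarrow> y \<in> M k \<Longrightarrow> P (x - y) = P x - P y"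
  using op_add[of P w x k "- y"] op_minus M_minus by simp

text \<open>Equality of principal symbols, i.e. in the graded quotient of \<open>M k\<close> by
  \<open>M (k - 1)\<close>.\<close>

definition eqg :: "int \<Rightarrow> ('x \<Rightarrow> real) \<Rightarrow> ('x \<Rightarrow> real) \<Rightarrow> bool"
  where "eqg k a b \<longleftrightarrow> a \<in> M k \<and> b \<in> M k \<and> a - b \<in> M (k - 1)"

lemma eqgI: "b \<in> M k \<Longrightarrow> a - b \<in> M (k - 1) \<Longrightarrow> eqg k a b"
  unfolding eqg_def using M_add[of "a - b" k b] M_mono[of "k - 1" k "a - b"] by auto

lemma eqg_refl: "a \<in> M k \<Longrightarrow> eqg k a a"
  by (simp add: eqg_def)
lemma eqg_sym: "eqg k a b \<Longrightarrow> eqg k b a"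
  unfolding eqg_def using M_minus[of "a - b" "k - 1"] by auto
lemma eqg_trans [trans]: "eqg k a b \<Longrightarrow> eqg k b c \<Longrightarrow> eqg k a c"
  unfolding eqg_def using M_add[of "a - b" "k - 1" "b - c"] by auto
lemma eqg_add: "eqg k a b \<Longrightarrow> eqg k c d \<Longrightarrow> eqg k (a + c) (b + d)"
  unfolding eqg_def using M_add[of a k c] M_add[of b k d] M_add[of "a - b" "k - 1" "c - d"]
  by (auto simp: algebra_simps)
lemma eqg_scale: "eqg k a b \<Longrightarrow> eqg k (r *\<^sub>R a) (r *\<^sub>R b)"
  unfolding eqg_def using M_scale[of "a - b" "k - 1" r] M_scale by (auto simp: scaleR_diff_right)
lemma eqg_minus: "eqg k a b \<Longrightarrow> eqg k (- a) (- b)"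
  using eqg_scale[of k a b "-1"] by simp
lemma eqg_diff: "eqg k a b \<Longrightarrow> eqg k c d \<Longrightarrow> eqg k (a - c) (b - d)"
  using eqg_add[OF _ eqg_minus, of k a b c d] by simp
lemma eqg_op: "filt_op M P w \<Longrightarrow> eqg k a b \<Longrightarrow> eqg (k + w) (P a) (P b)"
  unfolding eqg_def using op_M[of P w a k] op_M[of P w b k] op_M[of P w "a - b" "k - 1"] op_diff[of P w a k b]
  by (simp add: algebra_simps)
lemma eqg_0: "eqg k a 0 \<longleftrightarrow> a \<in> M (k - 1)"
  by (auto simp: eqg_def intro: M_mono[of "k - 1"])
lemma eqg_mem: "eqg k a b \<Longrightarrow> a - b \<in> M (k - 1)"
  by (simp add: eqg_def)
lemma eqg_cong: "eqg k a b \<Longrightarrow> k = k' \<Longrightarrow> b = b' \<Longrightarrow> eqg k' a b'"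
  by simp

lemma eqg_T: "eqg k a b \<Longrightarrow> eqg (k + 1) (T a) (T b)" by (rule eqg_op[OF opT])
lemma eqg_W: "eqg k a b \<Longrightarrow> eqg (k + (int i + 1)) (W i a) (W i b)" by (rule eqg_op[OF opW])
lemma eqg_Y: "eqg k a b \<Longrightarrow> eqg (k + (int i + 2)) (Y i a) (Y i b)" by (rule eqg_op[OF opY])

text \<open>Here \<open>r\<close> is the bracket of \<open>P\<close> and \<open>Q\<close> applied to
  \<open>x\<close>; its symbol is computed from representatives of the symbols of \<open>Q x\<close>
  and \<open>P x\<close>.\<close>

lemma eqg_commutator:
  assumes P: "filt_op M P v" and Q: "filt_op M Q w" and R: "P (Q x) - Q (P x) - r \<in> M (k + v + w - 1)"
    and y: "eqg (k + w) (Q x) y" and z: "eqg (k + v) (P x) z" and l: "l = k + v + w"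
  shows "eqg l r (P y - Q z)"
proof -
  have 1: "eqg l (P (Q x) - Q (P x)) (P y - Q z)"
    using eqg_diff[OF eqg_op[OF P y] eqg_cong[OF eqg_op[OF Q z] _ refl]] by (simp add: l algebra_simps)
  have "eqg l r (P (Q x) - Q (P x))"
    using M_minus[OF R] 1 by (intro eqgI) (auto simp: eqg_def algebra_simps l)
  thus ?thesis using 1 by (rule eqg_trans)
qed

lemma W_Suc:
  assumes "x \<in> M k" "eqg (k + 1) (T x) y" "eqg (k + int i + 1) (W i x) z"
  shows "eqg (k + int i + 2) (W (Suc i) x) (W i y - T z)"
  by (rule eqg_commutator[OF opW opT]) (use assms WT[of x k i] in \<open>auto simp: algebra_simps\<close>)

lemma Y_Suc:
  assumes "x \<in> M k" "1 \<le> i" "eqg (k + 1) (T x) y" "eqg (k + int i + 2) (Y i x) z"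
  shows "eqg (k + int i + 3) (Y (Suc i) x) (Y i y - T z)"
  by (rule eqg_commutator[OF opY opT]) (use assms YT[of x k i] in \<open>auto simp: algebra_simps\<close>)

lemma Y_ZW:
  assumes "x \<in> M k" "1 \<le> i" "eqg (k + 1) (Z x) y" "eqg (k + int i + 1) (W i x) z"
  shows "eqg (k + int i + 2) (Y i x) (Z z - W i y)"
  by (rule eqg_commutator[OF opW opW]) (use assms ZW[of x k i] in \<open>auto simp: algebra_simps\<close>)

lemma ZY_comm:
  assumes "x \<in> M k" "1 \<le> i" "eqg (k + 1) (Z x) y" "eqg (k + int i + 2) (Y i x) z"
  shows "eqg (k + int i + 3) (Z z) (Y i y)"
proof -
  have 1: "eqg (k + int i + 3) (Z (Y i x)) (Z z)" "eqg (k + int i + 3) (Y i (Z x)) (Y i y)"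
    using eqg_W[OF assms(4), of 0] eqg_Y[OF assms(3), of i] by (simp_all add: algebra_simps)
  have "eqg (k + int i + 3) (Z (Y i x)) (Y i (Z x))"
    using ZY[OF assms(1,2)] 1 by (intro eqgI) (auto simp: eqg_def algebra_simps)
  thus ?thesis using 1 eqg_trans eqg_sym by blast
qed

lemma T\<omega>': "i < n \<Longrightarrow> eqg (- int i - 1) (T (\<omega> (Suc i))) (\<omega> i)"
  using T\<omega>[of i] \<omega>M[of i] by (intro eqgI) (auto simp: algebra_simps)
lemma Tups': "i < m \<Longrightarrow> eqg (- int i - 2) (T (ups (Suc i))) (ups i)"
  using Tups[of i] upsM[of i] by (intro eqgI) (auto simp: algebra_simps)
lemma T\<omega>k: "i < n \<Longrightarrow> k = - int i - 1 \<Longrightarrow> eqg k (T (\<omega> (Suc i))) (\<omega> i)"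
  using T\<omega>' by simp
lemma Tupsk: "i < m \<Longrightarrow> k = - int i - 2 \<Longrightarrow> eqg k (T (ups (Suc i))) (ups i)"
  using Tups' by simp
lemma Z\<omega>1': "eqg (- 1) (Z (\<omega> 1)) (- \<tau>)"
  using Z\<omega>1 \<tau>M M_minus by (intro eqgI) auto
lemma Z\<omega>': "2 \<le> i \<Longrightarrow> i \<le> n \<Longrightarrow> eqg (- int i) (Z (\<omega> i)) 0"
  using Z\<omega>[of i] by (simp add: eqg_0)
lemma Zups': "1 \<le> i \<Longrightarrow> i \<le> m \<Longrightarrow> eqg (- int i - 1) (Z (ups i)) (- \<omega> i)"
  using Zups[of i] \<omega>M[of i] mn M_minus by (intro eqgI) (auto simp: algebra_simps)

lemma Z\<omega>k: "2 \<le> i \<Longrightarrow> i \<le> n \<Longrightarrow> k = - int i \<Longrightarrow> eqg k (Z (\<omega> i)) 0"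
  using Z\<omega>' by simp
lemma Zupsk: "1 \<le> i \<Longrightarrow> i \<le> m \<Longrightarrow> k = - int i - 1 \<Longrightarrow> eqg k (Z (ups i)) (- \<omega> i)"
  using Zups' by simp

lemma TM: "x \<in> M k \<Longrightarrow> T x \<in> M (k + 1)" by (rule op_M[OF opT])
lemma WM: "x \<in> M k \<Longrightarrow> W i x \<in> M (k + int i + 1)" using op_M[OF opW, of x k i] by (simp add: algebra_simps)
lemma T0 [simp]: "T 0 = 0" by (rule op_0[OF opT])
lemma W0 [simp]: "W i 0 = 0" by (rule op_0[OF opW])
lemma Y0 [simp]: "Y i 0 = 0" by (rule op_0[OF opY])

section \<open>Symbols of the derivatives of the components\<close>

text \<open>\<open>a\<close>, \<open>b\<close>, \<open>d\<close> are entries of the linear action of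
  a symmetry on the horizontal plane. The fourth entry, \<open>Z \<tau>\<close>, turns out to be
  negligible.\<close>

definition "a = T \<tau>"
definition "b = T \<zeta>"
definition "d = Z \<zeta>"

lemma \<zeta>M: "\<zeta> \<in> M (- 1)" using \<omega>M[of 0] by simp
lemma abdM: "a \<in> M 0" "b \<in> M 0" "d \<in> M 0"
  using TM[OF \<tau>M] TM[OF \<zeta>M] WM[OF \<zeta>M, of 0] by (simp_all add: a_def b_def d_def)

text \<open>As \<open>W (i + 1)\<close> is the bracket of \<open>W i\<close> with \<open>T\<close>,
  and \<open>T\<close> sends \<open>\<omega> j\<close> to \<open>\<omega> (j - 1)\<close>, the
  symbol of \<open>W (i + 1) (\<omega> j)\<close> is that of
  \<open>W i (\<omega> (j - 1)) - T (W i (\<omega> j))\<close>. The next lemmas run this recursion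
  along the successive diagonals of the pairs (i, j).\<close>

lemma W_\<omega>_low: "i + 2 \<le> j \<Longrightarrow> j \<le> n \<Longrightarrow> eqg (int i - int j) (W i (\<omega> j)) 0"
proof (induction i arbitrary: j)
  case 0
  thus ?case using Z\<omega>'[of j] by simp
next
  case (Suc i)
  then obtain j' where j: "j = Suc j'" by (cases j) auto
  have 1: "eqg (- int j - 1 + 1) (T (\<omega> j)) (\<omega> j')" unfolding j by (rule T\<omega>k) (use Suc.prems j in auto)
  have 2: "eqg (- int j - 1 + int i + 1) (W i (\<omega> j)) 0" using Suc.IH[of j] Suc.prems by simp
  have "eqg (int (Suc i) - int j) (W (Suc i) (\<omega> j)) (W i (\<omega> j') - T 0)"
    using W_Suc[OF \<omega>M[OF Suc.prems(2)] 1 2] by (simp add: algebra_simps)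
  also have "eqg (int (Suc i) - int j) (W i (\<omega> j') - T 0) 0"
    using Suc.IH[of j'] Suc.prems by (simp add: j)
  finally show ?case .
qed

lemma W_\<omega>_1: "Suc i \<le> n \<Longrightarrow> eqg (- 1) (W i (\<omega> (Suc i))) (- \<tau>)"
proof (induction i)
  case 0
  thus ?case using Z\<omega>1' by simp
next
  case (Suc i)
  let ?k = "- int (Suc (Suc i)) - 1"
  have 1: "eqg (?k + 1) (T (\<omega> (Suc (Suc i)))) (\<omega> (Suc i))" by (rule T\<omega>k) (use Suc.prems in auto)
  have 2: "eqg (?k + int i + 1) (W i (\<omega> (Suc (Suc i)))) 0" using W_\<omega>_low[of i "Suc (Suc i)"] Suc.prems by simp
  have "eqg (- 1) (W (Suc i) (\<omega> (Suc (Suc i)))) (W i (\<omega> (Suc i)) - T 0)"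
    using W_Suc[OF \<omega>M[OF Suc.prems] 1 2] by simp
  also have "eqg (- 1) (W i (\<omega> (Suc i)) - T 0) (- \<tau>)" using Suc by simp
  finally show ?case .
qed

lemma W_\<omega>_0: "i \<le> n \<Longrightarrow> eqg 0 (W i (\<omega> i)) (d + real i *\<^sub>R a)"
proof (induction i)
  case 0
  thus ?case using abdM by (simp add: d_def eqg_refl)
next
  case (Suc i)
  let ?k = "- int (Suc i) - 1"
  have 1: "eqg (?k + 1) (T (\<omega> (Suc i))) (\<omega> i)" by (rule T\<omega>k) (use Suc.prems in auto)
  have 2: "eqg (?k + int i + 1) (W i (\<omega> (Suc i))) (- \<tau>)" using W_\<omega>_1[of i] Suc.prems by simp
  have "eqg 0 (W (Suc i) (\<omega> (Suc i))) (W i (\<omega> i) - T (- \<tau>))"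
    using W_Suc[OF \<omega>M[OF Suc.prems] 1 2] by simp
  also have "eqg 0 (W i (\<omega> i) - T (- \<tau>)) (d + real i *\<^sub>R a - T (- \<tau>))"
    using Suc abdM by (intro eqg_diff eqg_refl) (auto simp: op_minus[OF opT \<tau>M] a_def[symmetric] M_minus)
  finally show ?case
    by (rule eqg_cong) (auto simp: op_minus[OF opT \<tau>M] a_def[symmetric] algebra_simps)
qed

text \<open>The coefficients sum the terms \<open>T (d + j a)\<close> coming from
  \<open>W_\<omega>_0\<close>. At \<open>i = n\<close> the left side vanishes, which makes the
  formula the relation \<open>R1\<close>.\<close>

lemma W_\<omega>_m1: "i \<le> n \<Longrightarrow> eqg 1 (W (Suc i) (\<omega> i))
    (Z b - (real i + 1) *\<^sub>R T d - (real i * (real i + 1) / 2) *\<^sub>R T a)"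
proof (induction i)
  case 0
  have "eqg 1 (W 1 \<zeta>) (Z b - T d)"
    using W_Suc[OF \<zeta>M eqg_refl eqg_refl, of 0] abdM WM[OF \<zeta>M, of 0] by (simp add: b_def d_def)
  thus ?case by simp
next
  case (Suc i)
  let ?k = "- int (Suc i) - 1"
  let ?R = "Z b - (real i + 1) *\<^sub>R T d - (real i * (real i + 1) / 2) *\<^sub>R T a"
  have 1: "eqg (?k + 1) (T (\<omega> (Suc i))) (\<omega> i)" by (rule T\<omega>k) (use Suc.prems in auto)
  have 2: "eqg (?k + int (Suc i) + 1) (W (Suc i) (\<omega> (Suc i))) (d + real (Suc i) *\<^sub>R a)"
    using W_\<omega>_0[of "Suc i"] Suc.prems by simp
  have e: "T (d + real (Suc i) *\<^sub>R a) = T d + real (Suc i) *\<^sub>R T a"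
    using op_add[OF opT abdM(3) M_scale[OF abdM(1)]] op_scale[OF opT abdM(1)] by simp
  have "eqg 1 (W (Suc (Suc i)) (\<omega> (Suc i))) (W (Suc i) (\<omega> i) - T (d + real (Suc i) *\<^sub>R a))"
    using W_Suc[OF \<omega>M[OF Suc.prems] 1 2] by simp
  also have "eqg 1 (W (Suc i) (\<omega> i) - T (d + real (Suc i) *\<^sub>R a)) (?R - T (d + real (Suc i) *\<^sub>R a))"
    using Suc eqg_T[OF eqg_refl, of "d + real (Suc i) *\<^sub>R a" 0] abdM
    by (intro eqg_diff eqg_refl) (auto intro: M_add M_scale simp: eqg_def)
  finally show ?case
    unfolding e by (rule eqg_cong) (auto simp: pw field_simps)
qed

text \<open>For \<open>i = 0\<close> the two contributions, from \<open>Z\<close> on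
  \<open>ups (j - 1)\<close> and from \<open>T\<close> on \<open>\<omega> j\<close>, are both
  \<open>\<omega> (j - 1)\<close> up to sign and cancel; the recursion carries the zero
  along.\<close>

lemma W_ups_low: "i + 2 \<le> j \<Longrightarrow> j \<le> m \<Longrightarrow> eqg (int i - int j) (W (Suc i) (ups j)) 0"
proof (induction i arbitrary: j)
  case 0
  then obtain j' where j: "j = Suc j'" "1 \<le> j'" by (cases j) auto
  have 1: "eqg (- int j - 2 + 1) (T (ups j)) (ups j')" unfolding j by (rule Tupsk) (use 0 j in auto)
  have 2: "eqg (- int j - 2 + int 0 + 1) (Z (ups j)) (- \<omega> j)" by (rule Zupsk) (use 0 mn in auto)
  have "eqg (- int j) (W 1 (ups j)) (Z (ups j') - T (- \<omega> j))"
    using W_Suc[OF upsM[OF 0(2)] 1 2] by simp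
  also have "T (- \<omega> j) = - T (\<omega> j)" using op_minus[OF opT \<omega>M[of j]] 0 mn by simp
  also have "eqg (- int j) (Z (ups j') - - T (\<omega> j)) (- \<omega> j' - - \<omega> j')"
    unfolding j(1) by (intro eqg_diff eqg_minus Zupsk T\<omega>k) (use 0 j mn in auto)
  finally show ?case by simp
next
  case (Suc i)
  then obtain j' where j: "j = Suc j'" by (cases j) auto
  have 1: "eqg (- int j - 2 + 1) (T (ups j)) (ups j')" unfolding j by (rule Tupsk) (use Suc.prems j in auto)
  have 2: "eqg (- int j - 2 + int (Suc i) + 1) (W (Suc i) (ups j)) 0" using Suc.IH[of j] Suc.prems by simp
  have "eqg (int (Suc i) - int j) (W (Suc (Suc i)) (ups j)) (W (Suc i) (ups j') - T 0)"
    using W_Suc[OF upsM[OF Suc.prems(2)] 1 2] by (simp add: algebra_simps)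
  also have "eqg (int (Suc i) - int j) (W (Suc i) (ups j') - T 0) 0"
    using Suc.IH[of j'] Suc.prems by (simp add: j)
  finally show ?case .
qed

lemma W_ups_diag: "Suc i \<le> m \<Longrightarrow> eqg (- 1) (W (Suc i) (ups (Suc i))) \<zeta>"
proof (induction i)
  case 0
  have 1: "eqg (- 3 + 1) (T (ups 1)) 0" using Tups'[of 0] mn by (simp add: ups0)
  have 2: "eqg (- 3 + int 0 + 1) (Z (ups 1)) (- \<omega> 1)" by (rule Zupsk) (use mn mn in auto)
  have "eqg (- 1) (W 1 (ups 1)) (Z 0 - T (- \<omega> 1))"
    using W_Suc[OF _ 1 2] upsM[of 1] mn by simp
  also have "T (- \<omega> 1) = - T (\<omega> 1)" using op_minus[OF opT \<omega>M[of 1]] mn by simp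
  also have "eqg (- 1) (Z 0 - - T (\<omega> 1)) \<zeta>"
    using T\<omega>'[of 0] mn by simp
  finally show ?case by simp
next
  case (Suc i)
  let ?j = "Suc (Suc i)"
  have 1: "eqg (- int ?j - 2 + 1) (T (ups ?j)) (ups (Suc i))" by (rule Tupsk) (use Suc.prems in auto)
  have 2: "eqg (- int ?j - 2 + int (Suc i) + 1) (W (Suc i) (ups ?j)) 0"
    using W_ups_low[of i ?j] Suc.prems by simp
  have "eqg (- 1) (W ?j (ups ?j)) (W (Suc i) (ups (Suc i)) - T 0)"
    using W_Suc[OF upsM[OF Suc.prems(1)] 1 2] by simp
  thus ?case using Suc eqg_trans by simp
qed

lemma T_pow_\<zeta>M: "(T ^^ k) \<zeta> \<in> M (int k - 1)"
proof (induction k)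
  case (Suc k)
  thus ?case using TM[of "(T ^^ k) \<zeta>" "int k - 1"] by simp
qed (simp add: \<zeta>M)

text \<open>The recursion in \<open>i\<close> is Pascal's rule: passing from \<open>k\<close> to
  \<open>k + 1\<close> adds one more \<open>T\<close> and one more binomial summation.\<close>

lemma W_ups_up: "i \<le> m \<Longrightarrow> eqg (int k) (W (i + Suc k) (ups i)) (((- 1) ^ Suc k * real ((i + k) choose (Suc k))) *\<^sub>R (T ^^ Suc k) \<zeta>)"
proof (induction k arbitrary: i)
  case 0
  thus ?case
  proof (induction i)
    case 0
    thus ?case using ups0 eqg_refl[of 0] by simp
  next
    case (Suc i)
    have 1: "eqg (- int (Suc i) - 2 + 1) (T (ups (Suc i))) (ups i)" by (rule Tupsk) (use Suc.prems in auto)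
    have 2: "eqg (- int (Suc i) - 2 + int (Suc i) + 1) (W (Suc i) (ups (Suc i))) \<zeta>"
      using W_ups_diag Suc.prems by simp
    have "eqg 0 (W (Suc (Suc i)) (ups (Suc i))) (W (Suc i) (ups i) - T \<zeta>)"
      using W_Suc[OF upsM[OF Suc.prems(1)] 1 2] by simp
    also have "eqg 0 (W (Suc i) (ups i) - T \<zeta>) (((- 1) ^ Suc 0 * real ((i + 0) choose (Suc 0))) *\<^sub>R (T ^^ Suc 0) \<zeta> - T \<zeta>)"
      using Suc T_pow_\<zeta>M[of 1] by (intro eqg_diff eqg_refl) auto
    finally have "eqg 0 (W (Suc (Suc i)) (ups (Suc i))) (((- 1) ^ Suc 0 * real (Suc i choose (Suc 0))) *\<^sub>R (T ^^ Suc 0) \<zeta>)"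
      by (rule eqg_cong) (auto simp: pw algebra_simps)
    thus ?case by simp
  qed
next
  case (Suc k)
  have "i \<le> m \<Longrightarrow> eqg (int (Suc k)) (W (i + Suc (Suc k)) (ups i))
    (((- 1) ^ Suc (Suc k) * real ((i + Suc k) choose (Suc (Suc k)))) *\<^sub>R (T ^^ Suc (Suc k)) \<zeta>)" for i
  proof (induction i)
    case 0
    thus ?case using ups0 eqg_refl[of 0] by (simp add: binomial_eq_0)
  next
    case (Suc i)
    let ?c = "(- 1) ^ Suc k * real ((Suc i + k) choose (Suc k))"
    let ?c' = "(- 1) ^ Suc (Suc k) * real ((i + Suc k) choose (Suc (Suc k)))"
    have 1: "eqg (- int (Suc i) - 2 + 1) (T (ups (Suc i))) (ups i)" by (rule Tupsk) (use Suc.prems in auto)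
    have 2: "eqg (- int (Suc i) - 2 + int (Suc i + Suc k) + 1) (W (Suc i + Suc k) (ups (Suc i))) (?c *\<^sub>R (T ^^ Suc k) \<zeta>)"
      using \<open>\<And>i. i \<le> m \<Longrightarrow> eqg (int k) (W (i + Suc k) (ups i)) _\<close>[OF Suc.prems] by (simp add: algebra_simps)
    have e: "T (?c *\<^sub>R (T ^^ Suc k) \<zeta>) = ?c *\<^sub>R (T ^^ Suc (Suc k)) \<zeta>"
      using op_scale[OF opT T_pow_\<zeta>M[of "Suc k"], of ?c] by simp
    have "eqg (int (Suc k)) (W (Suc i + Suc (Suc k)) (ups (Suc i))) (W (Suc i + Suc k) (ups i) - T (?c *\<^sub>R (T ^^ Suc k) \<zeta>))"
      using W_Suc[OF upsM[OF Suc.prems(1)] 1 2] by (simp add: algebra_simps)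
    also have "eqg (int (Suc k)) (W (Suc i + Suc k) (ups i) - T (?c *\<^sub>R (T ^^ Suc k) \<zeta>))
       (?c' *\<^sub>R (T ^^ Suc (Suc k)) \<zeta> - ?c *\<^sub>R (T ^^ Suc (Suc k)) \<zeta>)"
      unfolding e using Suc M_scale[OF T_pow_\<zeta>M[of "Suc (Suc k)"]]
      by (intro eqg_diff eqg_refl) (auto intro: M_minus)
    finally show ?case
      by (rule eqg_cong) (auto simp: pw algebra_simps)
  qed
  thus ?case using Suc.prems by blast
qed

text \<open>\<open>W_ups_up\<close> at \<open>i = m\<close>, \<open>k = n - m\<close> involves
  \<open>W (n + 1) = 0\<close>, while the coefficient, n over k + 1, is nonzero because
  \<open>m \<ge> 1\<close>. So at most \<open>n - m\<close> derivatives of \<open>\<zeta>\<close>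
  along \<open>T\<close> remain free.\<close>

lemma T_pow_top: "(T ^^ (Suc n - m)) \<zeta> \<in> M (int n - int m - 1)"
proof -
  define k where "k = n - m"
  have k: "Suc n - m = Suc k" "m + Suc k = Suc n" "m + k = n" "int k = int n - int m"
    using mn by (auto simp: k_def)
  define c where "c = (- 1) ^ Suc k * real (n choose (Suc k))"
  have "eqg (int k) 0 (c *\<^sub>R (T ^^ Suc k) \<zeta>)"
    using W_ups_up[of m k] Wn[of "Suc n"] by (simp add: k c_def)
  hence "c *\<^sub>R (T ^^ Suc k) \<zeta> \<in> M (int k - 1)" using eqg_sym eqg_0 by blast
  moreover have "c \<noteq> 0" using mn k by (simp add: k_def c_def)
  ultimately have "(T ^^ Suc k) \<zeta> \<in> M (int k - 1)"
    using M_scale[of "c *\<^sub>R (T ^^ Suc k) \<zeta>" "int k - 1" "inverse c"] by simp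
  thus ?thesis using k by simp
qed

lemma Y_\<omega>_1: "1 \<le> i \<Longrightarrow> Suc i \<le> n \<Longrightarrow> eqg 0 (Y i (\<omega> (Suc i))) (- Z \<tau>)"
proof -
  assume i: "1 \<le> i" "Suc i \<le> n"
  let ?k = "- int (Suc i) - 1"
  have "eqg (?k + 1) (Z (\<omega> (Suc i))) 0" by (rule Z\<omega>k) (use i mn in auto)
  moreover have "eqg (?k + int i + 1) (W i (\<omega> (Suc i))) (- \<tau>)" using W_\<omega>_1[OF i(2)] by simp
  ultimately have "eqg (?k + int i + 2) (Y i (\<omega> (Suc i))) (Z (- \<tau>) - W i 0)"
    by (intro Y_ZW \<omega>M i)
  thus ?thesis by (simp add: op_minus[OF opW \<tau>M])
qed

lemma Y_ups_1: "1 \<le> i \<Longrightarrow> Suc i \<le> m \<Longrightarrow> eqg (- 1) (Y i (ups (Suc i))) (- \<tau>)"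
proof -
  assume i: "1 \<le> i" "Suc i \<le> m"
  let ?k = "- int (Suc i) - 2"
  have 1: "eqg (?k + 1) (Z (ups (Suc i))) (- \<omega> (Suc i))" by (rule Zupsk) (use i mn in auto)
  have 2: "eqg (?k + int i + 1) (W i (ups (Suc i))) 0" using W_ups_low[of "i - 1" "Suc i"] i by simp
  have "eqg (?k + int i + 2) (Y i (ups (Suc i))) (Z 0 - W i (- \<omega> (Suc i)))"
    by (rule Y_ZW[OF upsM[OF i(2)] i(1) 1 2])
  moreover have "W i (- \<omega> (Suc i)) = - W i (\<omega> (Suc i))" using op_minus[OF opW \<omega>M[of "Suc i"]] i mn by simp
  ultimately have "eqg (- 1) (Y i (ups (Suc i))) (W i (\<omega> (Suc i)))" by simp
  thus ?thesis using W_\<omega>_1[of i] i mn eqg_trans by simp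
qed

text \<open>For \<open>m = 1\<close>, \<open>Y 2\<close> is zero and on \<open>\<omega> 3\<close>,
  which exists as \<open>n \<ge> 3\<close>, it has the symbol of \<open>Y 1 (\<omega> 2)\<close>,
  hence of \<open>- Z \<tau>\<close>. For \<open>m \<ge> 2\<close>, \<open>Z\<close> and
  \<open>Y 1\<close> commute modulo lower degree; on \<open>ups 2\<close> this reads
  \<open>- Z \<tau> = Z \<tau>\<close>.\<close>

lemma Z\<tau>: "eqg 0 (Z \<tau>) 0"
proof (cases "m = 1")
  case True
  hence n: "3 \<le> n" using mn by auto
  have Z3: "eqg (- 4 + 1) (Z (\<omega> 3)) 0" by (rule Z\<omega>k) (use n mn in auto)
  have "eqg (- 4 + int 1 + 1) (W 1 (\<omega> 3)) 0" using W_\<omega>_low[of 1 3] n by simp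
  from Y_ZW[OF _ _ Z3 this] have Y3: "eqg (- 4 + int 1 + 2) (Y 1 (\<omega> 3)) 0" using \<omega>M[of 3] n by simp
  have "eqg (- 4 + 1) (T (\<omega> 3)) (\<omega> 2)" using T\<omega>'[of 2] n by (simp add: numeral_3_eq_3 numeral_2_eq_2)
  from Y_Suc[OF _ _ this Y3] have "eqg 0 0 (Y 1 (\<omega> 2))"
    using \<omega>M[of 3] n Ym[of "Suc 1"] True by simp
  moreover have "eqg 0 (Y 1 (\<omega> 2)) (- Z \<tau>)" using Y_\<omega>_1[of 1] n by (simp add: numeral_2_eq_2)
  ultimately have "eqg 0 0 (- Z \<tau>)" by (rule eqg_trans)
  thus ?thesis using eqg_minus[OF eqg_sym] by fastforce
next
  case False
  hence m: "2 \<le> m" using mn by auto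
  have Z2: "eqg (- 4 + 1) (Z (ups 2)) (- \<omega> 2)" by (rule Zupsk) (use m mn in auto)
  have Y2: "eqg (- 4 + int 1 + 2) (Y 1 (ups 2)) (- \<tau>)" using Y_ups_1[of 1] m by (simp add: numeral_2_eq_2)
  have ups2: "ups 2 \<in> M (- 4)" using upsM[of 2] m by simp
  from ZY_comm[OF ups2 _ Z2 Y2] have "eqg 0 (Z (- \<tau>)) (Y 1 (- \<omega> 2))" by simp
  moreover have "Y 1 (- \<omega> 2) = - Y 1 (\<omega> 2)" using op_minus[OF opY \<omega>M[of 2]] mn by simp
  ultimately have "eqg 0 (- Z \<tau>) (- Y 1 (\<omega> 2))" by (simp add: op_minus[OF opW \<tau>M])
  moreover have "eqg 0 (- Y 1 (\<omega> 2)) (- (- Z \<tau>))" using Y_\<omega>_1[of 1] mn by (intro eqg_minus) (simp add: numeral_2_eq_2)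
  ultimately have "eqg 0 (- Z \<tau>) (Z \<tau>)" using eqg_trans by fastforce
  hence "- Z \<tau> - Z \<tau> \<in> M (- 1)" using eqg_mem by fastforce
  hence "Z \<tau> \<in> M (- 1)" by (rule M_lin1[where a = "- 1/2"]) (simp add: pw)
  thus ?thesis by (simp add: eqg_0)
qed

lemma Y_ups_0: "1 \<le> i \<Longrightarrow> i \<le> m \<Longrightarrow> eqg 0 (Y i (ups i)) (2 *\<^sub>R d + real i *\<^sub>R a)"
proof -
  assume i: "1 \<le> i" "i \<le> m"
  let ?k = "- int i - 2"
  have 1: "eqg (?k + 1) (Z (ups i)) (- \<omega> i)" by (rule Zupsk) (use i mn in auto)
  have 2: "eqg (?k + int i + 1) (W i (ups i)) \<zeta>" using W_ups_diag[of "i - 1"] i by simp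
  have "eqg (?k + int i + 2) (Y i (ups i)) (Z \<zeta> - W i (- \<omega> i))"
    by (rule Y_ZW[OF upsM[OF i(2)] i(1) 1 2])
  moreover have "W i (- \<omega> i) = - W i (\<omega> i)" using op_minus[OF opW \<omega>M[of i]] i mn by simp
  ultimately have "eqg 0 (Y i (ups i)) (d + W i (\<omega> i))" by (simp add: d_def)
  also have "eqg 0 (d + W i (\<omega> i)) (d + (d + real i *\<^sub>R a))"
    using W_\<omega>_0[of i] i mn abdM by (intro eqg_add eqg_refl) auto
  finally show ?thesis by (rule eqg_cong) (auto simp: pw)
qed

section \<open>Relations among the derivatives of \<open>a\<close>, \<open>b\<close> and
  \<open>d\<close>\<close>

lemma Y_ups_m1: "i \<le> m \<Longrightarrow> eqg 1 (Y (Suc i) (ups i)) (- ((real i * (real i + 1) / 2) *\<^sub>R T a + (2 * real i) *\<^sub>R T d))"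
proof (induction i)
  case 0
  thus ?case using ups0 eqg_refl[of 0] by simp
next
  case (Suc i)
  let ?k = "- int (Suc i) - 2" and ?x = "2 *\<^sub>R d + real (Suc i) *\<^sub>R a"
  let ?R = "- ((real i * (real i + 1) / 2) *\<^sub>R T a + (2 * real i) *\<^sub>R T d)"
  have 1: "eqg (?k + 1) (T (ups (Suc i))) (ups i)" by (rule Tupsk) (use Suc.prems in auto)
  have 2: "eqg (?k + int (Suc i) + 2) (Y (Suc i) (ups (Suc i))) ?x"
    using Y_ups_0[of "Suc i"] Suc.prems by simp
  have xM: "?x \<in> M 0" using abdM by (intro M_add M_scale)
  have e: "T ?x = 2 *\<^sub>R T d + real (Suc i) *\<^sub>R T a"
    using op_add[OF opT M_scale[OF abdM(3)] M_scale[OF abdM(1)]] op_scale[OF opT] abdM by metis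
  have "eqg 1 (Y (Suc (Suc i)) (ups (Suc i))) (Y (Suc i) (ups i) - T ?x)"
    using Y_Suc[OF upsM[OF Suc.prems(1)] _ 1 2] by simp
  also have "eqg 1 (Y (Suc i) (ups i) - T ?x) (?R - T ?x)"
    using Suc TM[OF xM] by (intro eqg_diff eqg_refl) auto
  finally show ?case unfolding e by (rule eqg_cong) (auto simp: pw field_simps)
qed

lemma eqg_mem1: "eqg 1 x y \<Longrightarrow> x - y \<in> M 0"
  using eqg_mem[of 1] by simp

lemma W1\<tau>: "eqg 1 (W 1 \<tau>) (Z a)"
proof -
  have "eqg (- 1 + int 0 + 1) (Z \<tau>) 0" using Z\<tau> by simp
  from W_Suc[OF \<tau>M eqg_refl this] show ?thesis using TM[OF \<tau>M] by (simp add: a_def)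
qed

lemma Z_lin: "x \<in> M 0 \<Longrightarrow> y \<in> M 0 \<Longrightarrow> Z (r *\<^sub>R x + s *\<^sub>R y) = r *\<^sub>R Z x + s *\<^sub>R Z y"
  using op_add[OF opW[of 0] M_scale M_scale] op_scale[OF opW[of 0]] by metis

lemma Y_\<omega>_diag: "1 \<le> i \<Longrightarrow> i \<le> n \<Longrightarrow>
  eqg 1 (Y i (\<omega> i)) (Z d + real i *\<^sub>R Z a + (if i = 1 then Z a else 0))"
proof -
  assume i: "1 \<le> i" "i \<le> n"
  let ?k = "- int i - 1"
  define y where "y = (if i = 1 then - \<tau> else 0)"
  have 1: "eqg (?k + 1) (Z (\<omega> i)) y" using Z\<omega>1' Z\<omega>'[of i] i by (auto simp: y_def)
  have 2: "eqg (?k + int i + 1) (W i (\<omega> i)) (d + real i *\<^sub>R a)" using W_\<omega>_0[of i] i by simp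
  have "eqg 1 (Y i (\<omega> i)) (Z (d + real i *\<^sub>R a) - W i y)"
    using Y_ZW[OF \<omega>M[OF i(2)] i(1) 1 2] by simp
  also have "Z (d + real i *\<^sub>R a) = Z d + real i *\<^sub>R Z a" using Z_lin[of d a 1 "real i"] abdM by simp
  also have "eqg 1 (Z d + real i *\<^sub>R Z a - W i y) (Z d + real i *\<^sub>R Z a - (if i = 1 then - Z a else 0))"
  proof (intro eqg_diff eqg_refl)
    show "Z d + real i *\<^sub>R Z a \<in> M 1" using WM[OF abdM(1), of 0] WM[OF abdM(3), of 0] by (auto intro!: M_add M_scale)
    show "eqg 1 (W i y) (if i = 1 then - Z a else 0)"
      using W1\<tau> eqg_minus by (auto simp: y_def op_minus[OF opW \<tau>M] eqg_0)
  qed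
  finally show ?thesis by (rule eqg_cong) auto
qed

text \<open>Two independent relations between \<open>Z a\<close> and \<open>Z d\<close>. The first
  compares \<open>Z\<close> after \<open>Y 1\<close> with \<open>Y 1\<close> after \<open>Z\<close>
  on \<open>ups 1\<close>. The second is \<open>Y 2 = 0\<close> on \<open>\<omega> 2\<close> if
  \<open>m = 1\<close>, and otherwise the same comparison for \<open>Y 2\<close> on
  \<open>ups 2\<close>.\<close>

lemma Zad: "Z a \<in> M 0" "Z d \<in> M 0"
proof -
  have n2: "2 \<le> n" by (rule mn)
  have Zm: "eqg (- 3 + 1) (Z (ups 1)) (- \<omega> 1)" by (rule Zupsk) (use mn mn in auto)
  have Ym1: "eqg (- 3 + int 1 + 2) (Y 1 (ups 1)) (2 *\<^sub>R d + 1 *\<^sub>R a)" using Y_ups_0[of 1] mn by simp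
  have ups1: "ups 1 \<in> M (- 3)" using upsM[of 1] mn by simp
  have e: "Z (2 *\<^sub>R d + 1 *\<^sub>R a) = 2 *\<^sub>R Z d + 1 *\<^sub>R Z a" by (rule Z_lin[OF abdM(3,1)])
  have A: "eqg 1 (2 *\<^sub>R Z d + 1 *\<^sub>R Z a) (Y 1 (- \<omega> 1))"
    using ZY_comm[OF ups1 _ Zm Ym1] unfolding e by simp
  have B: "eqg 1 (Y 1 (\<omega> 1)) (Z d + 2 *\<^sub>R Z a)"
    by (rule eqg_cong[OF Y_\<omega>_diag[of 1]]) (use mn in \<open>auto simp: pw\<close>)
  have C: "Y 1 (- \<omega> 1) = - Y 1 (\<omega> 1)" using op_minus[OF opY \<omega>M[of 1]] mn by simp
  note eqg_trans[OF A[unfolded C] eqg_minus[OF B]]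
  from eqg_mem1[OF this] have 1: "Z d + Z a \<in> M 0"
    by (rule M_lin1[where a = "1/3"]) (simp add: pw)
  have 2: "\<exists>r s. s \<noteq> r \<and> r *\<^sub>R Z d + s *\<^sub>R Z a \<in> M 0"
  proof (cases "m = 1")
    case True
    have "eqg 1 0 (Z d + 2 *\<^sub>R Z a)" using Y_\<omega>_diag[of 2] n2 Ym[of 2] True by simp
    from eqg_mem1[OF eqg_sym[OF this]] show ?thesis by (intro exI[of _ 1] exI[of _ 2]) simp
  next
    case False
    hence m: "2 \<le> m" using mn by auto
    have Zm: "eqg (- 4 + 1) (Z (ups 2)) (- \<omega> 2)" by (rule Zupsk) (use m mn in auto)
    have Ym1: "eqg (- 4 + int 2 + 2) (Y 2 (ups 2)) (2 *\<^sub>R d + 2 *\<^sub>R a)" using Y_ups_0[of 2] m by simp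
    have ups1: "ups 2 \<in> M (- 4)" using upsM[of 2] m by simp
    have e: "Z (2 *\<^sub>R d + 2 *\<^sub>R a) = 2 *\<^sub>R Z d + 2 *\<^sub>R Z a" by (rule Z_lin[OF abdM(3,1)])
    have A: "eqg 1 (2 *\<^sub>R Z d + 2 *\<^sub>R Z a) (Y 2 (- \<omega> 2))"
      using ZY_comm[OF ups1 _ Zm Ym1] unfolding e by simp
    have B: "eqg 1 (Y 2 (\<omega> 2)) (Z d + 2 *\<^sub>R Z a)"
      by (rule eqg_cong[OF Y_\<omega>_diag[of 2]]) (use mn in \<open>auto simp: pw\<close>)
    have C: "Y 2 (- \<omega> 2) = - Y 2 (\<omega> 2)" using op_minus[OF opY \<omega>M[of 2]] mn by simp
    note eqg_trans[OF A[unfolded C] eqg_minus[OF B]]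
    from eqg_mem1[OF this] have "3 *\<^sub>R Z d + 4 *\<^sub>R Z a \<in> M 0"
      by (rule M_lin1[where a = 1]) (simp add: pw)
    thus ?thesis by (intro exI[of _ 3] exI[of _ 4]) simp
  qed
  then obtain r s where rs: "s \<noteq> r" "r *\<^sub>R Z d + s *\<^sub>R Z a \<in> M 0" by blast
  \<comment> \<open>\<open>D\<close> is the determinant of the system with rows (1, 1) and (r,
    s).\<close>
  obtain D where D: "s = r + D" "D \<noteq> 0" using rs(1) that[of "s - r"] by auto
  show Za: "Z a \<in> M 0"
    by (rule M_lin2[OF rs(2) 1, where a = "1 / D" and b = "- r / D"])
      (use D in \<open>simp add: pw field_simps\<close>)
  show "Z d \<in> M 0"
    by (rule M_lin2[OF Za 1, where a = "- 1" and b = 1]) (simp add: pw)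
qed

lemma R1: "Z b - (real n + 1) *\<^sub>R T d - (real n * (real n + 1) / 2) *\<^sub>R T a \<in> M 0"
  using eqg_mem1[OF eqg_sym[OF W_\<omega>_m1[of n]]] Wn[of "Suc n"] by simp

text \<open>\<open>Y_ups_m1\<close> read at \<open>i = m\<close>, where \<open>Y (m + 1)\<close> is
  zero, and divided by \<open>2 m\<close>.\<close>

lemma R2: "T d + ((real m + 1) / 4) *\<^sub>R T a \<in> M 0"
proof -
  show ?thesis
    by (rule M_lin1[OF eqg_mem1[OF Y_ups_m1[of m]], where a = "1 / (2 * real m)"])
      (use mn in \<open>simp_all add: Ym pw field_simps\<close>)
qed

text \<open>\<open>Y 3 (ups 2)\<close> is computed both from the bracket of \<open>Z\<close> and
  \<open>W 3\<close> and by the recursion along \<open>T\<close>. Together with \<open>R1\<close>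
  this gives \<open>T d\<close> as \<open>- (n + 1) / 2\<close> times \<open>T a\<close>, whereas
  \<open>R2\<close> gives the factor \<open>- (m + 1) / 4\<close>; the two differ since
  \<open>m \<le> n\<close>.\<close>

lemma Ta_m2: assumes "2 \<le> m" shows "T a \<in> M 0"
proof -
  let ?k = "- int 2 - 2"
  have 1: "eqg (?k + 1) (Z (ups 2)) (- \<omega> 2)" by (rule Zupsk) (use assms mn in auto)
  have 2: "eqg (?k + int 3 + 1) (W 3 (ups 2)) ((- 2) *\<^sub>R b)"
    using W_ups_up[of 2 0] assms by (simp add: b_def numeral_3_eq_3)
  have "eqg 1 (Y 3 (ups 2)) (Z ((- 2) *\<^sub>R b) - W 3 (- \<omega> 2))"
    using Y_ZW[OF upsM[OF assms] _ 1 2] by simp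
  moreover have "W 3 (- \<omega> 2) = - W 3 (\<omega> 2)" using op_minus[OF opW \<omega>M[of 2]] mn by simp
  moreover have "Z ((- 2) *\<^sub>R b) = (- 2) *\<^sub>R Z b" by (rule op_scale[OF opW abdM(2)])
  ultimately have 3: "Y 3 (ups 2) - ((- 2) *\<^sub>R Z b + W 3 (\<omega> 2)) \<in> M 0" using eqg_mem1 by fastforce
  have 4: "W 3 (\<omega> 2) - (Z b - 3 *\<^sub>R T d - 3 *\<^sub>R T a) \<in> M 0"
    using eqg_mem1[OF W_\<omega>_m1[of 2]] mn by (simp add: numeral_3_eq_3)
  have 5: "Y 3 (ups 2) - - (3 *\<^sub>R T a + 4 *\<^sub>R T d) \<in> M 0"
    using eqg_mem1[OF Y_ups_m1[of 2]] assms by (simp add: numeral_3_eq_3)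
  have 6: "Z b - T d \<in> M 0"
    by (rule M_lin3[OF 3 4 5, where a = 1 and b = 1 and c = "- 1"]) (simp add: pw)
  have 7: "T d + ((real n + 1) / 2) *\<^sub>R T a \<in> M 0"
    by (rule M_lin2[OF 6 R1, where a = "1 / real n" and b = "- 1 / real n"])
      (use mn in \<open>simp add: pw field_simps\<close>)
  have ne: "(real n + 1) / 2 - (real m + 1) / 4 \<noteq> 0" using mn by simp
  show ?thesis
    by (rule M_lin2[OF 7 R2, where a = "1 / ((real n + 1) / 2 - (real m + 1) / 4)"
          and b = "- 1 / ((real n + 1) / 2 - (real m + 1) / 4)"])
      (use ne in \<open>simp add: pw divide_simps, simp add: algebra_simps\<close>)
qed

lemma Td: "T d + (1 / 2) *\<^sub>R T a \<in> M 0"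
proof (cases "m = 1")
  case True
  thus ?thesis using R2 by simp
next
  case False
  hence Ta: "T a \<in> M 0" using Ta_m2 mn by simp
  show ?thesis
    by (rule M_lin2[OF R2 Ta, where a = 1 and b = "1 / 2 - (real m + 1) / 4"]) (simp add: pw field_simps)
qed

lemma Zb: "Z b - ((real n ^ 2 - 1) / 2) *\<^sub>R T a \<in> M 0"
  by (rule M_lin2[OF R1 Td, where a = 1 and b = "real n + 1"])
    (simp add: pw field_simps power2_eq_square)

text \<open>\<open>q i\<close> is the coefficient of \<open>T a\<close> in
  \<open>W (i + 1) (\<omega> i)\<close>; \<open>r i\<close> is the sum of \<open>q 1\<close> to
  \<open>q i\<close> and measures the drift of \<open>W (i + 2) (\<omega> i)\<close> away from
  \<open>W 2 \<zeta>\<close>, in units of \<open>T (T a)\<close>.\<close>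

definition "q i = (real n ^ 2 - 1) / 2 + (real i + 1) / 2 - real i * (real i + 1) / 2"
definition "r i = real i * (real n ^ 2 - 1) / 2 + real i * (real i + 3) / 4 - real i * (real i + 1) * (real i + 2) / 6"

lemma W_\<omega>_m1': "i \<le> n \<Longrightarrow> eqg 1 (W (Suc i) (\<omega> i)) (q i *\<^sub>R T a)"
proof -
  assume i: "i \<le> n"
  have "W (Suc i) (\<omega> i) - q i *\<^sub>R T a \<in> M 0"
    by (rule M_lin3[OF eqg_mem1[OF W_\<omega>_m1[OF i]] Zb Td, where a = 1 and b = 1 and c = "- (real i + 1)"])
      (simp add: pw q_def field_simps)
  thus ?thesis using M_scale[OF TM[OF abdM(1)]] by (intro eqgI) auto
qed

lemma W_\<omega>_m2: "i \<le> n \<Longrightarrow> eqg 2 (W (Suc (Suc i)) (\<omega> i)) (W 2 \<zeta> - r i *\<^sub>R T (T a))"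
proof (induction i)
  case 0
  thus ?case using WM[OF \<zeta>M, of 2] by (simp add: r_def eqg_refl numeral_2_eq_2)
next
  case (Suc i)
  let ?k = "- int (Suc i) - 1"
  have TTa: "T (T a) \<in> M 2" using TM[OF TM[OF abdM(1)]] by simp
  have 1: "eqg (?k + 1) (T (\<omega> (Suc i))) (\<omega> i)" by (rule T\<omega>k) (use Suc.prems in auto)
  have 2: "eqg (?k + int (Suc (Suc i)) + 1) (W (Suc (Suc i)) (\<omega> (Suc i))) (q (Suc i) *\<^sub>R T a)"
    using W_\<omega>_m1'[of "Suc i"] Suc.prems by simp
  have e: "T (q (Suc i) *\<^sub>R T a) = q (Suc i) *\<^sub>R T (T a)" by (rule op_scale[OF opT TM[OF abdM(1)]])
  have "eqg 2 (W (Suc (Suc (Suc i))) (\<omega> (Suc i))) (W (Suc (Suc i)) (\<omega> i) - T (q (Suc i) *\<^sub>R T a))"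
    using W_Suc[OF \<omega>M[OF Suc.prems] 1 2] by simp
  also have "eqg 2 (W (Suc (Suc i)) (\<omega> i) - T (q (Suc i) *\<^sub>R T a)) (W 2 \<zeta> - r i *\<^sub>R T (T a) - q (Suc i) *\<^sub>R T (T a))"
    unfolding e using Suc M_scale[OF TTa] by (intro eqg_diff eqg_refl) auto
  finally show ?case
    by (rule eqg_cong) (auto simp: pw r_def q_def field_simps)
qed

text \<open>At \<open>i = n\<close> the left side of \<open>W_\<omega>_m2\<close> is zero, because
  \<open>W (n + 2)\<close> lies past the end of the chain.\<close>

lemma W2\<zeta>: "eqg 2 (W 2 \<zeta>) (r n *\<^sub>R T (T a))"
proof -
  have "eqg 2 0 (W 2 \<zeta> - r n *\<^sub>R T (T a))" using W_\<omega>_m2[of n] Wn[of "Suc (Suc n)"] by simp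
  hence "W 2 \<zeta> - r n *\<^sub>R T (T a) \<in> M 1" using eqg_mem[OF eqg_sym] by fastforce
  thus ?thesis using M_scale[OF TM[OF TM[OF abdM(1)]]] by (intro eqgI) auto
qed

text \<open>For \<open>m = 1\<close>, \<open>Y 3 = 0\<close> on \<open>\<omega> 2\<close> leaves
  \<open>q 2\<close> times \<open>Z (T a)\<close>, and \<open>q 2\<close> is (n^2 - 4) / 2. It
  vanishes precisely at the excluded value \<open>n = 2\<close>.\<close>

lemma ZTa: "Z (T a) \<in> M 1"
proof (cases "m = 1")
  case False
  thus ?thesis using WM[OF Ta_m2, of 0] mn by simp
next
  case True
  hence n: "3 \<le> n" using mn by auto
  let ?k = "- int 2 - 1"
  have 1: "eqg (?k + 1) (Z (\<omega> 2)) 0" by (rule Z\<omega>k) (use n mn in auto)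
  have 2: "eqg (?k + int 3 + 1) (W 3 (\<omega> 2)) (q 2 *\<^sub>R T a)" using W_\<omega>_m1'[of 2] n by (simp add: numeral_3_eq_3)
  have "eqg 2 (Y 3 (\<omega> 2)) (Z (q 2 *\<^sub>R T a) - W 3 0)"
    using Y_ZW[OF \<omega>M _ 1 2] n by simp
  hence "eqg 2 (q 2 *\<^sub>R Z (T a)) 0"
    using Ym[of 3] True eqg_sym op_scale[OF opW TM[OF abdM(1)], of 0 "q 2"] by simp
  hence *: "q 2 *\<^sub>R Z (T a) \<in> M 1" by (simp add: eqg_0)
  have "real n ^ 2 > 4" using n power_strict_mono[of 2 "real n" 2] by simp
  hence "q 2 \<noteq> 0" by (simp add: q_def)
  thus ?thesis by (intro M_lin1[OF *, where a = "1 / q 2"]) simp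
qed

lemma r_nonneg: "r n \<ge> 0"
proof -
  have "r n = real n * (real n - 1) * (4 * real n + 1) / 12"
    by (simp add: r_def field_simps power2_eq_square)
  moreover have "real n * (real n - 1) * (4 * real n + 1) \<ge> 0"
    using mn by (intro mult_nonneg_nonneg) auto
  ultimately show ?thesis by simp
qed

lemma Zpow_1: "eqg 1 (Z b) (((real n ^ 2 - 1) / 2) *\<^sub>R T a)"
  using Zb M_scale[OF TM[OF abdM(1)]] by (intro eqgI) auto

lemma W1b: "eqg 2 (W 1 b) ((q 0 + r n) *\<^sub>R T (T a))"
proof -
  have TTa: "T (T a) \<in> M 2" using TM[OF TM[OF abdM(1)]] by simp
  have 1: "eqg (- 1 + int 1 + 1) (W 1 \<zeta>) (q 0 *\<^sub>R T a)" using W_\<omega>_m1'[of 0] by simp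
  have "eqg 2 (W 2 \<zeta>) (W 1 b - T (q 0 *\<^sub>R T a))"
    using W_Suc[OF \<zeta>M eqg_refl 1] abdM by (simp add: b_def numeral_2_eq_2)
  hence "eqg 2 (W 1 b - T (q 0 *\<^sub>R T a) + T (q 0 *\<^sub>R T a)) (r n *\<^sub>R T (T a) + q 0 *\<^sub>R T (T a))"
    using eqg_trans[OF eqg_sym W2\<zeta>] M_scale[OF TTa] op_scale[OF opT TM[OF abdM(1)], of "q 0"]
    by (intro eqg_add) (auto intro: eqg_refl)
  thus ?thesis by (simp add: algebra_simps)
qed

text \<open>For \<open>m = 1\<close>, \<open>Y 3 = 0\<close> on \<open>ups 1\<close> says that
  \<open>Z (T b) + W 3 (\<omega> 1)\<close> is negligible. Both terms are multiples of
  \<open>T (T a)\<close>, and their coefficients add up to n^2 / 2 + 2 r(n), which is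
  positive.\<close>

lemma TTa: "T (T a) \<in> M 1"
proof (cases "m = 1")
  case False
  thus ?thesis using TM[OF Ta_m2] mn by simp
next
  case True
  hence n: "3 \<le> n" using mn by auto
  have TTa2: "T (T a) \<in> M 2" using TM[OF TM[OF abdM(1)]] by simp
  let ?k = "- int 1 - 2"
  have 1: "eqg (?k + 1) (Z (ups 1)) (- \<omega> 1)" by (rule Zupsk) (use mn mn in auto)
  have 2: "eqg (?k + int 3 + 1) (W 3 (ups 1)) (T b)"
    using W_ups_up[of 1 1] mn by (simp add: b_def numeral_3_eq_3)
  have "eqg 2 (Y 3 (ups 1)) (Z (T b) - W 3 (- \<omega> 1))"
    using Y_ZW[OF upsM _ 1 2] mn by simp
  hence "eqg 2 0 (Z (T b) + W 3 (\<omega> 1))"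
    using Ym[of 3] True op_minus[OF opW \<omega>M[of 1]] mn by simp
  hence A: "Z (T b) + W 3 (\<omega> 1) \<in> M 1" using eqg_mem[OF eqg_sym] by fastforce
  have "eqg (0 + int 0 + 1) (Z b) (((real n ^ 2 - 1) / 2) *\<^sub>R T a)" using Zpow_1 by simp
  from W_Suc[OF abdM(2) eqg_refl this] TM[OF abdM(2)]
  have "eqg 2 (W 1 b) (Z (T b) - T (((real n ^ 2 - 1) / 2) *\<^sub>R T a))" by simp
  hence "W 1 b - (Z (T b) - ((real n ^ 2 - 1) / 2) *\<^sub>R T (T a)) \<in> M 1"
    using eqg_mem[of 2] op_scale[OF opT TM[OF abdM(1)], of "(real n ^ 2 - 1) / 2"] by fastforce
  hence B: "(q 0 + r n + (real n ^ 2 - 1) / 2) *\<^sub>R T (T a) - Z (T b) \<in> M 1"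
    by (rule M_lin2[OF _ eqg_mem[OF W1b, simplified], where a = 1 and b = "- 1"])
      (simp add: pw algebra_simps)
  have "W 3 (\<omega> 1) - (W 2 \<zeta> - r 1 *\<^sub>R T (T a)) \<in> M 1"
    using eqg_mem[OF W_\<omega>_m2[of 1]] mn by (simp add: numeral_3_eq_3)
  hence C: "W 3 (\<omega> 1) - (r n - r 1) *\<^sub>R T (T a) \<in> M 1"
    by (rule M_lin2[OF _ eqg_mem[OF W2\<zeta>, simplified], where a = 1 and b = 1])
      (simp add: pw algebra_simps)
  let ?K = "q 0 + r n + (real n ^ 2 - 1) / 2 + (r n - r 1)"
  have D: "?K *\<^sub>R T (T a) \<in> M 1"
    by (rule M_lin3[OF A B C, where a = 1 and b = 1 and c = "- 1"]) (simp add: pw algebra_simps)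
  have "q 0 + (real n ^ 2 - 1) / 2 - r 1 = real n ^ 2 / 2" by (simp add: q_def r_def field_simps)
  hence "?K = real n ^ 2 / 2 + 2 * r n" by linarith
  moreover have "real n ^ 2 > 0" using mn by simp
  ultimately have "?K > 0" using r_nonneg by linarith
  thus ?thesis by (intro M_lin1[OF D, where a = "1 / ?K"]) simp
qed

text \<open>With \<open>T (T a)\<close> negligible the case \<open>k = 2\<close> is settled. For
  larger \<open>k\<close> the correction by \<open>T\<close> is negligible by the previous
  \<open>k\<close>, so \<open>i\<close> may be raised until \<open>i = n\<close>, where the operator
  is zero.\<close>

lemma W_\<omega>_high: "2 \<le> k \<Longrightarrow> i \<le> n \<Longrightarrow> eqg (int k) (W (i + k) (\<omega> i)) 0"
proof (induction k arbitrary: i rule: nat_induct_at_least)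
  case base
  have 1: "W 2 \<zeta> \<in> M 1"
    by (rule M_lin2[OF eqg_mem[OF W2\<zeta>, simplified] TTa, where a = 1 and b = "r n"]) (simp add: pw)
  have "W (Suc (Suc i)) (\<omega> i) \<in> M 1"
    by (rule M_lin3[OF eqg_mem[OF W_\<omega>_m2[OF base], simplified] 1 TTa, where a = 1 and b = 1 and c = "- r i"])
      (simp add: pw)
  thus ?case by (simp add: eqg_0)
next
  case (Suc k)
  have step: "eqg (int (Suc k)) (W (i + Suc k) (\<omega> i)) (W (Suc i + Suc k) (\<omega> (Suc i)))" if "Suc i \<le> n" for i
  proof -
    have 1: "eqg (- int (Suc i) - 1 + 1) (T (\<omega> (Suc i))) (\<omega> i)" by (rule T\<omega>k) (use that in auto)
    have 2: "eqg (- int (Suc i) - 1 + int (Suc i + k) + 1) (W (Suc i + k) (\<omega> (Suc i))) 0"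
      using Suc.IH[OF that] by (simp add: algebra_simps)
    have "eqg (int (Suc k)) (W (Suc (Suc i + k)) (\<omega> (Suc i))) (W (Suc i + k) (\<omega> i) - T 0)"
      using W_Suc[OF \<omega>M[OF that] 1 2] by (simp add: algebra_simps)
    thus ?thesis using eqg_sym by simp
  qed
  from Suc.prems show ?case
  proof (induction i rule: inc_induct)
    case base
    thus ?case using Wn[of "n + Suc k" "\<omega> n"] eqg_refl[of 0] by simp
  next
    case (step i)
    thus ?case using \<open>\<And>i. Suc i \<le> n \<Longrightarrow> eqg (int (Suc k)) (W (i + Suc k) (\<omega> i)) _\<close>[of i] eqg_trans by fastforce
  qed
qed

text \<open>\<open>W j\<close> is moved past one \<open>T\<close> at a time, at the price of
  \<open>W (j + 1)\<close>. The cases with \<open>j + k = 1\<close> are multiples of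
  \<open>T a\<close> and not themselves negligible, but one more \<open>T\<close> turns them into
  multiples of \<open>T (T a)\<close>.\<close>

lemma W_Tpow: "2 \<le> j + k \<Longrightarrow> eqg (int j + int k) (W j ((T ^^ k) \<zeta>)) 0"
proof (induction k arbitrary: j)
  case 0
  thus ?case using W_\<omega>_high[of j 0] by simp
next
  case (Suc k)
  let ?x = "(T ^^ k) \<zeta>"
  have x: "?x \<in> M (int k - 1)" by (rule T_pow_\<zeta>M)
  have Wx: "W j ?x \<in> M (int j + int k)" using WM[OF x, of j] by (simp add: algebra_simps)
  have 2: "eqg (int (Suc j) + int k) (W (Suc j) ?x) 0" using Suc.IH[of "Suc j"] Suc.prems by (simp add: algebra_simps)
  have 3: "T (W j ?x) \<in> M (int j + int k)"
  proof (cases "2 \<le> j + k")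
    case True
    hence "W j ?x \<in> M (int j + int k - 1)" using Suc.IH[of j] by (simp add: eqg_0)
    thus ?thesis using TM by fastforce
  next
    case False
    hence jk: "(j = 1 \<and> k = 0) \<or> (j = 0 \<and> k = 1)" using Suc.prems by auto
    then obtain c where "eqg 1 (W j ?x) (c *\<^sub>R T a)"
      using W_\<omega>_m1'[of 0] Zpow_1 by (auto simp: b_def)
    from eqg_T[OF this] have "eqg 2 (T (W j ?x)) (c *\<^sub>R T (T a))" using op_scale[OF opT TM[OF abdM(1)]] by simp
    hence "T (W j ?x) \<in> M 1"
      by (intro M_lin2[OF eqg_mem[of 2, simplified] TTa, of _ _ _ 1 c]) (auto simp: pw)
    thus ?thesis using jk by auto
  qed
  have 4: "W j (T ?x) - T (W j ?x) - W (Suc j) ?x \<in> M (int j + int k)"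
    using WT[OF x, of j] by (simp add: add.commute)
  have 5: "W (Suc j) ?x \<in> M (int j + int k)" using 2 by (simp add: eqg_0)
  have "W j (T ?x) \<in> M (int j + int k)"
    by (rule M_lin3[OF 4 5 3, where a = 1 and b = 1 and c = 1]) (simp add: pw)
  thus ?case by (simp add: eqg_0)
qed

lemma Z_Tpow: "2 \<le> k \<Longrightarrow> Z ((T ^^ k) \<zeta>) \<in> M (int k - 1)"
  using W_Tpow[of 0 k] by (simp add: eqg_0)

end

section \<open>Symmetries in an adapted frame\<close>

datatype leg = FT | FW nat | FY nat

primrec wt :: "leg \<Rightarrow> nat" where
  "wt FT = 1" | "wt (FW i) = i + 1" | "wt (FY i) = i + 2"

definition legs :: "nat \<Rightarrow> nat \<Rightarrow> leg set"
  where "legs m n = insert FT (FW ` {..n} \<union> FY ` {1..m})"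

lemma legs_simps [simp]: "FT \<in> legs m n" "FW i \<in> legs m n \<longleftrightarrow> i \<le> n" "FY i \<in> legs m n \<longleftrightarrow> 1 \<le> i \<and> i \<le> m"
  by (auto simp: legs_def)

lemma finite_legs [simp]: "finite (legs m n)"
  by (simp add: legs_def)

lemma card_legs: "card (legs m n) = m + n + 2"
proof -
  have "card (FW ` {..n} \<union> FY ` {1..m}) = (n + 1) + m"
    by (subst card_Un_disjoint) (auto simp: card_image inj_on_def)
  thus ?thesis by (subst legs_def, subst card_insert_disjoint) auto
qed

lemma wt_pos: "wt c \<ge> 1" by (cases c) auto

text \<open>A bracket of \<open>E e\<close> with a horizontal field is prescribed only in components
  of weight above \<open>wt e\<close>; the others are arbitrary. This is just what determines
  symbols, and just what every Monge equation can provide.\<close>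

locale adapted_frame =
  fixes B :: "'a::euclidean_space set" and E eps :: "leg \<Rightarrow> 'a \<Rightarrow> 'a" and m n :: nat
  assumes mn: "1 \<le> m" "m \<le> n" "2 \<le> n" "m = 1 \<Longrightarrow> 3 \<le> n"
    and frame: "smooth_frame B (legs m n) E eps"
    and conn: "connected B"
    and W_T: "\<And>i c q. i \<le> n \<Longrightarrow> c \<in> legs m n \<Longrightarrow> i + 2 \<le> wt c \<Longrightarrow> q \<in> B \<Longrightarrow>
      eps c q \<bullet> lie_bracket (E (FW i)) (E FT) q = (if c = FW (Suc i) then 1 else 0)"
    and Y_T: "\<And>i c q. 1 \<le> i \<Longrightarrow> i \<le> m \<Longrightarrow> c \<in> legs m n \<Longrightarrow> i + 3 \<le> wt c \<Longrightarrow> q \<in> B \<Longrightarrow>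
      eps c q \<bullet> lie_bracket (E (FY i)) (E FT) q = (if c = FY (Suc i) then 1 else 0)"
    and W_Z: "\<And>i c q. 1 \<le> i \<Longrightarrow> i \<le> n \<Longrightarrow> c \<in> legs m n \<Longrightarrow> i + 2 \<le> wt c \<Longrightarrow> q \<in> B \<Longrightarrow>
      eps c q \<bullet> lie_bracket (E (FW i)) (E (FW 0)) q = (if c = FY i then - 1 else 0)"
    and Y_Z: "\<And>i c q. 1 \<le> i \<Longrightarrow> i \<le> m \<Longrightarrow> c \<in> legs m n \<Longrightarrow> i + 3 \<le> wt c \<Longrightarrow> q \<in> B \<Longrightarrow>
      eps c q \<bullet> lie_bracket (E (FY i)) (E (FW 0)) q = 0"
begin

abbreviation "I \<equiv> legs m n"

lemma frame_facts:
  shows openB: "open B" and smE: "c \<in> I \<Longrightarrow> smooth_on B (E c)" and smeps: "c \<in> I \<Longrightarrow> smooth_on B (eps c)"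
    and rep: "q \<in> B \<Longrightarrow> (\<Sum>c\<in>I. (eps c q \<bullet> v) *\<^sub>R E c q) = v"
    and dual: "q \<in> B \<Longrightarrow> c \<in> I \<Longrightarrow> e \<in> I \<Longrightarrow> eps c q \<bullet> E e q = (if c = e then 1 else 0)"
  using frame unfolding smooth_frame_def by auto

lemma horiz_smooth: "D \<in> {FT, FW 0} \<Longrightarrow> smooth_on B (E D)"
  using smE by auto

lemma bracket_low:
  assumes "c \<in> I" "e \<in> I" "D \<in> {FT, FW 0}" "wt e + 1 < wt c" "q \<in> B"
  shows "eps c q \<bullet> lie_bracket (E e) (E D) q = 0"
proof (cases e)
  case FT
  thus ?thesis using assms W_T[of 0 c q] lie_bracket_anti[of "E FT" "E (FW 0)" q] by (auto split: if_splits)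
next
  case (FW i)
  thus ?thesis using assms W_T[of i c q] W_Z[of i c q]
    by (cases "i = 0") (auto split: if_splits)
next
  case (FY i)
  thus ?thesis using assms Y_T[of i c q] Y_Z[of i c q] by (auto split: if_splits)
qed

text \<open>The infinitesimal form of preserving the distribution: brackets with the two horizontal
  fields are horizontal. The value 0 outside \<open>B\<close> makes equality of functions mean
  equality on \<open>B\<close>.\<close>

definition syms :: "('a \<Rightarrow> 'a) set"
  where "syms = {V. smooth_on B V \<and> (\<forall>q\<in>B. \<forall>c\<in>I. 1 < wt c \<longrightarrow>
      eps c q \<bullet> lie_bracket V (E FT) q = 0 \<and> eps c q \<bullet> lie_bracket V (E (FW 0)) q = 0) \<and>
    (\<forall>q. q \<notin> B \<longrightarrow> V q = 0)}"

lemma syms_smooth: "V \<in> syms \<Longrightarrow> smooth_on B V"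
  by (simp add: syms_def)

lemma syms_bracket:
  "V \<in> syms \<Longrightarrow> q \<in> B \<Longrightarrow> c \<in> I \<Longrightarrow> 1 < wt c \<Longrightarrow> D \<in> {FT, FW 0} \<Longrightarrow> eps c q \<bullet> lie_bracket V (E D) q = 0"
  by (auto simp: syms_def)

definition comp :: "leg \<Rightarrow> ('a \<Rightarrow> 'a) \<times> 'a \<Rightarrow> real"
  where "comp c = (\<lambda>(V, q). eps c q \<bullet> V q)"

text \<open>The value 0 off \<open>syms\<close> and \<open>B\<close> makes the operator depend only
  on the values of \<open>\<Phi>\<close> there, as \<open>opf_cong\<close> records.\<close>

definition opf :: "('a \<Rightarrow> 'a) \<Rightarrow> (('a \<Rightarrow> 'a) \<times> 'a \<Rightarrow> real) \<Rightarrow> ('a \<Rightarrow> 'a) \<times> 'a \<Rightarrow> real"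
  where "opf X \<Phi> = (\<lambda>(V, q). if V \<in> syms \<and> q \<in> B then lie_deriv X (\<lambda>q. \<Phi> (V, q)) q else 0)"

text \<open>The bound in clause \<open>der\<close> keeps derivatives out of the negative levels: up
  to level -1 a functional is a combination of components, and so vanishes where these do. That
  components of higher weight may be differentiated as well is a consequence of the determining
  equations, proved in \<open>Mf_der_all\<close>.\<close>

inductive Mf :: "int \<Rightarrow> (('a \<Rightarrow> 'a) \<times> 'a \<Rightarrow> real) \<Rightarrow> bool" where
  zero: "Mf k 0"
| comp: "c \<in> I \<Longrightarrow> - int (wt c) \<le> k \<Longrightarrow> Mf k (comp c)"
| der: "Mf k \<Phi> \<Longrightarrow> - 1 \<le> k \<Longrightarrow> D \<in> {FT, FW 0} \<Longrightarrow> Mf (k + 1) (opf (E D) \<Phi>)"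
| up: "Mf k \<Phi> \<Longrightarrow> k \<le> l \<Longrightarrow> Mf l \<Phi>"
| add: "Mf k \<Phi> \<Longrightarrow> Mf k \<Psi> \<Longrightarrow> Mf k (\<Phi> + \<Psi>)"
| mul: "smooth_on B s \<Longrightarrow> Mf k \<Phi> \<Longrightarrow> Mf k (\<lambda>(V, q). s q * \<Phi> (V, q))"
| eqv: "Mf k \<Phi> \<Longrightarrow> (\<And>V q. V \<in> syms \<Longrightarrow> q \<in> B \<Longrightarrow> \<Phi> (V, q) = \<Psi> (V, q)) \<Longrightarrow> Mf k \<Psi>"

lemma opf_cong:
  "(\<And>V q. V \<in> syms \<Longrightarrow> q \<in> B \<Longrightarrow> \<Phi> (V, q) = \<Psi> (V, q)) \<Longrightarrow> opf X \<Phi> = opf X \<Psi>"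
  by (rule ext) (auto simp: opf_def intro!: lie_deriv_cong[OF openB])

lemma Mf_smooth: "Mf k \<Phi> \<Longrightarrow> V \<in> syms \<Longrightarrow> smooth_on B (\<lambda>q. \<Phi> (V, q))"
proof (induction rule: Mf.induct)
  case (comp c k)
  thus ?case by (simp add: comp_def smooth_on_inner openB smeps syms_smooth)
next
  case (der k \<Phi> D)
  have "smooth_on B (lie_deriv (E D) (\<lambda>q. \<Phi> (V, q)))"
    by (rule smooth_on_lie_deriv[OF openB horiz_smooth[OF der(3)] der(4)[OF der(5)]])
  thus ?case by (rule smooth_on_cong[OF openB, rotated]) (simp add: opf_def der(5))
next
  case (eqv k \<Phi> \<Psi>)
  thus ?case using smooth_on_cong[OF openB, of "\<lambda>q. \<Phi> (V, q)" "\<lambda>q. \<Psi> (V, q)"] by simp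
qed (auto intro!: smooth_intros openB simp: smooth_on_const)

lemma Mf_sum: "(\<And>i. i \<in> A \<Longrightarrow> Mf k (\<Phi> i)) \<Longrightarrow> Mf k (\<lambda>x. \<Sum>i\<in>A. \<Phi> i x)"
proof (induction A rule: infinite_finite_induct)
  case (infinite A)
  thus ?case using Mf.zero[of k] by (simp add: zero_fun_def)
next
  case empty
  thus ?case using Mf.zero[of k] by (simp add: zero_fun_def)
next
  case (insert i A)
  hence "Mf k (\<Phi> i + (\<lambda>x. \<Sum>i\<in>A. \<Phi> i x))" by (intro Mf.add) auto
  thus ?case using insert by (simp add: plus_fun_def)
qed

lemma Mf_scaleR: "Mf k \<Phi> \<Longrightarrow> Mf k (c *\<^sub>R \<Phi>)"
  by (rule Mf.eqv[OF Mf.mul[OF smooth_on_const[of B c]]]) (auto simp: scaleR_fun_apply)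

lemma Mf_subspace: "subspace {\<Phi>. Mf k \<Phi>}"
  using Mf.zero Mf.add Mf_scaleR by (auto simp: subspace_def)

lemma Mf_minus: "Mf k \<Phi> \<Longrightarrow> Mf k (- \<Phi>)"
  using Mf_scaleR[of k \<Phi> "- 1"] by simp

lemma Mf_diff: "Mf k \<Phi> \<Longrightarrow> Mf k \<Psi> \<Longrightarrow> Mf k (\<Phi> - \<Psi>)"
  using subspace_diff[OF Mf_subspace, of \<Phi> k \<Psi>] by simp

text \<open>The determining equation: expand \<open>V\<close> in the frame inside its bracket with
  \<open>E D\<close> and take the component \<open>c\<close>, which must vanish.\<close>

lemma comp_deriv:
  assumes V: "V \<in> syms" and q: "q \<in> B" and c: "c \<in> I" "1 < wt c" and D: "D \<in> {FT, FW 0}"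
  shows "lie_deriv (E D) (\<lambda>q. eps c q \<bullet> V q) q = (\<Sum>e\<in>I. (eps c q \<bullet> lie_bracket (E e) (E D) q) * (eps e q \<bullet> V q))"
proof -
  have sv: "smooth_on B (\<lambda>q. eps e q \<bullet> V q)" if "e \<in> I" for e
    by (intro smooth_intros openB smeps syms_smooth V that)
  have "lie_bracket V (E D) q = - lie_bracket (E D) (\<lambda>q. \<Sum>e\<in>I. (eps e q \<bullet> V q) *\<^sub>R E e q) q"
    by (subst lie_bracket_anti, subst lie_bracket_cong[OF openB q, of "E D" "E D" V "\<lambda>q. \<Sum>e\<in>I. (eps e q \<bullet> V q) *\<^sub>R E e q"])
      (auto simp: rep)
  also have "\<dots> = (\<Sum>e\<in>I. (eps e q \<bullet> V q) *\<^sub>R lie_bracket (E e) (E D) q - lie_deriv (E D) (\<lambda>q. eps e q \<bullet> V q) q *\<^sub>R E e q)"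
    by (subst lie_bracket_sum_scaleR_right[OF openB q sv smE horiz_smooth[OF D]])
      (auto simp: lie_bracket_anti[of "E D" "E _" q] sum_negf[symmetric] intro!: sum.cong)
  finally have "0 = eps c q \<bullet> (\<Sum>e\<in>I. (eps e q \<bullet> V q) *\<^sub>R lie_bracket (E e) (E D) q - lie_deriv (E D) (\<lambda>q. eps e q \<bullet> V q) q *\<^sub>R E e q)"
    using syms_bracket[OF V q c D] by simp
  also have "\<dots> = (\<Sum>e\<in>I. (eps c q \<bullet> lie_bracket (E e) (E D) q) * (eps e q \<bullet> V q))
      - (\<Sum>e\<in>I. lie_deriv (E D) (\<lambda>q. eps e q \<bullet> V q) q * (eps c q \<bullet> E e q))"
    by (simp add: inner_sum_right inner_diff_right sum_subtractf mult.commute)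
  also have "(\<Sum>e\<in>I. lie_deriv (E D) (\<lambda>q. eps e q \<bullet> V q) q * (eps c q \<bullet> E e q))
      = (\<Sum>e\<in>I. if c = e then lie_deriv (E D) (\<lambda>q. eps e q \<bullet> V q) q else 0)"
    using dual[OF q c(1)] by (intro sum.cong refl) auto
  finally show ?thesis using c by simp
qed

text \<open>The determining equation sorted by weight: legs of weight at least \<open>wt c\<close>
  give lower degree, those one step lighter give the leading term, and still lighter ones drop out
  by \<open>bracket_low\<close>.\<close>

lemma Mf_comp_deriv:
  assumes c: "c \<in> I" "1 < wt c" and D: "D \<in> {FT, FW 0}" and a0: "a0 \<in> I"
    and lead: "\<And>e q. e \<in> I \<Longrightarrow> wt e + 1 = wt c \<Longrightarrow> q \<in> B \<Longrightarrow>
      eps c q \<bullet> lie_bracket (E e) (E D) q = (if e = a0 then r else 0)"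
    and r: "wt a0 + 1 = wt c \<or> r = 0"
  shows "Mf (- int (wt c)) (opf (E D) (comp c) - r *\<^sub>R comp a0)"
proof -
  define s where "s = (\<lambda>e q. if wt c \<le> wt e then eps c q \<bullet> lie_bracket (E e) (E D) q else 0)"
  have "Mf (- int (wt c)) (\<lambda>x. \<Sum>e\<in>I. (\<lambda>(V, q). s e q * comp e (V, q)) x)"
  proof (rule Mf_sum)
    fix e assume e: "e \<in> I"
    show "Mf (- int (wt c)) (\<lambda>(V, q). s e q * comp e (V, q))"
    proof (cases "wt c \<le> wt e")
      case True
      have "smooth_on B (s e)" unfolding s_def using True e c
        by (auto intro!: smooth_intros openB smeps smE horiz_smooth[OF D])
      thus ?thesis using True e by (intro Mf.mul Mf.comp) auto
    next
      case False
      thus ?thesis by (intro Mf.eqv[OF Mf.zero]) (simp add: s_def)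
    qed
  qed
  thus ?thesis
  proof (rule Mf.eqv)
    fix V q assume V: "V \<in> syms" "q \<in> B"
    have split: "(eps c q \<bullet> lie_bracket (E e) (E D) q) * (eps e q \<bullet> V q)
        = s e q * (eps e q \<bullet> V q) + (if e = a0 then r * (eps e q \<bullet> V q) else 0)" if e: "e \<in> I" for e
    proof -
      consider "wt c \<le> wt e" | "wt e + 1 = wt c" | "wt e + 1 < wt c" by linarith
      thus ?thesis
      proof cases
        case 1
        thus ?thesis using r by (auto simp: s_def)
      next
        case 2
        thus ?thesis using lead[OF e 2 V(2)] by (auto simp: s_def)
      next
        case 3
        thus ?thesis using bracket_low[OF c(1) e D 3 V(2)] r by (auto simp: s_def)
      qed
    qed
    have "opf (E D) (comp c) (V, q) = (\<Sum>e\<in>I. s e q * (eps e q \<bullet> V q)) + r * (eps a0 q \<bullet> V q)"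
      using V a0 by (simp add: opf_def comp_def comp_deriv[OF V c D] split sum.distrib)
    thus "(\<Sum>e\<in>I. (case (V, q) of (V, q) \<Rightarrow> s e q * comp e (V, q)))
        = (opf (E D) (comp c) - r *\<^sub>R comp a0) (V, q)"
      by (simp add: comp_def scaleR_fun_apply)
  qed
qed

lemma opf_add:
  assumes "Mf k \<Phi>" "Mf l \<Psi>" shows "opf X (\<Phi> + \<Psi>) = opf X \<Phi> + opf X \<Psi>"
  using Mf_smooth[OF assms(1)] Mf_smooth[OF assms(2)]
  by (auto simp: opf_def fun_eq_iff lie_deriv_add[where U = B])

lemma opf_mul_at:
  assumes "Mf k \<Phi>" "smooth_on B s" "V \<in> syms" "q \<in> B"
  shows "opf X (\<lambda>(V, q). s q * \<Phi> (V, q)) (V, q) = s q * opf X \<Phi> (V, q) + lie_deriv X s q * \<Phi> (V, q)"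
  using Mf_smooth[OF assms(1,3)] assms by (auto simp: opf_def lie_deriv_mult[where U = B])

lemma Mf_der_all:
  assumes "Mf k \<Phi>" "D \<in> {FT, FW 0}"
  shows "Mf (k + 1) (opf (E D) \<Phi>)"
  using assms
proof (induction rule: Mf.induct)
  case (zero k)
  thus ?case
    by (intro Mf.eqv[OF Mf.zero]) (auto simp: opf_def zero_fun_def)
next
  case (comp c k)
  show ?case
  proof (cases "- 1 \<le> k")
    case True
    thus ?thesis using comp by (intro Mf.der Mf.comp) auto
  next
    case False
    hence w: "1 < wt c" using comp by auto
    define s where "s = (\<lambda>e q. if wt c \<le> wt e + 1 then eps c q \<bullet> lie_bracket (E e) (E D) q else 0)"
    have "Mf (k + 1) (\<lambda>x. \<Sum>e\<in>I. (\<lambda>(V, q). s e q * comp e (V, q)) x)"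
    proof (rule Mf_sum)
      fix e assume e: "e \<in> I"
      show "Mf (k + 1) (\<lambda>(V, q). s e q * comp e (V, q))"
      proof (cases "wt c \<le> wt e + 1")
        case True
        have "smooth_on B (s e)" unfolding s_def using True e comp(1)
          by (auto intro!: smooth_intros openB smeps smE horiz_smooth[OF comp(3)])
        thus ?thesis using True e comp(2) by (intro Mf.mul Mf.comp) auto
      next
        case False
        thus ?thesis by (intro Mf.eqv[OF Mf.zero]) (simp add: s_def)
      qed
    qed
    thus ?thesis
    proof (rule Mf.eqv)
      fix V q assume V: "V \<in> syms" "q \<in> B"
      have "(eps c q \<bullet> lie_bracket (E e) (E D) q) = s e q" if "e \<in> I" for e
        using bracket_low[OF comp(1) that comp(3) _ V(2)] by (auto simp: s_def)
      thus "(\<Sum>e\<in>I. (case (V, q) of (V, q) \<Rightarrow> s e q * comp e (V, q))) = opf (E D) (comp c) (V, q)"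
        using V by (simp add: opf_def comp_def comp_deriv[OF V comp(1) w comp(3)])
    qed
  qed
next
  case (der k \<Phi> D')
  thus ?case by (intro Mf.der) auto
next
  case (up k \<Phi> l)
  thus ?case by (intro Mf.up[of "k + 1" _ "l + 1"]) auto
next
  case (add k \<Phi> \<Psi>)
  thus ?case unfolding opf_add[OF add(1,2)] by (intro Mf.add) auto
next
  case (mul s k \<Phi>)
  have "Mf (k + 1) ((\<lambda>(V, q). s q * opf (E D) \<Phi> (V, q)) + (\<lambda>(V, q). lie_deriv (E D) s q * \<Phi> (V, q)))"
    using mul by (intro Mf.add Mf.mul smooth_intros openB horiz_smooth) (auto intro: Mf.up)
  thus ?case
    by (rule Mf.eqv) (simp add: opf_mul_at[OF mul(2,1)])
next
  case (eqv k \<Phi> \<Psi>)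
  have "opf (E D) \<Phi> = opf (E D) \<Psi>" by (rule opf_cong) (rule eqv(2))
  thus ?case using eqv by simp
qed

lemma opf_bracket:
  assumes "Mf k \<Phi>" "V \<in> syms" "q \<in> B" "smooth_on B X" "smooth_on B Y"
  shows "opf X (opf Y \<Phi>) (V, q) - opf Y (opf X \<Phi>) (V, q) = (\<Sum>c\<in>I. (eps c q \<bullet> lie_bracket X Y q) * opf (E c) \<Phi> (V, q))"
proof -
  have s: "smooth_on B (\<lambda>q. \<Phi> (V, q))" by (rule Mf_smooth[OF assms(1,2)])
  have e: "opf X (opf Y \<Phi>) (V, q) = lie_deriv X (lie_deriv Y (\<lambda>q. \<Phi> (V, q))) q" for X Y
    unfolding opf_def[of X] using assms by (auto simp: opf_def intro!: lie_deriv_cong[OF openB])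
  have "opf X (opf Y \<Phi>) (V, q) - opf Y (opf X \<Phi>) (V, q) = lie_deriv (lie_bracket X Y) (\<lambda>q. \<Phi> (V, q)) q"
    unfolding e by (rule lie_deriv_lie_bracket[OF openB assms(3-5) s, symmetric])
  also have "\<dots> = (\<Sum>c\<in>I. (eps c q \<bullet> lie_bracket X Y q) *\<^sub>R lie_deriv (E c) (\<lambda>q. \<Phi> (V, q)) q)"
    by (rule lie_deriv_left_at[OF s assms(3)]) (simp add: rep assms)
  finally show ?thesis using assms by (simp add: opf_def)
qed

text \<open>A derivative along a field equals, modulo the derivatives along light legs, its single
  heavy component. It is applied to brackets of frame fields.\<close>

lemma Mf_frame_low:
  assumes \<Phi>: "Mf k \<Phi>" and X: "smooth_on B X"
    and low: "\<And>c. c \<in> I \<Longrightarrow> wt c \<le> w \<Longrightarrow> Mf (k + int w) (opf (E c) \<Phi>)"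
    and lead: "\<And>c q. c \<in> I \<Longrightarrow> w < wt c \<Longrightarrow> q \<in> B \<Longrightarrow> eps c q \<bullet> X q = (if c = a0 then r else 0)"
    and a0: "a0 \<in> I \<and> w < wt a0 \<or> r = 0"
  shows "Mf (k + int w) ((\<lambda>(V, q). \<Sum>c\<in>I. (eps c q \<bullet> X q) * opf (E c) \<Phi> (V, q)) - r *\<^sub>R opf (E a0) \<Phi>)"
proof -
  define s where "s = (\<lambda>c q. if wt c \<le> w then eps c q \<bullet> X q else 0)"
  have "Mf (k + int w) (\<lambda>x. \<Sum>c\<in>I. (\<lambda>(V, q). s c q * opf (E c) \<Phi> (V, q)) x)"
  proof (rule Mf_sum)
    fix c assume c: "c \<in> I"
    show "Mf (k + int w) (\<lambda>(V, q). s c q * opf (E c) \<Phi> (V, q))"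
    proof (cases "wt c \<le> w")
      case True
      have "smooth_on B (s c)" unfolding s_def using True c
        by (auto intro!: smooth_intros openB smeps X)
      thus ?thesis using True c by (intro Mf.mul low) auto
    next
      case False
      thus ?thesis by (intro Mf.eqv[OF Mf.zero]) (simp add: s_def)
    qed
  qed
  thus ?thesis
  proof (rule Mf.eqv)
    fix V q assume V: "V \<in> syms" "q \<in> B"
    have "(eps c q \<bullet> X q) * opf (E c) \<Phi> (V, q) = s c q * opf (E c) \<Phi> (V, q) + (if c = a0 then r * opf (E c) \<Phi> (V, q) else 0)"
      if "c \<in> I" for c
      using lead[OF that _ V(2)] a0 by (auto simp: s_def not_le)
    hence "(\<Sum>c\<in>I. (eps c q \<bullet> X q) * opf (E c) \<Phi> (V, q))
        = (\<Sum>c\<in>I. s c q * opf (E c) \<Phi> (V, q)) + r * opf (E a0) \<Phi> (V, q)"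
      using a0 by (auto simp: sum.distrib)
    thus "(\<Sum>c\<in>I. (case (V, q) of (V, q) \<Rightarrow> s c q * opf (E c) \<Phi> (V, q)))
       = ((\<lambda>(V, q). \<Sum>c\<in>I. (eps c q \<bullet> X q) * opf (E c) \<Phi> (V, q)) - r *\<^sub>R opf (E a0) \<Phi>) (V, q)"
      by (simp add: scaleR_fun_apply)
  qed
qed

lemma smE_legs: "smooth_on B (E FT)" "i \<le> n \<Longrightarrow> smooth_on B (E (FW i))" "1 \<le> i \<Longrightarrow> i \<le> m \<Longrightarrow> smooth_on B (E (FY i))"
  using smE by auto

lemma Mf_opf_cong:
  "Mf k (\<Phi> - \<Psi>) \<Longrightarrow> Mf k \<Psi> \<Longrightarrow> Mf k \<Phi>"
  using Mf.add[of k "\<Phi> - \<Psi>" \<Psi>] by simp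

text \<open>Induction on the weight: up to sign and lighter fields, a frame field of weight
  \<open>w + 1\<close> is the bracket of one of weight \<open>w\<close> with a horizontal field, and
  for a bracket the claim follows from that for its factors.\<close>

lemma Mf_op: "c \<in> I \<Longrightarrow> Mf k \<Phi> \<Longrightarrow> Mf (k + int (wt c)) (opf (E c) \<Phi>)"
proof (induction "wt c" arbitrary: c k \<Phi> rule: less_induct)
  case less
  note \<Phi> = \<open>Mf k \<Phi>\<close>
  have low: "Mf (k + int w) (opf (E e) \<Phi>)" if "e \<in> I" "wt e \<le> w" "w < wt c" for e w
    using less(1)[of e k \<Phi>] that \<Phi> by (auto intro: Mf.up)
  show ?case
  proof (cases c)
    case FT
    thus ?thesis using Mf_der_all[OF \<Phi>, of FT] by simp
  next
    case (FW j)
    show ?thesis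
    proof (cases j)
      case 0
      thus ?thesis using Mf_der_all[OF \<Phi>, of "FW 0"] FW by simp
    next
      case (Suc i)
      hence i: "Suc i \<le> n" "c = FW (Suc i)" using less.prems FW by auto
      let ?X = "lie_bracket (E (FW i)) (E FT)"
      have F: "Mf (k + int (i + 1)) ((\<lambda>(V, q). \<Sum>c\<in>I. (eps c q \<bullet> ?X q) * opf (E c) \<Phi> (V, q)) - 1 *\<^sub>R opf (E c) \<Phi>)"
      proof (rule Mf_frame_low[OF \<Phi>])
        show "smooth_on B ?X" using i by (intro smooth_intros openB smE_legs) auto
        show "eps e q \<bullet> ?X q = (if e = c then 1 else 0)" if "e \<in> I" "i + 1 < wt e" "q \<in> B" for e q
          using W_T[of i e q] that i by auto
      qed (use low[of _ "i + 1"] i in auto)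
      hence 1: "Mf (k + int (wt c)) (opf (E c) \<Phi> - (\<lambda>(V, q). \<Sum>c\<in>I. (eps c q \<bullet> ?X q) * opf (E c) \<Phi> (V, q)))"
        using Mf.up[OF Mf_minus[OF F], of "k + int (wt c)"] i by simp
      have "Mf (k + int (wt c)) (opf (E (FW i)) (opf (E FT) \<Phi>) - opf (E FT) (opf (E (FW i)) \<Phi>))"
      proof (rule Mf_diff)
        show "Mf (k + int (wt c)) (opf (E (FW i)) (opf (E FT) \<Phi>))"
          using less(1)[of "FW i" "k + 1" "opf (E FT) \<Phi>"] Mf_der_all[OF \<Phi>, of FT] i by (simp add: algebra_simps)
        show "Mf (k + int (wt c)) (opf (E FT) (opf (E (FW i)) \<Phi>))"
          using Mf_der_all[OF less(1)[of "FW i" k \<Phi>], of FT] \<Phi> i by (simp add: algebra_simps)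
      qed
      hence "Mf (k + int (wt c)) (\<lambda>(V, q). \<Sum>c\<in>I. (eps c q \<bullet> ?X q) * opf (E c) \<Phi> (V, q))"
        by (rule Mf.eqv) (use i in \<open>simp add: opf_bracket[OF \<Phi>] smE_legs\<close>)
      with 1 show ?thesis by (rule Mf_opf_cong)
    qed
  next
    case (FY i)
    hence i: "1 \<le> i" "i \<le> m" "i \<le> n" "c = FY i" using less.prems mn by auto
    let ?X = "lie_bracket (E (FW i)) (E (FW 0))"
    have F: "Mf (k + int (i + 1)) ((\<lambda>(V, q). \<Sum>c\<in>I. (eps c q \<bullet> ?X q) * opf (E c) \<Phi> (V, q)) - (- 1) *\<^sub>R opf (E c) \<Phi>)"
    proof (rule Mf_frame_low[OF \<Phi>])
      show "smooth_on B ?X" using i by (intro smooth_intros openB smE_legs) auto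
      show "eps e q \<bullet> ?X q = (if e = c then - 1 else 0)" if "e \<in> I" "i + 1 < wt e" "q \<in> B" for e q
        using W_Z[of i e q] that i by auto
    qed (use low[of _ "i + 1"] i in auto)
    hence 1: "Mf (k + int (wt c)) (opf (E c) \<Phi> - (- 1) *\<^sub>R (\<lambda>(V, q). \<Sum>c\<in>I. (eps c q \<bullet> ?X q) * opf (E c) \<Phi> (V, q)))"
      using Mf.up[OF F, of "k + int (wt c)"] i by (simp add: add.commute)
    have "Mf (k + int (wt c)) (opf (E (FW i)) (opf (E (FW 0)) \<Phi>) - opf (E (FW 0)) (opf (E (FW i)) \<Phi>))"
    proof (rule Mf_diff)
      show "Mf (k + int (wt c)) (opf (E (FW i)) (opf (E (FW 0)) \<Phi>))"
        using less(1)[of "FW i" "k + 1" "opf (E (FW 0)) \<Phi>"] Mf_der_all[OF \<Phi>, of "FW 0"] i by (simp add: algebra_simps)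
      show "Mf (k + int (wt c)) (opf (E (FW 0)) (opf (E (FW i)) \<Phi>))"
        using Mf_der_all[OF less(1)[of "FW i" k \<Phi>], of "FW 0"] \<Phi> i by (simp add: algebra_simps)
    qed
    hence "Mf (k + int (wt c)) (\<lambda>(V, q). \<Sum>c\<in>I. (eps c q \<bullet> ?X q) * opf (E c) \<Phi> (V, q))"
      by (rule Mf.eqv) (use i in \<open>simp add: opf_bracket[OF \<Phi>] smE_legs\<close>)
    with 1 show ?thesis by (rule Mf_opf_cong[OF _ Mf_scaleR])
  qed
qed

definition "Wop i = (if i \<le> n then opf (E (FW i)) else (\<lambda>_. 0))"
definition "Yop i = (if 1 \<le> i \<and> i \<le> m then opf (E (FY i)) else (\<lambda>_. 0))"
definition "ups i = (if 1 \<le> i then comp (FY i) else 0)"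

lemma filt_op_opf: "c \<in> I \<Longrightarrow> filt_op (\<lambda>k. {\<Phi>. Mf k \<Phi>}) (opf (E c)) (int (wt c))"
proof (unfold filt_op_def, intro conjI allI ballI)
  fix k \<Phi> r assume "\<Phi> \<in> {\<Phi>. Mf k \<Phi>}"
  hence "smooth_on B (\<lambda>q. \<Phi> (V, q))" if "V \<in> syms" for V using Mf_smooth that by blast
  thus "opf (E c) (r *\<^sub>R \<Phi>) = r *\<^sub>R opf (E c) \<Phi>"
    using lie_deriv_mult[OF smooth_on_const[of B r]]
    by (auto simp: opf_def fun_eq_iff scaleR_fun_def)
qed (auto simp: opf_add Mf_op)

lemma filt_op_0: "filt_op (\<lambda>k. {\<Phi>. Mf k \<Phi>}) (\<lambda>_. 0) w"
  by (auto simp: filt_op_def Mf.zero)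

lemma frame_relation:
  assumes \<Phi>: "Mf k \<Phi>" and e: "e \<in> I" and D: "D \<in> {FT, FW 0}"
    and lead: "\<And>c q. c \<in> I \<Longrightarrow> wt e < wt c \<Longrightarrow> q \<in> B \<Longrightarrow>
      eps c q \<bullet> lie_bracket (E e) (E D) q = (if c = a0 then r else 0)"
    and a0: "a0 \<in> I \<and> wt e < wt a0 \<or> r = 0"
  shows "Mf (k + int (wt e)) (opf (E e) (opf (E D) \<Phi>) - opf (E D) (opf (E e) \<Phi>) - r *\<^sub>R opf (E a0) \<Phi>)"
proof -
  let ?X = "lie_bracket (E e) (E D)"
  have "Mf (k + int (wt e)) ((\<lambda>(V, q). \<Sum>c\<in>I. (eps c q \<bullet> ?X q) * opf (E c) \<Phi> (V, q)) - r *\<^sub>R opf (E a0) \<Phi>)"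
  proof (rule Mf_frame_low[OF \<Phi>])
    show "smooth_on B ?X" by (intro smooth_intros openB smE e horiz_smooth D)
    show "Mf (k + int (wt e)) (opf (E c) \<Phi>)" if "c \<in> I" "wt c \<le> wt e" for c
      using Mf_op[OF that(1) \<Phi>] by (rule Mf.up) (use that in simp)
  qed (use lead a0 in auto)
  thus ?thesis
    by (rule Mf.eqv) (simp add: opf_bracket[OF \<Phi>] smE e horiz_smooth[OF D] scaleR_fun_apply)
qed

text \<open>The commutation rules of the symbol calculus come from \<open>frame_relation\<close>,
  the rules for the components from \<open>Mf_comp_deriv\<close>. Operators past the end of a chain
  are taken to be zero.\<close>

sublocale sym: monge_symbol "\<lambda>k. {\<Phi>. Mf k \<Phi>}" "opf (E FT)" Wop Yop "comp FT" "\<lambda>i. comp (FW i)" ups m n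
proof
  show "filt_op (\<lambda>k. {\<Phi>. Mf k \<Phi>}) (opf (E FT)) 1" using filt_op_opf[of FT] by simp
  show "filt_op (\<lambda>k. {\<Phi>. Mf k \<Phi>}) (Wop i) (int i + 1)" for i
    using filt_op_opf[of "FW i"] filt_op_0 by (auto simp: Wop_def algebra_simps)
  show "filt_op (\<lambda>k. {\<Phi>. Mf k \<Phi>}) (Yop i) (int i + 2)" for i
    using filt_op_opf[of "FY i"] filt_op_0 by (auto simp: Yop_def algebra_simps)
  have T0: "opf X 0 = 0" for X
    by (auto simp: opf_def fun_eq_iff zero_fun_def)
  show "Wop i (opf (E FT) \<Phi>) - opf (E FT) (Wop i \<Phi>) - Wop (Suc i) \<Phi> \<in> {\<Phi>. Mf (k + int i + 1) \<Phi>}"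
    if "\<Phi> \<in> {\<Phi>. Mf k \<Phi>}" for \<Phi> k i
  proof -
    have \<Phi>: "Mf k \<Phi>" using that by simp
    consider "n < i" | "i = n" | "i < n" by linarith
    thus ?thesis
    proof cases
      case 1
      thus ?thesis using Mf.zero by (simp add: Wop_def T0)
    next
      case 2
      thus ?thesis using frame_relation[OF \<Phi>, of "FW n" FT FT 0] W_T[of n]
        by (force simp: Wop_def algebra_simps)
    next
      case 3
      thus ?thesis using frame_relation[OF \<Phi>, of "FW i" FT "FW (Suc i)" 1] W_T[of i]
        by (simp add: Wop_def algebra_simps)
    qed
  qed
  show "Wop 0 (Wop i \<Phi>) - Wop i (Wop 0 \<Phi>) - Yop i \<Phi> \<in> {\<Phi>. Mf (k + int i + 1) \<Phi>}"
    if "\<Phi> \<in> {\<Phi>. Mf k \<Phi>}" "1 \<le> i" for \<Phi> k i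
  proof -
    have \<Phi>: "Mf k \<Phi>" using that by simp
    consider "n < i" | "m < i" "i \<le> n" | "i \<le> m" "i \<le> n" using mn by linarith
    thus ?thesis
    proof cases
      case 1
      thus ?thesis using Mf.zero mn by (simp add: Wop_def Yop_def T0)
    next
      case 2
      have "Mf (k + int (wt (FW i))) (opf (E (FW i)) (opf (E (FW 0)) \<Phi>) - opf (E (FW 0)) (opf (E (FW i)) \<Phi>) - 0 *\<^sub>R opf (E FT) \<Phi>)"
        by (rule frame_relation[OF \<Phi>]) (use 2 that(2) in \<open>auto simp: W_Z split: if_splits\<close>)
      from Mf_scaleR[OF this, of "- 1"] show ?thesis using 2 by (simp add: Wop_def Yop_def algebra_simps)
    next
      case 3
      have "Mf (k + int (wt (FW i))) (opf (E (FW i)) (opf (E (FW 0)) \<Phi>) - opf (E (FW 0)) (opf (E (FW i)) \<Phi>) - (- 1) *\<^sub>R opf (E (FY i)) \<Phi>)"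
        by (rule frame_relation[OF \<Phi>]) (use 3 that(2) in \<open>auto simp: W_Z\<close>)
      from Mf_scaleR[OF this, of "- 1"] show ?thesis using 3 that(2) by (simp add: Wop_def Yop_def algebra_simps)
    qed
  qed
  show "Yop i (opf (E FT) \<Phi>) - opf (E FT) (Yop i \<Phi>) - Yop (Suc i) \<Phi> \<in> {\<Phi>. Mf (k + int i + 2) \<Phi>}"
    if "\<Phi> \<in> {\<Phi>. Mf k \<Phi>}" "1 \<le> i" for \<Phi> k i
  proof -
    have \<Phi>: "Mf k \<Phi>" using that by simp
    consider "m < i" | "i = m" | "i < m" by linarith
    thus ?thesis
    proof cases
      case 1
      thus ?thesis using Mf.zero by (simp add: Yop_def T0)
    next
      case 2
      have "Mf (k + int (wt (FY m))) (opf (E (FY m)) (opf (E FT) \<Phi>) - opf (E FT) (opf (E (FY m)) \<Phi>) - 0 *\<^sub>R opf (E FT) \<Phi>)"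
        by (rule frame_relation[OF \<Phi>]) (use mn in \<open>auto simp: Y_T split: if_splits\<close>)
      thus ?thesis using 2 mn by (simp add: Yop_def algebra_simps)
    next
      case 3
      have "Mf (k + int (wt (FY i))) (opf (E (FY i)) (opf (E FT) \<Phi>) - opf (E FT) (opf (E (FY i)) \<Phi>) - 1 *\<^sub>R opf (E (FY (Suc i))) \<Phi>)"
        by (rule frame_relation[OF \<Phi>]) (use 3 that(2) in \<open>auto simp: Y_T\<close>)
      thus ?thesis using 3 that(2) by (simp add: Yop_def algebra_simps)
    qed
  qed
  show "Wop 0 (Yop i \<Phi>) - Yop i (Wop 0 \<Phi>) \<in> {\<Phi>. Mf (k + int i + 2) \<Phi>}"
    if "\<Phi> \<in> {\<Phi>. Mf k \<Phi>}" "1 \<le> i" for \<Phi> k i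
  proof -
    have \<Phi>: "Mf k \<Phi>" using that by simp
    show ?thesis
    proof (cases "i \<le> m")
      case False
      thus ?thesis using Mf.zero by (simp add: Yop_def Wop_def T0)
    next
      case True
      have "Mf (k + int (wt (FY i))) (opf (E (FY i)) (opf (E (FW 0)) \<Phi>) - opf (E (FW 0)) (opf (E (FY i)) \<Phi>) - 0 *\<^sub>R opf (E FT) \<Phi>)"
        by (rule frame_relation[OF \<Phi>]) (use True that(2) in \<open>auto simp: Y_Z\<close>)
      from Mf_scaleR[OF this, of "- 1"] show ?thesis using True that(2) by (simp add: Wop_def Yop_def algebra_simps)
    qed
  qed
  show "comp FT \<in> {\<Phi>. Mf (- 1) \<Phi>}" using Mf.comp[of FT "- 1"] by simp
  show "comp (FW i) \<in> {\<Phi>. Mf (- int i - 1) \<Phi>}" if "i \<le> n" for i using Mf.comp[of "FW i" "- int i - 1"] that by simp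
  show "ups i \<in> {\<Phi>. Mf (- int i - 2) \<Phi>}" if "i \<le> m" for i
    using Mf.comp[of "FY i" "- int i - 2"] Mf.zero that by (simp add: ups_def)
  show "opf (E FT) (comp (FW (Suc i))) - comp (FW i) \<in> {\<Phi>. Mf (- int i - 2) \<Phi>}" if "i < n" for i
  proof -
    have "Mf (- int (wt (FW (Suc i)))) (opf (E FT) (comp (FW (Suc i))) - 1 *\<^sub>R comp (FW i))"
    proof (rule Mf_comp_deriv)
      fix e q assume e: "e \<in> I" "wt e + 1 = wt (FW (Suc i))" "q \<in> B"
      show "eps (FW (Suc i)) q \<bullet> lie_bracket (E e) (E FT) q = (if e = FW i then 1 else 0)"
        using e that W_T[of i "FW (Suc i)" q] Y_T[of "i - 1" "FW (Suc i)" q] by (cases e) auto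
    qed (use that in auto)
    thus ?thesis by (simp add: algebra_simps)
  qed
  show "opf (E FT) (ups (Suc i)) - ups i \<in> {\<Phi>. Mf (- int i - 3) \<Phi>}" if "i < m" for i
  proof -
    have "Mf (- int (wt (FY (Suc i)))) (opf (E FT) (comp (FY (Suc i))) - (if i = 0 then 0 else 1) *\<^sub>R comp (if i = 0 then FT else FY i))"
    proof (rule Mf_comp_deriv)
      fix e q assume e: "e \<in> I" "wt e + 1 = wt (FY (Suc i))" "q \<in> B"
      show "eps (FY (Suc i)) q \<bullet> lie_bracket (E e) (E FT) q = (if e = (if i = 0 then FT else FY i) then if i = 0 then 0 else 1 else 0)"
        using e that W_T[of "Suc i" "FY (Suc i)" q] Y_T[of i "FY (Suc i)" q] by (cases e) auto
    qed (use that in auto)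
    thus ?thesis by (simp add: algebra_simps ups_def split: if_splits)
  qed
  show "Wop 0 (comp (FW 1)) + comp FT \<in> {\<Phi>. Mf (- 2) \<Phi>}"
  proof -
    have "Mf (- int (wt (FW 1))) (opf (E (FW 0)) (comp (FW 1)) - (- 1) *\<^sub>R comp FT)"
    proof (rule Mf_comp_deriv)
      fix e q assume e: "e \<in> I" "wt e + 1 = wt (FW 1)" "q \<in> B"
      show "eps (FW 1) q \<bullet> lie_bracket (E e) (E (FW 0)) q = (if e = FT then - 1 else 0)"
        using e mn W_T[of 0 "FW 1" q] lie_bracket_anti[of "E FT" "E (FW 0)" q] by (cases e) auto
    qed (use mn in auto)
    thus ?thesis by (simp add: Wop_def)
  qed
  show "Wop 0 (comp (FW i)) \<in> {\<Phi>. Mf (- int i - 1) \<Phi>}" if "2 \<le> i" "i \<le> n" for i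
  proof -
    have "Mf (- int (wt (FW i))) (opf (E (FW 0)) (comp (FW i)) - 0 *\<^sub>R comp FT)"
    proof (rule Mf_comp_deriv)
      fix e q assume e: "e \<in> I" "wt e + 1 = wt (FW i)" "q \<in> B"
      show "eps (FW i) q \<bullet> lie_bracket (E e) (E (FW 0)) q = (if e = FT then 0 else 0)"
        using e that W_Z[of "i - 1" "FW i" q] Y_Z[of "i - 2" "FW i" q] by (cases e) auto
    qed (use that in auto)
    thus ?thesis by (auto simp: Wop_def elim: Mf.up)
  qed
  show "Wop 0 (ups i) + comp (FW i) \<in> {\<Phi>. Mf (- int i - 2) \<Phi>}" if "1 \<le> i" "i \<le> m" for i
  proof -
    have "Mf (- int (wt (FY i))) (opf (E (FW 0)) (comp (FY i)) - (- 1) *\<^sub>R comp (FW i))"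
    proof (rule Mf_comp_deriv)
      fix e q assume e: "e \<in> I" "wt e + 1 = wt (FY i)" "q \<in> B"
      show "eps (FY i) q \<bullet> lie_bracket (E e) (E (FW 0)) q = (if e = FW i then - 1 else 0)"
        using e that W_Z[of i "FY i" q] Y_Z[of "i - 1" "FY i" q] by (cases e) auto
    qed (use that mn in auto)
    thus ?thesis using that by (simp add: Wop_def ups_def algebra_simps)
  qed
qed (use mn Mf_subspace Mf.up in \<open>auto simp: Wop_def Yop_def ups_def\<close>)

end

section \<open>Finite type: the generating functionals\<close>

datatype gen = GC leg | GA | GD | GB nat | GE

context adapted_frame
begin

text \<open>Exactly what the relations of the symbol calculus leave undetermined.
  \<open>sym.b\<close> is \<open>GB 0\<close> when \<open>m < n\<close>; for \<open>m = n\<close> it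
  is negligible by \<open>T_pow_top\<close>.\<close>

definition gens :: "gen set"
  where "gens = GC ` I \<union> ({GA, GD} \<union> (GB ` {..<n - m} \<union> (if m = 1 then {GE} else {})))"

primrec gen_fun :: "gen \<Rightarrow> ('a \<Rightarrow> 'a) \<times> 'a \<Rightarrow> real" where
  "gen_fun (GC c) = comp c"
| "gen_fun GA = sym.a"
| "gen_fun GD = sym.d"
| "gen_fun (GB k) = (opf (E FT) ^^ Suc k) (comp (FW 0))"
| "gen_fun GE = opf (E FT) sym.a"

primrec gdeg :: "gen \<Rightarrow> int" where
  "gdeg (GC c) = - int (wt c)" | "gdeg GA = 0" | "gdeg GD = 0" | "gdeg (GB k) = int k" | "gdeg GE = 1"

lemma gens_simps [simp]:
  "GC c \<in> gens \<longleftrightarrow> c \<in> I" "GA \<in> gens" "GD \<in> gens" "GB k \<in> gens \<longleftrightarrow> k < n - m" "GE \<in> gens \<longleftrightarrow> m = 1"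
  by (auto simp: gens_def)

lemma finite_gens [simp]: "finite gens"
  by (simp add: gens_def)

lemma card_gens: "card gens = 2 * n + 4 + (if m = 1 then 1 else 0)"
proof -
  define R where "R = GB ` {..<n - m} \<union> (if m = 1 then {GE} else {})"
  have c: "card (GB ` A) = card A" for A by (rule card_image) (simp add: inj_on_def)
  have F: "card (GB ` {..<n - m} \<union> {GE}) = (n - m) + 1"
    by (subst card_Un_disjoint) (auto simp: c)
  have R: "card R = (n - m) + (if m = 1 then 1 else 0)"
  proof (cases "m = 1")
    case True
    thus ?thesis using F by (simp add: R_def)
  next
    case False
    thus ?thesis by (simp add: R_def c)
  qed
  have Rs: "finite R" "GA \<notin> R" "GD \<notin> R" "GC x \<notin> R" for x by (auto simp: R_def split: if_splits)
  have 1: "card (GC ` I) = m + n + 2" by (simp add: card_image inj_on_def card_legs)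
  have 2: "card ({GA, GD} \<union> R) = 2 + card R" using Rs by simp
  have "card gens = card (GC ` I) + card ({GA, GD} \<union> R)"
    unfolding gens_def R_def[symmetric] using Rs by (intro card_Un_disjoint) auto
  thus ?thesis using mn 1 2 R by auto
qed

lemma gen_Mf: "j \<in> gens \<Longrightarrow> Mf (gdeg j) (gen_fun j)"
proof (cases j)
  case (GC c)
  thus "j \<in> gens \<Longrightarrow> ?thesis" by (simp add: Mf.comp)
next
  case (GB k)
  thus ?thesis using sym.T_pow_\<zeta>M[of "Suc k"] by simp
next
  case GE
  thus ?thesis using Mf_der_all[of 0 sym.a FT] sym.abdM by simp
qed (use sym.abdM in auto)

text \<open>Combinations of generators with coefficients depending on the point. Admitting only
  generators of degree at most \<open>k\<close> keeps the filtration visible during the induction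
  over levels.\<close>

definition Gs :: "int \<Rightarrow> (('a \<Rightarrow> 'a) \<times> 'a \<Rightarrow> real) \<Rightarrow> bool"
  where "Gs k \<Phi> \<longleftrightarrow> (\<exists>s. (\<forall>j\<in>gens. smooth_on B (s j) \<and> (k < gdeg j \<longrightarrow> s j = (\<lambda>_. 0))) \<and>
    (\<forall>V\<in>syms. \<forall>q\<in>B. \<Phi> (V, q) = (\<Sum>j\<in>gens. s j q * gen_fun j (V, q))))"

lemma Gs_up: "Gs k \<Phi> \<Longrightarrow> k \<le> l \<Longrightarrow> Gs l \<Phi>"
  unfolding Gs_def by (elim exE, rule exI) auto

lemma Gs_eqv: "Gs k \<Phi> \<Longrightarrow> (\<And>V q. V \<in> syms \<Longrightarrow> q \<in> B \<Longrightarrow> \<Phi> (V, q) = \<Psi> (V, q)) \<Longrightarrow> Gs k \<Psi>"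
  unfolding Gs_def by (elim exE, rule_tac x = s in exI) simp

lemma Gs_zero: "Gs k 0"
  unfolding Gs_def by (rule exI[of _ "\<lambda>_ _. 0"]) (simp add: smooth_on_const zero_fun_apply)

lemma Gs_add:
  assumes "Gs k \<Phi>" "Gs k \<Psi>" shows "Gs k (\<Phi> + \<Psi>)"
proof -
  obtain s t where s: "\<forall>j\<in>gens. smooth_on B (s j) \<and> (k < gdeg j \<longrightarrow> s j = (\<lambda>_. 0))"
    "\<forall>V\<in>syms. \<forall>q\<in>B. \<Phi> (V, q) = (\<Sum>j\<in>gens. s j q * gen_fun j (V, q))"
    and t: "\<forall>j\<in>gens. smooth_on B (t j) \<and> (k < gdeg j \<longrightarrow> t j = (\<lambda>_. 0))"
    "\<forall>V\<in>syms. \<forall>q\<in>B. \<Psi> (V, q) = (\<Sum>j\<in>gens. t j q * gen_fun j (V, q))"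
    using assms unfolding Gs_def by blast
  show ?thesis
    unfolding Gs_def
    by (rule exI[of _ "\<lambda>j q. s j q + t j q"])
      (use s t in \<open>auto intro!: smooth_on_add openB simp: sum.distrib algebra_simps plus_fun_apply\<close>)
qed

lemma Gs_mul:
  assumes "Gs k \<Phi>" "smooth_on B r" shows "Gs k (\<lambda>(V, q). r q * \<Phi> (V, q))"
proof -
  obtain s where s: "\<forall>j\<in>gens. smooth_on B (s j) \<and> (k < gdeg j \<longrightarrow> s j = (\<lambda>_. 0))"
    "\<forall>V\<in>syms. \<forall>q\<in>B. \<Phi> (V, q) = (\<Sum>j\<in>gens. s j q * gen_fun j (V, q))"
    using assms unfolding Gs_def by blast
  show ?thesis
    unfolding Gs_def
    by (rule exI[of _ "\<lambda>j q. r q * s j q"])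
      (use s assms(2) in \<open>auto intro!: smooth_on_mult openB simp: sum_distrib_left mult.assoc\<close>)
qed

lemma Gs_scaleR: "Gs k \<Phi> \<Longrightarrow> Gs k (r *\<^sub>R \<Phi>)"
  by (rule Gs_eqv[OF Gs_mul[OF _ smooth_on_const[of B r]]]) (auto simp: scaleR_fun_apply)

lemma Gs_sum: "(\<And>i. i \<in> A \<Longrightarrow> Gs k (\<Phi> i)) \<Longrightarrow> Gs k (\<lambda>x. \<Sum>i\<in>A. \<Phi> i x)"
proof (induction A rule: infinite_finite_induct)
  case (insert i A)
  hence "Gs k (\<Phi> i + (\<lambda>x. \<Sum>i\<in>A. \<Phi> i x))" by (intro Gs_add) auto
  thus ?case using insert by (simp add: plus_fun_def)
qed (use Gs_zero[of k] in \<open>simp_all add: zero_fun_def\<close>)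

lemma Gs_gen: "j \<in> gens \<Longrightarrow> gdeg j \<le> k \<Longrightarrow> Gs k (gen_fun j)"
proof -
  assume j: "j \<in> gens" "gdeg j \<le> k"
  have "(\<Sum>i\<in>gens. (if i = j then 1 else 0) * gen_fun i x) = gen_fun j x" for x
  proof -
    have "(\<Sum>i\<in>gens. (if i = j then 1 else 0) * gen_fun i x) = (\<Sum>i\<in>gens. if i = j then gen_fun i x else 0)"
      by (intro sum.cong) auto
    thus ?thesis using j by simp
  qed
  thus ?thesis
    unfolding Gs_def by (intro exI[of _ "\<lambda>i _. if i = j then 1 else 0"]) (use j in \<open>auto intro: smooth_on_const\<close>)
qed

text \<open>A derivative of a generator is another generator or drops to level at most
  \<open>k\<close> by one of the relations, possibly after subtracting a multiple of
  \<open>T a\<close>; what has dropped is covered by \<open>MG\<close>.\<close>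

lemma Gs_gen_der:
  assumes MG: "\<And>\<Phi>. Mf k \<Phi> \<Longrightarrow> Gs k \<Phi>" and k: "- 1 \<le> k" and j: "j \<in> gens" "gdeg j \<le> k" and D: "D \<in> {FT, FW 0}"
  shows "Gs (k + 1) (opf (E D) (gen_fun j))"
proof -
  have MG': "Gs (k + 1) \<Phi>" if "Mf l \<Phi>" "l \<le> k" for l \<Phi>
    using MG[OF Mf.up[OF that]] by (rule Gs_up) simp
  have MG2: "Gs (k + 1) \<Phi>" if "Mf l (\<Phi> - r *\<^sub>R \<Psi>)" "l \<le> k" "Gs (k + 1) \<Psi>" for l \<Phi> \<Psi> r
    by (rule Gs_eqv[OF Gs_add[OF MG'[OF that(1,2)] Gs_scaleR[OF that(3), of r]]]) (simp add: pw)
  have Z: "Wop 0 = opf (E (FW 0))" by (simp add: Wop_def)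
  have Ta: "Gs (k + 1) (opf (E FT) sym.a)" if "0 \<le> k"
  proof (cases "m = 1")
    case True
    hence "GE \<in> gens" using gens_simps(5) by blast
    hence "Gs (k + 1) (gen_fun GE)" by (rule Gs_gen) (use that in simp)
    thus ?thesis by simp
  next
    case False
    thus ?thesis using sym.Ta_m2 mn that by (intro MG'[of 0]) auto
  qed
  show ?thesis
  proof (cases j)
    case (GC c)
    hence c: "c \<in> I" using j by simp
    show ?thesis
    proof (cases "wt c = 1")
      case False
      hence "- int (wt c) + 1 \<le> k" using k wt_pos[of c] by auto
      thus ?thesis using MG'[OF Mf_der_all[OF Mf.comp[OF c order_refl] D]] GC by simp
    next
      case True
      then consider "c = FT" | "c = FW 0" by (cases c) auto
      thus ?thesis
      proof cases
        case 1
        show ?thesis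
        proof (cases "D = FT")
          case True
          thus ?thesis using Gs_gen[of GA "k + 1"] GC 1 k by (simp add: sym.a_def)
        next
          case False
          hence "opf (E D) (gen_fun j) = Wop 0 (comp FT)" using D GC 1 Z by auto
          thus ?thesis using MG'[of "- 1" "Wop 0 (comp FT)"] sym.Z\<tau> k by (simp add: sym.eqg_0)
        qed
      next
        case 2
        show ?thesis
        proof (cases "D = FT")
          case False
          thus ?thesis using Gs_gen[of GD "k + 1"] GC 2 k D Z by (simp add: sym.d_def)
        next
          case True
          show ?thesis
          proof (cases "n = m")
            case nm: True
            hence "Suc n - m = 1" "int n - int m - 1 = - 1" using mn by auto
            hence "Mf (- 1) (opf (E FT) (comp (FW 0)))" using sym.T_pow_top by simp
            thus ?thesis using MG'[of "- 1" "opf (E FT) (comp (FW 0))"] k GC 2 True by simp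
          next
            case False
            thus ?thesis using Gs_gen[of "GB 0" "k + 1"] GC 2 k True mn by simp
          qed
        qed
      qed
    qed
  next
    case GA
    hence k0: "0 \<le> k" using j by simp
    show ?thesis
    proof (cases "D = FT")
      case True
      thus ?thesis using Ta[OF k0] GA by simp
    next
      case False
      thus ?thesis using MG'[of 0 "Wop 0 sym.a"] sym.Zad k0 D Z GA by auto
    qed
  next
    case GD
    hence k0: "0 \<le> k" using j by simp
    show ?thesis
    proof (cases "D = FT")
      case True
      have "Mf 0 (opf (E FT) sym.d - (- (1 / 2)) *\<^sub>R opf (E FT) sym.a)" using sym.Td by simp
      from MG2[OF this k0 Ta[OF k0]] show ?thesis using GD True by simp
    next
      case False
      thus ?thesis using MG'[of 0 "Wop 0 sym.d"] sym.Zad k0 D Z GD by auto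
    qed
  next
    case (GB i)
    hence i: "i < n - m" "int i \<le> k" using j by auto
    show ?thesis
    proof (cases "D = FT")
      case True
      show ?thesis
      proof (cases "Suc i = n - m")
        case False
        thus ?thesis using Gs_gen[of "GB (Suc i)" "k + 1"] GB i True by simp
      next
        case s: True
        have "Suc n - m = Suc (Suc i)" "int n - int m - 1 = int i" using s mn by auto
        thus ?thesis using MG'[of "int i" "(opf (E FT) ^^ Suc (Suc i)) (comp (FW 0))"] sym.T_pow_top GB i True by simp
      qed
    next
      case False
      show ?thesis
      proof (cases i)
        case 0
        hence k0: "0 \<le> k" using i by simp
        have "Mf 0 (Wop 0 sym.b - ((real n ^ 2 - 1) / 2) *\<^sub>R opf (E FT) sym.a)" using sym.Zb by simp
        from MG2[OF this k0 Ta[OF k0]] show ?thesis using GB False D Z 0 by (auto simp: sym.b_def)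
      next
        case (Suc i')
        thus ?thesis using MG'[of "int i" "Wop 0 ((opf (E FT) ^^ Suc i) (comp (FW 0)))"] sym.Z_Tpow[of "Suc i"] GB False D Z i
          by auto
      qed
    qed
  next
    case GE
    hence k1: "1 \<le> k" using j by simp
    thus ?thesis using MG'[of 1 "opf (E FT) (opf (E FT) sym.a)"] MG'[of 1 "Wop 0 (opf (E FT) sym.a)"] 
        sym.TTa sym.ZTa D Z GE by auto
  qed
qed

lemma Gs_der:
  assumes MG: "\<And>\<Phi>. Mf k \<Phi> \<Longrightarrow> Gs k \<Phi>" and k: "- 1 \<le> k" and \<Phi>: "Gs k \<Phi>" and D: "D \<in> {FT, FW 0}"
  shows "Gs (k + 1) (opf (E D) \<Phi>)"
proof -
  obtain s where s: "\<And>j. j \<in> gens \<Longrightarrow> smooth_on B (s j)" "\<And>j. j \<in> gens \<Longrightarrow> k < gdeg j \<Longrightarrow> s j = (\<lambda>_. 0)"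
    "\<And>V q. V \<in> syms \<Longrightarrow> q \<in> B \<Longrightarrow> \<Phi> (V, q) = (\<Sum>j\<in>gens. s j q * gen_fun j (V, q))"
    using \<Phi> unfolding Gs_def by blast
  have "Gs (k + 1) (\<lambda>x. \<Sum>j\<in>gens. ((\<lambda>(V, q). s j q * opf (E D) (gen_fun j) (V, q)) + (\<lambda>(V, q). lie_deriv (E D) (s j) q * gen_fun j (V, q))) x)"
  proof (intro Gs_sum Gs_add)
    fix j assume j: "j \<in> gens"
    show "Gs (k + 1) (\<lambda>(V, q). s j q * opf (E D) (gen_fun j) (V, q))"
    proof (cases "k < gdeg j")
      case True
      thus ?thesis by (intro Gs_eqv[OF Gs_zero]) (simp add: zero_fun_apply s(2)[OF j])
    next
      case False
      thus ?thesis using Gs_gen_der[OF MG k j _ D] s(1)[OF j] by (intro Gs_mul) auto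
    qed
    show "Gs (k + 1) (\<lambda>(V, q). lie_deriv (E D) (s j) q * gen_fun j (V, q))"
    proof (cases "k < gdeg j")
      case True
      thus ?thesis by (intro Gs_eqv[OF Gs_zero]) (simp add: zero_fun_apply s(2)[OF j])
    next
      case False
      thus ?thesis using s(1)[OF j] j
        by (intro Gs_mul Gs_gen smooth_on_lie_deriv openB horiz_smooth D) auto
    qed
  qed
  thus ?thesis
  proof (rule Gs_eqv)
    fix V q assume V: "V \<in> syms" "q \<in> B"
    have sg: "smooth_on B (\<lambda>q. gen_fun j (V, q))" if "j \<in> gens" for j
      by (rule Mf_smooth[OF gen_Mf[OF that] V(1)])
    have "opf (E D) \<Phi> (V, q) = lie_deriv (E D) (\<lambda>q. \<Sum>j\<in>gens. s j q * gen_fun j (V, q)) q"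
      using V by (auto simp: opf_def s(3) intro!: lie_deriv_cong[OF openB])
    also have "\<dots> = (\<Sum>j\<in>gens. lie_deriv (E D) (\<lambda>q. s j q * gen_fun j (V, q)) q)"
      using s(1) sg V by (intro lie_deriv_sum[where U = B] smooth_on_mult openB) auto
    also have "\<dots> = (\<Sum>j\<in>gens. s j q * opf (E D) (gen_fun j) (V, q) + lie_deriv (E D) (s j) q * gen_fun j (V, q))"
      using s(1) sg V by (intro sum.cong) (auto simp: lie_deriv_mult[where U = B] opf_def)
    finally show "(\<Sum>j\<in>gens. ((\<lambda>(V, q). s j q * opf (E D) (gen_fun j) (V, q)) + (\<lambda>(V, q). lie_deriv (E D) (s j) q * gen_fun j (V, q))) (V, q))
        = opf (E D) \<Phi> (V, q)" by (simp add: plus_fun_apply)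
  qed
qed

lemma Mf_Gs: "Mf k \<Phi> \<Longrightarrow> Gs k \<Phi>"
proof -
  \<comment> \<open>Up to level -1 clause \<open>der\<close> cannot have been used, so only the
    component generators occur.\<close>
  have base: "Mf l \<Phi> \<Longrightarrow> l \<le> - 1 \<Longrightarrow> Gs l \<Phi>" for l \<Phi>
  proof (induction rule: Mf.induct)
    case (comp c k)
    thus ?case using Gs_gen[of "GC c" k] by simp
  next
    case (up k \<Phi> l)
    thus ?case by (intro Gs_up[of k _ l]) auto
  qed (auto intro: Gs_zero Gs_add Gs_mul elim: Gs_eqv)
  have step: "Mf l \<Phi> \<Longrightarrow> l \<le> K \<Longrightarrow> Gs l \<Phi>" if "- 1 \<le> K" for K l \<Phi>
    using that
  proof (induction K arbitrary: l \<Phi> rule: int_ge_induct)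
    case base
    thus ?case using \<open>\<And>l \<Phi>. Mf l \<Phi> \<Longrightarrow> l \<le> - 1 \<Longrightarrow> Gs l \<Phi>\<close> by blast
  next
    case (step K)
    from step.prems show ?case
    proof (induction rule: Mf.induct)
      case (comp c k)
      thus ?case using Gs_gen[of "GC c" k] by simp
    next
      case (der k \<Phi> D)
      show ?case by (rule Gs_der[OF step.IH _ step.IH]) (use der in auto)
    next
      case (up k \<Phi> l)
      thus ?case by (intro Gs_up[of k _ l]) auto
    qed (auto intro: Gs_zero Gs_add Gs_mul elim: Gs_eqv)
  qed
  show "Mf k \<Phi> \<Longrightarrow> Gs k \<Phi>" using step[of "max k (- 1)" k \<Phi>] by simp
qed

theorem syms_determined:
  assumes V: "V \<in> syms" and p: "p \<in> B" and z: "\<And>j. j \<in> gens \<Longrightarrow> gen_fun j (V, p) = 0"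
  shows "V = 0"
proof -
  define P where "P = (\<lambda>c j s. (\<forall>j'\<in>gens. smooth_on B (s j')) \<and>
     (\<forall>V\<in>syms. \<forall>q\<in>B. opf (E c) (gen_fun j) (V, q) = (\<Sum>j'\<in>gens. s j' q * gen_fun j' (V, q))))"
  have "\<exists>s. P c j s" if "c \<in> I" "j \<in> gens" for c j
    using Mf_Gs[OF Mf_op[OF that(1) gen_Mf[OF that(2)]]] unfolding Gs_def P_def by blast
  then obtain s where "\<And>c j. c \<in> I \<Longrightarrow> j \<in> gens \<Longrightarrow> P c j (s c j)" by metis
  hence s: "\<And>c j j'. c \<in> I \<Longrightarrow> j \<in> gens \<Longrightarrow> j' \<in> gens \<Longrightarrow> smooth_on B (s c j j')"
    "\<And>c j V q. c \<in> I \<Longrightarrow> j \<in> gens \<Longrightarrow> V \<in> syms \<Longrightarrow> q \<in> B \<Longrightarrow>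
        opf (E c) (gen_fun j) (V, q) = (\<Sum>j'\<in>gens. s c j j' q * gen_fun j' (V, q))"
    unfolding P_def by blast+
  have g: "gen_fun j (V, q) = 0" if "j \<in> gens" "q \<in> B" for j q
  proof (rule frame_system_unique[OF frame conn p finite_gens, where g = "\<lambda>j q. gen_fun j (V, q)" and A = s])
    show "smooth_on B (\<lambda>q. gen_fun j (V, q))" if "j \<in> gens" for j by (rule Mf_smooth[OF gen_Mf[OF that] V])
    show "continuous_on B (s c j k)" if "c \<in> I" "j \<in> gens" "k \<in> gens" for c j k
      using smooth_on_continuous s(1) that by blast
    show "lie_deriv (E c) (\<lambda>q. gen_fun j (V, q)) q = (\<Sum>k\<in>gens. s c j k q * gen_fun k (V, q))"
      if "c \<in> I" "j \<in> gens" "q \<in> B" for c j q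
      using s(2)[OF that(1,2) V that(3)] V that by (simp add: opf_def)
  qed (use z that in auto)
  show ?thesis
  proof
    fix q
    show "V q = 0 q"
    proof (cases "q \<in> B")
      case True
      have "eps c q \<bullet> V q = 0" if "c \<in> I" for c using g[of "GC c" q] that True by (simp add: comp_def)
      thus ?thesis using rep[OF True, of "V q"] by (simp add: zero_fun_apply)
    next
      case False
      thus ?thesis using V by (simp add: syms_def zero_fun_apply)
    qed
  qed
qed

lemma syms_subspace: "subspace syms"
  unfolding subspace_def
proof (intro conjI ballI allI)
  have z: "lie_bracket (\<lambda>_. 0) X q = 0" if "q \<in> B" "smooth_on B X" for X q
    by (simp add: lie_bracket_def)
      (simp add: lie_deriv_def linear_0[OF frechet_derivative_linear[OF smooth_on_differentiable[OF that(2,1)]]])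
  show "0 \<in> syms"
    using z smE_legs(1) smE_legs(2)[of 0] by (auto simp: syms_def zero_fun_def smooth_on_const)
  fix V V' assume V: "V \<in> syms" "V' \<in> syms"
  show "V + V' \<in> syms"
    using V smE_legs(1) smE_legs(2)[of 0] lie_bracket_add_left[OF openB _ syms_smooth[OF V(1)] syms_smooth[OF V(2)]]
    by (auto simp: syms_def plus_fun_def inner_add_right intro!: smooth_on_add openB)
next
  fix r :: real and V assume V: "V \<in> syms"
  show "r *\<^sub>R V \<in> syms"
    using V smE_legs(1) smE_legs(2)[of 0] lie_bracket_scaleR_left[OF openB _ smooth_on_const[of B r] syms_smooth[OF V]]
    by (auto simp: syms_def scaleR_fun_def intro!: smooth_on_scaleR smooth_on_const openB)
qed

lemma Gs_linear:
  assumes "Mf k \<Phi>" "q \<in> B" "V \<in> syms" "V' \<in> syms"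
  shows "\<Phi> (V + r *\<^sub>R V', q) = \<Phi> (V, q) + r * \<Phi> (V', q)"
  using assms(1,2)
proof (induction arbitrary: q rule: Mf.induct)
  case (comp c k)
  thus ?case by (simp add: comp_def pw inner_add_right)
next
  case (der k \<Phi> D)
  have VV: "V + r *\<^sub>R V' \<in> syms"
    using syms_subspace assms by (intro subspace_add subspace_scale) auto
  have s: "smooth_on B (\<lambda>q. \<Phi> (V, q))" "smooth_on B (\<lambda>q. \<Phi> (V', q))"
    using Mf_smooth[OF der(1)] assms by auto
  have "lie_deriv (E D) (\<lambda>q. \<Phi> (V + r *\<^sub>R V', q)) q = lie_deriv (E D) (\<lambda>q. \<Phi> (V, q) + r * \<Phi> (V', q)) q"
    by (rule lie_deriv_cong[OF openB \<open>q \<in> B\<close>]) (auto simp: der(4))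
  also have "\<dots> = lie_deriv (E D) (\<lambda>q. \<Phi> (V, q)) q + r * lie_deriv (E D) (\<lambda>q. \<Phi> (V', q)) q"
    using s lie_deriv_add[OF s(1) _ der.prems, of "\<lambda>q. r * \<Phi> (V', q)"]
      lie_deriv_mult[OF smooth_on_const[of B r] s(2) der.prems]
    by (simp add: smooth_on_mult openB smooth_on_const)
  finally show ?case using VV assms der.prems by (simp add: opf_def)
next
  case (eqv k \<Phi> \<Psi>)
  have "V + r *\<^sub>R V' \<in> syms"
    using syms_subspace assms by (intro subspace_add subspace_scale) auto
  thus ?case using eqv(2)[symmetric] eqv(3,4) assms by simp
qed (auto simp: algebra_simps pw)

end

section \<open>The adapted frame of a Monge equation\<close>

locale monge =
  fixes m n :: nat and e :: "nat \<Rightarrow> 'a::euclidean_space" and U :: "'a set" and F :: "'a \<Rightarrow> real"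
  assumes mn: "1 \<le> m" "m \<le> n" "2 \<le> n" "m = 1 \<Longrightarrow> 3 \<le> n"
    and jet: "jet_frame m n e" and eq: "monge_equation m n e U F"
begin

text \<open>Indices count weight, hence run opposite to the order of differentiation, and brackets
  with the total derivative raise them. The value 0 out of range lets formulas run past the ends of
  the chains.\<close>

definition yy :: "nat \<Rightarrow> 'a" where "yy k = (if 1 \<le> k \<and> k \<le> m then d_y e (m - k) else 0)"
definition zz :: "nat \<Rightarrow> 'a" where "zz i = (if i \<le> n then d_z m e (n - i) else 0)"

lemma DIM: "DIM('a) = m + n + 2"
  using jet bij_betw_same_card[of e "{..<m + n + 2}" Basis] by (simp add: jet_frame_def)

lemma e_inner: "i < m + n + 2 \<Longrightarrow> j < m + n + 2 \<Longrightarrow> e i \<bullet> e j = (if i = j then 1 else 0)"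
  using jet bij_betwE[of e "{..<m + n + 2}" Basis] bij_betw_imp_inj_on[of e "{..<m + n + 2}" Basis]
  by (auto simp: jet_frame_def inner_Basis inj_on_eq_iff)

lemma U: "open U" and smF: "smooth_on U F"
  and Hne: "q \<in> U \<Longrightarrow> dir_deriv (d_z m e n) (dir_deriv (d_z m e n) F) q \<noteq> 0"
  using eq by (auto simp: monge_equation_def)

abbreviation "T0 \<equiv> total_derivative m n e F"

definition DT0 :: "'a \<Rightarrow> 'a \<Rightarrow> 'a"
  where "DT0 q v = (\<Sum>i<m - 1. (v \<bullet> d_y e (i + 1)) *\<^sub>R d_y e i) + frechet_derivative F (at q) v *\<^sub>R d_y e (m - 1)
      + (\<Sum>j<n. (v \<bullet> d_z m e (j + 1)) *\<^sub>R d_z m e j)"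

lemma T0_derivative: "q \<in> U \<Longrightarrow> (T0 has_derivative DT0 q) (at q)"
  unfolding total_derivative_def[abs_def] DT0_def[abs_def] coord_y_def coord_z_def
  by (auto intro!: derivative_eq_intros smooth_on_has_derivative[OF smF])

lemma smT0: "smooth_on U T0"
  unfolding total_derivative_def[abs_def] coord_y_def coord_z_def
  by (intro smooth_intros U smF)

lemma DT0_zz: "i \<le> n \<Longrightarrow> DT0 q (zz i) = zz (Suc i) + frechet_derivative F (at q) (zz i) *\<^sub>R yy 1"
proof -
  assume i: "i \<le> n"
  have 1: "(\<Sum>k<m - 1. (d_z m e (n - i) \<bullet> d_y e (k + 1)) *\<^sub>R d_y e k) = 0"
    by (rule sum.neutral) (auto simp: d_z_def d_y_def e_inner)
  have "(\<Sum>j<n. (d_z m e (n - i) \<bullet> d_z m e (j + 1)) *\<^sub>R d_z m e j)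
      = (\<Sum>j<n. if j = n - Suc i then if i < n then d_z m e j else 0 else 0)"
    by (rule sum.cong) (use i in \<open>auto simp: d_z_def e_inner\<close>)
  hence 2: "(\<Sum>j<n. (d_z m e (n - i) \<bullet> d_z m e (j + 1)) *\<^sub>R d_z m e j) = zz (Suc i)"
    using i mn by (auto simp: zz_def)
  show ?thesis using i 1 2 mn by (simp add: DT0_def zz_def[of i] yy_def)
qed

lemma DT0_yy: "1 \<le> k \<Longrightarrow> DT0 q (yy k) = yy (Suc k) + frechet_derivative F (at q) (yy k) *\<^sub>R yy 1" if q: "q \<in> U"
proof -
  assume k1: "1 \<le> k"
  have lin: "linear (frechet_derivative F (at q))"
    by (rule frechet_derivative_linear[OF smooth_on_differentiable[OF smF q]])
  show ?thesis
  proof (cases "k \<le> m")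
    case False
    thus ?thesis using linear_0[OF lin] by (simp add: DT0_def yy_def)
  next
    case k: True
    have 1: "(\<Sum>j<n. (d_y e (m - k) \<bullet> d_z m e (j + 1)) *\<^sub>R d_z m e j) = 0"
      by (rule sum.neutral) (use k1 k in \<open>auto simp: d_z_def d_y_def e_inner\<close>)
    have "(\<Sum>j<m - 1. (d_y e (m - k) \<bullet> d_y e (j + 1)) *\<^sub>R d_y e j)
        = (\<Sum>j<m - 1. if j = m - Suc k then if k < m then d_y e j else 0 else 0)"
      by (rule sum.cong) (use k k1 in \<open>auto simp: d_y_def e_inner\<close>)
    hence 2: "(\<Sum>j<m - 1. (d_y e (m - k) \<bullet> d_y e (j + 1)) *\<^sub>R d_y e j) = yy (Suc k)"
      using k k1 mn by (auto simp: yy_def)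
    show ?thesis using k k1 1 2 mn by (simp add: DT0_def yy_def[of k] yy_def[of "Suc 0"])
  qed
qed

lemma DT0_linear: "q \<in> U \<Longrightarrow> linear (DT0 q)"
  using has_derivative_linear[OF T0_derivative] .

definition P :: "'a \<Rightarrow> real" where "P = dir_deriv (d_z m e n) F"
definition H :: "'a \<Rightarrow> real" where "H = dir_deriv (d_z m e n) P"
text \<open>The coefficient of \<open>yy 1\<close> that arises when \<open>T0\<close> is
  differentiated along \<open>zz 1 + P yy 1\<close>.\<close>

definition \<kappa> :: "'a \<Rightarrow> real" where "\<kappa> q = dir_deriv (zz 1) F q + P q * dir_deriv (yy 1) F q"
text \<open>The linear interpolation from \<open>\<kappa>\<close> at \<open>i = 1\<close> to 0 at
  \<open>i = n + 1\<close>. Each bracket with \<open>TT\<close> lowers it by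
  \<open>\<kappa> / n\<close>. It has to reach 0 at the end of the chain: if \<open>m = n\<close>,
  the field \<open>yy n\<close> is of weight \<open>n + 2\<close> and must not occur in the bracket
  of \<open>WW n\<close> with \<open>TT\<close>.\<close>

definition \<kappa>i :: "nat \<Rightarrow> 'a \<Rightarrow> real" where "\<kappa>i i q = (real n + 1 - real i) / real n * \<kappa> q"
text \<open>The horizontal field \<open>T0\<close> may be changed by a multiple of
  \<open>zz 0\<close>. Along \<open>zz 0\<close> the derivative of \<open>P\<close> is
  \<open>H\<close>, which is nonzero, so the derivative of \<open>P\<close> along \<open>TT\<close>
  can be prescribed; \<open>f\<close> makes it \<open>\<kappa> / n\<close>.\<close>

definition f :: "'a \<Rightarrow> real" where "f q = (\<kappa> q / real n - lie_deriv T0 P q) / H q"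
definition TT :: "'a \<Rightarrow> 'a" where "TT q = T0 q + f q *\<^sub>R zz 0"
definition WW :: "nat \<Rightarrow> 'a \<Rightarrow> 'a" where "WW i q = zz i + P q *\<^sub>R yy i + \<kappa>i i q *\<^sub>R yy (i - 1)"
definition YY :: "nat \<Rightarrow> 'a \<Rightarrow> 'a" where "YY i q = H q *\<^sub>R yy i"

primrec mframe :: "leg \<Rightarrow> 'a \<Rightarrow> 'a" where
  "mframe FT = TT" | "mframe (FW i) = WW i" | "mframe (FY i) = YY i"

lemma H_nz: "q \<in> U \<Longrightarrow> H q \<noteq> 0"
  using Hne by (simp add: H_def P_def)

lemma smP: "smooth_on U P" unfolding P_def by (intro smooth_intros smF)
lemma smH: "smooth_on U H" unfolding H_def by (intro smooth_intros smP)
lemma sm\<kappa>: "smooth_on U \<kappa>" unfolding \<kappa>_def[abs_def] by (intro smooth_intros smP smF U)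
lemma sm\<kappa>i: "smooth_on U (\<kappa>i i)" unfolding \<kappa>i_def[abs_def] by (intro smooth_intros sm\<kappa> U)
lemma smf: "smooth_on U f"
  unfolding f_def[abs_def] by (intro smooth_intros sm\<kappa> smT0 smP smH U H_nz) (use mn in auto)
lemma smTT: "smooth_on U TT" unfolding TT_def[abs_def] by (intro smooth_intros smT0 smf U)
lemma smWW: "smooth_on U (WW i)" unfolding WW_def[abs_def] by (intro smooth_intros smP sm\<kappa>i U)
lemma smYY: "smooth_on U (YY i)" unfolding YY_def[abs_def] by (intro smooth_intros smH U)
lemma sm_mframe: "smooth_on U (mframe c)" by (cases c) (auto simp: smTT smWW smYY)

lemma yy0 [simp]: "yy 0 = 0" by (simp add: yy_def)
lemma WW0: "WW 0 = (\<lambda>q. zz 0)" by (simp add: WW_def[abs_def])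
lemma WW_top: "WW (Suc n) q = 0" using mn by (auto simp: WW_def \<kappa>i_def zz_def yy_def)
lemma zz0: "zz 0 = d_z m e n" by (simp add: zz_def)

lemma lie_zz0: "q \<in> U \<Longrightarrow> lie_deriv (\<lambda>_. zz 0) P q = H q"
  by (simp add: lie_deriv_def H_def dir_deriv_def zz0)

lemma TT_P: assumes "q \<in> U" shows "lie_deriv TT P q = \<kappa> q / real n"
proof -
  have "lie_deriv TT P q = lie_deriv T0 P q + f q * lie_deriv (\<lambda>_. zz 0) P q"
    unfolding TT_def[abs_def]
    using lie_deriv_left_add[OF smP assms, of T0 "\<lambda>q. f q *\<^sub>R zz 0"] lie_deriv_left_scaleR[OF smP assms, of f "\<lambda>_. zz 0"]
    by simp
  thus ?thesis using H_nz[OF assms] by (simp add: lie_zz0[OF assms] f_def)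
qed

lemma lie_TT: "q \<in> U \<Longrightarrow> lie_deriv X TT q = DT0 q (X q) + lie_deriv X f q *\<^sub>R zz 0"
proof -
  assume q: "q \<in> U"
  have "(TT has_derivative (\<lambda>v. DT0 q v + frechet_derivative f (at q) v *\<^sub>R zz 0)) (at q)"
    unfolding TT_def[abs_def]
    by (intro has_derivative_add T0_derivative q has_derivative_scaleR_left smooth_on_has_derivative[OF smf])
  from lie_deriv_eq[OF this] show ?thesis by (simp add: lie_deriv_def)
qed

lemma lie_WW: "q \<in> U \<Longrightarrow> lie_deriv X (WW i) q = lie_deriv X P q *\<^sub>R yy i + lie_deriv X (\<kappa>i i) q *\<^sub>R yy (i - 1)"
proof -
  assume q: "q \<in> U"
  have "((\<lambda>q. zz i + P q *\<^sub>R yy i + \<kappa>i i q *\<^sub>R yy (i - 1)) has_derivative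
    (\<lambda>v. 0 + frechet_derivative P (at q) v *\<^sub>R yy i + frechet_derivative (\<kappa>i i) (at q) v *\<^sub>R yy (i - 1))) (at q)"
    by (intro has_derivative_add has_derivative_const q has_derivative_scaleR_left
        smooth_on_has_derivative[OF smP] smooth_on_has_derivative[OF sm\<kappa>i])
  from lie_deriv_eq[OF this] show ?thesis by (simp add: lie_deriv_def WW_def[abs_def])
qed

lemma lie_YY: "q \<in> U \<Longrightarrow> lie_deriv X (YY i) q = lie_deriv X H q *\<^sub>R yy i"
proof -
  assume q: "q \<in> U"
  have "(YY i has_derivative (\<lambda>v. frechet_derivative H (at q) v *\<^sub>R yy i)) (at q)"
    unfolding YY_def[abs_def]
    by (intro q has_derivative_scaleR_left smooth_on_has_derivative[OF smH])
  from lie_deriv_eq[OF this] show ?thesis by (simp add: lie_deriv_def)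
qed

text \<open>The remainder has weight at most \<open>i + 1\<close>, as the adapted frame demands:
  \<open>yy (i - 1)\<close> has that weight, and \<open>yy 1\<close>, of weight 3, is present only
  for \<open>i \<ge> 2\<close>.\<close>

lemma bracket_WT:
  assumes q: "q \<in> U" and i: "i \<le> n"
  shows "\<exists>\<alpha> \<beta> \<gamma>. lie_bracket (WW i) TT q = WW (Suc i) q + \<alpha> *\<^sub>R yy 1 + \<beta> *\<^sub>R yy (i - 1) + \<gamma> *\<^sub>R zz 0 \<and> (i \<le> 1 \<longrightarrow> \<alpha> = 0)"
proof -
  note lin = DT0_linear[OF q]
  have D: "DT0 q (WW i q) = DT0 q (zz i) + P q *\<^sub>R DT0 q (yy i) + \<kappa>i i q *\<^sub>R DT0 q (yy (i - 1))"
    by (simp add: WW_def linear_add[OF lin] linear_cmul[OF lin])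
  have br: "lie_bracket (WW i) TT q = DT0 q (WW i q) + lie_deriv (WW i) f q *\<^sub>R zz 0
      - ((\<kappa> q / real n) *\<^sub>R yy i + lie_deriv TT (\<kappa>i i) q *\<^sub>R yy (i - 1))"
    by (simp add: lie_bracket_def lie_TT[OF q] lie_WW[OF q] TT_P[OF q])
  have k: "\<kappa>i i q - \<kappa> q / real n = \<kappa>i (Suc i) q" using mn by (simp add: \<kappa>i_def field_simps)
  let ?F = "frechet_derivative F (at q)"
  consider "i = 0" | "i = 1" | "2 \<le> i" by linarith
  thus ?thesis
  proof cases
    case 1
    have "?F (zz 0) = P q" by (simp add: P_def dir_deriv_def zz0)
    hence "DT0 q (WW 0 q) = zz 1 + P q *\<^sub>R yy 1" by (simp add: WW0 DT0_zz)
    thus ?thesis using 1 br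
      by (intro exI[of _ 0] exI[of _ "lie_deriv (WW i) f q"]) (simp add: WW_def[of "Suc 0"])
  next
    case 2
    have "DT0 q (WW 1 q) = zz 2 + P q *\<^sub>R yy 2 + \<kappa> q *\<^sub>R yy 1"
      using D 2 mn linear_0[OF lin] by (simp add: DT0_zz DT0_yy[OF q] \<kappa>_def dir_deriv_def algebra_simps numeral_2_eq_2)
    moreover have "\<kappa> q *\<^sub>R yy 1 - (\<kappa> q / real n) *\<^sub>R yy 1 = \<kappa>i 2 q *\<^sub>R yy 1"
    proof -
      have "\<kappa>i 1 q = \<kappa> q" using mn by (simp add: \<kappa>i_def)
      thus ?thesis using k 2 by (simp add: scaleR_diff_left[symmetric] numeral_2_eq_2)
    qed
    ultimately have "lie_bracket (WW i) TT q = WW (Suc i) q + lie_deriv (WW i) f q *\<^sub>R zz 0"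
      using br 2 by (simp add: WW_def[of "Suc (Suc 0)"] numeral_2_eq_2 algebra_simps)
    thus ?thesis
      by (intro exI[of _ 0] exI[of _ 0] exI[of _ "lie_deriv (WW i) f q"]) simp
  next
    case 3
    then obtain i' where i': "i = Suc i'" "1 \<le> i'" by (cases i) auto
    have "DT0 q (WW i q) = zz (Suc i) + P q *\<^sub>R yy (Suc i) + \<kappa>i i q *\<^sub>R yy i
        + (?F (zz i) + P q * ?F (yy i) + \<kappa>i i q * ?F (yy (i - 1))) *\<^sub>R yy 1"
      unfolding D using i i' by (simp add: DT0_zz DT0_yy[OF q] algebra_simps)
    moreover have "\<kappa>i i q *\<^sub>R yy i - (\<kappa> q / real n) *\<^sub>R yy i = \<kappa>i (Suc i) q *\<^sub>R yy i"
      using k by (simp add: scaleR_diff_left[symmetric])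
    ultimately have "lie_bracket (WW i) TT q = WW (Suc i) q + (?F (zz i) + P q * ?F (yy i) + \<kappa>i i q * ?F (yy (i - 1))) *\<^sub>R yy 1
       + (- lie_deriv TT (\<kappa>i i) q) *\<^sub>R yy (i - 1) + lie_deriv (WW i) f q *\<^sub>R zz 0"
      unfolding br by (simp add: WW_def[of "Suc i"] algebra_simps)
    thus ?thesis using 3 by (intro exI conjI) (assumption, simp)
  qed
qed

lemma bracket_YT:
  assumes q: "q \<in> U" and i: "1 \<le> i"
  shows "\<exists>\<alpha> \<beta> \<gamma>. lie_bracket (YY i) TT q = YY (Suc i) q + \<alpha> *\<^sub>R yy 1 + \<beta> *\<^sub>R yy i + \<gamma> *\<^sub>R zz 0"
proof -
  have D: "DT0 q (YY i q) = H q *\<^sub>R yy (Suc i) + (H q * frechet_derivative F (at q) (yy i)) *\<^sub>R yy 1"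
    using i by (simp add: YY_def linear_cmul[OF DT0_linear[OF q]] DT0_yy[OF q] algebra_simps)
  have "lie_bracket (YY i) TT q = YY (Suc i) q + (H q * frechet_derivative F (at q) (yy i)) *\<^sub>R yy 1
      + (- lie_deriv TT H q) *\<^sub>R yy i + lie_deriv (YY i) f q *\<^sub>R zz 0"
    unfolding lie_bracket_def by (simp add: lie_TT[OF q] lie_YY[OF q] D YY_def[of "Suc i"])
  thus ?thesis by blast
qed

lemma bracket_WZ:
  assumes q: "q \<in> U"
  shows "lie_bracket (WW i) (WW 0) q = - YY i q + (- lie_deriv (\<lambda>_. zz 0) (\<kappa>i i) q) *\<^sub>R yy (i - 1)"
  by (simp add: lie_bracket_def WW0 lie_WW[OF q] lie_zz0[OF q] YY_def)

lemma bracket_YZ: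
  assumes q: "q \<in> U"
  shows "lie_bracket (YY i) (WW 0) q = (- lie_deriv (\<lambda>_. zz 0) H q) *\<^sub>R yy i"
  by (simp add: lie_bracket_def WW0 lie_YY[OF q])

lemma mframe_span:
  assumes q: "q \<in> U" shows "span ((\<lambda>c. mframe c q) ` legs m n) = UNIV"
proof -
  let ?S = "span ((\<lambda>c. mframe c q) ` legs m n)"
  have E: "mframe c q \<in> ?S" if "c \<in> legs m n" for c using that by (intro span_base) auto
  have yy: "yy k \<in> ?S" for k
  proof (cases "1 \<le> k \<and> k \<le> m")
    case True
    have "inverse (H q) *\<^sub>R mframe (FY k) q \<in> ?S" using True by (intro span_scale E) auto
    thus ?thesis using H_nz[OF q] by (simp add: YY_def)
  qed (auto simp: yy_def span_zero)
  have zz: "zz i \<in> ?S" for i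
  proof (cases "i \<le> n")
    case True
    have "mframe (FW i) q - P q *\<^sub>R yy i - \<kappa>i i q *\<^sub>R yy (i - 1) \<in> ?S"
      using True by (intro span_diff span_scale E yy) auto
    thus ?thesis by (simp add: WW_def)
  qed (auto simp: zz_def span_zero)
  have dy: "d_y e i \<in> ?S" if "i < m" for i
    using yy[of "m - i"] that by (simp add: yy_def Suc_le_eq)
  have dz: "d_z m e j \<in> ?S" if "j \<le> n" for j
    using zz[of "n - j"] that by (simp add: zz_def)
  have "T0 q \<in> ?S"
  proof -
    have "mframe FT q - f q *\<^sub>R zz 0 \<in> ?S" by (intro span_diff span_scale E zz) auto
    thus ?thesis by (simp add: TT_def)
  qed
  moreover have "(\<Sum>i<m - 1. coord_y e (i + 1) q *\<^sub>R d_y e i) + F q *\<^sub>R d_y e (m - 1)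
      + (\<Sum>j<n. coord_z m e (j + 1) q *\<^sub>R d_z m e j) \<in> ?S"
    using mn by (intro span_add span_sum span_scale dy dz) auto
  ultimately have "T0 q - ((\<Sum>i<m - 1. coord_y e (i + 1) q *\<^sub>R d_y e i) + F q *\<^sub>R d_y e (m - 1)
      + (\<Sum>j<n. coord_z m e (j + 1) q *\<^sub>R d_z m e j)) \<in> ?S"
    by (rule span_diff)
  hence e0: "e 0 \<in> ?S" by (simp add: total_derivative_def d_x_def algebra_simps)
  have "e k \<in> ?S" if "k < m + n + 2" for k
  proof -
    consider "k = 0" | "1 \<le> k" "k \<le> m" | "m < k" by linarith
    thus ?thesis
    proof cases
      case 2
      thus ?thesis using dy[of "k - 1"] by (simp add: d_y_def)
    next
      case 3
      thus ?thesis using dz[of "k - m - 1"] that by (simp add: d_z_def)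
    qed (use e0 in simp)
  qed
  hence "e ` {..<m + n + 2} \<subseteq> ?S" by (intro image_subsetI) simp
  hence "Basis \<subseteq> ?S" using bij_betw_imp_surj_on[of e "{..<m + n + 2}" Basis] jet by (simp add: jet_frame_def)
  hence "span Basis \<subseteq> ?S" by (rule span_minimal) simp
  thus ?thesis by auto
qed

lemma span_mframe_horizontal: "span {mframe FT q, mframe (FW 0) q} = monge_distribution m n e F q"
proof -
  have "span {TT q, zz 0} = span {T0 q, zz 0}"
  proof (rule span_eq[THEN iffD2], intro conjI subsetI)
    have z: "zz 0 \<in> span {TT q, zz 0}" "zz 0 \<in> span {T0 q, zz 0}" by (auto intro: span_base)
    have "T0 q + f q *\<^sub>R zz 0 \<in> span {T0 q, zz 0}" by (intro span_add span_scale z) (auto intro: span_base)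
    thus "x \<in> span {T0 q, zz 0}" if "x \<in> {TT q, zz 0}" for x using that z by (auto simp: TT_def)
    have "TT q - f q *\<^sub>R zz 0 \<in> span {TT q, zz 0}" by (intro span_diff span_scale z) (auto intro: span_base)
    thus "x \<in> span {TT q, zz 0}" if "x \<in> {T0 q, zz 0}" for x using that z by (auto simp: TT_def)
  qed
  thus ?thesis by (simp add: monge_distribution_def WW0 zz0)
qed

theorem adapted_frame_exists:
  assumes B: "open B" "connected B" "B \<subseteq> U"
  shows "\<exists>eps. adapted_frame B mframe eps m n"
proof -
  obtain eps where fr: "smooth_frame B (legs m n) mframe eps"
    using smooth_frame_exists[OF B(1) finite_legs, of m n mframe] card_legs DIM smooth_on_subset[OF sm_mframe B(3)]
      mframe_span B(3) by (metis subsetD)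
  have dual: "eps c q \<bullet> mframe d q = (if c = d then 1 else 0)" if "q \<in> B" "c \<in> legs m n" "d \<in> legs m n" for c d q
    using fr that by (simp add: smooth_frame_def)
  have dyy: "eps c q \<bullet> yy k = 0" if "q \<in> B" "c \<in> legs m n" "c \<noteq> FY k" for c q k
  proof (cases "1 \<le> k \<and> k \<le> m")
    case True
    hence "H q * (eps c q \<bullet> yy k) = 0" using dual[OF that(1,2), of "FY k"] that by (simp add: YY_def)
    thus ?thesis using H_nz B(3) that by auto
  qed (auto simp: yy_def)
  have dzz: "eps c q \<bullet> zz 0 = 0" if "q \<in> B" "c \<in> legs m n" "c \<noteq> FW 0" for c q
    using dual[OF that(1,2), of "FW 0"] that by (simp add: WW0)
  have dW: "eps c q \<bullet> WW i q = (if c = FW i then 1 else 0)" if "q \<in> B" "c \<in> legs m n" "i \<le> Suc n" for c q i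
  proof (cases "i \<le> n")
    case True
    thus ?thesis using dual[OF that(1,2), of "FW i"] by simp
  next
    case False
    hence "i = Suc n" using that by simp
    thus ?thesis using that WW_top by auto
  qed
  have dY: "eps c q \<bullet> YY i q = (if c = FY i then 1 else 0)" if "q \<in> B" "c \<in> legs m n" "1 \<le> i" for c q i
  proof (cases "i \<le> m")
    case True
    thus ?thesis using dual[OF that(1,2), of "FY i"] that by simp
  next
    case False
    thus ?thesis using that by (auto simp: YY_def yy_def)
  qed
  have "adapted_frame B mframe eps m n"
  proof (unfold_locales)
    show "smooth_frame B (legs m n) mframe eps" by (rule fr)
    show "connected B" by (rule B)
    show "eps c q \<bullet> lie_bracket (mframe (FW i)) (mframe FT) q = (if c = FW (Suc i) then 1 else 0)"
      if i: "i \<le> n" and c: "c \<in> legs m n" "i + 2 \<le> wt c" and q: "q \<in> B" for i c q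
    proof -
      obtain \<alpha> \<beta> \<gamma> where br: "lie_bracket (WW i) TT q = WW (Suc i) q + \<alpha> *\<^sub>R yy 1 + \<beta> *\<^sub>R yy (i - 1) + \<gamma> *\<^sub>R zz 0"
        "i \<le> 1 \<longrightarrow> \<alpha> = 0" using bracket_WT[of q i] q B(3) i by blast
      have z1: "eps c q \<bullet> zz 0 = 0" using c by (intro dzz q) auto
      have z2: "\<beta> * (eps c q \<bullet> yy (i - 1)) = 0"
      proof (cases "i = 0")
        case False
        hence "c \<noteq> FY (i - 1)" using c by auto
        thus ?thesis using dyy[OF q c(1)] by simp
      qed simp
      have z3: "\<alpha> * (eps c q \<bullet> yy 1) = 0"
      proof (cases "i \<le> 1")
        case False
        hence "c \<noteq> FY 1" using c by auto
        thus ?thesis using dyy[OF q c(1)] by simp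
      qed (use br in simp)
      show ?thesis
        unfolding mframe.simps br(1) inner_add_right inner_scaleR_right z1 z2 z3
        using dW[OF q c(1), of "Suc i"] i by simp
    qed
    show "eps c q \<bullet> lie_bracket (mframe (FY i)) (mframe FT) q = (if c = FY (Suc i) then 1 else 0)"
      if i: "1 \<le> i" "i \<le> m" and c: "c \<in> legs m n" "i + 3 \<le> wt c" and q: "q \<in> B" for i c q
    proof -
      obtain \<alpha> \<beta> \<gamma> where br: "lie_bracket (YY i) TT q = YY (Suc i) q + \<alpha> *\<^sub>R yy 1 + \<beta> *\<^sub>R yy i + \<gamma> *\<^sub>R zz 0"
        using bracket_YT[of q i] q B(3) i by blast
      have "c \<noteq> FW 0" "c \<noteq> FY 1" "c \<noteq> FY i" using c i by auto
      thus ?thesis using dY[OF q c(1), of "Suc i"] dyy[OF q c(1)] dzz[OF q c(1)]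
        by (simp add: br inner_add_right)
    qed
    show "eps c q \<bullet> lie_bracket (mframe (FW i)) (mframe (FW 0)) q = (if c = FY i then - 1 else 0)"
      if i: "1 \<le> i" "i \<le> n" and c: "c \<in> legs m n" "i + 2 \<le> wt c" and q: "q \<in> B" for i c q
    proof -
      have "c \<noteq> FY (i - 1)" using c i by auto
      thus ?thesis using dY[OF q c(1) i(1)] dyy[OF q c(1), of "i - 1"] q B(3)
        by (auto simp: bracket_WZ inner_diff_right)
    qed
    show "eps c q \<bullet> lie_bracket (mframe (FY i)) (mframe (FW 0)) q = 0"
      if i: "1 \<le> i" "i \<le> m" and c: "c \<in> legs m n" "i + 3 \<le> wt c" and q: "q \<in> B" for i c q
    proof -
      have "c \<noteq> FY i" using c by auto
      thus ?thesis using dyy[OF q c(1), of i] q B(3) by (auto simp: bracket_YZ)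
    qed
  qed (use mn in auto)
  thus ?thesis by blast
qed

end

section \<open>Symmetry algebras of maximal dimension\<close>

text \<open>Gaussian elimination: equation \<open>j\<close> is solved for an unknown
  \<open>i0\<close> whose coefficient is nonzero, and \<open>M'\<close> is the reduced
  system.\<close>

lemma homogeneous_solution:
  fixes M :: "'i \<Rightarrow> 'j \<Rightarrow> real"
  assumes "finite J" "finite I" "card J < card I"
  shows "\<exists>c. (\<exists>i\<in>I. c i \<noteq> 0) \<and> (\<forall>j\<in>J. (\<Sum>i\<in>I. c i * M i j) = 0)"
  using assms
proof (induction J arbitrary: I M rule: finite_induct)
  case empty
  hence "I \<noteq> {}" by auto
  thus ?case by (intro exI[of _ "\<lambda>_. 1"]) auto
next
  case (insert j J)
  show ?case
  proof (cases "\<forall>i\<in>I. M i j = 0")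
    case True
    obtain c where "\<exists>i\<in>I. c i \<noteq> 0" "\<forall>j\<in>J. (\<Sum>i\<in>I. c i * M i j) = 0"
      using insert.IH[of I M] insert.prems insert.hyps by auto
    thus ?thesis using True by (intro exI[of _ c]) auto
  next
    case False
    then obtain i0 where i0: "i0 \<in> I" "M i0 j \<noteq> 0" by blast
    define M' where "M' = (\<lambda>i k. M i k - M i j / M i0 j * M i0 k)"
    have "card J < card (I - {i0})" using insert.prems insert.hyps i0 by auto
    then obtain c where c: "\<exists>i\<in>I - {i0}. c i \<noteq> 0" "\<forall>k\<in>J. (\<Sum>i\<in>I - {i0}. c i * M' i k) = 0"
      using insert.IH[of "I - {i0}" M'] insert.prems by auto
    define c0 where "c0 = - (\<Sum>i\<in>I - {i0}. c i * M i j) / M i0 j"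
    define c' where "c' = (\<lambda>i. if i = i0 then c0 else c i)"
    have s: "(\<Sum>i\<in>I. c' i * M i k) = c0 * M i0 k + (\<Sum>i\<in>I - {i0}. c i * M i k)" for k
      using insert.prems i0 by (subst sum.remove[of I i0]) (auto simp: c'_def intro!: sum.cong)
    have "(\<Sum>i\<in>I. c' i * M i k) = 0" if "k \<in> insert j J" for k
    proof (cases "k = j")
      case True
      thus ?thesis using i0 by (simp add: s c0_def)
    next
      case False
      hence "(\<Sum>i\<in>I - {i0}. c i * M' i k) = 0" using c that by auto
      moreover have "(\<Sum>i\<in>I - {i0}. c i * M' i k) = (\<Sum>i\<in>I - {i0}. c i * M i k) + c0 * M i0 k"
      proof -
        define r where "r = M i0 k / M i0 j"
        have "c i * M' i k = c i * M i k - (c i * M i j) * r" for i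
          by (simp add: M'_def algebra_simps r_def)
        hence "(\<Sum>i\<in>I - {i0}. c i * M' i k) = (\<Sum>i\<in>I - {i0}. c i * M i k) - (\<Sum>i\<in>I - {i0}. c i * M i j) * r"
          by (simp add: sum_subtractf sum_distrib_right[symmetric])
        thus ?thesis by (simp add: c0_def r_def)
      qed
      ultimately show ?thesis by (simp add: s)
    qed
    moreover have "\<exists>i\<in>I. c' i \<noteq> 0" using c(1) by (auto simp: c'_def)
    ultimately show ?thesis by (intro exI[of _ c']) auto
  qed
qed

section \<open>The weight filtration of vector fields and its invariance under symmetries\<close>

context adapted_frame
begin

declare pw [simp del]

text \<open>The sections over \<open>B\<close> of step \<open>w\<close> of the filtration by weight,
  i.e. of the flag generated by brackets with horizontal fields.\<close>

definition lo :: "nat \<Rightarrow> ('a \<Rightarrow> 'a) \<Rightarrow> bool"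
  where "lo w X \<longleftrightarrow> smooth_on B X \<and> (\<forall>q\<in>B. \<forall>c\<in>I. w < wt c \<longrightarrow> eps c q \<bullet> X q = 0)"

lemma lo_mono: "lo w X \<Longrightarrow> w \<le> w' \<Longrightarrow> lo w' X" by (auto simp: lo_def)

lemma lo_cong: "lo w X \<Longrightarrow> (\<And>q. q \<in> B \<Longrightarrow> X q = Y q) \<Longrightarrow> lo w Y"
  using smooth_on_cong[OF openB, of X Y] by (simp add: lo_def)

lemma lo_add: "lo w X \<Longrightarrow> lo w Y \<Longrightarrow> lo w (\<lambda>q. X q + Y q)"
  by (simp add: lo_def smooth_on_add openB inner_add_right)

lemma lo_scaleR: "smooth_on B s \<Longrightarrow> lo w X \<Longrightarrow> lo w (\<lambda>q. s q *\<^sub>R X q)"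
  by (simp add: lo_def smooth_on_scaleR openB)

lemma lo_minus: "lo w X \<Longrightarrow> lo w (\<lambda>q. - X q)"
  by (simp add: lo_def smooth_on_minus openB)

lemma lo_zero: "lo w (\<lambda>q. 0)" by (simp add: lo_def smooth_on_const)

lemma lo_sum: "(\<And>i. i \<in> A \<Longrightarrow> lo w (X i)) \<Longrightarrow> lo w (\<lambda>q. \<Sum>i\<in>A. X i q)"
  by (induction A rule: infinite_finite_induct) (auto intro: lo_zero lo_add)

lemma lo_E: "c \<in> I \<Longrightarrow> wt c \<le> w \<Longrightarrow> lo w (E c)"
  by (auto simp: lo_def smE dual)

lemma lo_expand:
  assumes "lo w X" "q \<in> B" shows "X q = (\<Sum>c\<in>I. (if wt c \<le> w then eps c q \<bullet> X q else 0) *\<^sub>R E c q)"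
proof -
  have "(\<Sum>c\<in>I. (if wt c \<le> w then eps c q \<bullet> X q else 0) *\<^sub>R E c q) = (\<Sum>c\<in>I. (eps c q \<bullet> X q) *\<^sub>R E c q)"
    using assms by (intro sum.cong) (auto simp: lo_def)
  thus ?thesis using rep[OF assms(2)] by simp
qed

lemma sm_coef: "lo w X \<Longrightarrow> c \<in> I \<Longrightarrow> smooth_on B (\<lambda>q. if wt c \<le> w then eps c q \<bullet> X q else 0)"
  by (cases "wt c \<le> w") (simp_all add: lo_def smooth_on_inner openB smeps smooth_on_const)

lemma lo_bracket_expand:
  assumes X: "lo w X" and q: "q \<in> B" and A: "smooth_on B A"
  shows "lie_bracket A X q = (\<Sum>c\<in>I. (if wt c \<le> w then eps c q \<bullet> X q else 0) *\<^sub>R lie_bracket A (E c) q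
      + lie_deriv A (\<lambda>q. if wt c \<le> w then eps c q \<bullet> X q else 0) q *\<^sub>R E c q)"
proof -
  have "lie_bracket A X q = lie_bracket A (\<lambda>q. \<Sum>c\<in>I. (if wt c \<le> w then eps c q \<bullet> X q else 0) *\<^sub>R E c q) q"
    by (rule lie_bracket_cong[OF openB q]) (auto simp: lo_expand[OF X, symmetric])
  also have "\<dots> = (\<Sum>c\<in>I. (if wt c \<le> w then eps c q \<bullet> X q else 0) *\<^sub>R lie_bracket A (E c) q
      + lie_deriv A (\<lambda>q. if wt c \<le> w then eps c q \<bullet> X q else 0) q *\<^sub>R E c q)"
    by (rule lie_bracket_sum_scaleR_right[OF openB q sm_coef[OF X] smE A])
  finally show ?thesis .
qed

lemma lo_bracket:
  assumes X: "lo w X" and A: "smooth_on B A" and w': "w \<le> w'"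
    and br: "\<And>c. c \<in> I \<Longrightarrow> wt c \<le> w \<Longrightarrow> lo w' (lie_bracket A (E c))"
  shows "lo w' (lie_bracket A X)"
proof (rule lo_cong[OF _ lo_bracket_expand[OF X _ A, symmetric]], rule lo_sum)
  fix c assume c: "c \<in> I"
  show "lo w' (\<lambda>q. (if wt c \<le> w then eps c q \<bullet> X q else 0) *\<^sub>R lie_bracket A (E c) q
      + lie_deriv A (\<lambda>q. if wt c \<le> w then eps c q \<bullet> X q else 0) q *\<^sub>R E c q)"
  proof (cases "wt c \<le> w")
    case True
    thus ?thesis
      using sm_coef[OF X c] by (intro lo_add lo_scaleR br c lo_E smooth_on_lie_deriv openB A) (use w' True in auto)
  next
    case False
    thus ?thesis by (simp add: lo_zero)
  qed
qed

lemma lo_bracket_horiz: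
  assumes X: "lo w X" and D: "D \<in> {FT, FW 0}"
  shows "lo (Suc w) (lie_bracket X (E D))"
proof -
  have "lo (Suc w) (lie_bracket (E D) X)"
  proof (rule lo_bracket[OF X horiz_smooth[OF D]])
    fix c assume c: "c \<in> I" "wt c \<le> w"
    have "lo (Suc w) (lie_bracket (E c) (E D))"
      using c bracket_low[OF _ c(1) D] smooth_on_lie_bracket[OF openB smE[OF c(1)] horiz_smooth[OF D]] by (auto simp: lo_def)
    from lo_minus[OF this] show "lo (Suc w) (lie_bracket (E D) (E c))"
      by (rule lo_cong) (simp add: lie_bracket_anti[of "E c"])
  qed simp
  from lo_minus[OF this] show ?thesis by (rule lo_cong) (simp add: lie_bracket_anti[of "E D"])
qed

lemma syms_lo1: "V \<in> syms \<Longrightarrow> D \<in> {FT, FW 0} \<Longrightarrow> lo 1 (lie_bracket V (E D))"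
  using syms_bracket[of V] syms_smooth[of V] by (auto simp: lo_def intro!: smooth_on_lie_bracket openB horiz_smooth)

lemma lie_bracket_uminus_right:
  assumes "smooth_on B A" "smooth_on B X" "q \<in> B"
  shows "lie_bracket A (\<lambda>q. - X q) q = - lie_bracket A X q"
  using lie_bracket_scaleR_right[OF openB assms(3) smooth_on_const[of B "- 1"] assms(2,1)]
  by simp

text \<open>A symmetry preserves the whole flag: heavier frame fields are brackets of lighter ones
  with horizontal fields, modulo lighter ones, and the Jacobi identity carries the property
  upwards.\<close>

lemma syms_lo_E: "V \<in> syms \<Longrightarrow> c \<in> I \<Longrightarrow> lo (wt c) (lie_bracket V (E c))"
proof (induction "wt c" arbitrary: c rule: less_induct)
  case less
  note V = less.prems(1) and sV = syms_smooth[OF less.prems(1)]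
  have low: "lo w (lie_bracket V X)" if "lo w X" "w < wt c" for w X
  proof (rule lo_bracket[OF that(1) sV order_refl])
    fix c' assume c': "c' \<in> I" "wt c' \<le> w"
    hence "lo (wt c') (lie_bracket V (E c'))" using less.hyps[of c'] V that by auto
    thus "lo w (lie_bracket V (E c'))" using c'(2) by (rule lo_mono)
  qed
  have step: "lo (wt c) (lie_bracket V (E c))"
    if e: "e \<in> I" "wt c = Suc (wt e)" and D: "D \<in> {FT, FW 0}" and r: "r \<noteq> 0"
      and lead: "\<And>c' q. c' \<in> I \<Longrightarrow> wt e < wt c' \<Longrightarrow> q \<in> B \<Longrightarrow> eps c' q \<bullet> lie_bracket (E e) (E D) q = (if c' = c then r else 0)"
    for e D r
  proof -
    let ?Y = "lie_bracket (E e) (E D)"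
    have sY: "smooth_on B ?Y" by (rule smooth_on_lie_bracket[OF openB smE[OF e(1)] horiz_smooth[OF D]])
    \<comment> \<open>The part of the bracket that is lighter than \<open>c\<close>; it is covered
      by the induction hypothesis through \<open>low\<close>.\<close>
    define L where "L = (\<lambda>q. ?Y q + - (r *\<^sub>R E c q))"
    have sL: "smooth_on B L" unfolding L_def
      by (intro smooth_intros openB sY smE less.prems)
    have "eps c' q \<bullet> L q = 0" if "c' \<in> I" "wt e < wt c'" "q \<in> B" for c' q
      using lead[OF that] dual[OF that(3,1) less.prems(2)] by (simp add: L_def inner_diff_right)
    hence L: "lo (wt e) L" using sL by (simp add: lo_def)
    have 1: "lo (wt c) (lie_bracket (lie_bracket V (E e)) (E D))"
      using lo_bracket_horiz[OF less.hyps[OF _ V e(1)] D] e by simp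
    have 2: "lo (wt c) (lie_bracket (E e) (lie_bracket V (E D)))"
    proof (rule lo_bracket[OF syms_lo1[OF V D] smE[OF e(1)]])
      fix c' assume c': "c' \<in> I" "wt c' \<le> 1"
      hence "c' \<in> {FT, FW 0}" by (cases c') auto
      from lo_bracket_horiz[OF lo_E[OF e(1) order_refl] this] show "lo (wt c) (lie_bracket (E e) (E c'))" using e by simp
    qed (use e in simp)
    have 3: "lo (wt c) (lie_bracket V L)" using lo_mono[OF low[OF L]] e by simp
    have Ec: "E c q = (1 / r) *\<^sub>R (?Y q + - L q)" for q using r by (simp add: L_def)
    have "lie_bracket V (E c) q = (1 / r) *\<^sub>R ((lie_bracket (lie_bracket V (E e)) (E D) q
        + lie_bracket (E e) (lie_bracket V (E D)) q) + - lie_bracket V L q)" if q: "q \<in> B" for q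
    proof -
      have "lie_bracket V (E c) q = lie_bracket V (\<lambda>q. (1 / r) *\<^sub>R (?Y q + - L q)) q"
        by (rule lie_bracket_cong[OF openB q]) (auto simp: Ec)
      also have "\<dots> = (1 / r) *\<^sub>R lie_bracket V (\<lambda>q. ?Y q + - L q) q"
        using lie_bracket_scaleR_right[OF openB q smooth_on_const[of B "1 / r"] _ sV, of "\<lambda>q. ?Y q + - L q"] sY sL
        by (simp add: smooth_on_diff openB)
      also have "lie_bracket V (\<lambda>q. ?Y q + - L q) q = lie_bracket V ?Y q + - lie_bracket V L q"
        using lie_bracket_add_right[OF openB q sY smooth_on_minus[OF openB sL] sV] lie_bracket_uminus_right[OF sV sL q] by simp
      also have "lie_bracket V ?Y q = lie_bracket (lie_bracket V (E e)) (E D) q + lie_bracket (E e) (lie_bracket V (E D)) q"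
        by (rule lie_bracket_jacobi[OF openB q sV smE[OF e(1)] horiz_smooth[OF D]])
      finally show ?thesis .
    qed
    moreover have "lo (wt c) (\<lambda>q. (1 / r) *\<^sub>R ((lie_bracket (lie_bracket V (E e)) (E D) q
        + lie_bracket (E e) (lie_bracket V (E D)) q) + - lie_bracket V L q))"
      by (intro lo_scaleR smooth_on_const lo_add lo_minus 1 2 3)
    ultimately show ?thesis using lo_cong by (metis (no_types, lifting))
  qed
  show ?case
  proof (cases c)
    case FT
    thus ?thesis using syms_lo1[OF V] by simp
  next
    case (FW j)
    show ?thesis
    proof (cases j)
      case 0
      thus ?thesis using syms_lo1[OF V] FW by simp
    next
      case (Suc i)
      thus ?thesis using step[of "FW i" FT 1] W_T[of i] FW less.prems by simp
    qed
  next
    case (FY i)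
    thus ?thesis using step[of "FW i" "FW 0" "- 1"] W_Z[of i] less.prems mn by simp
  qed
qed

section \<open>The Lie algebra of symmetries and its finite dimension\<close>

definition br :: "('a \<Rightarrow> 'a) \<Rightarrow> ('a \<Rightarrow> 'a) \<Rightarrow> 'a \<Rightarrow> 'a"
  where "br V V' = (\<lambda>q. if q \<in> B then lie_bracket V V' q else 0)"

lemma br_eq: "q \<in> B \<Longrightarrow> br V V' q = lie_bracket V V' q" by (simp add: br_def)

lemma smooth_br: "smooth_on B V \<Longrightarrow> smooth_on B V' \<Longrightarrow> smooth_on B (br V V')"
  by (rule smooth_on_cong[OF openB, of "lie_bracket V V'"]) (auto simp: br_def intro!: smooth_on_lie_bracket openB)

lemma br_syms:
  assumes V: "V \<in> syms" "V' \<in> syms" shows "br V V' \<in> syms"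
proof -
  note s = syms_smooth[OF V(1)] syms_smooth[OF V(2)]
  have lo1: "lo 1 (lie_bracket A X)" if "A \<in> syms" "lo 1 X" for A X
    using syms_lo_E[OF that(1)] by (intro lo_bracket[OF that(2) syms_smooth[OF that(1)] order_refl]) (auto intro: lo_mono)
  have *: "lo 1 (lie_bracket (br V V') (E D))" if D: "D \<in> {FT, FW 0}" for D
  proof -
    have "lo 1 (\<lambda>q. lie_bracket V (lie_bracket V' (E D)) q + - lie_bracket V' (lie_bracket V (E D)) q)"
      by (intro lo_add lo_minus lo1 V syms_lo1 D)
    thus ?thesis
    proof (rule lo_cong)
      fix q assume q: "q \<in> B"
      have "lie_bracket (br V V') (E D) q = lie_bracket (lie_bracket V V') (E D) q"
        by (rule lie_bracket_cong[OF openB q]) (auto simp: br_def)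
      thus "lie_bracket V (lie_bracket V' (E D)) q + - lie_bracket V' (lie_bracket V (E D)) q = lie_bracket (br V V') (E D) q"
        using lie_bracket_jacobi[OF openB q s horiz_smooth[OF D]] by simp
    qed
  qed
  show ?thesis using *[of FT] *[of "FW 0"] smooth_br[OF s] by (auto simp: syms_def lo_def br_def)
qed

lemma br_anti: "br U V = - br V U"
  by (auto simp: br_def fun_eq_iff uminus_apply lie_bracket_anti[of U V])

lemma br_add: "U \<in> syms \<Longrightarrow> V \<in> syms \<Longrightarrow> A \<in> syms \<Longrightarrow> br (U + V) A = br U A + br V A"
  using lie_bracket_add_left[OF openB _ syms_smooth syms_smooth syms_smooth, of _ U V A]
  by (auto simp: br_def fun_eq_iff plus_fun_apply) (simp add: plus_fun_def)

lemma br_scaleR: "U \<in> syms \<Longrightarrow> A \<in> syms \<Longrightarrow> br (r *\<^sub>R U) A = r *\<^sub>R br U A"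
  using lie_bracket_scaleR_left[OF openB _ smooth_on_const[of B r] syms_smooth syms_smooth, of _ U A]
  by (auto simp: br_def fun_eq_iff scaleR_fun_apply) (simp add: scaleR_fun_def)

lemma syms_closed: "0 \<in> syms" "U \<in> syms \<Longrightarrow> V \<in> syms \<Longrightarrow> U + V \<in> syms" "U \<in> syms \<Longrightarrow> V \<in> syms \<Longrightarrow> U - V \<in> syms"
  "U \<in> syms \<Longrightarrow> r *\<^sub>R U \<in> syms" "U \<in> syms \<Longrightarrow> - U \<in> syms"
  using subspace_0[OF syms_subspace] subspace_add[OF syms_subspace] subspace_diff[OF syms_subspace]
    subspace_scale[OF syms_subspace] subspace_neg[OF syms_subspace] by auto

lemma br_minus: "U \<in> syms \<Longrightarrow> A \<in> syms \<Longrightarrow> br (- U) A = - br U A"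
  using br_scaleR[of U A "- 1"] by simp
lemma br_diff: "U \<in> syms \<Longrightarrow> V \<in> syms \<Longrightarrow> A \<in> syms \<Longrightarrow> br (U - V) A = br U A - br V A"
  using br_add[of U "- V" A] br_minus[of V A] syms_closed by simp
lemma br_add_r: "U \<in> syms \<Longrightarrow> V \<in> syms \<Longrightarrow> A \<in> syms \<Longrightarrow> br A (U + V) = br A U + br A V"
  using br_add[of U V A] by (simp add: br_anti[of A])
lemma br_scaleR_r: "U \<in> syms \<Longrightarrow> A \<in> syms \<Longrightarrow> br A (r *\<^sub>R U) = r *\<^sub>R br A U"
  using br_scaleR[of U A r] by (simp add: br_anti[of A])
lemma br_diff_r: "U \<in> syms \<Longrightarrow> V \<in> syms \<Longrightarrow> A \<in> syms \<Longrightarrow> br A (U - V) = br A U - br A V"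
  using br_diff[of U V A] by (simp add: br_anti[of A])
lemma br_0: "A \<in> syms \<Longrightarrow> br 0 A = 0" "A \<in> syms \<Longrightarrow> br A 0 = 0"
  using br_scaleR[of 0 A 0] br_scaleR_r[of 0 A 0] syms_closed by auto

lemma br_jacobi:
  assumes "X \<in> syms" "U \<in> syms" "V \<in> syms"
  shows "br X (br U V) = br (br X U) V + br U (br X V)"
proof
  fix q
  show "br X (br U V) q = (br (br X U) V + br U (br X V)) q"
  proof (cases "q \<in> B")
    case True
    have "lie_bracket X (br U V) q = lie_bracket X (lie_bracket U V) q"
      "lie_bracket (br X U) V q = lie_bracket (lie_bracket X U) V q"
      "lie_bracket U (br X V) q = lie_bracket U (lie_bracket X V) q"
      by (rule lie_bracket_cong[OF openB True]; simp add: br_def)+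
    thus ?thesis
      using lie_bracket_jacobi[OF openB True assms[THEN syms_smooth]] True by (simp add: br_eq plus_fun_apply)
  qed (simp add: br_def plus_fun_apply)
qed

text \<open>Functionals are differential expressions in the symmetry, hence local.\<close>

lemma Mf_local:
  assumes "Mf k \<Phi>" "V \<in> syms" "open O'" "O' \<subseteq> B" "\<And>q. q \<in> O' \<Longrightarrow> V q = 0" "q \<in> O'"
  shows "\<Phi> (V, q) = 0"
  using assms(1,6)
proof (induction arbitrary: q rule: Mf.induct)
  case (comp c k)
  thus ?case using assms by (simp add: comp_def)
next
  case (der k \<Phi> D)
  have "lie_deriv (E D) (\<lambda>q. \<Phi> (V, q)) q = lie_deriv (E D) (\<lambda>q. 0) q"
    by (rule lie_deriv_cong[OF assms(3) \<open>q \<in> O'\<close>]) (auto simp: der)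
  thus ?case using der.prems assms by (auto simp: opf_def)
next
  case (eqv k \<Phi> \<Psi>)
  have "q \<in> B" using eqv.prems assms(4) by blast
  hence "\<Psi> (V, q) = \<Phi> (V, q)" using eqv(2) assms(2) by simp
  thus ?case using eqv by simp
qed (use assms in \<open>auto simp: pw\<close>)

lemma syms_locally_determined:
  assumes "V \<in> syms" "open O'" "O' \<subseteq> B" "p \<in> O'" "\<And>q. q \<in> O' \<Longrightarrow> V q = 0"
  shows "V = 0"
proof (rule syms_determined[OF assms(1)])
  show "p \<in> B" using assms by blast
  show "gen_fun j (V, p) = 0" if "j \<in> gens" for j
    by (rule Mf_local[OF gen_Mf[OF that] assms(1-3,5,4)])
qed

lemma gen_linear_sum:
  assumes "finite A" "\<And>x. x \<in> A \<Longrightarrow> X x \<in> syms" "Mf k \<Phi>" "p \<in> B"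
  shows "(\<Sum>x\<in>A. c x *\<^sub>R X x) \<in> syms \<and> \<Phi> (\<Sum>x\<in>A. c x *\<^sub>R X x, p) = (\<Sum>x\<in>A. c x * \<Phi> (X x, p))"
  using assms(1,2)
proof (induction A rule: finite_induct)
  case empty
  have "\<Phi> (0, p) = 0" using Mf_local[OF assms(3) syms_closed(1) openB order_refl _ assms(4)] by (simp add: pw)
  thus ?case using syms_closed by simp
next
  case (insert x A)
  hence 1: "(\<Sum>x\<in>A. c x *\<^sub>R X x) \<in> syms" "\<Phi> (\<Sum>x\<in>A. c x *\<^sub>R X x, p) = (\<Sum>x\<in>A. c x * \<Phi> (X x, p))" by auto
  have "\<Phi> ((\<Sum>x\<in>A. c x *\<^sub>R X x) + c x *\<^sub>R X x, p) = \<Phi> (\<Sum>x\<in>A. c x *\<^sub>R X x, p) + c x * \<Phi> (X x, p)"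
    by (rule Gs_linear[OF assms(3,4) 1(1)]) (use insert in auto)
  thus ?case using insert 1 syms_closed by (auto simp: add.commute)
qed

text \<open>Given more symmetries than generators, some nontrivial combination has all generators
  zero at \<open>p\<close>; by \<open>syms_determined\<close> it vanishes identically.\<close>

lemma dependent_syms:
  assumes "finite A" "\<And>x. x \<in> A \<Longrightarrow> X x \<in> syms" "card gens < card A" "p \<in> B"
  shows "\<exists>c. (\<exists>x\<in>A. c x \<noteq> 0) \<and> (\<Sum>x\<in>A. c x *\<^sub>R X x) = 0"
proof -
  obtain c where c: "\<exists>x\<in>A. c x \<noteq> 0" "\<forall>j\<in>gens. (\<Sum>x\<in>A. c x * gen_fun j (X x, p)) = 0"
    using homogeneous_solution[OF finite_gens assms(1,3), of "\<lambda>x j. gen_fun j (X x, p)"] by blast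
  have "(\<Sum>x\<in>A. c x *\<^sub>R X x) = 0"
  proof (rule syms_determined[OF _ assms(4)])
    show "(\<Sum>x\<in>A. c x *\<^sub>R X x) \<in> syms" using gen_linear_sum[where c = c and X = X, OF assms(1,2) Mf.zero assms(4)] by blast
    show "gen_fun j (\<Sum>x\<in>A. c x *\<^sub>R X x, p) = 0" if "j \<in> gens" for j
      using gen_linear_sum[where c = c and X = X, OF assms(1,2) gen_Mf[OF that] assms(4)] c(2) that by simp
  qed
  thus ?thesis using c by blast
qed

lemma independent_syms:
  assumes "A \<subseteq> syms" "independent A" "p \<in> B" shows "finite A \<and> card A \<le> card gens"
proof -
  have fin: "card A' \<le> card gens" if "A' \<subseteq> A" "finite A'" for A'
  proof (rule ccontr)
    assume "\<not> card A' \<le> card gens"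
    hence "card gens < card A'" by simp
    moreover have "x \<in> syms" if "x \<in> A'" for x using that \<open>A' \<subseteq> A\<close> assms(1) by blast
    ultimately obtain c where "\<exists>x\<in>A'. c x \<noteq> 0" "(\<Sum>x\<in>A'. c x *\<^sub>R x) = 0"
      using dependent_syms[where X = "\<lambda>x. x", OF \<open>finite A'\<close> _ _ assms(3)] by blast
    moreover have "independent A'" using assms that independent_mono by blast
    ultimately show False using that dependent_finite by blast
  qed
  have "finite A"
  proof (rule ccontr)
    assume "infinite A"
    then obtain A' where "A' \<subseteq> A" "finite A'" "card A' = Suc (card gens)"
      using infinite_arbitrarily_large by blast
    thus False using fin[of A'] by simp
  qed
  thus ?thesis using fin by blast
qed

lemma subspace_finite_basis:
  assumes "S \<subseteq> syms" "subspace S" "p \<in> B"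
  shows "\<exists>A. finite A \<and> A \<subseteq> S \<and> independent A \<and> span A = S"
proof -
  obtain A where A: "A \<subseteq> S" "independent A" "S \<subseteq> span A" "card A = dim S" by (rule basis_exists[of S])
  have "span A \<subseteq> S" by (rule span_minimal[OF A(1) assms(2)])
  hence "span A = S" using A(3) by (rule subset_antisym)
  moreover have "finite A" using independent_syms[OF order_trans[OF A(1) assms(1)] A(2) assms(3)] by blast
  ultimately show ?thesis using A by (intro exI[of _ A]) simp
qed

text \<open>As \<open>f\<close> is linear on \<open>S\<close> only, the count is done on a basis of
  \<open>S\<close>: its image together with a missed vector \<open>y\<close> would be an independent
  family in \<open>S\<close> with more members than the basis.\<close>

lemma injective_onto:
  assumes S: "S \<subseteq> syms" "subspace S" "p \<in> B"
    and f: "\<And>x. x \<in> S \<Longrightarrow> f x \<in> S" "\<And>x y. x \<in> S \<Longrightarrow> y \<in> S \<Longrightarrow> f (x + y) = f x + f y"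
      "\<And>c x. x \<in> S \<Longrightarrow> f (c *\<^sub>R x) = c *\<^sub>R f x"
    and inj: "\<And>x. x \<in> S \<Longrightarrow> f x = 0 \<Longrightarrow> x = 0"
    and y: "y \<in> S"
  shows "\<exists>x\<in>S. f x = y"
proof (rule ccontr)
  assume no: "\<not> (\<exists>x\<in>S. f x = y)"
  obtain A where A: "finite A" "A \<subseteq> S" "independent A" "span A = S" using subspace_finite_basis[OF S] by blast
  have fsum: "(\<Sum>x\<in>A'. c x *\<^sub>R x) \<in> S \<and> f (\<Sum>x\<in>A'. c x *\<^sub>R x) = (\<Sum>x\<in>A'. c x *\<^sub>R f x)" if "finite A'" "A' \<subseteq> S" for A' c
    using that
  proof (induction A' rule: finite_induct)
    case empty
    thus ?case using f(3)[of 0 0] S(2) subspace_0 by auto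
  next
    case (insert x A')
    define s where "s = (\<Sum>x\<in>A'. c x *\<^sub>R x)"
    have 1: "s \<in> S" "f s = (\<Sum>x\<in>A'. c x *\<^sub>R f x)" "x \<in> S" using insert by (auto simp: s_def)
    have 2: "c x *\<^sub>R x \<in> S" using S(2) 1(3) by (rule subspace_scale)
    have "c x *\<^sub>R x + s \<in> S" using S(2) 2 1(1) by (rule subspace_add)
    moreover have "f (c x *\<^sub>R x + s) = c x *\<^sub>R f x + f s" using f(2)[OF 2 1(1)] f(3)[OF 1(3)] by simp
    ultimately show ?case using insert.hyps 1 by (simp add: s_def)
  qed
  have injA: "inj_on f A"
  proof (rule inj_onI)
    fix x x' assume x: "x \<in> A" "x' \<in> A" "f x = f x'"
    have xS: "x \<in> S" "x' \<in> S" "(- 1) *\<^sub>R x' \<in> S" using x A S(2) subspace_scale by blast+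
    have "f (x + (- 1) *\<^sub>R x') = 0" using f(2)[OF xS(1,3)] f(3)[OF xS(2), of "- 1"] x by simp
    thus "x = x'" using inj[of "x + (- 1) *\<^sub>R x'"] xS S(2) subspace_add by fastforce
  qed
  have ind: "independent (f ` A)"
  proof (rule ccontr)
    assume "\<not> independent (f ` A)"
    then obtain u where u: "\<exists>v\<in>f ` A. u v \<noteq> 0" "(\<Sum>v\<in>f ` A. u v *\<^sub>R v) = 0"
      using dependent_finite[of "f ` A"] A by auto
    have "f (\<Sum>x\<in>A. u (f x) *\<^sub>R x) = 0" using u(2) fsum[OF A(1,2), of "\<lambda>x. u (f x)"] by (simp add: sum.reindex[OF injA])
    hence "(\<Sum>x\<in>A. u (f x) *\<^sub>R x) = 0" using inj fsum[OF A(1,2), of "\<lambda>x. u (f x)"] by blast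
    hence "\<exists>x\<in>A. u (f x) \<noteq> 0 \<Longrightarrow> dependent A" using dependent_finite[OF A(1)] by (metis (no_types))
    thus False using u(1) A(3) by blast
  qed
  have "y \<notin> span (f ` A)"
  proof
    assume "y \<in> span (f ` A)"
    then obtain u where "y = (\<Sum>v\<in>f ` A. u v *\<^sub>R v)" using span_finite[of "f ` A"] A by auto
    hence "y = f (\<Sum>x\<in>A. u (f x) *\<^sub>R x)" using fsum[OF A(1,2), of "\<lambda>x. u (f x)"] by (simp add: sum.reindex[OF injA])
    thus False using no fsum[OF A(1,2), of "\<lambda>x. u (f x)"] by blast
  qed
  hence "independent (insert y (f ` A))" "y \<notin> f ` A" using ind span_base[of y "f ` A"] by (auto simp: independent_insert)
  moreover have "insert y (f ` A) \<subseteq> span A" using y A f(1) by auto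
  ultimately have "card (insert y (f ` A)) \<le> card A" using independent_span_bound[OF A(1)] by blast
  thus False using \<open>y \<notin> f ` A\<close> A(1) by (simp add: card_image[OF injA])
qed

end

section \<open>The filtration of the symmetry algebra at the base point\<close>

locale maximal_symmetry = adapted_frame +
  fixes p :: 'a
  assumes pB: "p \<in> B"
    and onto: "\<And>t. \<exists>V\<in>syms. \<forall>j\<in>gens. gen_fun j (V, p) = t j"
begin

text \<open>The negative half of the filtration, by the weight of the value at \<open>p\<close>;
  \<open>Sneg 0\<close> is the isotropy algebra.\<close>

definition Sneg :: "nat \<Rightarrow> ('a \<Rightarrow> 'a) set"
  where "Sneg w = {V\<in>syms. \<forall>c\<in>I. w < wt c \<longrightarrow> eps c p \<bullet> V p = 0}"

lemma Sneg_syms: "V \<in> Sneg w \<Longrightarrow> V \<in> syms" by (simp add: Sneg_def)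

lemma Sneg_comp: "V \<in> Sneg w \<Longrightarrow> c \<in> I \<Longrightarrow> w < wt c \<Longrightarrow> eps c p \<bullet> V p = 0" by (simp add: Sneg_def)

lemma Sneg_subspace: "subspace (Sneg w)"
  using syms_closed by (auto simp: subspace_def Sneg_def plus_fun_apply zero_fun_apply scaleR_fun_apply inner_add_right)

lemma Sneg_0: "V \<in> Sneg 0 \<longleftrightarrow> V \<in> syms \<and> V p = 0"
proof
  assume V: "V \<in> Sneg 0"
  have "eps c p \<bullet> V p = 0" if "c \<in> I" for c using Sneg_comp[OF V that] wt_pos[of c] by simp
  hence "(\<Sum>c\<in>I. (eps c p \<bullet> V p) *\<^sub>R E c p) = 0" by simp
  thus "V \<in> syms \<and> V p = 0" using rep[OF pB, of "V p"] Sneg_syms[OF V] by simp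
qed (simp add: Sneg_def)

text \<open>Below level \<open>- w\<close> a functional is a combination of components of weight
  above \<open>w\<close>, and these vanish at \<open>p\<close>.\<close>

lemma Mf_Sneg: "Mf k \<Phi> \<Longrightarrow> V \<in> Sneg w \<Longrightarrow> k < - int w \<Longrightarrow> \<Phi> (V, p) = 0"
proof (induction rule: Mf.induct)
  case (comp c k)
  thus ?case using Sneg_comp[of V w c] by (auto simp: comp_def)
next
  case (eqv k \<Phi> \<Psi>)
  thus ?case using eqv(2)[OF Sneg_syms[OF eqv.prems(1)] pB] by simp
qed (auto simp: pw)

lemma eqg_Sneg: "sym.eqg k \<Phi> \<Psi> \<Longrightarrow> V \<in> Sneg w \<Longrightarrow> k \<le> - int w \<Longrightarrow> \<Phi> (V, p) = \<Psi> (V, p)"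
  using Mf_Sneg[of "k - 1" "\<Phi> - \<Psi>" V w] by (simp add: sym.eqg_def minus_apply)

lemma lie_deriv_syms_at:
  assumes "V \<in> syms" "smooth_on B g"
  shows "lie_deriv V g p = (\<Sum>a\<in>I. (eps a p \<bullet> V p) * lie_deriv (E a) g p)"
proof -
  have "V p = (\<Sum>a\<in>I. (eps a p \<bullet> V p) *\<^sub>R E a p)" by (simp add: rep[OF pB])
  thus ?thesis
    using lie_deriv_left_at[OF assms(2) pB, where X = V and c = "\<lambda>a. eps a p \<bullet> V p" and Y = E and I = I] by simp
qed

text \<open>Since \<open>X\<close> vanishes at \<open>p\<close>, only the derivative of its
  components along \<open>V\<close> survives there.\<close>

lemma bracket_isotropy:
  assumes V: "V \<in> syms" and X: "X \<in> Sneg 0" and c: "c \<in> I"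
  shows "eps c p \<bullet> br V X p = (\<Sum>a\<in>I. (eps a p \<bullet> V p) * opf (E a) (comp c) (X, p))"
proof -
  have X0: "X p = 0" and Xs: "X \<in> syms" using X Sneg_0 by auto
  have "br V X p = lie_deriv V X p"
    using X0 linear_0[OF frechet_derivative_linear[OF smooth_on_differentiable[OF syms_smooth[OF V] pB]]]
    by (simp add: br_eq[OF pB] lie_bracket_def lie_deriv_def)
  hence "eps c p \<bullet> br V X p = lie_deriv V (\<lambda>q. eps c q \<bullet> X q) p"
    using lie_deriv_inner[OF smeps[OF c] syms_smooth[OF Xs] pB, of V] X0 by simp
  also have "\<dots> = (\<Sum>a\<in>I. (eps a p \<bullet> V p) * lie_deriv (E a) (\<lambda>q. eps c q \<bullet> X q) p)"
    by (rule lie_deriv_syms_at[OF V smooth_on_inner[OF openB smeps[OF c] syms_smooth[OF Xs]]])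
  finally show ?thesis using Xs pB by (simp add: opf_def comp_def)
qed

lemma br_Sneg_isotropy:
  assumes V: "V \<in> Sneg w" and X: "X \<in> Sneg 0"
  shows "br V X \<in> Sneg w"
proof -
  have "eps c p \<bullet> br V X p = 0" if c: "c \<in> I" "w < wt c" for c
  proof -
    have "(eps a p \<bullet> V p) * opf (E a) (comp c) (X, p) = 0" if a: "a \<in> I" for a
    proof (cases "w < wt a")
      case True
      thus ?thesis using Sneg_comp[OF V a] by simp
    next
      case False
      thus ?thesis
        using Mf_Sneg[OF Mf_op[OF a Mf.comp[OF c(1) order_refl]] X] c by simp
    qed
    thus ?thesis unfolding bracket_isotropy[OF Sneg_syms[OF V] X c(1)] by (intro sum.neutral ballI)
  qed
  thus ?thesis using br_syms[OF Sneg_syms[OF V] Sneg_syms[OF X]] by (simp add: Sneg_def)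
qed

text \<open>Expand \<open>V\<close> in the frame. Brackets of \<open>R\<close> with a leg
  \<open>E b\<close> stay in weight at most \<open>wt b\<close> by \<open>syms_lo_E\<close>, so in
  weights above \<open>w\<close> only the differentiated components of \<open>V\<close>
  contribute.\<close>

lemma bracket_leading:
  assumes R: "R \<in> syms" "R p = E D p" and D: "D \<in> {FT, FW 0}" and V: "V \<in> Sneg w" and c: "c \<in> I" "w < wt c"
  shows "eps c p \<bullet> br R V p = opf (E D) (comp c) (V, p)"
proof -
  note Vs = Sneg_syms[OF V]
  have sv: "smooth_on B (\<lambda>q. eps b q \<bullet> V q)" if "b \<in> I" for b
    by (rule smooth_on_inner[OF openB smeps[OF that] syms_smooth[OF Vs]])
  have "br R V p = lie_bracket R (\<lambda>q. \<Sum>b\<in>I. (eps b q \<bullet> V q) *\<^sub>R E b q) p"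
    unfolding br_eq[OF pB] by (rule lie_bracket_cong[OF openB pB]) (auto simp: rep)
  also have "\<dots> = (\<Sum>b\<in>I. (eps b p \<bullet> V p) *\<^sub>R lie_bracket R (E b) p + lie_deriv R (\<lambda>q. eps b q \<bullet> V q) p *\<^sub>R E b p)"
    by (rule lie_bracket_sum_scaleR_right[OF openB pB sv smE syms_smooth[OF R(1)]])
  finally have "eps c p \<bullet> br R V p = (\<Sum>b\<in>I. (eps b p \<bullet> V p) * (eps c p \<bullet> lie_bracket R (E b) p))
      + (\<Sum>b\<in>I. lie_deriv R (\<lambda>q. eps b q \<bullet> V q) p * (eps c p \<bullet> E b p))"
    by (simp add: inner_sum_right inner_add_right sum.distrib)
  also have "(\<Sum>b\<in>I. (eps b p \<bullet> V p) * (eps c p \<bullet> lie_bracket R (E b) p)) = 0"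
  proof (rule sum.neutral, rule ballI)
    fix b assume b: "b \<in> I"
    show "(eps b p \<bullet> V p) * (eps c p \<bullet> lie_bracket R (E b) p) = 0"
      using Sneg_comp[OF V b] syms_lo_E[OF R(1) b] c pB by (cases "w < wt b") (auto simp: lo_def)
  qed
  also have "(\<Sum>b\<in>I. lie_deriv R (\<lambda>q. eps b q \<bullet> V q) p * (eps c p \<bullet> E b p))
      = (\<Sum>b\<in>I. if c = b then lie_deriv R (\<lambda>q. eps b q \<bullet> V q) p else 0)"
    by (rule sum.cong) (auto simp: dual[OF pB c(1)])
  finally have "eps c p \<bullet> br R V p = lie_deriv R (\<lambda>q. eps c q \<bullet> V q) p" using c by simp
  thus ?thesis using R(2) Vs pB by (simp add: opf_def comp_def lie_deriv_def)
qed

lemma br_Sneg_horizontal: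
  assumes R: "R \<in> syms" "R p = E D p" and D: "D \<in> {FT, FW 0}" and V: "V \<in> Sneg w"
  shows "br R V \<in> Sneg (Suc w)"
proof -
  have DI: "D \<in> I" using D by auto
  have "eps c p \<bullet> br R V p = 0" if c: "c \<in> I" "Suc w < wt c" for c
    using bracket_leading[OF R D V c(1)] c Mf_Sneg[OF Mf_der_all[OF Mf.comp[OF c(1) order_refl] D] V] by simp
  thus ?thesis using br_syms[OF R(1) Sneg_syms[OF V]] by (simp add: Sneg_def)
qed

text \<open>The positive half of the filtration, as in the prolongation of graded algebras: the
  order is at least \<open>k + 1\<close> if bracketing with any symmetry in \<open>Sneg 1\<close>
  leaves order at least \<open>k\<close>.\<close>

primrec Spos :: "nat \<Rightarrow> ('a \<Rightarrow> 'a) set" where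
  "Spos 0 = Sneg 0"
| "Spos (Suc k) = {U\<in>Spos k. \<forall>V\<in>Sneg 1. br U V \<in> Spos k}"

lemma Spos_sub: "Spos k \<subseteq> Sneg 0" by (induction k) auto

lemma Spos_syms: "U \<in> Spos k \<Longrightarrow> U \<in> syms" using Spos_sub Sneg_syms by blast

lemma Spos_subspace: "subspace (Spos k)"
proof (induction k)
  case 0
  thus ?case using Sneg_subspace by simp
next
  case (Suc k)
  have 0: "0 \<in> Spos k" by (rule subspace_0[OF Suc])
  show ?case
    unfolding subspace_def
  proof (intro conjI ballI allI)
    show "0 \<in> Spos (Suc k)" using 0 br_0(1)[OF Sneg_syms] by simp
    show "x + y \<in> Spos (Suc k)" if "x \<in> Spos (Suc k)" "y \<in> Spos (Suc k)" for x y
      using that subspace_add[OF Suc] br_add[OF Spos_syms Spos_syms Sneg_syms, of x k y k] by simp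
    show "c *\<^sub>R x \<in> Spos (Suc k)" if "x \<in> Spos (Suc k)" for x c
      using that subspace_scale[OF Suc] br_scaleR[OF Spos_syms Sneg_syms, of x k] by simp
  qed
qed

lemma Spos_isotropy: "U \<in> Spos k \<Longrightarrow> X \<in> Sneg 0 \<Longrightarrow> br U X \<in> Spos k"
proof (induction k arbitrary: U)
  case 0
  thus ?case using br_Sneg_isotropy[of U 0 X] by simp
next
  case (Suc k)
  have U: "U \<in> Spos k" "U \<in> syms" and X: "X \<in> syms" using Suc.prems Spos_syms Sneg_syms by auto
  have "br (br U X) V \<in> Spos k" if V: "V \<in> Sneg 1" for V
  proof -
    have Vs: "V \<in> syms" by (rule Sneg_syms[OF V])
    have XV: "br X V \<in> Sneg 1"
      using br_Sneg_isotropy[OF V Suc.prems(2)] subspace_neg[OF Sneg_subspace] br_anti[of X V] by metis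
    have "br (br U X) V = br U (br X V) - br X (br U V)"
      using br_jacobi[OF U(2) X Vs] br_anti[of X "br U V"] by (simp add: algebra_simps)
    moreover have "br U (br X V) \<in> Spos k" using Suc.prems(1) XV by simp
    moreover have "br X (br U V) \<in> Spos k"
      using Suc.IH[of "br U V"] Suc.prems V subspace_neg[OF Spos_subspace] br_anti[of X "br U V"] by (metis (no_types, lifting) Spos.simps(2) mem_Collect_eq)
    ultimately show ?thesis using subspace_diff[OF Spos_subspace] by simp
  qed
  thus ?case using Suc.IH[OF U(1)] Suc.prems by simp
qed

text \<open>As the dimension is maximal, the generators take arbitrary values at the base point; these values
  make the symmetry \<open>XX\<close> the grading element.\<close>

definition XX :: "'a \<Rightarrow> 'a"
  where "XX = (SOME V. V \<in> syms \<and> (\<forall>j\<in>gens. gen_fun j (V, p) = (case j of GA \<Rightarrow> 1 | GD \<Rightarrow> 1 | _ \<Rightarrow> 0)))"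

lemma XX: "XX \<in> syms" "j \<in> gens \<Longrightarrow> gen_fun j (XX, p) = (case j of GA \<Rightarrow> 1 | GD \<Rightarrow> 1 | _ \<Rightarrow> 0)"
proof -
  have "\<exists>V. V \<in> syms \<and> (\<forall>j\<in>gens. gen_fun j (V, p) = (case j of GA \<Rightarrow> 1 | GD \<Rightarrow> 1 | _ \<Rightarrow> 0))"
    using onto[of "\<lambda>j. case j of GA \<Rightarrow> 1 | GD \<Rightarrow> 1 | _ \<Rightarrow> 0"] by blast
  from someI_ex[OF this, folded XX_def] show "XX \<in> syms" "j \<in> gens \<Longrightarrow> gen_fun j (XX, p) = (case j of GA \<Rightarrow> 1 | GD \<Rightarrow> 1 | _ \<Rightarrow> 0)"
    by blast+
qed

lemma XX_isotropy: "XX \<in> Sneg 0"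
  using XX(1) XX(2)[of "GC _"] by (auto simp: Sneg_def comp_def)

lemma XX_eqg: "sym.eqg 0 \<Phi> \<Psi> \<Longrightarrow> \<Phi> (XX, p) = \<Psi> (XX, p)"
  using eqg_Sneg[OF _ XX_isotropy] by simp

lemma XX_abd: "sym.a (XX, p) = 1" "sym.d (XX, p) = 1" "sym.b (XX, p) = 0"
proof -
  show "sym.a (XX, p) = 1" "sym.d (XX, p) = 1" using XX(2)[of GA] XX(2)[of GD] by simp_all
  show "sym.b (XX, p) = 0"
  proof (cases "m < n")
    case True
    thus ?thesis using XX(2)[of "GB 0"] by (simp add: sym.b_def)
  next
    case False
    hence e: "Suc n - m = 1" "int n - int m - 1 = - 1" using mn by auto
    have "Mf (- 1) sym.b" using sym.T_pow_top unfolding e by (simp add: sym.b_def)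
    thus ?thesis using Mf_Sneg[OF _ XX_isotropy] by simp
  qed
qed

text \<open>The symbols \<open>a\<close>, \<open>d + i a\<close> and \<open>2 d + i a\<close>
  describe the action on \<open>T\<close>, \<open>W i\<close> and \<open>Y i\<close>. With
  \<open>a = d = 1\<close> they are 1, i + 1 and i + 2, the weights of these legs; the mixed entries
  of equal weight are multiples of \<open>b\<close> or \<open>Z \<tau>\<close> and vanish.\<close>

lemma XX_weights:
  assumes a: "a \<in> I" and c: "c \<in> I" and w: "wt a = wt c"
  shows "opf (E a) (comp c) (XX, p) = (if a = c then real (wt c) else 0)"
proof -
  have Wop: "i \<le> n \<Longrightarrow> Wop i = opf (E (FW i))" for i by (simp add: Wop_def)
  have Yop: "1 \<le> i \<Longrightarrow> i \<le> m \<Longrightarrow> Yop i = opf (E (FY i))" for i by (simp add: Yop_def)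
  have ups: "1 \<le> i \<Longrightarrow> ups i = comp (FY i)" for i by (simp add: ups_def)
  show ?thesis
  proof (cases c)
    case FT
    then consider "a = FT" | "a = FW 0" using w by (cases a) auto
    thus ?thesis
    proof cases
      case 1
      thus ?thesis using XX_abd(1) FT by (simp add: sym.a_def)
    next
      case 2
      thus ?thesis using XX_eqg[OF sym.Z\<tau>] FT by (simp add: Wop zero_fun_apply)
    qed
  next
    case (FW i)
    show ?thesis
    proof (cases a)
      case FT
      thus ?thesis using XX_abd(3) FW w by (auto simp: sym.b_def)
    next
      case (FW i')
      hence "i' = i" using \<open>c = FW i\<close> w by simp
      thus ?thesis using XX_eqg[OF sym.W_\<omega>_0[of i]] XX_abd FW \<open>c = FW i\<close> c
        by (simp add: Wop plus_fun_apply scaleR_fun_apply)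
    next
      case (FY i')
      hence i: "i = Suc i'" "1 \<le> i'" "i' \<le> m" using \<open>c = FW i\<close> w a by auto
      have "sym.eqg 0 (Yop i' (comp (FW (Suc i')))) (- Wop 0 (comp FT))" using sym.Y_\<omega>_1[of i'] i c \<open>c = FW i\<close> by simp
      from XX_eqg[OF this] XX_eqg[OF sym.Z\<tau>] show ?thesis using i FY \<open>c = FW i\<close> by (simp add: Yop uminus_apply zero_fun_apply Wop)
    qed
  next
    case (FY i)
    hence i: "1 \<le> i" "i \<le> m" using c by auto
    show ?thesis
    proof (cases a)
      case FT
      thus ?thesis using FY w by simp
    next
      case (FW i')
      hence i': "i' = Suc i" "Suc i \<le> n" using FY w a by auto
      have "Wop (Suc i) (ups i) (XX, p) = 0"
        using XX_eqg[OF sym.W_ups_up[of i 0, simplified]] i XX_abd(3) by (simp add: sym.b_def scaleR_fun_apply uminus_apply)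
      thus ?thesis using i i' FW FY by (simp add: Wop ups)
    next
      case (FY i')
      hence "i' = i" using \<open>c = FY i\<close> w by simp
      thus ?thesis using XX_eqg[OF sym.Y_ups_0[of i]] XX_abd FY \<open>c = FY i\<close> i
        by (simp add: Yop ups plus_fun_apply scaleR_fun_apply)
    qed
  qed
qed

definition LX :: "('a \<Rightarrow> 'a) \<Rightarrow> ('a \<Rightarrow> 'a)" where "LX V = br XX V"

lemma LX_syms: "V \<in> syms \<Longrightarrow> LX V \<in> syms" unfolding LX_def by (rule br_syms[OF XX(1)])

text \<open>The components of weight \<open>w\<close> are read off from \<open>XX_weights\<close>;
  lighter legs do not interfere, as their contributions are functionals of negative degree on an
  isotropic symmetry.\<close>

lemma LX_Sneg:
  assumes V: "V \<in> Sneg w" and w: "1 \<le> w" shows "LX V + real w *\<^sub>R V \<in> Sneg (w - 1)"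
proof -
  have Vs: "V \<in> syms" by (rule Sneg_syms[OF V])
  have "eps c p \<bullet> (LX V + real w *\<^sub>R V) p = 0" if c: "c \<in> I" "w - 1 < wt c" for c
  proof -
    have "eps c p \<bullet> br V XX p = (\<Sum>a\<in>I. (eps a p \<bullet> V p) * opf (E a) (comp c) (XX, p))"
      by (rule bracket_isotropy[OF Vs XX_isotropy c(1)])
    also have "\<dots> = (\<Sum>a\<in>I. if a = c then (eps a p \<bullet> V p) * real w else 0)"
    proof (rule sum.cong[OF refl])
      fix a assume a: "a \<in> I"
      consider "w < wt a" | "wt a \<le> w" "wt a < wt c" | "wt a = wt c" "wt c = w" using c(2) by linarith
      thus "(eps a p \<bullet> V p) * opf (E a) (comp c) (XX, p) = (if a = c then (eps a p \<bullet> V p) * real w else 0)"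
      proof cases
        case 1
        thus ?thesis using Sneg_comp[OF V a] by auto
      next
        case 2
        thus ?thesis using Mf_Sneg[OF Mf_op[OF a Mf.comp[OF c(1) order_refl]] XX_isotropy] by auto
      next
        case 3
        thus ?thesis using XX_weights[OF a c(1)] by auto
      qed
    qed
    finally have "eps c p \<bullet> br V XX p = (eps c p \<bullet> V p) * real w" using c by simp
    thus ?thesis
      by (simp add: LX_def br_anti[of XX V] plus_fun_apply uminus_apply minus_apply scaleR_fun_apply inner_diff_right)
  qed
  thus ?thesis using LX_syms[OF Vs] syms_closed Vs by (simp add: Sneg_def)
qed

lemma LX_add: "U \<in> syms \<Longrightarrow> V \<in> syms \<Longrightarrow> LX (U + V) = LX U + LX V"
  unfolding LX_def using br_add_r XX(1) by blast

lemma LX_scaleR: "U \<in> syms \<Longrightarrow> LX (r *\<^sub>R U) = r *\<^sub>R LX U"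
  unfolding LX_def using br_scaleR_r XX(1) by blast

text \<open>Induction with the Jacobi identity: a test symmetry in \<open>Sneg 1\<close> is acted on
  by -1 modulo isotropy, so bracketing with it shifts the eigenvalue by one.\<close>

lemma LX_Spos: "U \<in> Spos k \<Longrightarrow> LX U - real k *\<^sub>R U \<in> Spos (Suc k)"
proof (induction k arbitrary: U)
  case 0
  have U: "U \<in> Sneg 0" "U \<in> syms" using 0 Sneg_syms by auto
  have LU: "LX U \<in> Sneg 0"
    unfolding LX_def using br_Sneg_isotropy[OF XX_isotropy U(1)] .
  have "br (LX U) V \<in> Sneg 0" if V: "V \<in> Sneg 1" for V
  proof -
    have Vs: "V \<in> syms" by (rule Sneg_syms[OF V])
    have UV: "br U V \<in> Sneg 1"
      using br_Sneg_isotropy[OF V U(1)] subspace_neg[OF Sneg_subspace] br_anti[of U V] by metis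
    have 1: "LX (br U V) + br U V \<in> Sneg 0" using LX_Sneg[OF UV] by simp
    have 2: "LX V + V \<in> Sneg 0" using LX_Sneg[OF V] by simp
    have "br U (LX V + V) \<in> Sneg 0" by (rule br_Sneg_isotropy[OF U(1) 2])
    moreover have "br (LX U) V = (LX (br U V) + br U V) - br U (LX V + V)"
      using br_jacobi[OF XX(1) U(2) Vs] br_add_r[OF LX_syms[OF Vs] Vs U(2)] by (simp add: LX_def algebra_simps)
    ultimately show ?thesis using 1 subspace_diff[OF Sneg_subspace] by metis
  qed
  thus ?case using LU by simp
next
  case (Suc k)
  have U: "U \<in> Spos k" "U \<in> Spos (Suc k)" "U \<in> syms" using Suc.prems Spos_syms by auto
  have LU: "LX U \<in> Spos (Suc k)"
    using Spos_isotropy[OF U(2) XX_isotropy] subspace_neg[OF Spos_subspace] br_anti[of XX U] unfolding LX_def by metis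
  have "br (LX U - real (Suc k) *\<^sub>R U) V \<in> Spos (Suc k)" if V: "V \<in> Sneg 1" for V
  proof -
    have Vs: "V \<in> syms" by (rule Sneg_syms[OF V])
    have UV: "br U V \<in> Spos k" using U(2) V by simp
    have 1: "LX (br U V) - real k *\<^sub>R br U V \<in> Spos (Suc k)" by (rule Suc.IH[OF UV])
    have 2: "LX V + V \<in> Sneg 0" using LX_Sneg[OF V] by simp
    have 3: "br U (LX V + V) \<in> Spos (Suc k)" by (rule Spos_isotropy[OF U(2) 2])
    define r where "r = real (Suc k)"
    have r: "real k = r - 1" by (simp add: r_def)
    have "br (LX U - r *\<^sub>R U) V = (LX (br U V) - real k *\<^sub>R br U V) - br U (LX V + V)"
      using br_jacobi[OF XX(1) U(3) Vs] br_add_r[OF LX_syms[OF Vs] Vs U(3)]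
        br_diff[OF LX_syms[OF U(3)] syms_closed(4)[OF U(3)] Vs] br_scaleR[OF U(3) Vs]
      unfolding r by (simp add: LX_def algebra_simps)
    thus ?thesis unfolding r_def using 1 3 subspace_diff[OF Spos_subspace] by metis
  qed
  thus ?case
    using LU U(2) subspace_diff[OF Spos_subspace] subspace_scale[OF Spos_subspace] by (subst Spos.simps(2)) blast
qed

section \<open>Frames generated by two symmetries with horizontal values\<close>

primrec rW :: "('a \<Rightarrow> 'a) \<Rightarrow> ('a \<Rightarrow> 'a) \<Rightarrow> nat \<Rightarrow> ('a \<Rightarrow> 'a)" where
  "rW RT RZ 0 = RZ" | "rW RT RZ (Suc i) = br (rW RT RZ i) RT"

primrec rY :: "('a \<Rightarrow> 'a) \<Rightarrow> ('a \<Rightarrow> 'a) \<Rightarrow> nat \<Rightarrow> ('a \<Rightarrow> 'a)" where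
  "rY RT RZ 0 = 0" | "rY RT RZ (Suc i) = (if i = 0 then br RZ (rW RT RZ 1) else br (rY RT RZ i) RT)"

primrec rF :: "('a \<Rightarrow> 'a) \<Rightarrow> ('a \<Rightarrow> 'a) \<Rightarrow> leg \<Rightarrow> ('a \<Rightarrow> 'a)" where
  "rF RT RZ FT = RT" | "rF RT RZ (FW i) = rW RT RZ i" | "rF RT RZ (FY i) = rY RT RZ i"

context
  fixes RT RZ :: "'a \<Rightarrow> 'a"
  assumes RT: "RT \<in> syms" "RT p = E FT p" and RZ: "RZ \<in> syms" "RZ p = E (FW 0) p"
begin

abbreviation "w \<equiv> rW RT RZ"
abbreviation "y \<equiv> rY RT RZ"

lemma w_syms: "w i \<in> syms" by (induction i) (auto simp: RT RZ br_syms)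

lemma y_syms: "y i \<in> syms"
proof (induction i)
  case (Suc i)
  thus ?case using br_syms[OF RZ(1) w_syms[of 1]] br_syms[OF Suc RT(1)] by simp
qed (simp add: syms_closed)

lemma RT_leading:
  assumes V: "V \<in> Sneg v" and v: "1 \<le> v" and c: "c \<in> I" "wt c = Suc v"
  shows "eps c p \<bullet> br V RT p = - (case c of FT \<Rightarrow> 0 | FW j \<Rightarrow> comp (FW (j - 1)) (V, p) | FY j \<Rightarrow> ups (j - 1) (V, p))"
proof -
  have 1: "eps c p \<bullet> br V RT p = - opf (E FT) (comp c) (V, p)"
    using bracket_leading[OF RT _ V c(1)] c(2) by (simp add: br_anti[of V RT] uminus_apply)
  show ?thesis
  proof (cases c)
    case (FW j)
    then obtain i where i: "j = Suc i" "i < n" "v = Suc i" using c v by (cases j) auto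
    hence "opf (E FT) (comp (FW (Suc i))) (V, p) = comp (FW i) (V, p)" by (intro eqg_Sneg[OF sym.T\<omega>' V]) auto
    thus ?thesis using 1 FW i(1) by simp
  next
    case (FY j)
    then obtain i where i: "j = Suc i" "i < m" "v = i + 2" using c by (cases j) auto
    thus ?thesis using 1 FY eqg_Sneg[OF sym.Tups'[of i], of V] V by (simp add: ups_def)
  qed (use c v in simp)
qed

lemma RZ_leading:
  assumes V: "V \<in> Sneg v" and v: "2 \<le> v" and c: "c \<in> I" "wt c = Suc v"
  shows "eps c p \<bullet> br RZ V p = (case c of FY j \<Rightarrow> - (eps (FW j) p \<bullet> V p) | _ \<Rightarrow> 0)"
proof -
  have 1: "eps c p \<bullet> br RZ V p = Wop 0 (comp c) (V, p)" using bracket_leading[OF RZ _ V c(1)] c(2) by (simp add: Wop_def)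
  show ?thesis
  proof (cases c)
    case (FW j)
    hence "j = v" "v \<le> n" using c by auto
    thus ?thesis using 1 FW v eqg_Sneg[OF sym.Z\<omega>'[of v] V] by (simp add: zero_fun_apply)
  next
    case (FY j)
    hence j: "1 \<le> j" "j \<le> m" "Suc j = v" using c by auto
    have "Wop 0 (ups j) (V, p) = (- comp (FW j)) (V, p)" by (rule eqg_Sneg[OF sym.Zups'[of j] V]) (use j in auto)
    thus ?thesis using 1 FY j Sneg_syms[OF V] pB by (simp add: ups_def uminus_apply comp_def)
  qed (use c v in simp)
qed

lemma RT_Sneg: "V \<in> Sneg v \<Longrightarrow> br V RT \<in> Sneg (Suc v)"
  using br_Sneg_horizontal[OF RT, of V v] subspace_neg[OF Sneg_subspace, of "br RT V" "Suc v"] br_anti[of V RT] by simp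

text \<open>Symmetries with the values of frame fields at \<open>p\<close> have the opposite leading
  bracket there, as right-invariant and left-invariant fields do. Each step of the chain contributes
  one such sign.\<close>

lemma w_leading:
  "i \<le> Suc n \<Longrightarrow> w i \<in> Sneg (i + 1) \<and> (\<forall>c\<in>I. wt c = i + 1 \<longrightarrow> eps c p \<bullet> w i p = (if c = FW i then (- 1) ^ i else 0))"
proof (induction i)
  case 0
  have "FW 0 \<in> I" by simp
  thus ?case using RZ dual[OF pB] by (auto simp: Sneg_def)
next
  case (Suc i)
  hence V: "w i \<in> Sneg (i + 1)" and l: "\<And>c. c \<in> I \<Longrightarrow> wt c = i + 1 \<Longrightarrow> eps c p \<bullet> w i p = (if c = FW i then (- 1) ^ i else 0)"
    by auto
  have "eps c p \<bullet> w (Suc i) p = (if c = FW (Suc i) then (- 1) ^ Suc i else 0)" if c: "c \<in> I" "wt c = Suc i + 1" for c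
    using RT_leading[OF V _ c(1)] c l[of "FW i"] l[of "FY (i - 1)"] Suc.prems by (cases c) (auto simp: comp_def ups_def zero_fun_apply)
  thus ?case using RT_Sneg[OF V] by simp
qed

lemma y_leading:
  "1 \<le> i \<Longrightarrow> i \<le> Suc m \<Longrightarrow> y i \<in> Sneg (i + 2) \<and> (\<forall>c\<in>I. wt c = i + 2 \<longrightarrow> eps c p \<bullet> y i p = (if c = FY i then (- 1) ^ (i + 1) else 0))"
proof (induction i rule: nat_induct_at_least)
  case base
  have V: "w 1 \<in> Sneg 2" "eps (FW 1) p \<bullet> w 1 p = - 1" using w_leading[of 1] mn by (auto simp: numeral_2_eq_2)
  have "eps c p \<bullet> y 1 p = (if c = FY 1 then (- 1) ^ (1 + 1) else 0)" if c: "c \<in> I" "wt c = 1 + 2" for c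
    using RZ_leading[OF V(1) _ c(1)] c V(2) by (cases c) (auto simp: numeral_2_eq_2)
  thus ?case using br_Sneg_horizontal[OF RZ _ V(1)] by (simp add: numeral_3_eq_3)
next
  case (Suc i)
  hence V: "y i \<in> Sneg (i + 2)" and l: "\<And>c. c \<in> I \<Longrightarrow> wt c = i + 2 \<Longrightarrow> eps c p \<bullet> y i p = (if c = FY i then (- 1) ^ (i + 1) else 0)"
    by auto
  have yS: "y (Suc i) = br (y i) RT" using Suc.hyps by simp
  have "eps c p \<bullet> y (Suc i) p = (if c = FY (Suc i) then (- 1) ^ (Suc i + 1) else 0)" if c: "c \<in> I" "wt c = Suc i + 2" for c
    unfolding yS using RT_leading[OF V _ c(1)] c l[of "FW (Suc i)"] l[of "FY i"] Suc.hyps by (cases c) (auto simp: comp_def ups_def)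
  thus ?case using RT_Sneg[OF V] Suc.hyps by (simp add: yS)
qed

text \<open>With respect to the weight the values at \<open>p\<close> are triangular with nonzero
  diagonal entries.\<close>

lemma frame_at_p: "span ((\<lambda>c. rF RT RZ c p) ` I) = UNIV"
proof -
  let ?S = "span ((\<lambda>c. rF RT RZ c p) ` I)"
  have lead: "rF RT RZ c \<in> Sneg (wt c) \<and> (\<exists>s. s \<noteq> 0 \<and> (\<forall>c'\<in>I. wt c' = wt c \<longrightarrow> eps c' p \<bullet> rF RT RZ c p = (if c' = c then s else 0)))"
    if c: "c \<in> I" for c
  proof (cases c)
    case FT
    have "eps c' p \<bullet> RT p = (if c' = FT then 1 else 0)" if "c' \<in> I" for c'
      using dual[OF pB that, of FT] RT(2) by simp
    thus ?thesis using FT RT(1) by (auto simp: Sneg_def intro!: exI[of _ 1])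
  next
    case (FW i)
    hence "i \<le> Suc n" "((- 1) ^ i :: real) \<noteq> 0" using c by auto
    thus ?thesis using w_leading[of i] FW by (metis add.commute plus_1_eq_Suc rF.simps(2) wt.simps(2))
  next
    case (FY i)
    hence "1 \<le> i" "i \<le> Suc m" "((- 1) ^ (i + 1) :: real) \<noteq> 0" using c by auto
    thus ?thesis using y_leading[of i] FY by (metis rF.simps(3) wt.simps(3))
  qed
  have Ec: "c \<in> I \<Longrightarrow> E c p \<in> ?S" for c
  proof (induction "wt c" arbitrary: c rule: less_induct)
    case less
    let ?R = "rF RT RZ c"
    obtain s where R: "?R \<in> Sneg (wt c)" "s \<noteq> 0" "\<And>c'. c' \<in> I \<Longrightarrow> wt c' = wt c \<Longrightarrow> eps c' p \<bullet> ?R p = (if c' = c then s else 0)"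
      using lead[OF less.prems] by blast
    have "?R p = (\<Sum>c'\<in>I. (eps c' p \<bullet> ?R p) *\<^sub>R E c' p)" by (simp add: rep[OF pB])
    also have "\<dots> = (\<Sum>c'\<in>I. (if c' = c then s *\<^sub>R E c' p else 0) + (if wt c' < wt c then (eps c' p \<bullet> ?R p) *\<^sub>R E c' p else 0))"
    proof (rule sum.cong[OF refl])
      fix c' assume "c' \<in> I"
      thus "(eps c' p \<bullet> ?R p) *\<^sub>R E c' p = (if c' = c then s *\<^sub>R E c' p else 0) + (if wt c' < wt c then (eps c' p \<bullet> ?R p) *\<^sub>R E c' p else 0)"
        using R(3)[of c'] Sneg_comp[OF R(1), of c'] by (cases "wt c'" "wt c" rule: linorder_cases) auto
    qed
    also have "\<dots> = s *\<^sub>R E c p + (\<Sum>c'\<in>I. if wt c' < wt c then (eps c' p \<bullet> ?R p) *\<^sub>R E c' p else 0)"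
      using less.prems by (simp add: sum.distrib)
    finally have eq: "?R p = s *\<^sub>R E c p + (\<Sum>c'\<in>I. if wt c' < wt c then (eps c' p \<bullet> ?R p) *\<^sub>R E c' p else 0)"
      (is "_ = _ + ?L") .
    have "E c p = (1 / s) *\<^sub>R (v - L)" if "v = s *\<^sub>R E c p + L" for v L using that R(2) by simp
    from this[OF eq] have "E c p = (1 / s) *\<^sub>R (?R p - ?L)" .
    moreover have "?R p \<in> ?S" using less.prems by (auto intro: span_base)
    moreover have "?L \<in> ?S"
    proof (rule span_sum)
      fix c' assume "c' \<in> I"
      thus "(if wt c' < wt c then (eps c' p \<bullet> ?R p) *\<^sub>R E c' p else 0) \<in> ?S"
        using less.hyps[of c'] by (simp add: span_scale span_zero)
    qed
    ultimately show ?case by (simp add: span_diff span_scale)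
  qed
  have "(eps c p \<bullet> v) *\<^sub>R E c p \<in> ?S" if "c \<in> I" for c v by (rule span_scale[OF Ec[OF that]])
  hence "(\<Sum>c\<in>I. (eps c p \<bullet> v) *\<^sub>R E c p) \<in> ?S" for v by (rule span_sum)
  hence "v \<in> ?S" for v by (simp only: rep[OF pB])
  thus ?thesis by auto
qed

lemma rF_syms: "rF RT RZ c \<in> syms" by (cases c) (auto simp: RT w_syms y_syms)

text \<open>The Jacobi identity passes closure under brackets with \<open>RT\<close> and
  \<open>RZ\<close> on to all their iterated brackets.\<close>

lemma rF_closed:
  assumes J: "J \<subseteq> syms" "\<And>U. U \<in> J \<Longrightarrow> br U RT \<in> J" "\<And>U. U \<in> J \<Longrightarrow> br U RZ \<in> J" "subspace J"
  shows "U \<in> J \<Longrightarrow> br U (rF RT RZ c) \<in> J"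
proof -
  have step: "br U (br A A') \<in> J" if A: "A \<in> syms" "A' \<in> syms" "\<And>U. U \<in> J \<Longrightarrow> br U A \<in> J" "\<And>U. U \<in> J \<Longrightarrow> br U A' \<in> J" and U: "U \<in> J" for U A A'
  proof -
    have Us: "U \<in> syms" using U J(1) by blast
    have "br U (br A A') = br (br U A) A' + - br (br U A') A"
      using br_jacobi[OF Us A(1,2)] br_anti[of A "br U A'"] by simp
    thus ?thesis using A(3,4) U subspace_add[OF J(4)] subspace_neg[OF J(4)] by metis
  qed
  have w: "U \<in> J \<Longrightarrow> br U (w i) \<in> J" for U i
  proof (induction i arbitrary: U)
    case 0
    thus ?case using J(3) by simp
  next
    case (Suc i)
    show ?case using step[OF w_syms RT(1) Suc.IH J(2) Suc.prems] by simp
  qed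
  have y: "U \<in> J \<Longrightarrow> br U (y i) \<in> J" for U i
  proof (induction i arbitrary: U)
    case 0
    have "U \<in> syms" using 0 J(1) by blast
    thus ?case using br_0(2)[of U] subspace_0[OF J(4)] by simp
  next
    case (Suc i)
    show ?case
    proof (cases "i = 0")
      case True
      have "br U (br RZ (w 1)) \<in> J" by (rule step[OF RZ(1) w_syms[of 1] J(3) w[of _ 1] Suc.prems])
      thus ?thesis using True by simp
    next
      case False
      have "br U (br (y i) RT) \<in> J" by (rule step[OF y_syms[of i] RT(1) Suc.IH J(2) Suc.prems])
      thus ?thesis using False by simp
    qed
  qed
  show "U \<in> J \<Longrightarrow> br U (rF RT RZ c) \<in> J" by (cases c) (simp_all add: J(2) w y)
qed

end

end

lemma sum_fun_apply: "(\<Sum>b\<in>A. f b) q = (\<Sum>b\<in>A. (f b :: _ \<Rightarrow> 'b::comm_monoid_add) q)"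
  by (induction A rule: infinite_finite_induct) (simp_all add: plus_fun_apply zero_fun_apply)

context maximal_symmetry
begin

text \<open>Both sides are the trace of the identity, computed in the frame at \<open>p\<close> and
  in the standard basis.\<close>

lemma dimension: "card I = DIM('a)"
proof -
  have "real (card I) = (\<Sum>c\<in>I. E c p \<bullet> eps c p)" using dual[OF pB] by (simp add: inner_commute)
  also have "\<dots> = (\<Sum>c\<in>I. \<Sum>b\<in>Basis. (eps c p \<bullet> b) * (E c p \<bullet> b))"
    by (subst euclidean_inner) (simp add: mult.commute)
  also have "\<dots> = (\<Sum>b\<in>Basis. (\<Sum>c\<in>I. (eps c p \<bullet> b) *\<^sub>R E c p) \<bullet> b)"
    by (subst sum.swap) (simp add: inner_sum_left)
  also have "\<dots> = real DIM('a)" by (simp add: rep[OF pB])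
  finally show ?thesis by simp
qed

lemma horizontal_value: "\<exists>V\<in>Sneg 1. D \<in> {FT, FW 0} \<longrightarrow> V p = E D p"
proof (cases "D \<in> {FT, FW 0}")
  case True
  hence DI: "D \<in> I" by auto
  obtain V where V: "V \<in> syms" "\<forall>j\<in>gens. gen_fun j (V, p) = (case j of GC c \<Rightarrow> (if c = D then 1 else 0) | _ \<Rightarrow> 0)"
    using onto[of "\<lambda>j. case j of GC c \<Rightarrow> (if c = D then 1 else 0) | _ \<Rightarrow> 0"] by blast
  have c: "eps c p \<bullet> V p = (if c = D then 1 else 0)" if "c \<in> I" for c
    using V(2)[rule_format, of "GC c"] that by (simp add: gens_def comp_def V(1) pB)
  have "V p = (\<Sum>c\<in>I. (eps c p \<bullet> V p) *\<^sub>R E c p)" by (simp add: rep[OF pB])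
  also have "\<dots> = (\<Sum>c\<in>I. if c = D then E c p else 0)" by (rule sum.cong) (auto simp: c)
  finally have "V p = E D p" using DI by simp
  moreover have "V \<in> Sneg 1" using V(1) c True by (auto simp: Sneg_def)
  ultimately show ?thesis by blast
next
  case False
  thus ?thesis using subspace_0[OF Sneg_subspace] by blast
qed

lemma local_frame:
  assumes T: "RT \<in> syms" "RT p = E FT p" and Z: "RZ \<in> syms" "RZ p = E (FW 0) p"
  shows "\<exists>r \<rho>. 0 < r \<and> ball p r \<subseteq> B \<and> smooth_frame (ball p r) I (rF RT RZ) \<rho>"
proof -
  note sR = syms_smooth[OF rF_syms[OF T Z]]
  from frame_spans_near[OF openB pB finite_legs dimension sR frame_at_p[OF T Z]]
  obtain r where r: "0 < r" "ball p r \<subseteq> B" "\<And>q. q \<in> ball p r \<Longrightarrow> span ((\<lambda>c. rF RT RZ c q) ` I) = UNIV" by blast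
  show ?thesis
    using smooth_frame_exists[OF open_ball finite_legs dimension smooth_on_subset[OF sR r(2)] r(3)] r(1,2) by blast
qed

text \<open>A symmetry of infinite order of vanishing lies in a finite-dimensional space that is closed under
  brackets with a local frame of symmetries, hence solves a closed linear system along that frame.\<close>

lemma Spos_Inter: "(\<And>k. U \<in> Spos k) \<Longrightarrow> U = 0"
proof -
  assume U: "\<And>k. U \<in> Spos k"
  define J where "J = (\<Inter>k. Spos k)"
  have sJ: "subspace J" unfolding J_def by (rule subspace_Inter) (use Spos_subspace in auto)
  have Js: "J \<subseteq> syms" unfolding J_def using Spos_syms by blast
  have Jp: "V p = 0" if "V \<in> J" for V using that Spos_sub Sneg_0 unfolding J_def by blast
  obtain VT where VT: "VT \<in> Sneg 1" "VT p = E FT p" using horizontal_value[of FT] by auto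
  obtain VZ where VZ: "VZ \<in> Sneg 1" "VZ p = E (FW 0) p" using horizontal_value[of "FW 0"] by auto
  note T = Sneg_syms[OF VT(1)] VT(2) and Z = Sneg_syms[OF VZ(1)] VZ(2)
  have Jb: "br V A \<in> J" if "V \<in> J" "A \<in> Sneg 1" for V A
    unfolding J_def
  proof
    fix k
    have "V \<in> Spos (Suc k)" using that(1) unfolding J_def by blast
    thus "br V A \<in> Spos k" using that(2) by simp
  qed
  define R where "R = rF VT VZ"
  have JR: "V \<in> J \<Longrightarrow> br V (R c) \<in> J" for V c
    unfolding R_def by (rule rF_closed[OF T Z Js Jb[OF _ VT(1)] Jb[OF _ VZ(1)] sJ])
  have sR: "smooth_on B (R c)" for c unfolding R_def by (rule syms_smooth[OF rF_syms[OF T Z]])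
  obtain r \<rho> where r: "0 < r" "ball p r \<subseteq> B" and \<rho>: "smooth_frame (ball p r) I R \<rho>"
    unfolding R_def using local_frame[OF T Z] by blast
  obtain A where A: "finite A" "A \<subseteq> J" "independent A" "span A = J" using subspace_finite_basis[OF Js sJ pB] by blast
  have "\<exists>\<kappa>. br a (R c) = (\<Sum>b\<in>A. \<kappa> b *\<^sub>R b)" if "a \<in> A" for a c
    using JR[of a c] that A(2,4) span_finite[OF A(1)] by blast
  then obtain \<kappa> where \<kappa>: "\<And>a c. a \<in> A \<Longrightarrow> br a (R c) = (\<Sum>b\<in>A. \<kappa> a c b *\<^sub>R b)" by metis
  have sa: "smooth_on B a" if "a \<in> A" for a using that A(2) Js by (blast intro: syms_smooth)
  \<comment> \<open>\<open>G (a, i)\<close> is a coordinate of the basis symmetry \<open>a\<close>.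
    Solving the bracket relation \<open>\<kappa>\<close> for the derivative of \<open>a\<close>
    along \<open>R c\<close> gives the matrix \<open>K\<close>.\<close>
  define G where "G = (\<lambda>(a :: 'a \<Rightarrow> 'a, i) q. a q \<bullet> i)"
  define K where "K = (\<lambda>c (a, i) (b, i') q. (if b = a then dir_deriv i' (R c) q \<bullet> i else 0) - (if i' = i then \<kappa> a c b else 0))"
  have sK: "continuous_on (ball p r) (K c j k)" for c j k
  proof -
    have d: "continuous_on (ball p r) (\<lambda>q. dir_deriv i' (R c) q \<bullet> i)" for i i'
      by (intro continuous_intros smooth_on_continuous[OF smooth_on_dir_deriv[OF smooth_on_subset[OF sR r(2)]]])
    show ?thesis unfolding K_def split_def
      by (cases "fst k = fst j"; cases "snd k = snd j") (auto intro!: continuous_intros d)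
  qed
  have sys: "lie_deriv (R c) (G j) q = (\<Sum>k\<in>A \<times> Basis. K c j k q * G k q)"
    if j: "j \<in> A \<times> Basis" and q: "q \<in> ball p r" for c j q
  proof -
    obtain a i where ai: "j = (a, i)" "a \<in> A" "i \<in> Basis" using j by auto
    have qB: "q \<in> B" using q r(2) by blast
    have "lie_bracket a (R c) q = (\<Sum>b\<in>A. \<kappa> a c b *\<^sub>R b q)"
      using fun_cong[OF \<kappa>[OF ai(2), of c], of q] br_eq[OF qB] by (simp add: sum_fun_apply scaleR_fun_apply)
    hence "lie_deriv (R c) a q = lie_deriv a (R c) q - (\<Sum>b\<in>A. \<kappa> a c b *\<^sub>R b q)"
      unfolding lie_bracket_def by (simp add: algebra_simps)
    moreover have "lie_deriv (R c) (G j) q = lie_deriv (R c) a q \<bullet> i"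
      using dir_deriv_inner[OF smooth_on_differentiable[OF sa[OF ai(2)] qB], of "R c q" i]
      by (simp add: G_def ai lie_deriv_def dir_deriv_def)
    moreover have "lie_deriv a (R c) q = (\<Sum>i'\<in>Basis. (a q \<bullet> i') *\<^sub>R dir_deriv i' (R c) q)"
      by (rule lie_deriv_Basis[OF sR qB])
    ultimately have "lie_deriv (R c) (G j) q = (\<Sum>i'\<in>Basis. (a q \<bullet> i') * (dir_deriv i' (R c) q \<bullet> i)) - (\<Sum>b\<in>A. \<kappa> a c b * (b q \<bullet> i))"
      by (simp add: inner_diff_left inner_sum_left)
    also have "(\<Sum>i'\<in>Basis. (a q \<bullet> i') * (dir_deriv i' (R c) q \<bullet> i)) = (\<Sum>b\<in>A. \<Sum>i'\<in>Basis. (if b = a then dir_deriv i' (R c) q \<bullet> i else 0) * (b q \<bullet> i'))"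
    proof -
      have "(\<Sum>b\<in>A. \<Sum>i'\<in>Basis. (if b = a then dir_deriv i' (R c) q \<bullet> i else 0) * (b q \<bullet> i'))
        = (\<Sum>b\<in>A. if b = a then \<Sum>i'\<in>Basis. (dir_deriv i' (R c) q \<bullet> i) * (b q \<bullet> i') else 0)" by (rule sum.cong) auto
      thus ?thesis using ai A(1) by (simp add: mult.commute)
    qed
    also have "(\<Sum>b\<in>A. \<kappa> a c b * (b q \<bullet> i)) = (\<Sum>b\<in>A. \<Sum>i'\<in>Basis. (if i' = i then \<kappa> a c b else 0) * (b q \<bullet> i'))"
    proof (rule sum.cong[OF refl])
      fix b
      have "(\<Sum>i'\<in>Basis. (if i' = i then \<kappa> a c b else 0) * (b q \<bullet> i')) = (\<Sum>i'\<in>Basis. if i' = i then \<kappa> a c b * (b q \<bullet> i') else 0)"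
        by (rule sum.cong) auto
      thus "\<kappa> a c b * (b q \<bullet> i) = (\<Sum>i'\<in>Basis. (if i' = i then \<kappa> a c b else 0) * (b q \<bullet> i'))" using ai by simp
    qed
    also have "(\<Sum>b\<in>A. \<Sum>i'\<in>Basis. (if b = a then dir_deriv i' (R c) q \<bullet> i else 0) * (b q \<bullet> i'))
        - (\<Sum>b\<in>A. \<Sum>i'\<in>Basis. (if i' = i then \<kappa> a c b else 0) * (b q \<bullet> i'))
        = (\<Sum>k\<in>A \<times> Basis. K c j k q * G k q)"
      by (simp add: sum.cartesian_product' sum_subtractf[symmetric] K_def G_def ai left_diff_distrib)
    finally show ?thesis .
  qed
  have "a q \<bullet> i = 0" if "a \<in> A" "i \<in> Basis" "q \<in> ball p r" for a i q
  proof -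
    have s: "smooth_on (ball p r) (G j)" if "j \<in> A \<times> Basis" for j
      using that smooth_on_subset[OF sa r(2)] by (auto simp: G_def intro!: smooth_intros)
    have z: "G j p = 0" if "j \<in> A \<times> Basis" for j using that by (auto simp: G_def dest!: Jp[OF subsetD[OF A(2)]])
    have "G (a, i) q = 0"
    proof (rule frame_system_unique[OF \<rho> _ _ _ s sK sys z that(3)])
      show "connected (ball p r)" by simp
      show "p \<in> ball p r" using r(1) by simp
      show "finite (A \<times> (Basis :: 'a set))" using A(1) by simp
    qed (use that in auto)
    thus ?thesis by (simp add: G_def)
  qed
  hence "a = 0" if "a \<in> A" for a
    using syms_locally_determined[of a "ball p r" p] that r A(2) Js by (metis (no_types, lifting) centre_in_ball euclidean_all_zero_iff open_ball subsetD)
  hence "A \<subseteq> {0}" by blast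
  hence "J \<subseteq> {0}" using A(4) span_mono[of A "{0}"] by simp
  thus "U = 0" using U by (auto simp: J_def)
qed

text \<open>\<open>XX\<close> acts as \<open>k\<close> on \<open>Spos k\<close> modulo the next
  step. A negative eigenvalue never matches, so \<open>U\<close> moves into every
  \<open>Spos k\<close>.\<close>

lemma eigen_Spos:
  assumes U: "U \<in> Sneg 0" and L: "LX U = s *\<^sub>R U" "s < 0" shows "U = 0"
proof (rule Spos_Inter)
  fix k show "U \<in> Spos k"
  proof (induction k)
    case (Suc k)
    have "(s - real k) *\<^sub>R U \<in> Spos (Suc k)" using LX_Spos[OF Suc] L(1) by (simp add: scaleR_left_diff_distrib)
    hence "(1 / (s - real k)) *\<^sub>R (s - real k) *\<^sub>R U \<in> Spos (Suc k)" by (rule subspace_scale[OF Spos_subspace])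
    moreover have "s - real k \<noteq> 0" using L(2) by simp
    ultimately show ?case by simp
  qed (simp add: U)
qed

text \<open>The same argument in negative weights: on each step the eigenvalue mismatches and
  \<open>U\<close> descends to the isotropy algebra.\<close>

lemma eigen_Sneg: "U \<in> Sneg k \<Longrightarrow> LX U = s *\<^sub>R U \<Longrightarrow> s < - real k \<Longrightarrow> U = 0"
proof (induction k)
  case 0
  thus ?case using eigen_Spos by simp
next
  case (Suc k)
  have "(s + real (Suc k)) *\<^sub>R U \<in> Sneg k" using LX_Sneg[OF Suc.prems(1)] Suc.prems(2) by (simp add: scaleR_left_distrib)
  hence "(1 / (s + real (Suc k))) *\<^sub>R (s + real (Suc k)) *\<^sub>R U \<in> Sneg k" by (rule subspace_scale[OF Sneg_subspace])
  moreover have "s + real (Suc k) \<noteq> 0" using Suc.prems(3) by simp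
  ultimately have "U \<in> Sneg k" by simp
  thus ?case using Suc by simp
qed

lemma eigen_br:
  assumes "A \<in> syms" "A' \<in> syms" "LX A = s *\<^sub>R A" "LX A' = t *\<^sub>R A'"
  shows "LX (br A A') = (s + t) *\<^sub>R br A A'"
  using br_jacobi[OF XX(1) assms(1,2)] br_scaleR[OF assms(1,2)] br_scaleR_r[OF assms(2,1)] assms(3,4)
  by (simp add: LX_def scaleR_left_distrib)

text \<open>Start from any symmetry \<open>V\<close> with the right value; \<open>LX V + V\<close>
  is isotropic. On the isotropy algebra -1 is not an eigenvalue, so \<open>LX\<close> plus the
  identity is injective and, by finite dimension, onto. Removing the preimage of the error makes
  \<open>V\<close> an exact eigenvector.\<close>

lemma eigen_horizontal:
  assumes D: "D \<in> {FT, FW 0}" shows "\<exists>R\<in>syms. R p = E D p \<and> LX R = - R"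
proof -
  obtain V where V: "V \<in> Sneg 1" "V p = E D p" using horizontal_value[of D] D by blast
  note Vs = Sneg_syms[OF V(1)]
  have f: "LX U + U \<in> Sneg 0" if "U \<in> Sneg 0" for U
    using subspace_add[OF Sneg_subspace br_Sneg_isotropy[OF XX_isotropy that] that] by (simp add: LX_def)
  have "\<exists>U\<in>Sneg 0. LX U + U = LX V + V"
  proof (rule injective_onto[OF _ Sneg_subspace pB f])
    show "Sneg 0 \<subseteq> syms" using Sneg_syms by blast
    show "x = 0" if "x \<in> Sneg 0" "LX x + x = 0" for x
      using eigen_Spos[OF that(1), of "- 1"] that(2) by (simp add: eq_neg_iff_add_eq_0)
    show "LX (x + y) + (x + y) = (LX x + x) + (LX y + y)" if "x \<in> Sneg 0" "y \<in> Sneg 0" for x y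
      using LX_add[OF Sneg_syms[OF that(1)] Sneg_syms[OF that(2)]] by simp
    show "LX (c *\<^sub>R x) + c *\<^sub>R x = c *\<^sub>R (LX x + x)" if "x \<in> Sneg 0" for c x
      using LX_scaleR[OF Sneg_syms[OF that]] by (simp add: scaleR_right_distrib)
    show "LX V + V \<in> Sneg 0" using LX_Sneg[OF V(1)] by simp
  qed
  then obtain U where U: "U \<in> Sneg 0" "LX U + U = LX V + V" by blast
  note Us = Sneg_syms[OF U(1)]
  have "LX (V - U) = LX V - LX U" unfolding LX_def by (rule br_diff_r[OF Vs Us XX(1)])
  also have "\<dots> = (LX V + V) - V - LX U" by simp
  also have "\<dots> = - (V - U)" unfolding U(2)[symmetric] by simp
  finally have "LX (V - U) = - (V - U)" .
  moreover have "(V - U) p = E D p" using U(1) Sneg_0 V(2) by (simp add: minus_apply)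
  ultimately show ?thesis using syms_closed(3)[OF Vs Us] by blast
qed

end

section \<open>The nilpotent algebra generated by \<open>RT\<close> and \<open>RZ\<close>\<close>

locale flat_symmetries = maximal_symmetry +
  fixes RT RZ :: "'a \<Rightarrow> 'a"
  assumes RT: "RT \<in> syms" "RT p = E FT p" "LX RT = - RT"
    and RZ: "RZ \<in> syms" "RZ p = E (FW 0) p" "LX RZ = - RZ"
begin

abbreviation "RW \<equiv> rW RT RZ"
abbreviation "RY \<equiv> rY RT RZ"

lemmas RW_syms = w_syms[OF RT(1,2) RZ(1,2)]
lemmas RY_syms = y_syms[OF RT(1,2) RZ(1,2)]
lemmas RZ_lead = RZ_leading[OF RT(1,2) RZ(1,2)]
lemmas RW_leading = w_leading[OF RT(1,2) RZ(1,2)]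
lemmas RY_leading = y_leading[OF RT(1,2) RZ(1,2)]

lemma RW_eigen: "LX (RW i) = - real (i + 1) *\<^sub>R RW i"
proof (induction i)
  case (Suc i)
  have "LX (br (RW i) RT) = (- real (i + 1) + - 1) *\<^sub>R br (RW i) RT"
    by (rule eigen_br[OF RW_syms RT(1) Suc]) (simp add: RT)
  moreover have "- real (i + 1) + - 1 = - real (Suc i + 1)" by simp
  ultimately show ?case by simp
qed (simp add: RZ)

lemma RY_eigen: "LX (RY i) = - real (i + 2) *\<^sub>R RY i"
proof (induction i)
  case 0
  thus ?case using br_0(2)[OF XX(1)] by (simp add: LX_def)
next
  case (Suc i)
  show ?case
  proof (cases "i = 0")
    case True
    have "LX (br RZ (RW 1)) = (- 1 + - real (1 + 1)) *\<^sub>R br RZ (RW 1)"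
      by (rule eigen_br[OF RZ(1) RW_syms _ RW_eigen]) (simp add: RZ)
    thus ?thesis using True by simp
  next
    case False
    have "LX (br (RY i) RT) = (- real (i + 2) + - 1) *\<^sub>R br (RY i) RT"
      by (rule eigen_br[OF RY_syms RT(1) Suc]) (simp add: RT)
    thus ?thesis using False by (simp add: algebra_simps)
  qed
qed

text \<open>Without components of weight \<open>k + 1\<close> at \<open>p\<close>, \<open>U\<close>
  lies in \<open>Sneg k\<close>, where an eigenvalue below \<open>- k\<close> leaves it no
  room.\<close>

lemma eigen_top:
  assumes "U \<in> Sneg (Suc k)" "\<And>c. c \<in> I \<Longrightarrow> wt c = Suc k \<Longrightarrow> eps c p \<bullet> U p = 0" "LX U = s *\<^sub>R U" "s < - real k"
  shows "U = 0"
proof (rule eigen_Sneg[OF _ assms(3,4)])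
  show "U \<in> Sneg k"
    using assms(1,2) by (auto simp: Sneg_def) 
qed

lemma RW_top: "n < i \<Longrightarrow> RW i = 0"
proof (induction i)
  case (Suc i)
  show ?case
  proof (cases "i = n")
    case True
    have "RW (Suc n) \<in> Sneg (Suc (n + 1))" "\<And>c. c \<in> I \<Longrightarrow> wt c = Suc (n + 1) \<Longrightarrow> eps c p \<bullet> RW (Suc n) p = 0"
      using RW_leading[of "Suc n"] by auto
    from eigen_top[OF this RW_eigen] show ?thesis unfolding True by simp
  next
    case False
    hence "RW i = 0" "i \<noteq> 0" using Suc by auto
    thus ?thesis using br_0(1)[OF RT(1)] by simp
  qed
qed simp

lemma RY_top: "m < i \<Longrightarrow> RY i = 0"
proof (induction i)
  case (Suc i)
  show ?case
  proof (cases "i = m")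
    case True
    have "RY (Suc m) \<in> Sneg (Suc (m + 2))" "\<And>c. c \<in> I \<Longrightarrow> wt c = Suc (m + 2) \<Longrightarrow> eps c p \<bullet> RY (Suc m) p = 0"
      using RY_leading[of "Suc m"] by auto
    from eigen_top[OF this RY_eigen] show ?thesis unfolding True by simp
  next
    case False
    hence "RY i = 0" "i \<noteq> 0" using Suc by auto
    thus ?thesis using br_0(1)[OF RT(1)] by simp
  qed
qed simp

lemma RY_step: "1 \<le> i \<Longrightarrow> br (RY i) RT = RY (Suc i)" by simp

text \<open>Both sides have eigenvalue \<open>- (i + 2)\<close> and the same components of weight
  \<open>i + 2\<close> at \<open>p\<close>, so \<open>eigen_top\<close> annihilates their
  difference.\<close>

lemma RZ_RW: "1 \<le> i \<Longrightarrow> br RZ (RW i) = RY i"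
proof (cases "i \<le> n")
  case False
  thus ?thesis using RW_top RY_top mn br_0(2)[OF RZ(1)] by simp
next
  case True
  assume i: "1 \<le> i"
  have V: "RW i \<in> Sneg (i + 1)" and l: "\<And>c. c \<in> I \<Longrightarrow> wt c = i + 1 \<Longrightarrow> eps c p \<bullet> RW i p = (if c = FW i then (- 1) ^ i else 0)"
    using RW_leading[of i] True by auto
  have b: "br RZ (RW i) \<in> Sneg (Suc (i + 1))" by (rule br_Sneg_horizontal[OF RZ(1,2) _ V]) simp
  have lead: "eps c p \<bullet> br RZ (RW i) p = (if c = FY i then (- 1) ^ (i + 1) else 0)" if c: "c \<in> I" "wt c = Suc (i + 1)" for c
    using RZ_lead[OF V _ c] i c l[of "FW i"] True by (cases c) auto
  have Y: "RY i \<in> Sneg (Suc (i + 1)) \<and> (\<forall>c\<in>I. wt c = Suc (i + 1) \<longrightarrow> eps c p \<bullet> RY i p = (if c = FY i then (- 1) ^ (i + 1) else 0))"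
  proof (cases "i \<le> m")
    case True
    thus ?thesis using RY_leading[of i] i by simp
  next
    case False
    hence "RY i = 0" using RY_top by simp
    thus ?thesis using False subspace_0[OF Sneg_subspace] by (auto simp: zero_fun_apply)
  qed
  note s = br_syms[OF RZ(1) RW_syms[of i]] RY_syms[of i]
  have "br RZ (RW i) - RY i = 0"
  proof (rule eigen_top)
    show "br RZ (RW i) - RY i \<in> Sneg (Suc (i + 1))" using subspace_diff[OF Sneg_subspace b] Y by blast
    show "eps c p \<bullet> (br RZ (RW i) - RY i) p = 0" if "c \<in> I" "wt c = Suc (i + 1)" for c
      using lead[OF that] Y that by (simp add: minus_apply inner_diff_right)
    have 1: "LX (br RZ (RW i)) = (- 1 + - real (i + 1)) *\<^sub>R br RZ (RW i)"
      by (rule eigen_br[OF RZ(1) RW_syms _ RW_eigen]) (simp add: RZ)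
    have 2: "LX (br RZ (RW i) - RY i) = LX (br RZ (RW i)) - LX (RY i)" unfolding LX_def by (rule br_diff_r[OF s XX(1)])
    have r: "- 1 + - real (i + 1) = - real (i + 2)" by simp
    show "LX (br RZ (RW i) - RY i) = - real (i + 2) *\<^sub>R (br RZ (RW i) - RY i)"
      unfolding 2 1 RY_eigen r by (simp only: scaleR_right_diff_distrib)
  qed simp
  thus ?thesis by simp
qed

lemma RZ_RY: "br RZ (RY i) = 0"
proof (cases "1 \<le> i \<and> i \<le> m")
  case False
  hence "RY i = 0" using RY_top[of i] by (cases "i = 0") auto
  thus ?thesis using br_0(2)[OF RZ(1)] by simp
next
  case True
  hence V: "RY i \<in> Sneg (i + 2)" and l: "\<And>c. c \<in> I \<Longrightarrow> wt c = i + 2 \<Longrightarrow> eps c p \<bullet> RY i p = (if c = FY i then (- 1) ^ (i + 1) else 0)"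
    using RY_leading[of i] by auto
  have "br RZ (RY i) \<in> Sneg (Suc (i + 2))" by (rule br_Sneg_horizontal[OF RZ(1,2) _ V]) simp
  moreover have "eps c p \<bullet> br RZ (RY i) p = 0" if c: "c \<in> I" "wt c = Suc (i + 2)" for c
    using RZ_lead[OF V _ c] c l[of "FW (Suc i)"] mn(2) by (cases c) auto
  moreover have "LX (br RZ (RY i)) = (- 1 + - real (i + 2)) *\<^sub>R br RZ (RY i)"
    by (rule eigen_br[OF RZ(1) RY_syms _ RY_eigen]) (simp add: RZ)
  moreover have "- 1 + - real (i + 2) < - real (i + 2)" by simp
  ultimately show ?thesis by (rule eigen_top)
qed

text \<open>Apply the Jacobi identity to \<open>RZ\<close>, \<open>RW (i + 1)\<close> and
  \<open>RT\<close>. By \<open>RZ_RW\<close> two of the three terms are both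
  \<open>RY (i + 2)\<close>, which leaves the bracket with \<open>RW 1\<close>; larger
  \<open>j\<close> follow by bracketing with \<open>RT\<close>.\<close>

lemma RW_RW: "br (RW (Suc i)) (RW (Suc j)) = 0"
proof (induction j arbitrary: i)
  case 0
  have "br RZ (br (RW (Suc i)) RT) = br (br RZ (RW (Suc i))) RT + br (RW (Suc i)) (br RZ RT)"
    by (rule br_jacobi[OF RZ(1) RW_syms RT(1)])
  moreover have "br RZ (br (RW (Suc i)) RT) = RY (Suc (Suc i))" using RZ_RW[of "Suc (Suc i)"] by simp
  moreover have "br (br RZ (RW (Suc i))) RT = RY (Suc (Suc i))" using RZ_RW[of "Suc i"] RY_step[of "Suc i"] by simp
  ultimately show ?case by simp
next
  case (Suc j)
  have "br (RW (Suc i)) (br (RW (Suc j)) RT) = br (br (RW (Suc i)) (RW (Suc j))) RT + br (RW (Suc j)) (br (RW (Suc i)) RT)"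
    by (rule br_jacobi[OF RW_syms RW_syms RT(1)])
  also have "br (br (RW (Suc i)) (RW (Suc j))) RT = 0" unfolding Suc.IH by (rule br_0(1)[OF RT(1)])
  also have "br (RW (Suc j)) (br (RW (Suc i)) RT) = 0" using Suc.IH[of "Suc i"] br_anti[of "RW (Suc j)" "RW (Suc (Suc i))"] by simp
  finally show ?case by simp
qed

lemma RW_RY: "br (RW i) (RY j) = 0"
proof (induction i arbitrary: j)
  case 0
  thus ?case using RZ_RY by simp
next
  case (Suc i)
  show ?case
  proof (cases "j = 0")
    case True
    thus ?thesis using br_0(2)[OF RW_syms[of "Suc i"]] by simp
  next
    case False
    have "br (RY j) (br (RW i) RT) = br (br (RY j) (RW i)) RT + br (RW i) (br (RY j) RT)"
      by (rule br_jacobi[OF RY_syms RW_syms RT(1)])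
    also have "br (RY j) (RW i) = 0" using Suc.IH[of j] br_anti[of "RY j" "RW i"] by simp
    also have "br (RY j) RT = RY (Suc j)" using False by simp
    finally show ?thesis using Suc.IH[of "Suc j"] br_0(1)[OF RT(1)] br_anti[of "RW (Suc i)" "RY j"] by simp
  qed
qed

lemma RY_RY: "br (RY i) (RY j) = 0"
proof (induction i arbitrary: j)
  case 0
  thus ?case using br_0(1)[OF RY_syms] by simp
next
  case (Suc i)
  have YW: "br (RY j) (RW k) = 0" for j k using RW_RY[of k j] br_anti[of "RY j" "RW k"] by simp
  consider "i = 0" | "i \<noteq> 0" "j = 0" | "i \<noteq> 0" "j \<noteq> 0" by blast
  thus ?case
  proof cases
    case 1
    have "br (RY j) (br RZ (RW 1)) = br (br (RY j) RZ) (RW 1) + br RZ (br (RY j) (RW 1))"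
      by (rule br_jacobi[OF RY_syms RZ(1) RW_syms])
    hence "br (RY j) (br RZ (RW 1)) = 0" unfolding YW using YW[of j 0] br_0[OF RZ(1)] br_0(1)[OF RW_syms[of 1]] by simp
    thus ?thesis using 1 br_anti[of "br RZ (RW 1)" "RY j"] by simp
  next
    case 2
    thus ?thesis using br_0(2)[OF RY_syms[of "Suc i"]] by simp
  next
    case 3
    have "br (RY j) (br (RY i) RT) = br (br (RY j) (RY i)) RT + br (RY i) (br (RY j) RT)"
      by (rule br_jacobi[OF RY_syms RY_syms RT(1)])
    also have "br (RY j) (RY i) = 0" using Suc.IH[of j] br_anti[of "RY j" "RY i"] by simp
    also have "br (RY j) RT = RY (Suc j)" using 3 by simp
    finally show ?thesis using Suc.IH[of "Suc j"] br_0(1)[OF RT(1)] br_anti[of "RY (Suc i)" "RY j"] 3 by simp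
  qed
qed

end

lemma (in maximal_symmetry) flat_symmetries_exist: "\<exists>RT RZ. flat_symmetries B E eps m n p RT RZ"
proof -
  obtain RT where "RT \<in> syms" "RT p = E FT p" "LX RT = - RT" using eigen_horizontal[of FT] by blast
  moreover obtain RZ where "RZ \<in> syms" "RZ p = E (FW 0) p" "LX RZ = - RZ" using eigen_horizontal[of "FW 0"] by blast
  ultimately show ?thesis by (blast intro: flat_symmetries.intro flat_symmetries_axioms.intro maximal_symmetry_axioms)
qed

section \<open>Flat coordinates\<close>

text \<open>The coefficient of the model symmetry \<open>RW i\<close> in the
  \<open>z\<close>-coordinate of index \<open>k\<close>: the field \<open>RW 0\<close> has
  \<open>x ^ k / fact k\<close>, and each bracket with translation in \<open>x\<close>
  differentiates and changes the sign.\<close>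

definition xpow :: "('a \<Rightarrow> real) \<Rightarrow> nat \<Rightarrow> nat \<Rightarrow> 'a \<Rightarrow> real"
  where "xpow x i k q = (if i \<le> k then (- 1) ^ i * x q ^ (k - i) / fact (k - i) else 0)"

lemma smooth_on_xpow: "open U \<Longrightarrow> smooth_on U x \<Longrightarrow> smooth_on U (xpow x i k)"
  unfolding xpow_def[abs_def] by (cases "i \<le> k") (auto intro!: smooth_intros)

lemma lie_deriv_xpow:
  assumes "smooth_on U x" "q \<in> U"
  shows "lie_deriv X (xpow x i k) q = - xpow x (Suc i) k q * lie_deriv X x q"
proof -
  note d = smooth_on_has_derivative[OF assms]
  consider "i < k" | "i = k" | "k < i" by linarith
  thus ?thesis
  proof cases
    case 1
    then obtain j where k: "k = Suc (i + j)" using less_imp_Suc_add by blast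
    have "((\<lambda>q. (- 1) ^ i * x q ^ Suc j / fact (Suc j)) has_derivative
        (\<lambda>v. (- 1) ^ i * (of_nat (Suc j) * frechet_derivative x (at q) v * x q ^ j) / fact (Suc j))) (at q)"
      by (rule derivative_eq_intros d refl | simp)+
    moreover have "xpow x i k = (\<lambda>q. (- 1) ^ i * x q ^ Suc j / fact (Suc j))" by (auto simp: xpow_def k Suc_diff_le)
    ultimately have "lie_deriv X (xpow x i k) q = (- 1) ^ i * (of_nat (Suc j) * lie_deriv X x q * x q ^ j) / fact (Suc j)"
      by (simp only: lie_deriv_eq) (simp add: lie_deriv_def)
    also have "\<dots> = - xpow x (Suc i) k q * lie_deriv X x q"
      by (simp add: xpow_def k divide_simps del: of_nat_Suc)
    finally show ?thesis .
  next
    case 2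
    hence "xpow x i k = (\<lambda>q. (- 1) ^ i)" by (auto simp: xpow_def)
    thus ?thesis using 2 by (simp add: xpow_def)
  next
    case 3
    hence "xpow x i k = (\<lambda>q. 0)" by (auto simp: xpow_def)
    thus ?thesis using 3 by (simp add: xpow_def)
  qed
qed

locale flat_frame = flat_symmetries +
  fixes r :: real and \<rho> :: "leg \<Rightarrow> 'a \<Rightarrow> 'a"
  assumes r: "0 < r" "ball p r \<subseteq> B" and fr: "smooth_frame (ball p r) I (rF RT RZ) \<rho>"
begin

abbreviation "RF \<equiv> rF RT RZ"
abbreviation "N \<equiv> ball p r"

lemma pN: "p \<in> N" using r by simp

lemma N_B: "q \<in> N \<Longrightarrow> q \<in> B" using r by blast

lemma RF_syms: "RF c \<in> syms" by (rule rF_syms[OF RT(1,2) RZ(1,2)])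

lemma smRF: "smooth_on N (RF c)" by (rule smooth_on_subset[OF syms_smooth[OF RF_syms] r(2)])

lemma RF_top: "c \<notin> I \<Longrightarrow> RF c = 0"
proof (cases c)
  case (FY i)
  assume "c \<notin> I"
  thus ?thesis using FY RY_top by (cases "i = 0") auto
qed (use RW_top in auto)

lemma RF_bracket:
  assumes "q \<in> N"
  shows "lie_bracket (RW i) RT q = RW (Suc i) q" "1 \<le> i \<Longrightarrow> lie_bracket (RY i) RT q = RY (Suc i) q"
    "1 \<le> i \<Longrightarrow> lie_bracket RZ (RW i) q = RY i q" "lie_bracket (RW (Suc i)) (RW (Suc j)) q = 0"
    "lie_bracket (RW i) (RY j) q = 0" "lie_bracket (RY i) (RY j) q = 0"
  using br_eq[OF N_B[OF assms]] RY_step[of i] RZ_RW[of i] RW_RW[of i j] RW_RY[of i j] RY_RY[of i j]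
  by (simp_all add: zero_fun_apply flip: br_eq[OF N_B[OF assms]] rW.simps(2))

text \<open>\<open>frame_poincare\<close> with the exact structure constants inserted.
  \<open>gx\<close> extends \<open>g\<close> by 0 to legs past the ends of the chains, whose fields
  are zero.\<close>

lemma coordinate_exists:
  fixes g :: "leg \<Rightarrow> 'a \<Rightarrow> real"
  defines "gx \<equiv> \<lambda>c q. if c \<in> I then g c q else 0"
  assumes sg: "\<And>c. c \<in> I \<Longrightarrow> smooth_on N (g c)"
    and WT: "\<And>i q. i \<le> n \<Longrightarrow> q \<in> N \<Longrightarrow> lie_deriv (RW i) (g FT) q - lie_deriv RT (g (FW i)) q = gx (FW (Suc i)) q"
    and YT: "\<And>i q. 1 \<le> i \<Longrightarrow> i \<le> m \<Longrightarrow> q \<in> N \<Longrightarrow> lie_deriv (RY i) (g FT) q - lie_deriv RT (g (FY i)) q = gx (FY (Suc i)) q"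
    and ZW: "\<And>i q. 1 \<le> i \<Longrightarrow> i \<le> n \<Longrightarrow> q \<in> N \<Longrightarrow> lie_deriv RZ (g (FW i)) q - lie_deriv (RW i) (g (FW 0)) q = gx (FY i) q"
    and WW: "\<And>i j q. 1 \<le> i \<Longrightarrow> i \<le> n \<Longrightarrow> 1 \<le> j \<Longrightarrow> j \<le> n \<Longrightarrow> q \<in> N \<Longrightarrow> lie_deriv (RW i) (g (FW j)) q = lie_deriv (RW j) (g (FW i)) q"
    and WY: "\<And>i j q. i \<le> n \<Longrightarrow> 1 \<le> j \<Longrightarrow> j \<le> m \<Longrightarrow> q \<in> N \<Longrightarrow> lie_deriv (RW i) (g (FY j)) q = lie_deriv (RY j) (g (FW i)) q"
    and YY: "\<And>i j q. 1 \<le> i \<Longrightarrow> i \<le> m \<Longrightarrow> 1 \<le> j \<Longrightarrow> j \<le> m \<Longrightarrow> q \<in> N \<Longrightarrow> lie_deriv (RY i) (g (FY j)) q = lie_deriv (RY j) (g (FY i)) q"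
  shows "\<exists>f. smooth_on N f \<and> f p = 0 \<and> (\<forall>q\<in>N. \<forall>c\<in>I. lie_deriv (RF c) f q = g c q)"
proof (rule frame_poincare[OF r(1) fr sg])
  fix c d q assume c: "c \<in> I" and d: "d \<in> I" and q: "q \<in> N"
  define S where "S = (\<lambda>v. \<Sum>k\<in>I. (\<rho> k q \<bullet> v) * g k q)"
  define P where "P = (\<lambda>c d. lie_deriv (RF c) (g d) q - lie_deriv (RF d) (g c) q = S (lie_bracket (RF c) (RF d) q))"
  have S_neg: "S (- v) = - S v" for v by (simp add: S_def sum_negf)
  have S0: "S 0 = 0" by (simp add: S_def)
  have anti: "P c d" if "P d c" for c d
    using that S_neg[of "lie_bracket (RF d) (RF c) q"] lie_bracket_anti[of "RF c" "RF d" q] by (simp add: P_def)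
  have SR: "S (RF k q) = gx k q" for k
  proof (cases "k \<in> I")
    case True
    have "S (RF k q) = (\<Sum>k'\<in>I. if k' = k then g k' q else 0)"
      unfolding S_def using fr True q by (intro sum.cong) (auto simp: smooth_frame_def)
    thus ?thesis using True by (simp add: gx_def)
  next
    case False
    thus ?thesis using S0 by (simp add: gx_def RF_top zero_fun_apply)
  qed
  have same: "P c c" for c using S0 by (simp add: P_def lie_bracket_same)
  have TW: "P (FW i) FT" if "i \<le> n" for i
    using WT[OF that q] SR[of "FW (Suc i)"] RF_bracket(1)[OF q, of i] by (simp add: P_def)
  have TY: "P (FY i) FT" if "1 \<le> i" "i \<le> m" for i
    using YT[OF that q] SR[of "FY (Suc i)"] RF_bracket(2)[OF q, of i] that by (simp add: P_def)
  have Z: "P (FW 0) (FW i)" if "1 \<le> i" "i \<le> n" for i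
    using ZW[OF that q] SR[of "FY i"] RF_bracket(3)[OF q, of i] that by (simp add: P_def)
  have W: "P (FW i) (FW j)" if "i \<le> n" "j \<le> n" for i j
  proof (cases "i = 0 \<or> j = 0")
    case True
    thus ?thesis using same[of "FW 0"] Z[of i] Z[of j] anti[of "FW 0" "FW i"] that
      by (metis One_nat_def Suc_leI neq0_conv)
  next
    case False
    then obtain i' j' where ij: "i = Suc i'" "j = Suc j'" by (metis not0_implies_Suc)
    thus ?thesis using WW[OF _ _ _ _ q, of i j] RF_bracket(4)[OF q, of i' j'] that S0 by (simp add: P_def)
  qed
  have Y: "P (FW i) (FY j)" if "i \<le> n" "1 \<le> j" "j \<le> m" for i j
    using WY[OF that q] RF_bracket(5)[OF q, of i j] S0 by (simp add: P_def)
  have YY': "P (FY i) (FY j)" if "1 \<le> i" "i \<le> m" "1 \<le> j" "j \<le> m" for i j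
    using YY[OF that q] RF_bracket(6)[OF q, of i j] S0 by (simp add: P_def)
  have "P c d"
  proof (cases c)
    case FT
    thus ?thesis using same[of FT] anti[OF TW] anti[OF TY] d by (cases d) auto
  next
    case (FW i)
    thus ?thesis using TW[of i] W[of i] Y[of i] c d by (cases d) auto
  next
    case (FY i)
    thus ?thesis using TY[of i] anti[OF Y, of _ i] YY'[of i] c d by (cases d) auto
  qed
  thus "lie_deriv (RF c) (g d) q - lie_deriv (RF d) (g c) q = (\<Sum>k\<in>I. (\<rho> k q \<bullet> lie_bracket (RF c) (RF d) q) * g k q)"
    by (simp add: P_def S_def)
qed

lemma horizontal_bracket:
  assumes V: "V \<in> syms" and q: "q \<in> B" and D: "D \<in> {FT, FW 0}"
  shows "lie_bracket V (E D) q = (\<Sum>D'\<in>{FT, FW 0}. (eps D' q \<bullet> lie_bracket V (E D) q) *\<^sub>R E D' q)"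
proof -
  have "lie_bracket V (E D) q = (\<Sum>c\<in>I. (eps c q \<bullet> lie_bracket V (E D) q) *\<^sub>R E c q)" by (simp add: rep[OF q])
  also have "\<dots> = (\<Sum>D'\<in>{FT, FW 0}. (eps D' q \<bullet> lie_bracket V (E D) q) *\<^sub>R E D' q)"
  proof (rule sum.mono_neutral_right)
    show "\<forall>c\<in>I - {FT, FW 0}. (eps c q \<bullet> lie_bracket V (E D) q) *\<^sub>R E c q = 0"
    proof
      fix c assume c: "c \<in> I - {FT, FW 0}"
      hence "1 < wt c" by (cases c) auto
      thus "(eps c q \<bullet> lie_bracket V (E D) q) *\<^sub>R E c q = 0" using syms_bracket[OF V q _ _ D] c by simp
    qed
  qed auto
  finally show ?thesis .
qed

text \<open>The contact forms evaluated on the horizontal fields satisfy a closed system along the frame of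
  symmetries, because brackets with symmetries preserve the horizontal distribution.\<close>

lemma contact_vanish:
  fixes f h :: "'j \<Rightarrow> 'a \<Rightarrow> real" and x :: "'a \<Rightarrow> real"
  defines "G \<equiv> \<lambda>j D q. lie_deriv (E D) (f j) q - h j q * lie_deriv (E D) x q"
  assumes J: "finite J" and sf: "\<And>j. j \<in> J \<Longrightarrow> smooth_on N (f j)" and sh: "\<And>j. j \<in> J \<Longrightarrow> smooth_on N (h j)"
    and sx: "smooth_on N x"
    and x: "\<And>c q. c \<in> I \<Longrightarrow> q \<in> N \<Longrightarrow> lie_deriv (RF c) x q = (if c = FT then 1 else 0)"
    and rel: "\<And>c j D q. c \<in> I \<Longrightarrow> j \<in> J \<Longrightarrow> D \<in> {FT, FW 0} \<Longrightarrow> q \<in> N \<Longrightarrow>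
      lie_deriv (E D) (lie_deriv (RF c) (f j)) q - lie_deriv (RF c) (h j) q * lie_deriv (E D) x q = (\<Sum>k\<in>J. \<kappa> c j k * G k D q)"
    and init: "\<And>j D. j \<in> J \<Longrightarrow> D \<in> {FT, FW 0} \<Longrightarrow> G j D p = 0"
    and q: "q \<in> N" and j: "j \<in> J" and D: "D \<in> {FT, FW 0}"
  shows "G j D q = 0"
proof -
  have oN: "open N" by simp
  have sE: "smooth_on N (E D)" if "D \<in> {FT, FW 0}" for D by (rule smooth_on_subset[OF horiz_smooth[OF that] r(2)])
  define \<alpha> where "\<alpha> = (\<lambda>c D D' q. eps D' q \<bullet> lie_bracket (RF c) (E D) q)"
  define A where "A = (\<lambda>c (j :: 'j, D) (j', D') q. (if j = j' then \<alpha> c D D' q else 0) + (if D = D' then \<kappa> c j j' else 0))"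
  have s\<alpha>: "continuous_on N (\<alpha> c D D')" if "D \<in> {FT, FW 0}" "D' \<in> {FT, FW 0}" for c D D'
  proof (rule smooth_on_continuous)
    have "D' \<in> I" using that by auto
    thus "smooth_on N (\<alpha> c D D')"
      unfolding \<alpha>_def by (intro smooth_intros oN smRF sE that(1) smooth_on_subset[OF smeps r(2)])
  qed
  have sA: "continuous_on N (A c j k)" if "j \<in> J \<times> {FT, FW 0}" "k \<in> J \<times> {FT, FW 0}" for c j k
    using s\<alpha>[of "snd j" "snd k" c] that unfolding A_def split_def
    by (cases "fst j = fst k"; cases "snd j = snd k") (auto intro!: continuous_intros)
  have sG: "smooth_on N (G j D)" if "j \<in> J" "D \<in> {FT, FW 0}" for j D
    unfolding G_def by (intro smooth_intros oN sE that sf sh sx)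
  have sys: "lie_deriv (RF c) (\<lambda>q. case jD of (j, D) \<Rightarrow> G j D q) q = (\<Sum>k\<in>J \<times> {FT, FW 0}. A c jD k q * (case k of (j, D) \<Rightarrow> G j D q))"
    if c: "c \<in> I" and jD: "jD \<in> J \<times> {FT, FW 0}" and q: "q \<in> N" for c jD q
  proof -
    obtain j D where jD': "jD = (j, D)" "j \<in> J" "D \<in> {FT, FW 0}" using jD by auto
    note s = sf[OF jD'(2)] sh[OF jD'(2)] sE[OF jD'(3)]
    have bb: "lie_deriv (RF c) (lie_deriv (E D) u) q = (\<Sum>D'\<in>{FT, FW 0}. \<alpha> c D D' q * lie_deriv (E D') u q) + lie_deriv (E D) (lie_deriv (RF c) u) q"
      if u: "smooth_on N u" for u :: "'a \<Rightarrow> real"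
    proof -
      have "lie_deriv (lie_bracket (RF c) (E D)) u q = (\<Sum>D'\<in>{FT, FW 0}. \<alpha> c D D' q *\<^sub>R lie_deriv (E D') u q)"
        using lie_deriv_left_at[OF u q, where X = "lie_bracket (RF c) (E D)" and c = "\<lambda>D'. \<alpha> c D D' q" and Y = E and I = "{FT, FW 0}"]
          horizontal_bracket[OF RF_syms N_B[OF q] jD'(3), of c] unfolding \<alpha>_def by blast
      thus ?thesis using lie_deriv_lie_bracket[OF oN q smRF s(3) u, of c] by simp
    qed
    have x0: "lie_deriv (E D) (lie_deriv (RF c) x) q = 0"
    proof -
      have "lie_deriv (E D) (lie_deriv (RF c) x) q = lie_deriv (E D) (\<lambda>q. if c = FT then 1 else 0) q"
        by (rule lie_deriv_cong[OF oN q x[OF c] refl])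
      thus ?thesis by simp
    qed
    have "lie_deriv (RF c) (G j D) q = lie_deriv (RF c) (lie_deriv (E D) (f j)) q
       - (h j q * lie_deriv (RF c) (lie_deriv (E D) x) q + lie_deriv (RF c) (h j) q * lie_deriv (E D) x q)"
      unfolding G_def
      by (subst lie_deriv_diff[OF _ _ q], (intro smooth_intros oN s sx)+, subst lie_deriv_mult[OF s(2) _ q])
        (intro smooth_intros oN s sx, simp)
    also have "\<dots> = (\<Sum>D'\<in>{FT, FW 0}. \<alpha> c D D' q * G j D' q) + (\<Sum>k\<in>J. \<kappa> c j k * G k D q)"
      unfolding bb[OF s(1)] bb[OF sx] x0 rel[OF c jD'(2,3) q, symmetric] by (simp add: G_def algebra_simps)
    also have "(\<Sum>D'\<in>{FT, FW 0}. \<alpha> c D D' q * G j D' q) = (\<Sum>k\<in>J. \<Sum>D'\<in>{FT, FW 0}. (if j = k then \<alpha> c D D' q else 0) * G k D' q)"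
    proof -
      have "(\<Sum>k\<in>J. \<Sum>D'\<in>{FT, FW 0}. (if j = k then \<alpha> c D D' q else 0) * G k D' q)
        = (\<Sum>k\<in>J. if k = j then \<Sum>D'\<in>{FT, FW 0}. \<alpha> c D D' q * G k D' q else 0)" by (rule sum.cong) auto
      thus ?thesis using J jD' by simp
    qed
    also have "(\<Sum>k\<in>J. \<kappa> c j k * G k D q) = (\<Sum>k\<in>J. \<Sum>D'\<in>{FT, FW 0}. (if D = D' then \<kappa> c j k else 0) * G k D' q)"
      using jD'(3) by (intro sum.cong refl) auto
    also have "(\<Sum>k\<in>J. \<Sum>D'\<in>{FT, FW 0}. (if j = k then \<alpha> c D D' q else 0) * G k D' q) + \<dots>
        = (\<Sum>k\<in>J \<times> {FT, FW 0}. A c jD k q * (case k of (j, D) \<Rightarrow> G j D q))"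
      unfolding sum.cartesian_product' sum.distrib[symmetric] jD'(1) A_def by (simp add: distrib_right)
    finally show ?thesis by (simp add: jD'(1))
  qed
  define GG where "GG = (\<lambda>(j, D) q. G j D q)"
  have "GG (j, D) q = 0"
  proof (rule frame_system_unique[where g = GG, OF fr _ pN _ _ sA _ _ q])
    show "connected N" by simp
    show "finite (J \<times> {FT, FW 0})" using J by simp
    show "smooth_on N (GG jD)" if "jD \<in> J \<times> {FT, FW 0}" for jD using that sG by (auto simp: GG_def)
    show "lie_deriv (RF c) (GG jD) q = (\<Sum>k\<in>J \<times> {FT, FW 0}. A c jD k q * GG k q)"
      if "c \<in> I" "jD \<in> J \<times> {FT, FW 0}" "q \<in> N" for c jD q
      using sys[OF that] by (simp add: split_def GG_def)
    show "GG jD p = 0" if "jD \<in> J \<times> {FT, FW 0}" for jD using that init by (auto simp: GG_def)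
    show "(j, D) \<in> J \<times> {FT, FW 0}" using j D by simp
  qed
  thus ?thesis by (simp add: GG_def)
qed

text \<open>The contact relations of the model: the differential of \<open>co c\<close> should be
  \<open>contact co c\<close> times that of \<open>x\<close> on horizontal fields. Indices count
  down to the highest derivative, so the equation itself enters at \<open>FY 1\<close>.\<close>

definition contact :: "(leg \<Rightarrow> 'a \<Rightarrow> real) \<Rightarrow> leg \<Rightarrow> 'a \<Rightarrow> real"
  where "contact co c = (case c of FT \<Rightarrow> (\<lambda>q. 0) | FW k \<Rightarrow> co (FW (k - 1))
    | FY k \<Rightarrow> if k = 1 then (\<lambda>q. (co (FW 0) q)\<^sup>2) else co (FY (k - 1)))"

text \<open>Coordinates are prescribed by their derivatives along the frame of symmetries, which are
  copied from the symmetries of the model. The contact relations then hold at \<open>p\<close>,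
  where the horizontal fields agree with \<open>RT\<close> and \<open>RZ\<close>, and spread by
  \<open>contact_vanish\<close>.\<close>

lemma flat_coordinates:
  "\<exists>co. (\<forall>c\<in>I. smooth_on N (co c)) \<and>
    (\<forall>c\<in>I - {FT, FW 0}. \<forall>D\<in>{FT, FW 0}. \<forall>q\<in>N. lie_deriv (E D) (co c) q = contact co c q * lie_deriv (E D) (co FT) q) \<and>
    (\<forall>v. (\<forall>c\<in>I. frechet_derivative (co c) (at p) v = 0) \<longrightarrow> v = 0)"
proof -
  have oN: "open N" by simp
  note c0 = lie_deriv_const
  have "\<exists>f :: 'a \<Rightarrow> real. smooth_on N f \<and> f p = 0 \<and> (\<forall>q\<in>N. \<forall>c\<in>I. lie_deriv (RF c) f q = (if c = FT then 1 else 0))"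
    by (rule coordinate_exists[where g = "\<lambda>c q. if c = FT then 1 else 0"]) (auto simp: c0 smooth_on_const)
  then obtain x :: "'a \<Rightarrow> real" where x: "smooth_on N x" "x p = 0" "\<And>q c. q \<in> N \<Longrightarrow> c \<in> I \<Longrightarrow> lie_deriv (RF c) x q = (if c = FT then 1 else 0)"
    by blast
  define XP where "XP = xpow x"
  note sXP = smooth_on_xpow[OF oN x(1), folded XP_def]
  have DXP: "lie_deriv X (XP i k) q = - XP (Suc i) k q * lie_deriv X x q" if "q \<in> N" for X i k q
    unfolding XP_def by (rule lie_deriv_xpow[OF x(1) that])
  have XPt: "k < i \<Longrightarrow> XP i k q = 0" for i k q by (simp add: XP_def xpow_def)
  have XPs: "XP (Suc i) (Suc k) q = - XP i k q" for i k q by (simp add: XP_def xpow_def)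
  have XPp: "XP i k p = (if i = k then (- 1) ^ k else 0)" for i k by (auto simp: XP_def xpow_def x(2))
  have XR: "lie_deriv RT (XP i k) q = - XP (Suc i) k q" "j \<le> n \<Longrightarrow> lie_deriv (RW j) (XP i k) q = 0"
     "1 \<le> j \<Longrightarrow> j \<le> m \<Longrightarrow> lie_deriv (RY j) (XP i k) q = 0" if "q \<in> N" for i j k q
    using x(3)[OF that, of FT] x(3)[OF that, of "FW j"] x(3)[OF that, of "FY j"] by (auto simp: DXP[OF that])
  have ZX: "lie_deriv RZ (XP i k) q = 0" if "q \<in> N" for i k q using XR(2)[OF that, of 0] by simp
  \<comment> \<open>In the model the symmetries \<open>RW i\<close> add polynomials in
    \<open>x\<close> to \<open>z\<close>, while \<open>RT\<close> and the \<open>RY i\<close> leave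
    the \<open>z\<close>-coordinates fixed.\<close>
  define gz where "gz = (\<lambda>k c. case c of FT \<Rightarrow> (\<lambda>q. 0) | FW i \<Rightarrow> XP i k | FY i \<Rightarrow> (\<lambda>q. 0))"
  have "\<exists>f. smooth_on N f \<and> f p = 0 \<and> (\<forall>q\<in>N. \<forall>c\<in>I. lie_deriv (RF c) f q = gz k c q)" if k: "k \<le> n" for k
  proof (rule coordinate_exists)
    show "smooth_on N (gz k c)" for c by (cases c) (auto simp: gz_def smooth_on_const sXP)
    show "lie_deriv (RW i) (gz k FT) q - lie_deriv RT (gz k (FW i)) q = (if FW (Suc i) \<in> I then gz k (FW (Suc i)) q else 0)"
      if "i \<le> n" "q \<in> N" for i q
      using that XPt[of k "Suc i"] k by (auto simp: gz_def c0 XR)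
  qed (auto simp: gz_def c0 XR ZX)
  then obtain zc where zc: "\<And>k. k \<le> n \<Longrightarrow> smooth_on N (zc k)" "\<And>k. k \<le> n \<Longrightarrow> zc k p = 0"
    "\<And>k q c. k \<le> n \<Longrightarrow> q \<in> N \<Longrightarrow> c \<in> I \<Longrightarrow> lie_deriv (RF c) (zc k) q = gz k c q" by metis
  have ZR: "lie_deriv RT (zc k) q = 0" "j \<le> n \<Longrightarrow> lie_deriv (RW j) (zc k) q = XP j k q" "lie_deriv RZ (zc k) q = XP 0 k q"
     "1 \<le> j \<Longrightarrow> j \<le> m \<Longrightarrow> lie_deriv (RY j) (zc k) q = 0" if "q \<in> N" "k \<le> n" for j k q
    using zc(3)[OF that(2,1), of FT] zc(3)[OF that(2,1), of "FW j"] zc(3)[OF that(2,1), of "FW 0"] zc(3)[OF that(2,1), of "FY j"]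
    by (auto simp: gz_def)
  \<comment> \<open>Adding a function to \<open>z\<close> changes the square of its highest
    derivative to first order by twice a product. Hence \<open>2 * zc k\<close> along
    \<open>RZ\<close>; compatibility with the brackets of \<open>RZ\<close> and \<open>RW i\<close>
    then forces the factor -2 along \<open>RY i\<close>.\<close>
  define gy where "gy = (\<lambda>k c. case c of FT \<Rightarrow> (\<lambda>q. 0) | FW i \<Rightarrow> (\<lambda>q. if i = 0 then 2 * zc k q else 0) | FY i \<Rightarrow> (\<lambda>q. - 2 * XP i k q))"
  have D2: "lie_deriv X (\<lambda>q. s * u q) q = s * lie_deriv X u q" if "smooth_on N u" "q \<in> N" for X s q and u :: "'a \<Rightarrow> real"
    using lie_deriv_mult[OF smooth_on_const that, of X s] by (simp add: c0)
  have D2n: "lie_deriv X (\<lambda>q. - (2 * XP i k q)) q = - (2 * lie_deriv X (XP i k) q)" if "q \<in> N" for X i k q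
    using D2[OF sXP that, of X "- 2"] by simp
  have "\<exists>f. smooth_on N f \<and> f p = 0 \<and> (\<forall>q\<in>N. \<forall>c\<in>I. lie_deriv (RF c) f q = gy k c q)" if k: "k \<le> m" for k
  proof (rule coordinate_exists)
    have kn: "k \<le> n" using k mn by simp
    show "smooth_on N (gy k c)" for c
    proof (cases c)
      case (FW i)
      thus ?thesis by (cases "i = 0") (auto simp: gy_def intro!: smooth_intros oN zc(1) kn)
    qed (auto simp: gy_def intro!: smooth_intros oN sXP)
    show "lie_deriv (RW i) (gy k FT) q - lie_deriv RT (gy k (FW i)) q = (if FW (Suc i) \<in> I then gy k (FW (Suc i)) q else 0)"
      if "i \<le> n" "q \<in> N" for i q
      using that by (cases "i = 0") (auto simp: gy_def c0 D2[OF zc(1)[OF kn]] ZR kn)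
    show "lie_deriv (RY i) (gy k FT) q - lie_deriv RT (gy k (FY i)) q = (if FY (Suc i) \<in> I then gy k (FY (Suc i)) q else 0)"
      if "1 \<le> i" "i \<le> m" "q \<in> N" for i q
      using that XPt[of k "Suc i"] k by (auto simp: gy_def c0 D2n XR)
    show "lie_deriv RZ (gy k (FW i)) q - lie_deriv (RW i) (gy k (FW 0)) q = (if FY i \<in> I then gy k (FY i) q else 0)"
      if "1 \<le> i" "i \<le> n" "q \<in> N" for i q
      using that XPt[of k i] k by (auto simp: gy_def c0 D2[OF zc(1)[OF kn]] ZR kn)
    show "lie_deriv (RW i) (gy k (FY j)) q = lie_deriv (RY j) (gy k (FW i)) q" if "i \<le> n" "1 \<le> j" "j \<le> m" "q \<in> N" for i j q
      using that by (cases "i = 0") (auto simp: gy_def c0 D2n D2[OF zc(1)[OF kn]] XR ZX ZR kn)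
  qed (auto simp: gy_def c0 D2n XR)
  then obtain yc where yc: "\<And>k. k \<le> m \<Longrightarrow> smooth_on N (yc k)" "\<And>k. k \<le> m \<Longrightarrow> yc k p = 0"
    "\<And>k q c. k \<le> m \<Longrightarrow> q \<in> N \<Longrightarrow> c \<in> I \<Longrightarrow> lie_deriv (RF c) (yc k) q = gy k c q" by metis
  define co where "co = (\<lambda>c. case c of FT \<Rightarrow> x | FW k \<Rightarrow> zc k | FY k \<Rightarrow> yc k)"
  define gv where "gv = (\<lambda>c. case c of FT \<Rightarrow> (\<lambda>d q. if d = FT then 1 else 0) | FW k \<Rightarrow> gz k | FY k \<Rightarrow> gy k)"
  have sco: "smooth_on N (co c)" if "c \<in> I" for c using that x(1) zc(1) yc(1) by (cases c) (auto simp: co_def)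
  have Rco: "lie_deriv (RF d) (co c) q = gv c d q" if "c \<in> I" "d \<in> I" "q \<in> N" for c d q
    using that x(3)[of q d] zc(3)[of _ q d] yc(3)[of _ q d] by (cases c) (auto simp: co_def gv_def)
  have z0: "zc 0 = co (FW 0)" by (simp add: co_def)
  have sq: "lie_deriv X (\<lambda>q. (zc 0 q)\<^sup>2) q = 2 * zc 0 q * lie_deriv X (zc 0) q" if "q \<in> N" for X q
    using lie_deriv_mult[OF zc(1) zc(1) that, of 0 0 X] by (simp add: power2_eq_square)
  let ?J = "I - {FT, FW 0}"
  let ?G = "\<lambda>j D q. lie_deriv (E D) (co j) q - contact co j q * lie_deriv (E D) x q"
  have "?G j D q = 0" if j: "j \<in> ?J" and D: "D \<in> {FT, FW 0}" and q: "q \<in> N" for j D q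
  proof (rule contact_vanish[where f = co and h = "contact co" and x = x and J = ?J, OF _ _ _ x(1) x(3) _ _ q j D])
    show "finite ?J" by simp
    show "smooth_on N (co j)" if "j \<in> ?J" for j using that sco by simp
    show "smooth_on N (contact co j)" if "j \<in> ?J" for j
    proof (cases j)
      case FT
      thus ?thesis using that by simp
    next
      case (FW k)
      thus ?thesis using that sco[of "FW (k - 1)"] by (auto simp: contact_def)
    next
      case (FY k)
      have "k \<noteq> 1 \<Longrightarrow> FY (k - 1) \<in> I" using FY that by auto
      thus ?thesis using FY sco[of "FY (k - 1)"] sco[of "FW 0"] by (auto simp: contact_def intro!: smooth_intros oN)
    qed
    have val: "lie_deriv (E FT) u p = lie_deriv RT u p" "lie_deriv (E (FW 0)) u p = lie_deriv RZ u p" for u :: "'a \<Rightarrow> real"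
      using RT(2) RZ(2) by (simp_all add: lie_deriv_def)
    have cp: "contact co j p = 0" if "j \<in> ?J" for j
      using that zc(2) yc(2) by (cases j) (auto simp: contact_def co_def)
    have Rp: "lie_deriv RT (co j) p = 0" "lie_deriv RZ (co j) p = 0" if "j \<in> ?J" for j
      using that Rco[of j FT p] Rco[of j "FW 0" p] pN zc(2) mn by (cases j; auto simp: gv_def gz_def gy_def XPp)+
    show "?G j D p = 0" if "j \<in> ?J" "D \<in> {FT, FW 0}" for j D using that Rp cp by (auto simp: val)
    \<comment> \<open>Along \<open>RZ\<close> the contact form of \<open>FY i\<close> changes by
      twice the contact form of \<open>FW i\<close>; all other derivatives of contact forms along
      the frame vanish.\<close>
    show "lie_deriv (E D) (lie_deriv (RF c) (co j)) q - lie_deriv (RF c) (contact co j) q * lie_deriv (E D) x q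
      = (\<Sum>k\<in>?J. (case j of FY i \<Rightarrow> if c = FW 0 \<and> k = FW i then 2 else 0 | _ \<Rightarrow> 0) * ?G k D q)"
      if c: "c \<in> I" and j: "j \<in> ?J" and D: "D \<in> {FT, FW 0}" and q: "q \<in> N" for c j D q
    proof -
      have 1: "lie_deriv (E D) (lie_deriv (RF c) (co j)) q = lie_deriv (E D) (gv j c) q"
        by (rule lie_deriv_cong[OF oN q _ refl]) (use Rco j c in auto)
      show ?thesis
      proof (cases j)
        case FT
        thus ?thesis using j by simp
      next
        case (FW k)
        then obtain k' where k: "k = Suc k'" "Suc k' \<le> n" using j by (cases k) auto
        have "lie_deriv (RF c) (contact co j) q = gz k' c q" using FW k zc(3)[OF _ q c, of k'] by (simp add: contact_def co_def)
        thus ?thesis unfolding 1 using FW k by (cases c) (auto simp: gv_def gz_def c0 DXP[OF q] XPs)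
      next
        case (FY k)
        then obtain k' where k: "k = Suc k'" "Suc k' \<le> m" "Suc k' \<le> n" using j mn by (cases k) auto
        have sum: "(\<Sum>k\<in>?J. (case j of FY i \<Rightarrow> if c = FW 0 \<and> k = FW i then 2 else 0 | _ \<Rightarrow> 0) * ?G k D q)
          = (if c = FW 0 then 2 * ?G (FW (Suc k')) D q else 0)"
        proof -
          have "(\<Sum>k\<in>?J. (case j of FY i \<Rightarrow> if c = FW 0 \<and> k = FW i then 2 else 0 | _ \<Rightarrow> 0) * ?G k D q)
            = (\<Sum>k\<in>?J. if k = FW (Suc k') then if c = FW 0 then 2 * ?G k D q else 0 else 0)"
            by (rule sum.cong) (auto simp: FY k)
          thus ?thesis using k by simp
        qed
        have h: "lie_deriv (RF c) (contact co j) q = (if k' = 0 then 2 * zc 0 q * gz 0 c q else gy k' c q)"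
          using FY k zc(3)[OF _ q c, of 0] yc(3)[OF _ q c, of k'] sq[OF q, of "RF c"] by (simp add: contact_def co_def)
        show ?thesis
        proof (cases c)
          case FT
          thus ?thesis unfolding 1 sum h by (simp add: FY gv_def gy_def gz_def c0)
        next
          case (FW i)
          thus ?thesis
          proof (cases "i = 0")
            case True
            thus ?thesis unfolding 1 sum h using FW k
              by (simp add: FY gv_def gy_def gz_def D2[OF zc(1) q] contact_def co_def XP_def xpow_def algebra_simps)
          next
            case False
            thus ?thesis unfolding 1 sum h using FW k XPt[of 0 i q] by (simp add: FY gv_def gy_def gz_def c0)
          qed
        next
          case (FY i)
          hence i: "1 \<le> i" using c by auto
          show ?thesis unfolding 1 sum h using FY i k XPt[of "Suc 0" "Suc i" q]
            by (simp add: \<open>j = FY k\<close> gv_def gy_def gz_def D2n[OF q] DXP[OF q] XPs)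
        qed
      qed
    qed
  qed
  moreover have "v = 0" if v: "\<And>c. c \<in> I \<Longrightarrow> frechet_derivative (co c) (at p) v = 0" for v
  proof -
    have rv: "v = (\<Sum>d\<in>I. (\<rho> d p \<bullet> v) *\<^sub>R RF d p)" using fr pN by (simp add: smooth_frame_def)
    have e: "(\<Sum>d\<in>I. (\<rho> d p \<bullet> v) * gv c d p) = 0" if "c \<in> I" for c
    proof -
      have "lie_deriv (\<lambda>_. v) (co c) p = (\<Sum>d\<in>I. (\<rho> d p \<bullet> v) *\<^sub>R lie_deriv (RF d) (co c) p)"
        using lie_deriv_left_at[OF sco[OF that] pN, where X = "\<lambda>_. v" and c = "\<lambda>d. \<rho> d p \<bullet> v" and Y = RF and I = I] rv by blast
      thus ?thesis using v[OF that] Rco[OF that _ pN] by (simp add: lie_deriv_def)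
    qed
    have "\<rho> c p \<bullet> v = 0" if c: "c \<in> I" for c
    proof -
      \<comment> \<open>The coordinates vanish at \<open>p\<close>, so there the matrix of
        prescribed derivatives is diagonal with nonzero entries.\<close>
      have "\<exists>s. s \<noteq> 0 \<and> (\<forall>d\<in>I. gv c d p = (if d = c then s else 0))"
      proof (cases c)
        case FT
        thus ?thesis by (auto simp: gv_def intro!: exI[of _ 1])
      next
        case (FW k)
        thus ?thesis by (intro exI[of _ "(- 1) ^ k"]) (auto simp: gv_def gz_def XPp split: leg.split)
      next
        case (FY k)
        hence "zc k p = 0" using zc(2)[of k] c mn by simp
        thus ?thesis using FY by (intro exI[of _ "- 2 * (- 1) ^ k"]) (auto simp: gv_def gy_def XPp split: leg.split)
      qed
      then obtain s where s: "s \<noteq> 0" "\<And>d. d \<in> I \<Longrightarrow> gv c d p = (if d = c then s else 0)" by blast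
      have "(\<Sum>d\<in>I. (\<rho> d p \<bullet> v) * gv c d p) = (\<Sum>d\<in>I. if d = c then (\<rho> d p \<bullet> v) * s else 0)" by (rule sum.cong) (auto simp: s(2))
      thus ?thesis using e[OF c] s(1) c by simp
    qed
    thus "v = 0" using rv by simp
  qed
  ultimately show ?thesis using sco by (intro exI[of _ co]) (auto simp: co_def)
qed

end

text \<open>An injective image of the horizontal plane that lies in a span of two vectors fills it,
  by dimension.\<close>

lemma (in adapted_frame) horizontal_image:
  fixes f :: "'a \<Rightarrow> 'a"
  assumes q: "q \<in> B" and f: "linear f" "inj f" "f (E FT q) \<in> span {a, b}" "f (E (FW 0) q) \<in> span {a, b}"
  shows "f ` span {E FT q, E (FW 0) q} = span {a, b}"
proof -
  have dual': "eps FT q \<bullet> E FT q = 1" "eps FT q \<bullet> E (FW 0) q = 0" "eps (FW 0) q \<bullet> E (FW 0) q = 1"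
    using dual[OF q, of FT FT] dual[OF q, of FT "FW 0"] dual[OF q, of "FW 0" "FW 0"] by simp_all
  have ind: "independent {E FT q, E (FW 0) q}" "E FT q \<noteq> E (FW 0) q"
  proof -
    have "E (FW 0) q \<noteq> 0" using dual'(3) by (metis inner_zero_right zero_neq_one)
    moreover have "E FT q \<notin> span {E (FW 0) q}"
      using dual' by (metis inner_scaleR_right mult_zero_right span_breakdown_eq span_empty singletonD right_minus_eq zero_neq_one)
    ultimately show "independent {E FT q, E (FW 0) q}" "E FT q \<noteq> E (FW 0) q"
      by (auto simp: independent_insert span_base)
  qed
  show ?thesis
    unfolding linear_span_image[OF f(1), symmetric]
  proof (rule subspace_dim_equal)
    show "span (f ` {E FT q, E (FW 0) q}) \<subseteq> span {a, b}"
      by (rule span_minimal) (use f(3,4) in auto)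
    have "dim (span {a, b}) \<le> card {a, b}"
      unfolding dim_span by (rule dim_le_card') simp
    also have "\<dots> \<le> 2" by (simp add: card_insert_le_m1)
    also have "2 = dim {E FT q, E (FW 0) q}" using dim_eq_card_independent[OF ind(1)] ind(2) by simp
    also have "\<dots> = dim (f ` {E FT q, E (FW 0) q})"
      by (rule dim_image_eq[OF f(1), symmetric]) (rule inj_on_subset[OF f(2)], simp)
    finally show "dim (span {a, b}) \<le> dim (span (f ` {E FT q, E (FW 0) q}))" by simp
  qed simp_all
qed

context monge
begin

primrec ev :: "leg \<Rightarrow> 'a" where "ev FT = d_x e" | "ev (FW k) = zz k" | "ev (FY k) = yy k"

lemma ev_inner: "c \<in> legs m n \<Longrightarrow> d \<in> legs m n \<Longrightarrow> ev c \<bullet> ev d = (if c = d then 1 else 0)"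
  by (cases c; cases d) (auto simp: zz_def yy_def d_x_def d_y_def d_z_def e_inner)

lemma sum_legs: "(\<Sum>c\<in>legs m n. g c) = g FT + (\<Sum>k\<le>n. g (FW k)) + (\<Sum>k=1..m. (g (FY k) :: 'b::comm_monoid_add))"
proof -
  have "(\<Sum>c\<in>legs m n. g c) = g FT + (\<Sum>c\<in>FW ` {..n} \<union> FY ` {1..m}. g c)"
    unfolding legs_def by (subst sum.insert) auto
  also have "(\<Sum>c\<in>FW ` {..n} \<union> FY ` {1..m}. g c) = (\<Sum>c\<in>FW ` {..n}. g c) + (\<Sum>c\<in>FY ` {1..m}. g c)"
    by (rule sum.union_disjoint) auto
  finally show ?thesis by (simp add: sum.reindex inj_on_def add.assoc)
qed

definition cc :: "leg \<Rightarrow> 'a \<Rightarrow> real" where "cc c q = q \<bullet> ev c"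

text \<open>The contact coefficients of the model in its own coordinates, that is, the components of
  its total derivative apart from those of \<open>x\<close> and of the highest derivative of
  \<open>z\<close>.\<close>

definition pr :: "leg \<Rightarrow> 'a \<Rightarrow> real"
  where "pr c q = (case c of FT \<Rightarrow> 0 | FW k \<Rightarrow> cc (FW (k - 1)) q
    | FY k \<Rightarrow> if k = 1 then (cc (FW 0) q)\<^sup>2 else cc (FY (k - 1)) q)"

lemma model_total:
  "total_derivative m n e (model_rhs m n e) q = ev FT + (\<Sum>c\<in>legs m n - {FT, FW 0}. pr c q *\<^sub>R ev c)"
proof -
  let ?g = "\<lambda>c. if c \<in> {FT, FW 0} then 0 else pr c q *\<^sub>R ev c"
  have "(\<Sum>c\<in>legs m n - {FT, FW 0}. pr c q *\<^sub>R ev c) = (\<Sum>c\<in>legs m n. ?g c)"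
    by (rule sum.mono_neutral_cong_left) auto
  also have "\<dots> = (\<Sum>k\<le>n. ?g (FW k)) + (\<Sum>k=1..m. ?g (FY k))" by (simp add: sum_legs)
  also have "(\<Sum>k\<le>n. ?g (FW k)) = (\<Sum>k<n. ?g (FW (Suc k)))" by (subst sum.atMost_shift) simp
  also have "\<dots> = (\<Sum>k<n. ?g (FW (Suc (n - Suc k))))" by (rule sum.nat_diff_reindex[symmetric])
  also have "\<dots> = (\<Sum>j<n. coord_z m e (j + 1) q *\<^sub>R d_z m e j)"
  proof (rule sum.cong[OF refl])
    fix j assume "j \<in> {..<n}"
    hence j: "j < n" "Suc (n - Suc j) = n - j" by auto
    thus "?g (FW (Suc (n - Suc j))) = coord_z m e (j + 1) q *\<^sub>R d_z m e j"
      using j by (simp add: pr_def cc_def zz_def coord_z_def)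
  qed
  also have "(\<Sum>k=1..m. ?g (FY k)) = (\<Sum>k<m. ?g (FY (Suc k)))" by (simp add: sum.atLeast1_atMost_eq)
  also have "\<dots> = ?g (FY 1) + (\<Sum>k<m - 1. ?g (FY (Suc (Suc k))))"
    using mn(1) by (subst Suc_pred'[of m], simp, subst sum.lessThan_Suc_shift) simp
  also have "(\<Sum>k<m - 1. ?g (FY (Suc (Suc k)))) = (\<Sum>k<m - 1. ?g (FY (Suc (Suc (m - 1 - Suc k)))))"
    by (rule sum.nat_diff_reindex[symmetric])
  also have "\<dots> = (\<Sum>i<m - 1. coord_y e (i + 1) q *\<^sub>R d_y e i)"
  proof (rule sum.cong[OF refl])
    fix i assume "i \<in> {..<m - 1}"
    hence i: "Suc i < m" "Suc (Suc (m - 1 - Suc i)) = m - i" "Suc 0 \<le> m - Suc i" by auto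
    thus "?g (FY (Suc (Suc (m - 1 - Suc i)))) = coord_y e (i + 1) q *\<^sub>R d_y e i"
      unfolding i(2) using i by (simp add: pr_def cc_def yy_def coord_y_def)
  qed
  also have "?g (FY 1) = model_rhs m n e q *\<^sub>R d_y e (m - 1)"
    using mn(1) by (simp add: pr_def cc_def yy_def model_rhs_def coord_z_def zz_def)
  finally show ?thesis by (simp add: total_derivative_def algebra_simps)
qed

text \<open>The map with components \<open>co\<close> is a local diffeomorphism as its differential
  at \<open>p\<close> is injective. The contact relations say that the image of a horizontal vector
  is a combination of the model's total derivative and the direction of its highest derivative of
  \<open>z\<close>.\<close>

theorem flat_equivalence:
  assumes "flat_frame B mframe eps m n p RT RZ r \<rho>" and BU: "B \<subseteq> U"
  shows "internally_equivalent_at m n e p U F UNIV (model_rhs m n e)"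
proof -
  interpret flat_frame B mframe eps m n p RT RZ r \<rho> by fact
  let ?I = "legs m n"
  obtain co where sco: "\<And>c. c \<in> ?I \<Longrightarrow> smooth_on N (co c)"
    and con: "\<And>c D q. c \<in> ?I - {FT, FW 0} \<Longrightarrow> D \<in> {FT, FW 0} \<Longrightarrow> q \<in> N \<Longrightarrow>
      lie_deriv (mframe D) (co c) q = contact co c q * lie_deriv (mframe D) (co FT) q"
    and inj: "\<And>v. (\<And>c. c \<in> ?I \<Longrightarrow> frechet_derivative (co c) (at p) v = 0) \<Longrightarrow> v = 0"
    using flat_coordinates by metis
  define \<Phi> where "\<Phi> = (\<lambda>q. \<Sum>c\<in>?I. co c q *\<^sub>R ev c)"
  have oN: "open N" by simp
  have s\<Phi>: "smooth_on N \<Phi>" unfolding \<Phi>_def by (intro smooth_intros oN sco)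
  have D\<Phi>: "frechet_derivative \<Phi> (at q) v = (\<Sum>c\<in>?I. frechet_derivative (co c) (at q) v *\<^sub>R ev c)" if q: "q \<in> N" for q v
  proof -
    have "(\<Phi> has_derivative (\<lambda>v. \<Sum>c\<in>?I. frechet_derivative (co c) (at q) v *\<^sub>R ev c)) (at q)"
      unfolding \<Phi>_def
    proof (rule has_derivative_sum)
      fix c assume "c \<in> ?I"
      thus "((\<lambda>q. co c q *\<^sub>R ev c) has_derivative (\<lambda>v. frechet_derivative (co c) (at q) v *\<^sub>R ev c)) (at q)"
        by (intro has_derivative_scaleR_left[OF smooth_on_has_derivative[OF sco q]])
    qed
    from fun_cong[OF frechet_derivative_at[OF this], of v] show ?thesis by simp
  qed
  have lin: "linear (frechet_derivative \<Phi> (at q))" if "q \<in> N" for q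
    by (rule frechet_derivative_linear[OF smooth_on_differentiable[OF s\<Phi> that]])
  have \<Phi>ev: "\<Phi> q \<bullet> ev c = co c q" if "c \<in> ?I" for c q
  proof -
    have "\<Phi> q \<bullet> ev c = (\<Sum>d\<in>?I. if d = c then co d q else 0)"
      unfolding \<Phi>_def inner_sum_left by (rule sum.cong) (auto simp: ev_inner that)
    thus ?thesis using that by simp
  qed
  have "inj (frechet_derivative \<Phi> (at p))"
    unfolding linear_injective_0[OF lin[OF pN]]
  proof (intro allI impI)
    fix v assume v: "frechet_derivative \<Phi> (at p) v = 0"
    show "v = 0"
    proof (rule inj)
      fix c assume c: "c \<in> ?I"
      have "frechet_derivative \<Phi> (at p) v \<bullet> ev c = (\<Sum>d\<in>?I. if d = c then frechet_derivative (co d) (at p) v else 0)"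
        unfolding D\<Phi>[OF pN] inner_sum_left by (rule sum.cong) (auto simp: ev_inner c)
      thus "frechet_derivative (co c) (at p) v = 0" using c v by simp
    qed
  qed
  from smooth_inverse_function[OF oN pN s\<Phi> this] obtain V V' g where
    V: "p \<in> V" "V \<subseteq> N" "diffeomorphism V V' \<Phi> g" "\<And>q. q \<in> V \<Longrightarrow> inj (frechet_derivative \<Phi> (at q))" by blast
  have "contact co c q = pr c (\<Phi> q)" if c: "c \<in> ?I - {FT, FW 0}" for c q
  proof (cases c)
    case (FY k)
    hence "k \<noteq> 1 \<Longrightarrow> FY (k - 1) \<in> ?I" using c by auto
    thus ?thesis using \<Phi>ev[of "FW 0"] \<Phi>ev[of "FY (k - 1)"] FY by (auto simp: contact_def pr_def cc_def)
  qed (use c \<Phi>ev[of "FW (_ - 1)"] in \<open>auto simp: contact_def pr_def cc_def\<close>)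
  hence T: "total_derivative m n e (model_rhs m n e) (\<Phi> q) = ev FT + (\<Sum>c\<in>?I - {FT, FW 0}. contact co c q *\<^sub>R ev c)" for q
    unfolding model_total by simp
  have "frechet_derivative \<Phi> (at q) ` monge_distribution m n e F q = monge_distribution m n e (model_rhs m n e) (\<Phi> q)"
    if qV: "q \<in> V" for q
  proof -
    have q: "q \<in> N" using qV V(2) by blast
    let ?f = "frechet_derivative \<Phi> (at q)"
    let ?\<Delta> = "monge_distribution m n e (model_rhs m n e) (\<Phi> q)"
    have sub: "?f (mframe D q) \<in> ?\<Delta>" if D: "D \<in> {FT, FW 0}" for D
    proof -
      let ?L = "\<lambda>c. lie_deriv (mframe D) (co c) q"
      have "?f (mframe D q) = (\<Sum>c\<in>?I. ?L c *\<^sub>R ev c)" by (simp add: D\<Phi>[OF q] lie_deriv_def)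
      also have "\<dots> = ?L FT *\<^sub>R ev FT + ?L (FW 0) *\<^sub>R ev (FW 0) + (\<Sum>c\<in>?I - {FT, FW 0}. ?L c *\<^sub>R ev c)"
        by (subst sum.remove[of _ FT], simp, simp, subst sum.remove[of _ "FW 0"]) (auto simp: insert_commute Diff_insert[symmetric] add.assoc)
      also have "(\<Sum>c\<in>?I - {FT, FW 0}. ?L c *\<^sub>R ev c) = ?L FT *\<^sub>R (\<Sum>c\<in>?I - {FT, FW 0}. contact co c q *\<^sub>R ev c)"
        using con[OF _ D q] by (simp add: scaleR_sum_right mult.commute)
      finally have "?f (mframe D q) = ?L FT *\<^sub>R total_derivative m n e (model_rhs m n e) (\<Phi> q) + ?L (FW 0) *\<^sub>R d_z m e n"
        unfolding T by (simp add: algebra_simps zz_def)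
      thus ?thesis unfolding monge_distribution_def by (auto intro!: span_add span_scale intro: span_base)
    qed
    have "?f ` span {mframe FT q, mframe (FW 0) q} = ?\<Delta>"
      unfolding monge_distribution_def
      by (rule horizontal_image[OF N_B[OF q] lin[OF q] V(4)[OF qV]])
        (use sub[of FT] sub[of "FW 0"] in \<open>simp_all only: monge_distribution_def insert_iff simp_thms\<close>)
    thus ?thesis by (simp only: span_mframe_horizontal)
  qed
  moreover have "V \<subseteq> U" using V(2) r(2) BU by blast
  ultimately show ?thesis using V(1,3)
    unfolding internally_equivalent_at_def locally_equivalent_at_def carries_distribution_def by blast
qed

lemma maximal_equivalence:
  assumes "maximal_symmetry B mframe eps m n p" and BU: "B \<subseteq> U"
  shows "internally_equivalent_at m n e p U F UNIV (model_rhs m n e)"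
proof -
  interpret maximal_symmetry B mframe eps m n p by fact
  obtain RT RZ where fl: "flat_symmetries B mframe eps m n p RT RZ" using flat_symmetries_exist by blast
  interpret flat_symmetries B mframe eps m n p RT RZ by fact
  obtain r \<rho> where "0 < r" "ball p r \<subseteq> B" "smooth_frame (ball p r) (legs m n) (rF RT RZ) \<rho>"
    using local_frame[OF RT(1,2) RZ(1,2)] by blast
  hence "flat_frame B mframe eps m n p RT RZ r \<rho>"
    using fl by (simp add: flat_frame_def flat_frame_axioms_def)
  thus ?thesis by (rule flat_equivalence[OF _ BU])
qed

end

section \<open>Flows of infinitesimal symmetries\<close>

lemma partial_derivatives:
  fixes g :: "real \<times> 'a::euclidean_space \<Rightarrow> 'b::euclidean_space"
  assumes g: "smooth_on S g" and s: "(t, q) \<in> S"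
  shows "((\<lambda>t. g (t, q)) has_vector_derivative dir_deriv (1, 0) g (t, q)) (at t)"
    and "((\<lambda>q. g (t, q)) has_derivative (\<lambda>v. dir_deriv (0, v) g (t, q))) (at q)"
proof -
  note d = smooth_on_has_derivative[OF g s]
  have l: "linear (frechet_derivative g (at (t, q)))" using has_derivative_linear[OF d] .
  have 1: "((\<lambda>t. (t, q)) has_derivative (\<lambda>h. (h, 0))) (at t)" and 2: "((\<lambda>q. (t, q)) has_derivative (\<lambda>v. (0, v))) (at q)"
    by (auto intro!: derivative_eq_intros)
  have "((\<lambda>t. g (t, q)) has_derivative (\<lambda>h. frechet_derivative g (at (t, q)) (h, 0))) (at t)"
    using has_derivative_compose[OF 1, of g] d by simp
  moreover have "frechet_derivative g (at (t, q)) (h, 0) = h *\<^sub>R dir_deriv (1, 0) g (t, q)" for h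
    using linear_scale[OF l, of h "(1, 0)"] by (simp add: dir_deriv_def)
  ultimately show "((\<lambda>t. g (t, q)) has_vector_derivative dir_deriv (1, 0) g (t, q)) (at t)"
    by (simp add: has_vector_derivative_def)
  show "((\<lambda>q. g (t, q)) has_derivative (\<lambda>v. dir_deriv (0, v) g (t, q))) (at q)"
    using has_derivative_compose[OF 2, of g] d by (simp add: dir_deriv_def)
qed

lemma smooth_on_along:
  assumes "(\<gamma> has_vector_derivative v) (at t)" "smooth_on B g" "\<gamma> t \<in> B"
  shows "((\<lambda>s. g (\<gamma> s)) has_vector_derivative frechet_derivative g (at (\<gamma> t)) v) (at t)"
proof -
  note d = smooth_on_has_derivative[OF assms(2,3)]
  have "((\<lambda>s. g (\<gamma> s)) has_derivative (\<lambda>x. frechet_derivative g (at (\<gamma> t)) (x *\<^sub>R v))) (at t)"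
    by (rule has_derivative_compose[OF assms(1)[unfolded has_vector_derivative_def] d])
  thus ?thesis by (simp add: has_vector_derivative_def linear_cmul[OF has_derivative_linear[OF d]])
qed

text \<open>The variational equation, from the symmetry of mixed partial derivatives.\<close>

lemma flow_variation:
  fixes X :: "'a::euclidean_space \<Rightarrow> 'a"
  assumes fl: "local_flow X V W eps \<phi>" and W: "open W" "W \<subseteq> V" and V: "open V" and X: "smooth_on V X"
    and t: "t \<in> {- eps<..<eps}" and q: "q \<in> W"
  defines "\<Phi> \<equiv> \<lambda>(t, q). \<phi> t q"
  shows "frechet_derivative (\<phi> t) (at q) v = dir_deriv (0, v) \<Phi> (t, q)"
    and "((\<lambda>t. dir_deriv (0, v) \<Phi> (t, q)) has_vector_derivative frechet_derivative X (at (\<phi> t q)) (dir_deriv (0, v) \<Phi> (t, q))) (at t)"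
proof -
  let ?S = "{- eps<..<eps} \<times> W"
  have S: "open ?S" using W by (simp add: open_Times)
  have s: "smooth_on ?S \<Phi>" using fl by (simp add: local_flow_def \<Phi>_def)
  have tq: "(t, q) \<in> ?S" using t q by simp
  show fr: "frechet_derivative (\<phi> t) (at q) v = dir_deriv (0, v) \<Phi> (t, q)" for v
    using fun_cong[OF frechet_derivative_at[OF partial_derivatives(2)[OF s tq]], of v] by (simp add: \<Phi>_def)
  have Xq: "dir_deriv (1, 0) \<Phi> (t, q') = X (\<phi> t q')" if "q' \<in> W" for q'
  proof -
    have "(t, q') \<in> ?S" using that t by simp
    from partial_derivatives(1)[OF s this] have "((\<lambda>s. \<phi> s q') has_vector_derivative dir_deriv (1, 0) \<Phi> (t, q')) (at t)"
      by (simp add: \<Phi>_def)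
    moreover have "((\<lambda>s. \<phi> s q') has_vector_derivative X (\<phi> t q')) (at t)" using fl that t by (simp add: local_flow_def)
    ultimately show ?thesis by (rule vector_derivative_unique_at)
  qed
  have \<phi>V: "\<phi> t q \<in> V" using fl t q by (simp add: local_flow_def)
  have "((\<lambda>q. X (\<phi> t q)) has_derivative (\<lambda>v. dir_deriv (0, v) (dir_deriv (1, 0) \<Phi>) (t, q))) (at q)"
    by (rule has_derivative_transform_within_open[OF partial_derivatives(2)[OF smooth_on_dir_deriv[OF s] tq] W(1) q Xq])
  moreover have "((\<lambda>q. X (\<phi> t q)) has_derivative (\<lambda>v. frechet_derivative X (at (\<phi> t q)) (dir_deriv (0, v) \<Phi> (t, q)))) (at q)"
    using has_derivative_compose[OF partial_derivatives(2)[OF s tq], of X] smooth_on_has_derivative[OF X \<phi>V] by (simp add: \<Phi>_def)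
  ultimately have "(\<lambda>v. dir_deriv (0, v) (dir_deriv (1, 0) \<Phi>) (t, q)) = (\<lambda>v. frechet_derivative X (at (\<phi> t q)) (dir_deriv (0, v) \<Phi> (t, q)))"
    by (rule has_derivative_unique)
  hence "dir_deriv (1, 0) (dir_deriv (0, v) \<Phi>) (t, q) = frechet_derivative X (at (\<phi> t q)) (dir_deriv (0, v) \<Phi> (t, q))"
    unfolding dir_deriv_commute[OF S tq s, of "(1, 0)" "(0, v)"] by (rule fun_cong)
  thus "((\<lambda>t. dir_deriv (0, v) \<Phi> (t, q)) has_vector_derivative frechet_derivative X (at (\<phi> t q)) (dir_deriv (0, v) \<Phi> (t, q))) (at t)"
    using partial_derivatives(1)[OF smooth_on_dir_deriv[OF s] tq] by metis
qed

context adapted_frame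
begin

abbreviation "horizontal q \<equiv> span {E FT q, E (FW 0) q}"

lemma horizontal_comp: "q \<in> B \<Longrightarrow> v \<in> horizontal q \<longleftrightarrow> (\<forall>c\<in>I. 1 < wt c \<longrightarrow> eps c q \<bullet> v = 0)"
proof
  assume q: "q \<in> B" and v: "v \<in> horizontal q"
  then obtain a b where "v = a *\<^sub>R E FT q + b *\<^sub>R E (FW 0) q"
    by (auto simp: span_insert span_singleton algebra_simps)
  thus "\<forall>c\<in>I. 1 < wt c \<longrightarrow> eps c q \<bullet> v = 0" using q by (auto simp: inner_add_right dual)
next
  assume q: "q \<in> B" and v: "\<forall>c\<in>I. 1 < wt c \<longrightarrow> eps c q \<bullet> v = 0"
  have "(eps c q \<bullet> v) *\<^sub>R E c q \<in> horizontal q" if "c \<in> I" for c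
  proof (cases "1 < wt c")
    case True
    thus ?thesis using v that span_zero by simp
  next
    case False
    hence "c \<in> {FT, FW 0}" using that by (cases c) auto
    thus ?thesis by (auto intro: span_scale span_base)
  qed
  hence "(\<Sum>c\<in>I. (eps c q \<bullet> v) *\<^sub>R E c q) \<in> horizontal q" by (rule span_sum)
  thus "v \<in> horizontal q" by (simp add: rep[OF q])
qed

lemma dual_derivative:
  assumes X: "smooth_on B X" and q: "q \<in> B" and c: "c \<in> I" "d \<in> I"
  shows "lie_deriv X (eps c) q \<bullet> E d q = - (eps c q \<bullet> lie_deriv X (E d) q)"
proof -
  have "lie_deriv X (\<lambda>q. eps c q \<bullet> E d q) q = lie_deriv X (\<lambda>q. if c = d then 1 else 0) q"
    by (rule lie_deriv_cong[OF openB q]) (simp_all add: dual c)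
  thus ?thesis
    using lie_deriv_inner[OF smeps[OF c(1)] smE[OF c(2)] q, of X] by simp
qed

text \<open>The flow carries \<open>E D q\<close> to horizontal vectors, so each non-horizontal
  component of the image is constantly zero in \<open>t\<close>. Its derivative at
  \<open>t = 0\<close> is minus the component of the bracket of \<open>X\<close> with
  \<open>E D\<close>.\<close>

lemma flow_preserves_syms:
  assumes X: "open V" "smooth_on V X" "flow_preserves X V \<Delta>" and B: "B \<subseteq> V" "\<And>q. q \<in> B \<Longrightarrow> \<Delta> q = horizontal q"
  shows "(\<lambda>q. if q \<in> B then X q else 0) \<in> syms"
proof -
  note XB = smooth_on_subset[OF X(2) B(1)]
  have key: "eps c q \<bullet> lie_bracket X (E D) q = 0" if q: "q \<in> B" and c: "c \<in> I" "1 < wt c" and D: "D \<in> {FT, FW 0}" for c q D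
  proof -
    have DI: "D \<in> I" using D by auto
    obtain W e \<phi> where W: "open W" "q \<in> W" "W \<subseteq> V" "e > 0" and fl: "local_flow X V W e \<phi>"
      and car: "\<And>t. t \<in> {- e<..<e} \<Longrightarrow> carries_distribution (\<phi> t) W \<Delta> \<Delta>"
      using X(3) q B(1) unfolding flow_preserves_def by (meson subsetD)
    note var = flow_variation[OF fl W(1,3) X(1,2) _ W(2)]
    let ?v = "E D q" and ?\<Phi> = "\<lambda>(t, q). \<phi> t q"
    have 0: "(0::real) \<in> {- e<..<e}" using W(4) by simp
    have \<phi>0: "\<phi> 0 q = q" and "((\<lambda>s. \<phi> s q) has_vector_derivative X (\<phi> 0 q)) (at 0)"
      using fl W(2) 0 unfolding local_flow_def by blast+
    hence d\<phi>: "((\<lambda>s. \<phi> s q) has_vector_derivative X q) (at 0)" by simp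
    have w0: "dir_deriv (0, ?v) ?\<Phi> (0, q) = ?v"
    proof -
      have "frechet_derivative (\<phi> 0) (at q) = frechet_derivative (\<lambda>x. x) (at q)"
        by (rule frechet_derivative_cong_open[OF W(1,2)]) (use fl in \<open>simp add: local_flow_def\<close>)
      thus ?thesis using var(1)[OF 0, of ?v] by simp
    qed
    have "\<forall>\<^sub>F t in at 0. \<phi> t q \<in> B"
      using has_vector_derivative_continuous[OF d\<phi>] openB q \<phi>0 by (metis continuous_within topological_tendstoD)
    hence "\<forall>\<^sub>F t in nhds 0. \<phi> t q \<in> B" using \<phi>0 q by (simp add: eventually_nhds_conv_at)
    then obtain T where T: "open T" "0 \<in> T" "\<And>t. t \<in> T \<Longrightarrow> \<phi> t q \<in> B" by (auto simp: eventually_nhds)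
    have h0: "eps c (\<phi> t q) \<bullet> dir_deriv (0, ?v) ?\<Phi> (t, q) = 0" if t: "t \<in> T \<inter> {- e<..<e}" for t
    proof -
      have "?v \<in> \<Delta> q" using D by (auto simp: B(2)[OF q] intro: span_base)
      hence "frechet_derivative (\<phi> t) (at q) ?v \<in> \<Delta> (\<phi> t q)"
        using car[of t] t W(2) unfolding carries_distribution_def by blast
      thus ?thesis using var(1)[of t ?v] B(2)[OF T(3)] horizontal_comp[OF T(3)] t c by simp
    qed
    have "((\<lambda>t. eps c (\<phi> t q)) has_vector_derivative lie_deriv X (eps c) q) (at 0)"
      using smooth_on_along[OF d\<phi> smeps[OF c(1)]] \<phi>0 q by (simp add: lie_deriv_def)
    moreover have "((\<lambda>t. dir_deriv (0, ?v) ?\<Phi> (t, q)) has_vector_derivative lie_deriv (E D) X q) (at 0)"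
      using var(2)[OF 0, of ?v] by (simp add: w0 \<phi>0 lie_deriv_def)
    ultimately have "((\<lambda>t. eps c (\<phi> t q) \<bullet> dir_deriv (0, ?v) ?\<Phi> (t, q)) has_vector_derivative
        (eps c q \<bullet> lie_deriv (E D) X q + lie_deriv X (eps c) q \<bullet> ?v)) (at 0)"
      using bounded_bilinear.has_vector_derivative[OF bounded_bilinear_inner] w0 \<phi>0 by fastforce
    moreover have "((\<lambda>t. eps c (\<phi> t q) \<bullet> dir_deriv (0, ?v) ?\<Phi> (t, q)) has_vector_derivative 0) (at 0)"
    proof (rule has_vector_derivative_transform_within_open[of "\<lambda>_. 0"])
      show "open (T \<inter> {- e<..<e})" using T(1) by auto
    qed (use T 0 h0 in auto)
    ultimately have "eps c q \<bullet> lie_deriv (E D) X q + lie_deriv X (eps c) q \<bullet> ?v = 0" by (rule vector_derivative_unique_at)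
    thus ?thesis using dual_derivative[OF XB q c(1) DI] by (simp add: lie_bracket_def inner_diff_right)
  qed
  let ?X = "\<lambda>q. if q \<in> B then X q else 0"
  have "lie_bracket ?X (E D) q = lie_bracket X (E D) q" if "q \<in> B" for q D
    by (rule lie_bracket_cong[OF openB that]) auto
  moreover have "smooth_on B ?X" by (rule smooth_on_cong[OF openB _ XB]) simp
  ultimately show ?thesis using key by (simp add: syms_def)
qed

text \<open>An interval with its unit field is a frame, so \<open>frame_system_unique\<close> also
  serves as uniqueness for linear ordinary differential equations.\<close>

lemma interval_frame: "smooth_frame {- e<..<e} {()} (\<lambda>_ _. 1 :: real) (\<lambda>_ _. 1)"
  by (simp add: smooth_frame_def smooth_on_const)

text \<open>The components of the linearised flow in the adapted frame solve a linear differential equation,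
  in which the non-horizontal components form a closed subsystem.\<close>

lemma syms_flow_carries:
  assumes X: "X \<in> syms" and fl: "local_flow X B W e \<phi>" and W: "open W" "W \<subseteq> B" and t: "t \<in> {- e<..<e}"
  shows "carries_distribution (\<phi> t) W horizontal horizontal"
  unfolding carries_distribution_def
proof
  fix q assume q: "q \<in> W"
  note sX = syms_smooth[OF X]
  note var = flow_variation[OF fl W openB sX _ q]
  let ?I = "{- e<..<e}" and ?\<Phi> = "\<lambda>(t, q). \<phi> t q"
  define w where "w = (\<lambda>v s. dir_deriv (0, v) ?\<Phi> (s, q))"
  have fr: "frechet_derivative (\<phi> s) (at q) v = w v s"
    and dw: "(w v has_vector_derivative frechet_derivative X (at (\<phi> s q)) (w v s)) (at s)" if "s \<in> ?I" for s v
    using var[OF that] by (simp_all add: w_def)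
  have e0: "0 \<in> ?I" using t by auto
  have \<phi>B: "\<phi> s q \<in> B" and d\<phi>: "((\<lambda>s. \<phi> s q) has_vector_derivative X (\<phi> s q)) (at s)" if "s \<in> ?I" for s
    using fl that q by (auto simp: local_flow_def)
  have \<phi>0: "\<phi> 0 q = q" using fl q by (simp add: local_flow_def)
  have w0: "w v 0 = v" for v
  proof -
    have "frechet_derivative (\<phi> 0) (at q) = frechet_derivative (\<lambda>x. x) (at q)"
      by (rule frechet_derivative_cong_open[OF W(1) q]) (use fl in \<open>simp add: local_flow_def\<close>)
    thus ?thesis using fr[OF e0, of v] by simp
  qed
  have s\<Phi>: "smooth_on (?I \<times> W) ?\<Phi>" using fl by (simp add: local_flow_def)
  have oI: "open ?I" by simp
  have sm1: "smooth_on ?I (\<lambda>s. g (s, q))" if "smooth_on (?I \<times> W) g" for g :: "real \<times> 'a \<Rightarrow> 'a"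
  proof (rule smooth_on_compose[OF oI _ _ that])
    show "open (?I \<times> W)" using W(1) by (simp add: open_Times)
    have "(\<lambda>s :: real. (s, q)) = (\<lambda>s. (s, 0) + (0, q))" by auto
    thus "smooth_on ?I (\<lambda>s. (s, q))"
      by (simp only:) (intro smooth_intros oI smooth_on_linear bounded_linear_Pair bounded_linear_ident bounded_linear_zero)
  qed (use q in auto)
  have s\<phi>: "smooth_on ?I (\<lambda>s. \<phi> s q)" using sm1[OF s\<Phi>] by simp
  have sw: "smooth_on ?I (w v)" for v unfolding w_def by (rule sm1[OF smooth_on_dir_deriv[OF s\<Phi>]])
  have along: "smooth_on ?I (\<lambda>s. g (\<phi> s q))" if "smooth_on B g" for g :: "'a \<Rightarrow> 'a"
    by (rule smooth_on_compose[OF oI openB \<phi>B that s\<phi>])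
  define K where "K = (\<lambda>c d s. - (eps c (\<phi> s q) \<bullet> lie_bracket X (E d) (\<phi> s q)))"
  define g where "g = (\<lambda>v c s. eps c (\<phi> s q) \<bullet> w v s)"
  have sK: "continuous_on ?I (K c d)" if "c \<in> I" "d \<in> I" for c d
    unfolding K_def
    by (rule smooth_on_continuous) (intro smooth_intros oI along smeps that smooth_on_lie_bracket openB sX smE)
  have sg: "smooth_on ?I (g v c)" if "c \<in> I" for v c
    unfolding g_def by (intro smooth_intros oI along smeps that sw)
  have dg: "lie_deriv (\<lambda>_. 1) (g v c) s = (\<Sum>d\<in>I. K c d s * g v d s)" if c: "c \<in> I" and s: "s \<in> ?I" for v c s
  proof -
    let ?y = "\<phi> s q"
    note y = \<phi>B[OF s]
    have l: "linear (frechet_derivative X (at ?y))"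
      by (rule frechet_derivative_linear[OF smooth_on_differentiable[OF sX y]])
    have "((\<lambda>s. eps c (\<phi> s q)) has_vector_derivative lie_deriv X (eps c) ?y) (at s)"
      using smooth_on_along[OF d\<phi>[OF s] smeps[OF c] y] by (simp add: lie_deriv_def)
    from bounded_bilinear.has_vector_derivative[OF bounded_bilinear_inner this dw[OF s, of v]]
    have "(g v c has_vector_derivative eps c ?y \<bullet> frechet_derivative X (at ?y) (w v s) + lie_deriv X (eps c) ?y \<bullet> w v s) (at s)"
      unfolding g_def .
    hence "lie_deriv (\<lambda>_. 1) (g v c) s = eps c ?y \<bullet> frechet_derivative X (at ?y) (w v s) + lie_deriv X (eps c) ?y \<bullet> w v s"
      unfolding has_vector_derivative_def by (drule_tac X = "\<lambda>_. 1" in lie_deriv_eq) simp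
    moreover have "w v s = (\<Sum>d\<in>I. g v d s *\<^sub>R E d ?y)" unfolding g_def by (simp add: rep[OF y])
    ultimately have "lie_deriv (\<lambda>_. 1) (g v c) s = (\<Sum>d\<in>I. g v d s * (eps c ?y \<bullet> lie_deriv (E d) X ?y + lie_deriv X (eps c) ?y \<bullet> E d ?y))"
      by (simp add: linear_sum[OF l] linear_cmul[OF l] inner_sum_right sum.distrib distrib_left lie_deriv_def)
    also have "\<dots> = (\<Sum>d\<in>I. K c d s * g v d s)"
      by (rule sum.cong[OF refl]) (simp add: K_def dual_derivative[OF sX y c] lie_bracket_def inner_diff_right algebra_simps)
    finally show ?thesis .
  qed
  let ?H = "{c\<in>I. 1 < wt c}"
  have hor: "w (E D q) s \<in> horizontal (\<phi> s q)" if D: "D \<in> {FT, FW 0}" and s: "s \<in> ?I" for D s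
  proof -
    have "g (E D q) c s = 0" if "c \<in> ?H" for c
    proof (rule frame_system_unique[where g = "g (E D q)" and A = "\<lambda>_. K" and J = ?H, OF interval_frame _ e0 _ _ _ _ _ s that])
      show "lie_deriv (\<lambda>_. 1) (g (E D q) c) s = (\<Sum>d\<in>?H. K c d s * g (E D q) d s)" if "c \<in> ?H" "s \<in> ?I" for c s
      proof -
        have "(\<Sum>d\<in>I. K c d s * g (E D q) d s) = (\<Sum>d\<in>?H. K c d s * g (E D q) d s)"
        proof (rule sum.mono_neutral_right)
          show "\<forall>d\<in>I - ?H. K c d s * g (E D q) d s = 0"
          proof
            fix d assume "d \<in> I - ?H"
            hence "d \<in> {FT, FW 0}" by (cases d) auto
            hence "K c d s = 0" unfolding K_def using syms_bracket[OF X \<phi>B] that by simp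
            thus "K c d s * g (E D q) d s = 0" by simp
          qed
        qed auto
        thus ?thesis using dg[of c s] that by simp
      qed
      show "g (E D q) c 0 = 0" if "c \<in> ?H" for c
        using that D by (auto simp: g_def w0 \<phi>0 dual[OF subsetD[OF W(2) q]])
    qed (use sg sK in auto)
    thus ?thesis using fr s horizontal_comp[OF \<phi>B[OF s]] by (simp add: g_def)
  qed
  have l: "linear (frechet_derivative (\<phi> t) (at q))"
  proof -
    have *: "(t, q) \<in> ?I \<times> W" using t q by simp
    have "frechet_derivative (\<phi> t) (at q) = (\<lambda>v. w v t)" using fr[OF t] by (simp add: fun_eq_iff)
    thus ?thesis using has_derivative_linear[OF partial_derivatives(2)[OF s\<Phi> *]] by (simp only: w_def)
  qed
  \<comment> \<open>Uniqueness run from time \<open>t\<close> back to time 0: a vector killed at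
    time \<open>t\<close> was already zero.\<close>
  have "inj (frechet_derivative (\<phi> t) (at q))"
    unfolding linear_injective_0[OF l]
  proof (intro allI impI)
    fix v assume "frechet_derivative (\<phi> t) (at q) v = 0"
    hence "w v t = 0" using fr[OF t] by simp
    hence gt: "g v c t = 0" for c by (simp add: g_def)
    have "g v c 0 = 0" if "c \<in> I" for c
      by (rule frame_system_unique[where g = "g v" and A = "\<lambda>_. K", OF interval_frame _ t finite_legs sg sK dg gt e0 that]) auto
    hence "eps c q \<bullet> v = 0" if "c \<in> I" for c using that by (simp add: g_def w0 \<phi>0)
    thus "v = 0" using rep[of q v] W(2) q by (simp add: subsetD)
  qed
  thus "frechet_derivative (\<phi> t) (at q) ` horizontal q = horizontal (\<phi> t q)"
    using hor[OF _ t, of FT] hor[OF _ t, of "FW 0"] fr[OF t]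
    by (intro horizontal_image[OF subsetD[OF W(2) q] l]) simp_all
qed

end

section \<open>Symmetries of the model equation\<close>

lemma smooth_on_exp: "smooth_on UNIV (exp :: real \<Rightarrow> real)"
proof -
  have "Ck_on k UNIV (\<lambda>t. c * exp t)" for k and c :: real
  proof (induction k arbitrary: c)
    case 0
    show ?case by (auto intro!: continuous_intros)
  next
    case (Suc k)
    have d: "((\<lambda>t. c * exp t) has_derivative (\<lambda>h. c * (exp t * h))) (at t)" for t :: real
      by (auto intro!: derivative_eq_intros)
    have "dir_deriv v (\<lambda>t. c * exp t) = (\<lambda>t. (c * v) * exp t)" for v
      by (rule ext) (simp add: dir_deriv_eq[OF d])
    thus ?case using Suc d by (auto simp: differentiable_def)
  qed
  from this[of _ 1] show ?thesis by (simp add: smooth_on_def)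
qed

locale model_equation =
  fixes m n :: nat and e :: "nat \<Rightarrow> 'a::euclidean_space"
  assumes mn: "1 \<le> m" "m \<le> n" "2 \<le> n" "m = 1 \<Longrightarrow> 3 \<le> n" and jet: "jet_frame m n e"
begin

lemma model_monge_equation: "monge_equation m n e UNIV (model_rhs m n e)"
proof -
  let ?z = "d_z m e n"
  have d: "((\<lambda>q. (q \<bullet> ?z)\<^sup>2) has_derivative (\<lambda>v. 2 * (q \<bullet> ?z) * (v \<bullet> ?z))) (at q)" for q
    by (auto intro!: derivative_eq_intros)
  have 1: "dir_deriv v (model_rhs m n e) = (\<lambda>q. 2 * (q \<bullet> ?z) * (v \<bullet> ?z))" for v
    unfolding model_rhs_def[abs_def] coord_z_def by (rule ext) (rule dir_deriv_eq[OF d])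
  have d2: "((\<lambda>q. 2 * (q \<bullet> ?z) * (v \<bullet> ?z)) has_derivative (\<lambda>u. 2 * (u \<bullet> ?z) * (v \<bullet> ?z))) (at q)" for q v
    by (auto intro!: derivative_eq_intros)
  note 2 = dir_deriv_eq[OF d2]
  have "?z \<in> Basis" using jet bij_betwE by (fastforce simp: jet_frame_def d_z_def)
  hence "?z \<bullet> ?z \<noteq> 0" by simp
  moreover have "smooth_on UNIV (model_rhs m n e)"
    unfolding model_rhs_def[abs_def] coord_z_def by (intro smooth_intros open_UNIV)
  ultimately show ?thesis by (simp add: monge_equation_def 1 2)
qed

sublocale monge m n e UNIV "model_rhs m n e"
  by unfold_locales (use mn jet model_monge_equation in auto)

abbreviation "L \<equiv> legs m n"
abbreviation "cx \<equiv> cc FT"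
abbreviation "cz k \<equiv> cc (FW k)"
abbreviation "cy k \<equiv> cc (FY k)"

definition vf :: "(leg \<Rightarrow> 'a \<Rightarrow> real) \<Rightarrow> 'a \<Rightarrow> 'a" where "vf \<xi> q = (\<Sum>c\<in>L. \<xi> c q *\<^sub>R ev c)"

lemma cc_sum: "c \<in> L \<Longrightarrow> cc c (\<Sum>d\<in>L. g d *\<^sub>R ev d) = g c"
proof -
  assume c: "c \<in> L"
  have "cc c (\<Sum>d\<in>L. g d *\<^sub>R ev d) = (\<Sum>d\<in>L. if d = c then g d else 0)"
    unfolding cc_def inner_sum_left by (rule sum.cong) (auto simp: ev_inner c)
  thus ?thesis using c by simp
qed

lemma cc_vf: "c \<in> L \<Longrightarrow> cc c (vf \<xi> q) = \<xi> c q" unfolding vf_def by (rule cc_sum)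

lemma cc_outside: "c \<notin> L \<Longrightarrow> cc c q = 0" by (cases c) (auto simp: cc_def zz_def yy_def)

lemma cc_linear: "cc c (u + v) = cc c u + cc c v" "cc c (s *\<^sub>R u) = s * cc c u"
  by (simp_all add: cc_def inner_add_left)

lemma cc_ev: "c \<in> L \<Longrightarrow> d \<in> L \<Longrightarrow> cc c (ev d) = (if c = d then 1 else 0)"
  unfolding cc_def using ev_inner[of d c] by auto

lemma cc_rep: "(\<Sum>c\<in>L. cc c q *\<^sub>R ev c) = q"
proof -
  have i: "inj_on ev L" by (rule inj_onI) (metis ev_inner zero_neq_one)
  have sub: "ev ` L \<subseteq> Basis"
    using jet bij_betwE[of e "{..<m + n + 2}" Basis] by (auto simp: jet_frame_def legs_def d_x_def zz_def yy_def d_z_def d_y_def)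
  hence "ev ` L = Basis" by (intro card_subset_eq) (auto simp: card_image[OF i] card_legs DIM)
  hence "(\<Sum>c\<in>L. cc c q *\<^sub>R ev c) = (\<Sum>b\<in>Basis. (q \<bullet> b) *\<^sub>R b)"
    using sum.reindex[OF i, of "\<lambda>b. (q \<bullet> b) *\<^sub>R b"] by (simp add: cc_def)
  thus ?thesis by (simp add: euclidean_representation)
qed

lemma smooth_cc [smooth_intros]: "smooth_on U (cc c)"
  unfolding cc_def[abs_def] by (rule smooth_on_linear[OF bounded_linear_inner_left])

lemma cc_derivative: "(cc c has_derivative cc c) (at q)"
  unfolding cc_def[abs_def] by (rule has_derivative_inner_left[OF has_derivative_ident])

lemma lie_cc: "lie_deriv X (cc c) q = cc c (X q)" by (rule lie_deriv_eq[OF cc_derivative])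

definition tc :: "leg \<Rightarrow> 'a \<Rightarrow> real"
  where "tc c = (if c = FT then (\<lambda>q. 1) else if c = FW 0 then (\<lambda>q. 0) else pr c)"

lemma T0_vf: "T0 q = vf tc q"
proof -
  have "vf tc q = tc FT q *\<^sub>R ev FT + (\<Sum>c\<in>L - {FT}. tc c q *\<^sub>R ev c)" unfolding vf_def by (rule sum.remove) auto
  also have "(\<Sum>c\<in>L - {FT}. tc c q *\<^sub>R ev c) = (\<Sum>c\<in>L - {FT, FW 0}. tc c q *\<^sub>R ev c)"
    by (rule sum.mono_neutral_right) (auto simp: tc_def)
  also have "\<dots> = (\<Sum>c\<in>L - {FT, FW 0}. pr c q *\<^sub>R ev c)" by (rule sum.cong) (auto simp: tc_def)
  finally show ?thesis unfolding model_total by (simp add: tc_def[of FT])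
qed

lemma cc_T0: "c \<in> L \<Longrightarrow> cc c (T0 q) = tc c q" unfolding T0_vf by (rule cc_vf)

lemma cx_T0: "cx (T0 q) = 1" using cc_T0[of FT] by (simp add: tc_def)

lemma cz_T0: "cz 0 (T0 q) = 0" "k \<le> n \<Longrightarrow> cz (Suc k) (T0 q) = (if k < n then cz k q else 0)"
  using cc_T0[of "FW 0"] cc_T0[of "FW (Suc k)"] cc_outside[of "FW (Suc k)"] by (auto simp: tc_def pr_def)

lemma smooth_pr: "smooth_on UNIV (pr c)"
proof (cases c)
  case FT
  hence "pr c = (\<lambda>q. 0)" by (auto simp: pr_def)
  thus ?thesis by (simp add: smooth_on_const)
next
  case (FW k)
  hence "pr c = cz (k - 1)" by (auto simp: pr_def)
  thus ?thesis by (simp add: smooth_cc)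
next
  case (FY k)
  hence "pr c = (if k = 1 then (\<lambda>q. (cz 0 q)\<^sup>2) else cy (k - 1))" by (auto simp: pr_def)
  thus ?thesis by (auto intro!: smooth_intros)
qed

lemma smooth_tc: "smooth_on UNIV (tc c)" by (auto simp: tc_def smooth_pr smooth_on_const)

lemma lie_vf:
  assumes "\<And>c. c \<in> L \<Longrightarrow> smooth_on UNIV (\<xi> c)"
  shows "lie_deriv X (vf \<xi>) q = vf (\<lambda>c. lie_deriv X (\<xi> c)) q"
proof -
  have "lie_deriv X (\<lambda>q. \<xi> c q *\<^sub>R ev c) q = lie_deriv X (\<xi> c) q *\<^sub>R ev c" if "c \<in> L" for c
    using lie_deriv_scaleR[OF assms[OF that] smooth_on_const, of q X "ev c"] by simp
  thus ?thesis
    unfolding vf_def[abs_def]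
    by (subst lie_deriv_sum[where U = UNIV]) (auto intro!: smooth_intros assms)
qed

lemma smooth_vf: "(\<And>c. c \<in> L \<Longrightarrow> smooth_on UNIV (\<xi> c)) \<Longrightarrow> smooth_on UNIV (vf \<xi>)"
  unfolding vf_def[abs_def] by (intro smooth_intros open_UNIV)

text \<open>The linearisation of \<open>pr c\<close> in the direction of
  \<open>\<xi>\<close>.\<close>

definition dpr :: "(leg \<Rightarrow> 'a \<Rightarrow> real) \<Rightarrow> leg \<Rightarrow> 'a \<Rightarrow> real"
  where "dpr \<xi> c q = (case c of FT \<Rightarrow> 0 | FW k \<Rightarrow> \<xi> (FW (k - 1)) q
    | FY k \<Rightarrow> if k = 1 then 2 * cz 0 q * \<xi> (FW 0) q else \<xi> (FY (k - 1)) q)"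

lemma lie_pr: "c \<in> L - {FT, FW 0} \<Longrightarrow> lie_deriv (vf \<xi>) (pr c) q = dpr \<xi> c q"
proof (cases c)
  case (FW k)
  assume "c \<in> L - {FT, FW 0}"
  hence "pr c = cz (k - 1)" "FW (k - 1) \<in> L" using FW by (auto simp: pr_def)
  thus ?thesis using FW by (simp add: lie_cc cc_vf dpr_def)
next
  case (FY k)
  assume c: "c \<in> L - {FT, FW 0}"
  show ?thesis
  proof (cases "k = 1")
    case True
    hence "pr c = (\<lambda>q. cz 0 q * cz 0 q)" using FY by (auto simp: pr_def power2_eq_square)
    thus ?thesis using FY True lie_deriv_mult[OF smooth_cc smooth_cc, of q UNIV "vf \<xi>" "FW 0" "FW 0"]
      by (simp add: lie_cc cc_vf dpr_def)
  next
    case False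
    hence "pr c = cy (k - 1)" "FY (k - 1) \<in> L" using FY c by (auto simp: pr_def)
    thus ?thesis using FY False by (simp add: lie_cc cc_vf dpr_def)
  qed
qed simp

text \<open>The prolongation conditions of classical symmetry analysis: only the coefficient of the
  highest derivative of \<open>z\<close> may depend on it, and the other coefficients obey the
  prolongation formula, with a correction for the motion of \<open>x\<close>. They make the brackets
  with both generators of the distribution horizontal.\<close>

definition prolonged :: "(leg \<Rightarrow> 'a \<Rightarrow> real) \<Rightarrow> bool"
  where "prolonged \<xi> \<longleftrightarrow> (\<forall>c\<in>L. smooth_on UNIV (\<xi> c)) \<and> (\<forall>q. \<forall>c\<in>L - {FW 0}. lie_deriv (\<lambda>_. zz 0) (\<xi> c) q = 0) \<and>
    (\<forall>q. \<forall>c\<in>L - {FT, FW 0}. lie_deriv T0 (\<xi> c) q = dpr \<xi> c q + pr c q * lie_deriv T0 (\<xi> FT) q)"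

lemma prolonged_syms:
  assumes \<xi>: "prolonged \<xi>" and fr: "adapted_frame UNIV mframe eps m n"
  shows "vf \<xi> \<in> adapted_frame.syms UNIV mframe eps m n"
proof -
  interpret adapted_frame UNIV mframe eps m n by fact
  let ?X = "vf \<xi>"
  have s: "\<And>c. c \<in> L \<Longrightarrow> smooth_on UNIV (\<xi> c)" using \<xi> by (simp add: prolonged_def)
  note sX = smooth_vf[of \<xi>, OF s]
  have zz0': "zz 0 = ev (FW 0)" by simp
  have "T0 q \<in> span {T0 q, zz 0}" and z: "zz 0 \<in> span {T0 q, zz 0}" for q by (auto intro: span_base)
  note T = this(1)
  have H: "span {T0 q, zz 0} = horizontal q" for q
    using span_mframe_horizontal[of q] by (simp add: monge_distribution_def zz0)
  have Z: "lie_bracket ?X (\<lambda>_. zz 0) q \<in> span {T0 q, zz 0}" for q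
  proof -
    have "lie_bracket ?X (\<lambda>_. zz 0) q = - vf (\<lambda>c. lie_deriv (\<lambda>_. zz 0) (\<xi> c)) q"
      by (simp add: lie_bracket_def lie_vf[OF s])
    also have "vf (\<lambda>c. lie_deriv (\<lambda>_. zz 0) (\<xi> c)) q = (\<Sum>c\<in>{FW 0}. lie_deriv (\<lambda>_. zz 0) (\<xi> c) q *\<^sub>R ev c)"
      unfolding vf_def by (rule sum.mono_neutral_right) (use \<xi> in \<open>auto simp: prolonged_def\<close>)
    finally show ?thesis using z[of q] by (simp add: span_neg span_scale)
  qed
  have TT': "lie_bracket ?X T0 q \<in> span {T0 q, zz 0}" for q
  proof -
    let ?a = "lie_deriv T0 (\<xi> FT) q" and ?b = "lie_deriv T0 (\<xi> (FW 0)) q"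
    have T0e: "T0 = vf tc" by (rule ext) (rule T0_vf)
    have "lie_deriv ?X T0 q = vf (\<lambda>c. lie_deriv ?X (tc c)) q" by (subst T0e) (rule lie_vf[OF smooth_tc])
    hence "lie_bracket ?X T0 q = vf (\<lambda>c. lie_deriv ?X (tc c)) q - vf (\<lambda>c. lie_deriv T0 (\<xi> c)) q"
      by (simp only: lie_bracket_def lie_vf[OF s])
    also have "\<dots> = (\<Sum>c\<in>L. (- ?a * tc c q + (if c = FW 0 then - ?b else 0)) *\<^sub>R ev c)"
      unfolding vf_def sum_subtractf[symmetric] scaleR_left_diff_distrib[symmetric]
    proof (rule sum.cong[OF refl], rule arg_cong[where f = "\<lambda>s. s *\<^sub>R _"])
      fix c assume c: "c \<in> L"
      consider "c = FT" | "c = FW 0" | "c \<in> L - {FT, FW 0}" using c by blast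
      thus "lie_deriv (\<lambda>q. \<Sum>c\<in>L. \<xi> c q *\<^sub>R ev c) (tc c) q - lie_deriv T0 (\<xi> c) q = - ?a * tc c q + (if c = FW 0 then - ?b else 0)"
      proof cases
        case 3
        hence "lie_deriv ?X (tc c) q = dpr \<xi> c q" using lie_pr[of c \<xi> q] by (simp add: tc_def)
        moreover have "lie_deriv T0 (\<xi> c) q = dpr \<xi> c q + pr c q * ?a" using \<xi> 3 by (simp add: prolonged_def)
        ultimately show ?thesis using 3 by (simp add: tc_def vf_def[abs_def])
      qed (auto simp: tc_def)
    qed
    also have "\<dots> = (- ?a) *\<^sub>R T0 q + (- ?b) *\<^sub>R zz 0"
    proof -
      have "(\<Sum>c\<in>L. (if c = FW 0 then - ?b else 0) *\<^sub>R ev c) = (\<Sum>c\<in>L. if c = FW 0 then - ?b *\<^sub>R ev c else 0)"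
        by (rule sum.cong) auto
      hence 1: "(\<Sum>c\<in>L. (if c = FW 0 then - ?b else 0) *\<^sub>R ev c) = (- ?b) *\<^sub>R zz 0" by simp
      show ?thesis unfolding scaleR_left_distrib sum.distrib 1 T0_vf vf_def by (simp add: scaleR_sum_right)
    qed
    finally show ?thesis using T z by (simp add: span_diff span_scale span_neg)
  qed
  have "lie_bracket ?X TT q \<in> span {T0 q, zz 0}" for q
  proof -
    have "lie_bracket ?X TT q = lie_bracket ?X T0 q + lie_bracket ?X (\<lambda>q. f q *\<^sub>R zz 0) q"
      unfolding TT_def[abs_def]
      by (rule lie_bracket_add_right[OF open_UNIV _ smT0 _ sX]) (auto intro!: smooth_intros smf)
    also have "lie_bracket ?X (\<lambda>q. f q *\<^sub>R zz 0) q = f q *\<^sub>R lie_bracket ?X (\<lambda>_. zz 0) q + lie_deriv ?X f q *\<^sub>R zz 0"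
      by (rule lie_bracket_scaleR_right[OF open_UNIV _ smf smooth_on_const sX]) simp
    finally show ?thesis using TT' Z z by (simp add: span_add span_scale)
  qed
  hence "lie_bracket ?X (mframe D) q \<in> horizontal q" if "D \<in> {FT, FW 0}" for D q
    using Z[of q] that unfolding H by (auto simp: WW0)
  hence "eps c q \<bullet> lie_bracket ?X (mframe D) q = 0" if "c \<in> L" "1 < wt c" "D \<in> {FT, FW 0}" for c D q
    using horizontal_comp[OF UNIV_I, of "lie_bracket ?X (mframe D) q" q] that by blast
  from this[where D = FT] this[where D = "FW 0"] show ?thesis using sX by (simp add: syms_def)
qed

abbreviation "\<Delta> \<equiv> monge_distribution m n e (model_rhs m n e)"

lemma local_symmetryI:
  assumes \<xi>: "prolonged \<xi>"
    and fl: "\<And>p. \<exists>W \<delta> \<phi>. open W \<and> p \<in> W \<and> \<delta> > 0 \<and> local_flow (vf \<xi>) UNIV W \<delta> \<phi>"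
  shows "vf \<xi> \<in> local_symmetries UNIV \<Delta> p"
proof -
  obtain eps where fr: "adapted_frame UNIV mframe eps m n" using adapted_frame_exists[of UNIV] by auto
  interpret adapted_frame UNIV mframe eps m n by fact
  have H: "\<Delta> = horizontal" by (rule ext) (rule span_mframe_horizontal[symmetric])
  have "flow_preserves (vf \<xi>) UNIV \<Delta>"
    unfolding flow_preserves_def H
  proof
    fix p
    obtain W \<delta> \<phi> where "open W" "p \<in> W" "\<delta> > 0" "local_flow (vf \<xi>) UNIV W \<delta> \<phi>" using fl[of p] by blast
    thus "\<exists>W \<delta> \<phi>. open W \<and> p \<in> W \<and> W \<subseteq> UNIV \<and> \<delta> > 0 \<and> local_flow (vf \<xi>) UNIV W \<delta> \<phi> \<and>
        (\<forall>t\<in>{- \<delta><..<\<delta>}. carries_distribution (\<phi> t) W horizontal horizontal)"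
      using syms_flow_carries[OF prolonged_syms[OF \<xi> fr], of W \<delta> \<phi>] by (intro exI[of _ W] exI[of _ \<delta>] exI[of _ \<phi>]) simp
  qed
  moreover have "smooth_on UNIV (vf \<xi>)" using \<xi> by (intro smooth_vf) (simp add: prolonged_def)
  ultimately show ?thesis unfolding local_symmetries_def by (intro CollectI exI[of _ UNIV]) auto
qed

lemma local_flow_components:
  assumes W: "open W" and s: "\<And>c. c \<in> L \<Longrightarrow> smooth_on ({- \<delta><..<\<delta>} \<times> W) (\<gamma> c)" and 0: "\<And>c q. c \<in> L \<Longrightarrow> q \<in> W \<Longrightarrow> \<gamma> c (0, q) = cc c q"
    and d: "\<And>c q t. c \<in> L \<Longrightarrow> q \<in> W \<Longrightarrow> t \<in> {- \<delta><..<\<delta>} \<Longrightarrow>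
      ((\<lambda>t. \<gamma> c (t, q)) has_real_derivative \<xi> c (\<Sum>c\<in>L. \<gamma> c (t, q) *\<^sub>R ev c)) (at t)"
  shows "local_flow (vf \<xi>) UNIV W \<delta> (\<lambda>t q. \<Sum>c\<in>L. \<gamma> c (t, q) *\<^sub>R ev c)"
  unfolding local_flow_def
proof (intro conjI ballI)
  have "smooth_on ({- \<delta><..<\<delta>} \<times> W) (\<lambda>z. \<Sum>c\<in>L. \<gamma> c z *\<^sub>R ev c)"
    using W s by (intro smooth_intros open_Times) auto
  thus "smooth_on ({- \<delta><..<\<delta>} \<times> W) (\<lambda>(t, q). \<Sum>c\<in>L. \<gamma> c (t, q) *\<^sub>R ev c)" by (simp add: split_def)
  fix q assume q: "q \<in> W"
  show "(\<Sum>c\<in>L. \<gamma> c (0, q) *\<^sub>R ev c) = q" using 0[OF _ q] by (simp add: cc_rep)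
  fix t assume t: "t \<in> {- \<delta><..<\<delta>}"
  show "((\<lambda>t. \<Sum>c\<in>L. \<gamma> c (t, q) *\<^sub>R ev c) has_vector_derivative vf \<xi> (\<Sum>c\<in>L. \<gamma> c (t, q) *\<^sub>R ev c)) (at t)"
    unfolding vf_def
    by (rule has_vector_derivative_sum) (use has_vector_derivative_scaleR[OF d[OF _ q t] has_vector_derivative_const] in simp)
qed simp

lemma smooth_snd: "open W \<Longrightarrow> smooth_on UNIV g \<Longrightarrow> smooth_on (S \<times> W) (\<lambda>z. g (snd z) :: real)" if "open S" for g :: "'a \<Rightarrow> real" and S :: "real set"
  by (rule smooth_on_compose[OF open_Times[OF that] open_UNIV]) (auto intro!: smooth_on_linear bounded_linear_snd)

lemma smooth_fst: "smooth_on S (\<lambda>z. fst z :: real)"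
  by (rule smooth_on_linear[OF bounded_linear_fst])

text \<open>If \<open>ups\<close> is the derivative of \<open>\<xi>\<close> along itself and constant along the flow, the flow is quadratic in time.\<close>

lemma quadratic_flow_symmetry:
  assumes \<xi>: "prolonged \<xi>" and ups: "\<And>c. c \<in> L \<Longrightarrow> smooth_on UNIV (ups c)"
    and eq: "\<And>c q t u. c \<in> L \<Longrightarrow> (\<And>d. d \<in> L \<Longrightarrow> cc d u = cc d q + t * \<xi> d q + t\<^sup>2 / 2 * ups d q) \<Longrightarrow> \<xi> c u = \<xi> c q + t * ups c q"
  shows "vf \<xi> \<in> local_symmetries UNIV \<Delta> p"
proof (rule local_symmetryI[OF \<xi>], intro exI conjI)
  define \<gamma> where "\<gamma> = (\<lambda>c z. cc c (snd z) + fst z * \<xi> c (snd z) + (fst z)\<^sup>2 / 2 * ups c (snd z))"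
  have s: "smooth_on UNIV (\<xi> c)" if "c \<in> L" for c using \<xi> that by (simp add: prolonged_def)
  show "local_flow (vf \<xi>) UNIV UNIV 1 (\<lambda>t q. \<Sum>c\<in>L. \<gamma> c (t, q) *\<^sub>R ev c)"
  proof (rule local_flow_components[OF open_UNIV])
    fix c assume c: "c \<in> L"
    show "smooth_on ({- 1<..<1} \<times> UNIV) (\<gamma> c)"
      unfolding \<gamma>_def
      by (intro smooth_intros smooth_fst open_Times open_greaterThanLessThan open_UNIV smooth_snd[OF open_greaterThanLessThan open_UNIV s[OF c]]
        smooth_snd[OF open_greaterThanLessThan open_UNIV ups[OF c]] smooth_snd[OF open_greaterThanLessThan open_UNIV smooth_cc]) simp
    show "\<gamma> c (0, q) = cc c q" for q by (simp add: \<gamma>_def)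
    fix q t
    have "((\<lambda>t. \<gamma> c (t, q)) has_real_derivative \<xi> c q + t * ups c q) (at t)"
      unfolding \<gamma>_def by (auto intro!: derivative_eq_intros)
    thus "((\<lambda>t. \<gamma> c (t, q)) has_real_derivative \<xi> c (\<Sum>c\<in>L. \<gamma> c (t, q) *\<^sub>R ev c)) (at t)"
      using eq[OF c, of "\<Sum>c\<in>L. \<gamma> c (t, q) *\<^sub>R ev c" q t] by (simp add: cc_sum \<gamma>_def)
  qed
qed auto

definition xm :: "nat \<Rightarrow> 'a \<Rightarrow> real" where "xm s q = cx q ^ s / fact s"

lemma smooth_xm [smooth_intros]: "open U \<Longrightarrow> smooth_on U (xm s)" unfolding xm_def[abs_def] by (intro smooth_intros) auto

lemma lie_xm: "lie_deriv X (xm s) q = (if s = 0 then 0 else xm (s - 1) q * cx (X q))"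
proof -
  have "xm s = xpow cx 0 s" by (auto simp: xm_def xpow_def)
  hence "lie_deriv X (xm s) q = - xpow cx (Suc 0) s q * cx (X q)"
    using lie_deriv_xpow[OF smooth_cc, of q UNIV X FT 0 s] by (simp add: lie_cc)
  thus ?thesis by (cases s) (auto simp: xpow_def xm_def)
qed

text \<open>For \<open>l \<ge> 1\<close> the coefficients are those of the binomial series with
  exponent \<open>- l\<close>. For \<open>l = 0\<close> truncated subtraction leaves the term
  \<open>j = 0\<close> alone, the integrand itself.\<close>

definition ibp :: "nat \<Rightarrow> nat \<Rightarrow> 'a \<Rightarrow> real"
  where "ibp d l q = (\<Sum>j\<le>d. ((- 1) ^ j * real ((l + j - 1) choose j)) * (xm (d - j) q * cz (l + j) q))"

lemma smooth_ibp [smooth_intros]: "open U \<Longrightarrow> smooth_on U (ibp d l)"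
  unfolding ibp_def[abs_def] by (intro smooth_intros)

lemma lie_ibp: "lie_deriv X (ibp d l) q = (\<Sum>j\<le>d. ((- 1) ^ j * real ((l + j - 1) choose j)) *
    (xm (d - j) q * cz (l + j) (X q) + (if j = d then 0 else xm (d - Suc j) q * cx (X q)) * cz (l + j) q))"
  unfolding ibp_def[abs_def]
  by (subst lie_deriv_sum[where U = UNIV], (intro smooth_intros open_UNIV)[1], simp, rule sum.cong[OF refl],
      subst lie_deriv_mult[OF smooth_on_const[of UNIV]], (intro smooth_intros open_UNIV)[1], simp,
      subst lie_deriv_mult[where U = UNIV], (intro smooth_intros open_UNIV)+)
    (auto simp: lie_xm lie_cc)

text \<open>Repeated integration by parts of \<open>x\<^sup>d z\<^sup>(\<^sup>n\<^sup>)\<close> along solutions.\<close>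

lemma T_ibp: "Suc l + d \<le> n \<Longrightarrow> lie_deriv T0 (ibp d (Suc l)) q = ibp d l q"
proof -
  assume l: "Suc l + d \<le> n"
  let ?a = "\<lambda>l j. (- 1) ^ j * real ((l + j - 1) choose j)"
  have rec: "?a (Suc l) j + ?a (Suc l) (Suc j) = ?a l (Suc j)" for j by (simp add: algebra_simps)
  have "lie_deriv T0 (ibp d (Suc l)) q = (\<Sum>j\<le>d. ?a (Suc l) j * (xm (d - j) q * cz (l + j) q))
     + (\<Sum>j\<le>d. ?a (Suc l) j * ((if j = d then 0 else xm (d - Suc j) q) * cz (Suc l + j) q))"
    unfolding lie_ibp sum.distrib[symmetric]
    by (rule sum.cong) (use l cz_T0(2) in \<open>auto simp: cx_T0 algebra_simps\<close>)
  also have "(\<Sum>j\<le>d. ?a (Suc l) j * ((if j = d then 0 else xm (d - Suc j) q) * cz (Suc l + j) q))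
      = (\<Sum>j<d. ?a (Suc l) j * (xm (d - Suc j) q * cz (l + Suc j) q))"
    by (subst lessThan_Suc_atMost[symmetric], subst sum.lessThan_Suc) simp
  also have "(\<Sum>j\<le>d. ?a (Suc l) j * (xm (d - j) q * cz (l + j) q))
      = xm d q * cz l q + (\<Sum>j<d. ?a (Suc l) (Suc j) * (xm (d - Suc j) q * cz (l + Suc j) q))"
    by (subst sum.atMost_shift) simp
  finally have eq: "lie_deriv T0 (ibp d (Suc l)) q = xm d q * cz l q + (\<Sum>j<d. ?a (Suc l) (Suc j) * (xm (d - Suc j) q * cz (l + Suc j) q))
      + (\<Sum>j<d. ?a (Suc l) j * (xm (d - Suc j) q * cz (l + Suc j) q))" .
  have "lie_deriv T0 (ibp d (Suc l)) q
      = xm d q * cz l q + (\<Sum>j<d. (?a (Suc l) j + ?a (Suc l) (Suc j)) * (xm (d - Suc j) q * cz (l + Suc j) q))"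
    unfolding distrib_right sum.distrib eq by (simp only: ac_simps)
  also have "\<dots> = ibp d l q" unfolding rec ibp_def by (subst sum.atMost_shift) simp
  finally show ?thesis .
qed

section \<open>Coefficients and flows of the polynomial symmetries of the model\<close>

primrec f_x :: "leg \<Rightarrow> 'a \<Rightarrow> real" where
  "f_x FT = (\<lambda>q. 1)" | "f_x (FW r) = (\<lambda>q. 0)" | "f_x (FY r) = (\<lambda>q. 0)"

primrec f_y :: "nat \<Rightarrow> leg \<Rightarrow> 'a \<Rightarrow> real" where
  "f_y k FT = (\<lambda>q. 0)" | "f_y k (FW r) = (\<lambda>q. 0)" | "f_y k (FY r) = (if k \<le> r then xm (r - k) else (\<lambda>q. 0))"

text \<open>The shift of \<open>z\<close> by \<open>x ^ k / fact k\<close>. The square of the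
  highest derivative then changes to first order by twice the integrand of \<open>ibp\<close>, so
  the \<open>y\<close>-coordinates change by its repeated antiderivatives.\<close>

primrec f_z :: "nat \<Rightarrow> leg \<Rightarrow> 'a \<Rightarrow> real" where
  "f_z k FT = (\<lambda>q. 0)" | "f_z k (FW r) = (if n \<le> k + r then xm (k + r - n) else (\<lambda>q. 0))"
| "f_z k (FY l) = (if n \<le> k then (\<lambda>q. 2 * ibp (k - n) l q) else (\<lambda>q. 0))"

text \<open>Weights of two scalings: \<open>w1\<close> stretches \<open>x\<close> and keeps the
  highest derivatives of \<open>y\<close> and \<open>z\<close> fixed, \<open>w2\<close> stretches
  \<open>z\<close> by 1 and \<open>y\<close> by 2.\<close>

primrec w1 :: "leg \<Rightarrow> real" where "w1 FT = 1" | "w1 (FW r) = r" | "w1 (FY r) = r"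
primrec w2 :: "leg \<Rightarrow> real" where "w2 FT = 0" | "w2 (FW r) = 1" | "w2 (FY r) = 2"

definition f_s :: "(leg \<Rightarrow> real) \<Rightarrow> leg \<Rightarrow> 'a \<Rightarrow> real" where "f_s w c = (\<lambda>q. w c * cc c q)"

text \<open>The projective field x^2 \<partial>_x acting on \<open>z\<close> as on a density, by (2n
  - 1) x z \<partial>_z, prolonged. For \<open>m = 1\<close> the right-hand side changes, beyond the
  motion of \<open>x\<close>, by a total derivative, with primitive the \<open>FY\<close>
  entry.\<close>

primrec f_p :: "leg \<Rightarrow> 'a \<Rightarrow> real" where
  "f_p FT = (\<lambda>q. (cx q)\<^sup>2)"
| "f_p (FW r) = (\<lambda>q. (2 * real r - 1) * (cx q * cz r q) + (real n ^ 2 - real r ^ 2) * cz (Suc r) q)"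
| "f_p (FY r) = (\<lambda>q. real n ^ 2 * (cz 1 q)\<^sup>2)"

lemma cc_zz0: "c \<in> L \<Longrightarrow> c \<noteq> FW 0 \<Longrightarrow> cc c (zz 0) = 0" "cz (Suc k) (zz 0) = 0"
  using cc_ev[of c "FW 0"] cc_ev[of "FW (Suc k)" "FW 0"] cc_outside[of "FW (Suc k)"] by (cases "Suc k \<le> n"; auto)+

lemma pr_cases: "pr (FW (Suc k)) = cz k" "pr (FY (Suc 0)) = (\<lambda>q. (cz 0 q)\<^sup>2)" "pr (FY (Suc (Suc k))) = cy (Suc k)"
  by (auto simp: pr_def)

lemma cy_T0: "1 \<le> k \<Longrightarrow> k \<le> m \<Longrightarrow> cy k (T0 q) = pr (FY k) q"
  using cc_T0[of "FY k"] by (simp add: tc_def)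

lemma prolongedI:
  assumes "\<And>c. c \<in> L \<Longrightarrow> smooth_on UNIV (\<xi> c)" "\<And>q c. c \<in> L \<Longrightarrow> c \<noteq> FW 0 \<Longrightarrow> lie_deriv (\<lambda>_. zz 0) (\<xi> c) q = 0"
    and "\<And>q k. k < n \<Longrightarrow> lie_deriv T0 (\<xi> (FW (Suc k))) q = \<xi> (FW k) q + cz k q * lie_deriv T0 (\<xi> FT) q"
    and "\<And>q. lie_deriv T0 (\<xi> (FY (Suc 0))) q = 2 * cz 0 q * \<xi> (FW 0) q + (cz 0 q)\<^sup>2 * lie_deriv T0 (\<xi> FT) q"
    and "\<And>q k. Suc (Suc k) \<le> m \<Longrightarrow> lie_deriv T0 (\<xi> (FY (Suc (Suc k)))) q = \<xi> (FY (Suc k)) q + cy (Suc k) q * lie_deriv T0 (\<xi> FT) q"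
  shows "prolonged \<xi>"
proof -
  have "lie_deriv T0 (\<xi> c) q = dpr \<xi> c q + pr c q * lie_deriv T0 (\<xi> FT) q" if c: "c \<in> L - {FT, FW 0}" for c q
  proof (cases c)
    case (FW k)
    then obtain k' where "k = Suc k'" "k' < n" using c by (cases k) auto
    thus ?thesis using assms(3)[of k' q] FW by (simp add: dpr_def pr_cases)
  next
    case (FY k)
    then obtain k' where k: "k = Suc k'" "Suc k' \<le> m" using c by (cases k) auto
    thus ?thesis using assms(4)[of q] assms(5)[of "k' - 1" q] FY by (cases k') (simp_all add: dpr_def pr_cases)
  qed (use c in simp)
  thus ?thesis using assms(1,2) by (simp add: prolonged_def)
qed

lemma prolonged_x: "prolonged f_x"
proof (rule prolongedI)
  show "smooth_on UNIV (f_x c)" for c by (cases c) (auto simp: smooth_on_const)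
  show "lie_deriv (\<lambda>_. zz 0) (f_x c) q = 0" for c q by (cases c) auto
qed simp_all

lemma prolonged_y: "1 \<le> k \<Longrightarrow> prolonged (f_y k)"
proof (rule prolongedI)
  show "smooth_on UNIV (f_y k c)" for c by (cases c) (auto simp: smooth_on_const smooth_xm)
  show "lie_deriv (\<lambda>_. zz 0) (f_y k c) q = 0" for c q
    by (cases c) (auto simp: lie_xm cc_zz0)
qed (auto simp: lie_xm cx_T0 Suc_diff_le not_le)

lemma prolonged_z: "k \<le> 2 * n - m \<Longrightarrow> prolonged (f_z k)"
proof (rule prolongedI)
  assume k: "k \<le> 2 * n - m"
  have D2: "lie_deriv X (\<lambda>q. 2 * ibp d l q) q = 2 * lie_deriv X (ibp d l) q" for X d l q
    using lie_deriv_mult[OF smooth_on_const smooth_ibp[OF open_UNIV], of q X 2] by simp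
  show "smooth_on UNIV (f_z k c)" for c
    by (cases c) (auto simp: smooth_on_const smooth_xm intro!: smooth_intros)
  show "lie_deriv (\<lambda>_. zz 0) (f_z k c) q = 0" if c: "c \<in> L" "c \<noteq> FW 0" for c q
  proof (cases c)
    case (FY l)
    then obtain l' where "l = Suc l'" using c by (cases l) auto
    moreover have "cx (zz 0) = 0" by (rule cc_zz0(1)) simp_all
    ultimately show ?thesis using FY by (simp add: D2 lie_ibp cc_zz0(2) cong: if_cong)
  qed (use c in \<open>auto simp: lie_xm cc_zz0\<close>)
  show "lie_deriv T0 (f_z k (FW (Suc r))) q = f_z k (FW r) q + cz r q * lie_deriv T0 (f_z k FT) q" for r q
  proof (cases "n \<le> k + r")
    case True
    thus ?thesis by (simp add: lie_xm cx_T0 Suc_diff_le)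
  next
    case False
    hence "k + Suc r - n = 0" by simp
    with False show ?thesis
      by (cases "n \<le> k + Suc r") (simp_all only: f_z.simps lie_xm lie_deriv_const if_True if_False simp_thms mult_zero_right add_0)
  qed
  have 0: "ibp d 0 q = xm d q * cz 0 q" for d q
  proof -
    have "ibp d 0 q = (\<Sum>j\<le>d. if j = 0 then xm d q * cz 0 q else 0)"
      unfolding ibp_def by (rule sum.cong) auto
    thus ?thesis by simp
  qed
  \<comment> \<open>The bound on \<open>k\<close> ensures that no antiderivative of \<open>z\<close>
    itself is needed: all indices in \<open>ibp\<close> stay at most \<open>n\<close>.\<close>
  have b: "Suc l + (k - n) \<le> n" if "Suc l \<le> m" "n \<le> k" for l using that k mn(2) by linarith
  show "lie_deriv T0 (f_z k (FY (Suc 0))) q = 2 * cz 0 q * f_z k (FW 0) q + (cz 0 q)\<^sup>2 * lie_deriv T0 (f_z k FT) q" for q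
    using T_ibp[OF b[of 0], of q] mn(1) by (simp add: D2 0)
  show "lie_deriv T0 (f_z k (FY (Suc (Suc l)))) q = f_z k (FY (Suc l)) q + cy (Suc l) q * lie_deriv T0 (f_z k FT) q"
    if "Suc (Suc l) \<le> m" for l q
    using T_ibp[OF b[OF that], of q] by (simp add: D2)
qed

lemma lie_s: "lie_deriv X (f_s w c) q = w c * cc c (X q)"
proof -
  have "((\<lambda>q. w c * cc c q) has_derivative (\<lambda>v. w c * cc c v)) (at q)"
    by (intro has_derivative_mult_right cc_derivative)
  thus ?thesis unfolding f_s_def by (rule lie_deriv_eq)
qed

lemma prolonged_s:
  assumes "\<And>k. w (FW (Suc k)) = w (FW k) + w FT" "w (FY 1) = 2 * w (FW 0) + w FT" "\<And>k. w (FY (Suc (Suc k))) = w (FY (Suc k)) + w FT"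
  shows "prolonged (f_s w)"
proof (rule prolongedI)
  show "smooth_on UNIV (f_s w c)" for c unfolding f_s_def by (intro smooth_intros open_UNIV)
  have fs: "f_s w c q = w c * cc c q" for c q by (simp add: f_s_def)
  show "lie_deriv (\<lambda>_. zz 0) (f_s w c) q = 0" if "c \<in> L" "c \<noteq> FW 0" for c q by (simp add: lie_s cc_zz0(1) that)
  show "lie_deriv T0 (f_s w (FW (Suc k))) q = f_s w (FW k) q + cz k q * lie_deriv T0 (f_s w FT) q" if "k < n" for k q
    using that by (simp add: lie_s fs cx_T0 cz_T0 assms algebra_simps)
  show "lie_deriv T0 (f_s w (FY (Suc 0))) q = 2 * cz 0 q * f_s w (FW 0) q + (cz 0 q)\<^sup>2 * lie_deriv T0 (f_s w FT) q" for q
    using mn(1) assms(2) by (simp add: lie_s fs cx_T0 cy_T0 pr_cases algebra_simps power2_eq_square)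
  show "lie_deriv T0 (f_s w (FY (Suc (Suc k)))) q = f_s w (FY (Suc k)) q + cy (Suc k) q * lie_deriv T0 (f_s w FT) q"
    if "Suc (Suc k) \<le> m" for k q
    using that by (simp add: lie_s fs cx_T0 cy_T0 pr_cases assms algebra_simps)
qed

lemma scaling_symmetry:
  assumes "prolonged (f_s w)" shows "vf (f_s w) \<in> local_symmetries UNIV \<Delta> p"
proof (rule local_symmetryI[OF assms], intro exI conjI)
  define \<gamma> where "\<gamma> = (\<lambda>c z. exp (w c * fst z) * cc c (snd z))"
  show "local_flow (vf (f_s w)) UNIV UNIV 1 (\<lambda>t q. \<Sum>c\<in>L. \<gamma> c (t, q) *\<^sub>R ev c)"
  proof (rule local_flow_components[OF open_UNIV])
    fix c assume c: "c \<in> L"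
    have o: "open ({- 1<..<1::real} \<times> (UNIV :: 'a set))" by (simp add: open_Times)
    have "smooth_on ({- 1<..<1::real} \<times> (UNIV :: 'a set)) (\<lambda>z. exp (w c * fst z))"
      by (rule smooth_on_compose[OF o open_UNIV _ smooth_on_exp]) (auto intro!: smooth_intros smooth_fst o)
    thus "smooth_on ({- 1<..<1} \<times> UNIV) (\<gamma> c)"
      unfolding \<gamma>_def by (intro smooth_intros o smooth_snd[OF open_greaterThanLessThan open_UNIV smooth_cc])
    show "\<gamma> c (0, q) = cc c q" for q by (simp add: \<gamma>_def)
    fix q t
    have "((\<lambda>t. \<gamma> c (t, q)) has_real_derivative w c * \<gamma> c (t, q)) (at t)"
      unfolding \<gamma>_def by (auto intro!: derivative_eq_intros)
    thus "((\<lambda>t. \<gamma> c (t, q)) has_real_derivative f_s w c (\<Sum>c\<in>L. \<gamma> c (t, q) *\<^sub>R ev c)) (at t)"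
      by (simp add: f_s_def cc_sum c)
  qed
qed auto

lemma x_symmetry: "vf f_x \<in> local_symmetries UNIV \<Delta> p"
proof (rule quadratic_flow_symmetry[OF prolonged_x, of "\<lambda>_ _. 0"])
  show "f_x c u = f_x c q + t * 0" for c u q t by (cases c) auto
qed (simp add: smooth_on_const)

lemma y_symmetry: "1 \<le> k \<Longrightarrow> vf (f_y k) \<in> local_symmetries UNIV \<Delta> p"
proof (rule quadratic_flow_symmetry[OF prolonged_y, of k "\<lambda>_ _. 0"])
  fix c q t u assume u: "\<And>d. d \<in> L \<Longrightarrow> cc d u = cc d q + t * f_y k d q + t\<^sup>2 / 2 * 0"
  show "f_y k c u = f_y k c q + t * 0" using u[of FT] by (cases c) (auto simp: xm_def)
qed (simp_all add: smooth_on_const)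

lemma z_symmetry:
  assumes k: "k \<le> 2 * n - m" shows "vf (f_z k) \<in> local_symmetries UNIV \<Delta> p"
proof -
  \<comment> \<open>\<open>ibp\<close> is linear in \<open>z\<close>, and the
    \<open>z\<close>-coefficients of the field depend on \<open>x\<close> only. So the second
    derivative of the flow arises in the \<open>y\<close>-coordinates alone, by inserting the field
    into \<open>ibp\<close>.\<close>
  define ups where "ups = (\<lambda>c q. case c of FY l \<Rightarrow> if n \<le> k
    then 2 * (\<Sum>j\<le>k - n. ((- 1) ^ j * real ((l + j - 1) choose j)) * (xm (k - n - j) q * f_z k (FW (l + j)) q)) else 0 | _ \<Rightarrow> 0)"
  show ?thesis
  proof (rule quadratic_flow_symmetry[OF prolonged_z[OF k]])
    show "smooth_on UNIV (ups c)" for c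
    proof (cases c)
      case (FY l)
      have "smooth_on UNIV (f_z k (FW r))" for r by (auto simp: smooth_on_const smooth_xm)
      thus ?thesis unfolding ups_def FY by (cases "n \<le> k") (auto intro!: smooth_intros simp del: f_z.simps)
    qed (auto simp: ups_def smooth_on_const)
    fix c q t u assume c: "c \<in> L" and u: "\<And>d. d \<in> L \<Longrightarrow> cc d u = cc d q + t * f_z k d q + t\<^sup>2 / 2 * ups d q"
    have x: "xm s u = xm s q" for s using u[of FT] by (simp add: ups_def xm_def)
    have z: "cz r u = cz r q + t * f_z k (FW r) q" if "r \<le> n" for r using u[of "FW r"] that by (simp add: ups_def)
    show "f_z k c u = f_z k c q + t * ups c q"
    proof (cases c)
      case (FY l)
      show ?thesis
      proof (cases "n \<le> k")
        case True
        have "ibp (k - n) l u = ibp (k - n) l q + t * (\<Sum>j\<le>k - n. ((- 1) ^ j * real ((l + j - 1) choose j)) * (xm (k - n - j) q * f_z k (FW (l + j)) q))"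
          unfolding ibp_def sum_distrib_left sum.distrib[symmetric]
        proof (rule sum.cong[OF refl])
          fix j assume "j \<in> {..k - n}"
          hence "l + j \<le> n" using c FY k True mn(2) by auto
          note z = z[OF this]
          show "(- 1) ^ j * real ((l + j - 1) choose j) * (xm (k - n - j) u * cz (l + j) u) =
            (- 1) ^ j * real ((l + j - 1) choose j) * (xm (k - n - j) q * cz (l + j) q) +
            t * ((- 1) ^ j * real ((l + j - 1) choose j) * (xm (k - n - j) q * f_z k (FW (l + j)) q))"
            unfolding z x by (simp add: algebra_simps del: f_z.simps)
        qed
        thus ?thesis using True FY by (simp add: ups_def del: f_z.simps(2))
      qed (simp add: FY ups_def)
    qed (auto simp: ups_def x)
  qed
qed

section \<open>The projective symmetry in the case \<open>m = 1\<close>\<close>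

lemma projective_derivatives:
  "lie_deriv X (f_p FT) q = 2 * cx q * cx (X q)"
  "lie_deriv X (f_p (FW r)) q = (2 * real r - 1) * (cx q * cz r (X q) + cx (X q) * cz r q) + (real n ^ 2 - real r ^ 2) * cz (Suc r) (X q)"
  "lie_deriv X (f_p (FY r)) q = real n ^ 2 * (2 * cz 1 q * cz 1 (X q))"
proof -
  have sq: "((\<lambda>q. (cc c q)\<^sup>2) has_derivative (\<lambda>v. 2 * cc c q * cc c v)) (at q)" for c
    by (rule derivative_eq_intros cc_derivative refl)+ (simp add: mult.commute mult.left_commute)
  show "lie_deriv X (f_p FT) q = 2 * cx q * cx (X q)" unfolding f_p.simps by (rule lie_deriv_eq[OF sq])
  show "lie_deriv X (f_p (FY r)) q = real n ^ 2 * (2 * cz 1 q * cz 1 (X q))"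
    unfolding f_p.simps by (rule lie_deriv_eq[OF has_derivative_mult_right[OF sq]])
  show "lie_deriv X (f_p (FW r)) q = (2 * real r - 1) * (cx q * cz r (X q) + cx (X q) * cz r q) + (real n ^ 2 - real r ^ 2) * cz (Suc r) (X q)"
    unfolding f_p.simps
    by (rule lie_deriv_eq[OF has_derivative_add[OF has_derivative_mult_right[OF has_derivative_mult[OF cc_derivative cc_derivative]]
        has_derivative_mult_right[OF cc_derivative]]])
qed

lemma prolonged_p: "m = 1 \<Longrightarrow> prolonged f_p"
proof (rule prolongedI)
  assume m: "m = 1"
  show "smooth_on UNIV (f_p c)" for c by (cases c) (auto intro!: smooth_intros)
  show "lie_deriv (\<lambda>_. zz 0) (f_p c) q = 0" if c: "c \<in> L" "c \<noteq> FW 0" for c q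
  proof -
    have x: "cx (zz 0) = 0" by (rule cc_zz0(1)) simp_all
    show ?thesis
    proof (cases c)
      case (FW r)
      thus ?thesis using c cc_zz0(1)[OF c] x by (simp add: projective_derivatives cc_zz0(2) del: f_p.simps)
    qed (use x cc_zz0(2)[of 0] in \<open>simp_all add: projective_derivatives del: f_p.simps\<close>)
  qed
  show "lie_deriv T0 (f_p (FW (Suc k))) q = f_p (FW k) q + cz k q * lie_deriv T0 (f_p FT) q" if k: "k < n" for k q
  proof -
    have "(real n ^ 2 - real (Suc k) ^ 2) * cz (Suc (Suc k)) (T0 q) = (real n ^ 2 - real (Suc k) ^ 2) * cz (Suc k) q"
      using cz_T0(2)[of "Suc k" q] k by (cases "Suc k < n") (auto simp: not_less le_antisym Suc_le_eq)
    thus ?thesis using cz_T0(2)[of k q] k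
      unfolding projective_derivatives by (simp add: cx_T0 power2_eq_square algebra_simps)
  qed
  show "lie_deriv T0 (f_p (FY (Suc 0))) q = 2 * cz 0 q * f_p (FW 0) q + (cz 0 q)\<^sup>2 * lie_deriv T0 (f_p FT) q" for q
    using cz_T0(2)[of 0 q] mn unfolding projective_derivatives by (simp add: cx_T0 power2_eq_square algebra_simps)
qed simp

text \<open>With u = 1 - t x and s = t / u the flow of \<open>f_p\<close> sends \<open>x\<close> to
  x / u and the \<open>z\<close>-coordinate of index \<open>r\<close> to
  \<open>u ^ (1 - 2 r)\<close> times the polynomial \<open>pw' r s\<close>. Its coefficients
  \<open>pc r k\<close> are forced by \<open>pw'_derivative\<close>; \<open>pi'\<close> is the
  primitive in \<open>s\<close> of the square of \<open>pw' 1\<close> and gives the motion of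
  \<open>y\<close>.\<close>

definition pc :: "nat \<Rightarrow> nat \<Rightarrow> real" where "pc r k = (\<Prod>i<k. real n ^ 2 - real (r + i) ^ 2) / fact k"

definition pw' :: "nat \<Rightarrow> real \<Rightarrow> 'a \<Rightarrow> real" where "pw' r s q = (\<Sum>k\<le>n. pc r k * s ^ k * cz (r + k) q)"

definition pi' :: "real \<Rightarrow> 'a \<Rightarrow> real"
  where "pi' s q = (\<Sum>a\<le>n. \<Sum>b\<le>n. (pc 1 a * cz (1 + a) q) * (pc 1 b * cz (1 + b) q) / (real (a + b) + 1) * s ^ Suc (a + b))"

lemma pw'_derivative: "((\<lambda>s. pw' r s q) has_real_derivative (real n ^ 2 - real r ^ 2) * pw' (Suc r) s q) (at s)"
proof -
  have pc: "pc r (Suc k) * real (Suc k) = (real n ^ 2 - real r ^ 2) * pc (Suc r) k" for k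
    unfolding pc_def by (subst prod.lessThan_Suc_shift) (simp add: field_simps del: of_nat_Suc)
  have "((\<lambda>s. pw' r s q) has_real_derivative (\<Sum>k\<le>n. pc r k * (real k * s ^ (k - 1)) * cz (r + k) q)) (at s)"
    unfolding pw'_def by (auto intro!: derivative_eq_intros sum.cong simp: algebra_simps)
  also have "(\<Sum>k\<le>n. pc r k * (real k * s ^ (k - 1)) * cz (r + k) q) = (\<Sum>k<n. (pc r (Suc k) * real (Suc k)) * s ^ k * cz (Suc r + k) q)"
    by (subst sum.atMost_shift) (simp add: algebra_simps)
  also have "\<dots> = (real n ^ 2 - real r ^ 2) * (\<Sum>k<n. pc (Suc r) k * s ^ k * cz (Suc r + k) q)"
    unfolding pc by (simp add: sum_distrib_left mult.assoc)
  \<comment> \<open>The term \<open>k = n\<close> may be added: it contains a coordinate of index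
    above \<open>n\<close>, which is zero by \<open>cc_outside\<close>.\<close>
  also have "(\<Sum>k<n. pc (Suc r) k * s ^ k * cz (Suc r + k) q) = pw' (Suc r) s q"
    unfolding pw'_def by (subst lessThan_Suc_atMost[symmetric], subst sum.lessThan_Suc) (simp add: cc_outside)
  finally show ?thesis .
qed

lemma pi'_derivative: "((\<lambda>s. pi' s q) has_real_derivative (pw' 1 s q)\<^sup>2) (at s)"
proof -
  let ?A = "\<lambda>a. pc 1 a * cz (1 + a) q"
  have "((\<lambda>s. ?A a * ?A b / (real (a + b) + 1) * s ^ Suc (a + b)) has_real_derivative (?A a * s ^ a) * (?A b * s ^ b)) (at s)" for a b
  proof -
    have "((\<lambda>s. s ^ Suc (a + b)) has_real_derivative real (Suc (a + b)) * s ^ (a + b)) (at s)"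
      using DERIV_pow[of "Suc (a + b)" s] by simp
    note d = DERIV_cmult[OF this, of "?A a * ?A b / (real (a + b) + 1)"]
    have "v * w / c * (c * (y * z)) = (v * y) * (w * z)" if "c \<noteq> 0" for v w c y z :: real using that by simp
    moreover have "real (Suc (a + b)) = real (a + b) + 1" "real (a + b) + 1 \<noteq> 0" by linarith+
    ultimately have "?A a * ?A b / (real (a + b) + 1) * (real (Suc (a + b)) * s ^ (a + b)) = (?A a * s ^ a) * (?A b * s ^ b)"
      by (simp only: power_add)
    thus ?thesis using DERIV_cong[OF d] by blast
  qed
  hence "((\<lambda>s. pi' s q) has_real_derivative (\<Sum>a\<le>n. \<Sum>b\<le>n. (?A a * s ^ a) * (?A b * s ^ b))) (at s)"
    unfolding pi'_def by (intro DERIV_sum)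
  thus ?thesis by (simp add: pw'_def power2_eq_square sum_product algebra_simps)
qed

lemma projective_symmetry:
  assumes m: "m = 1" shows "vf f_p \<in> local_symmetries UNIV \<Delta> p"
proof (rule local_symmetryI[OF prolonged_p[OF m]])
  fix p :: 'a
  \<comment> \<open>On the unit ball around \<open>p\<close> the coordinate \<open>x\<close> is
    bounded by \<open>norm p + 2\<close>, so for these times 1 - t x does not vanish and the flow
    does not blow up.\<close>
  define \<delta> where "\<delta> = 1 / (norm p + 2)"
  define W where "W = ball p 1"
  let ?S = "{- \<delta><..<\<delta>} \<times> W"
  define u where "u = (\<lambda>z :: real \<times> 'a. 1 - fst z * cx (snd z))"
  define \<gamma> where "\<gamma> = (\<lambda>c z. case c of FT \<Rightarrow> cx (snd z) * inverse (u z)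
    | FW r \<Rightarrow> u z * inverse (u z) ^ (2 * r) * pw' r (fst z * inverse (u z)) (snd z)
    | FY r \<Rightarrow> cy r (snd z) + real n ^ 2 * pi' (fst z * inverse (u z)) (snd z))"
  have \<delta>: "\<delta> > 0" by (simp add: \<delta>_def add_nonneg_pos)
  have nz: "u (t, q) \<noteq> 0" if t: "t \<in> {- \<delta><..<\<delta>}" and q: "q \<in> W" for t q
  proof -
    have "ev FT \<in> Basis" using jet bij_betwE[of e "{..<m + n + 2}" Basis] by (simp add: jet_frame_def d_x_def)
    hence "\<bar>cx q\<bar> \<le> norm q" unfolding cc_def by (rule Basis_le_norm)
    also have "\<dots> < norm p + 2" using q norm_triangle_sub[of q p] by (simp add: W_def dist_norm norm_minus_commute)
    finally have "\<bar>t\<bar> * \<bar>cx q\<bar> < 1 / (norm p + 2) * (norm p + 2)"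
      using t by (intro mult_strict_mono') (auto simp: \<delta>_def)
    also have "\<dots> = 1"
    proof -
      have "norm p + 2 \<noteq> 0" using norm_ge_zero[of p] by linarith
      thus ?thesis by simp
    qed
    finally have "\<bar>t * cx q\<bar> < 1" by (simp add: abs_mult)
    thus ?thesis by (simp add: u_def)
  qed
  have oW: "open W" by (simp add: W_def)
  have oS: "open ?S" using oW by (simp add: open_Times)
  have sc: "smooth_on ?S (\<lambda>z. cc c (snd z))" for c by (rule smooth_snd[OF open_greaterThanLessThan oW smooth_cc])
  have su: "smooth_on ?S u" unfolding u_def by (intro smooth_intros oS smooth_fst sc)
  have siu: "smooth_on ?S (\<lambda>z. inverse (u z))" by (rule smooth_on_inverse[OF oS su]) (use nz in auto)
  have sp: "smooth_on ?S (\<lambda>z. pw' r (fst z * inverse (u z)) (snd z))" for r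
    unfolding pw'_def by (intro smooth_intros oS smooth_fst sc siu)
  have si: "smooth_on ?S (\<lambda>z. pi' (fst z * inverse (u z)) (snd z))"
    unfolding pi'_def divide_inverse by (intro smooth_intros oS smooth_fst sc siu)
  show "\<exists>W \<delta> \<phi>. open W \<and> p \<in> W \<and> \<delta> > 0 \<and> local_flow (vf f_p) UNIV W \<delta> \<phi>"
  proof (intro exI conjI)
    show "local_flow (vf f_p) UNIV W \<delta> (\<lambda>t q. \<Sum>c\<in>L. \<gamma> c (t, q) *\<^sub>R ev c)"
    proof (rule local_flow_components[OF oW])
      show "smooth_on ?S (\<gamma> c)" for c
        unfolding \<gamma>_def by (cases c) (auto intro!: smooth_intros oS smooth_fst sc su siu sp si)
      show "\<gamma> c (0, q) = cc c q" for c q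
      proof -
        have "pw' r 0 q = cz r q" for r
          unfolding pw'_def by (subst sum.atMost_shift) (simp add: pc_def)
        moreover have "pi' 0 q = 0" by (simp add: pi'_def)
        ultimately show ?thesis by (cases c) (auto simp: \<gamma>_def u_def)
      qed
      fix c q t assume c: "c \<in> L" and q: "q \<in> W" and t: "t \<in> {- \<delta><..<\<delta>}"
      let ?x = "cx q" and ?U = "\<lambda>t. 1 - t * cx q"
      let ?I = "\<lambda>t. inverse (?U t)"
      have U: "?U t \<noteq> 0" using nz[OF t q] by (simp add: u_def)
      have dI: "(?I has_real_derivative ?x * ?I t ^ 2) (at t)"
        using U by (auto intro!: derivative_eq_intros simp: power2_eq_square)
      have dIk: "((\<lambda>t. ?I t ^ k) has_real_derivative real k * ?x * ?I t ^ Suc k) (at t)" for k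
        by (rule DERIV_cong[OF DERIV_power[OF dI]]) (cases k, auto simp: power2_eq_square)
      have dS: "((\<lambda>t. t * ?I t) has_real_derivative ?I t ^ 2) (at t)"
      proof (rule DERIV_cong[OF DERIV_mult[OF DERIV_ident dI]])
        have "1 * i + x * i\<^sup>2 * t = i\<^sup>2" if "(1 - t * x) * i = 1" for i x :: real using that by algebra
        thus "1 * ?I t + ?x * ?I t ^ 2 * t = ?I t ^ 2" using U by simp
      qed
      have dU: "(?U has_real_derivative - ?x) (at t)" by (auto intro!: derivative_eq_intros)
      have UI: "?U t * ?I t = 1" using U by simp
      have s: "cc c (\<Sum>c\<in>L. \<gamma> c (t, q) *\<^sub>R ev c) = \<gamma> c (t, q)" if "c \<in> L" for c by (rule cc_sum[OF that])
      show "((\<lambda>t. \<gamma> c (t, q)) has_real_derivative f_p c (\<Sum>c\<in>L. \<gamma> c (t, q) *\<^sub>R ev c)) (at t)"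
      proof (cases c)
        case FT
        have "((\<lambda>t. ?x * ?I t) has_real_derivative ?x * (?x * ?I t ^ 2)) (at t)" by (rule DERIV_cmult[OF dI])
        thus ?thesis using s[of FT] by (simp add: FT \<gamma>_def u_def power_mult_distrib power2_eq_square mult.assoc mult.left_commute)
      next
        case (FW r)
        let ?w = "\<lambda>r t. pw' r (t * ?I t) q"
        have w: "((\<lambda>t. ?w r t) has_real_derivative ((real n ^ 2 - real r ^ 2) * ?w (Suc r) t) * ?I t ^ 2) (at t)"
          by (rule DERIV_chain2[OF pw'_derivative dS])
        note d = DERIV_mult[OF DERIV_mult[OF dU dIk[of "2 * r"]] w]
        have n1: "(real n ^ 2 - real r ^ 2) * cz (Suc r) (\<Sum>c\<in>L. \<gamma> c (t, q) *\<^sub>R ev c) = (real n ^ 2 - real r ^ 2) * \<gamma> (FW (Suc r)) (t, q)"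
        proof (cases "r < n")
          case True
          thus ?thesis by (simp add: s)
        next
          case False
          hence "r = n" using c FW by simp
          thus ?thesis by simp
        qed
        have e: "(- ?x * ?I t ^ (2 * r) + real (2 * r) * ?x * ?I t ^ Suc (2 * r) * ?U t) * ?w r t
            + (real n ^ 2 - real r ^ 2) * ?w (Suc r) t * ?I t ^ 2 * (?U t * ?I t ^ (2 * r))
          = (2 * real r - 1) * ((?x * ?I t) * (?U t * ?I t ^ (2 * r) * ?w r t))
            + (real n ^ 2 - real r ^ 2) * (?U t * ?I t ^ (2 * Suc r) * ?w (Suc r) t)"
        proof -
          have alg: "(- x * J + 2 * r' * x * (i * J) * U) * w + N * w' * i\<^sup>2 * (U * J) = (2 * r' - 1) * ((x * i) * (U * J * w)) + N * (U * (i\<^sup>2 * J) * w')"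
            if "U * i = 1" for x J r' i U w N w' :: real
            using that by algebra
          show ?thesis using alg[OF UI, of ?x "?I t ^ (2 * r)" "real r" "?w r t" "real n ^ 2 - real r ^ 2" "?w (Suc r) t"]
            by (simp add: power_add[symmetric] numeral_2_eq_2)
        qed
        have "cz r (\<Sum>c\<in>L. \<gamma> c (t, q) *\<^sub>R ev c) = \<gamma> (FW r) (t, q)" by (rule s) (use c FW in simp)
        hence "f_p c (\<Sum>c\<in>L. \<gamma> c (t, q) *\<^sub>R ev c) = (2 * real r - 1) * (\<gamma> FT (t, q) * \<gamma> (FW r) (t, q)) + (real n ^ 2 - real r ^ 2) * \<gamma> (FW (Suc r)) (t, q)"
          using n1 s[of FT] FW by simp
        also have "\<dots> = (- ?x * ?I t ^ (2 * r) + real (2 * r) * ?x * ?I t ^ Suc (2 * r) * ?U t) * ?w r t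
            + (real n ^ 2 - real r ^ 2) * ?w (Suc r) t * ?I t ^ 2 * (?U t * ?I t ^ (2 * r))"
          unfolding e by (simp add: \<gamma>_def u_def)
        finally show ?thesis using d FW by (simp add: \<gamma>_def u_def)
      next
        case (FY r)
        have "((\<lambda>t. cy r q + real n ^ 2 * pi' (t * ?I t) q) has_real_derivative 0 + real n ^ 2 * ((pw' 1 (t * ?I t) q)\<^sup>2 * ?I t ^ 2)) (at t)"
          by (intro DERIV_add DERIV_const DERIV_cmult DERIV_chain2[OF pi'_derivative dS])
        moreover have "cz 1 (\<Sum>c\<in>L. \<gamma> c (t, q) *\<^sub>R ev c) = ?I t * pw' 1 (t * ?I t) q"
        proof -
          have "cz 1 (\<Sum>c\<in>L. \<gamma> c (t, q) *\<^sub>R ev c) = \<gamma> (FW 1) (t, q)" by (rule s) (use mn in simp)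
          also have "\<dots> = ?U t * ?I t ^ 2 * pw' 1 (t * ?I t) q" by (simp add: \<gamma>_def u_def)
          also have "\<dots> = (?U t * ?I t) * (?I t * pw' 1 (t * ?I t) q)" by (simp only: power2_eq_square mult.assoc)
          finally show ?thesis unfolding UI by simp
        qed
        ultimately show ?thesis by (simp add: FY \<gamma>_def u_def power_mult_distrib mult.commute)
      qed
    qed
  qed (use oW \<delta> in \<open>auto simp: W_def\<close>)
qed

end

section \<open>The dimension of the symmetry algebra\<close>

lemma polynomial_vanishes:
  fixes a :: "nat \<Rightarrow> real"
  assumes "\<delta> > 0" "\<And>s. \<bar>s\<bar> < \<delta> \<Longrightarrow> (\<Sum>k\<le>K. a k * (x + s) ^ k) = 0" "k \<le> K"
  shows "a k = 0"
proof (rule ccontr)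
  assume "a k \<noteq> 0"
  hence "finite {z. (\<Sum>i\<le>K. a i * z ^ i) = 0}" using assms(3) by (subst polyfun_finite_roots) auto
  moreover have "{x - \<delta><..<x + \<delta>} \<subseteq> {z. (\<Sum>i\<le>K. a i * z ^ i) = 0}"
    using assms(2)[of "_ - x"] by (auto simp: abs_less_iff)
  ultimately have "finite {x - \<delta><..<x + \<delta>}" by (rule finite_subset[rotated])
  thus False using assms(1) by (simp add: infinite_Ioo)
qed

context model_equation
begin

text \<open>The list comprises \<open>m\<close> shifts of \<open>y\<close>,
  \<open>2n - m + 1\<close> shifts of \<open>z\<close>, one translation, two scalings and, for
  \<open>m = 1\<close>, the projective field; this gives \<open>2n + 4\<close> or
  \<open>2n + 5\<close>.\<close>

definition fam :: "nat \<Rightarrow> leg \<Rightarrow> 'a \<Rightarrow> real"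
  where "fam i = (if i < m then f_y (Suc i) else if i \<le> 2 * n then f_z (i - m) else
    if i = 2 * n + 1 then f_x else if i = 2 * n + 2 then f_s w1 else if i = 2 * n + 3 then f_s w2 else f_p)"

abbreviation "N \<equiv> 2 * n + 4 + (if m = 1 then 1 else 0)"

lemma fam_symmetry: "i < N \<Longrightarrow> vf (fam i) \<in> local_symmetries UNIV \<Delta> p"
proof -
  assume i: "i < N"
  have "prolonged (f_s w1)" "prolonged (f_s w2)" by (intro prolonged_s; simp)+
  note s = this[THEN scaling_symmetry]
  have "m = 1" if "\<not> i \<le> 2 * n + 3" using i that by (auto split: if_splits)
  thus ?thesis
    unfolding fam_def using s x_symmetry y_symmetry[of "Suc i"] z_symmetry[of "i - m"] projective_symmetry by auto
qed

text \<open>The coefficients are read off from the components of \<open>x\<close>, then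
  \<open>z\<close>, then \<open>y\<close>, each being a polynomial in the base coordinates once the
  earlier coefficients are known to vanish.\<close>

lemma fam_independent: "independent_germs p N (\<lambda>i. vf (fam i))"
  unfolding independent_germs_def
proof (intro allI impI)
  fix c :: "nat \<Rightarrow> real" and i
  assume "\<forall>\<^sub>F q in nhds p. (\<Sum>i<N. c i *\<^sub>R vf (fam i) q) = 0" and i: "i < N"
  then obtain \<delta> where \<delta>: "\<delta> > 0" "\<And>q. dist q p < \<delta> \<Longrightarrow> (\<Sum>i<N. c i *\<^sub>R vf (fam i) q) = 0"
    unfolding eventually_nhds_metric by blast
  define b where "b = (if m = 1 then c (2 * n + 4) else 0)"
  have split: "(\<Sum>i<m. c i * f_y (Suc i) l q) + (\<Sum>k\<le>2 * n - m. c (m + k) * f_z k l q) + c (2 * n + 1) * f_x l q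
    + c (2 * n + 2) * f_s w1 l q + c (2 * n + 3) * f_s w2 l q + b * f_p l q = 0"
    if l: "l \<in> L" and q: "dist q p < \<delta>" for l q
  proof -
    let ?g = "\<lambda>i. c i * fam i l q"
    have "(\<Sum>i<N. ?g i) = cc l (\<Sum>i<N. c i *\<^sub>R vf (fam i) q)"
      using cc_vf[OF l] by (simp add: cc_def inner_sum_left)
    hence 0: "(\<Sum>i<N. ?g i) = 0" using \<delta>(2)[OF q] by (simp add: cc_def)
    have "(\<Sum>i<N. ?g i) = (\<Sum>i<2 * n + 1. ?g i) + ?g (2 * n + 1) + ?g (2 * n + 2) + ?g (2 * n + 3) + (if m = 1 then ?g (2 * n + 4) else 0)"
      by (simp add: numeral_eq_Suc)
    also have "(\<Sum>i<2 * n + 1. ?g i) = (\<Sum>i<m. ?g i) + (\<Sum>i=m..<2 * n + 1. ?g i)"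
      unfolding lessThan_atLeast0 by (rule sum.atLeastLessThan_concat[symmetric]) (use mn in auto)
    also have "(\<Sum>i<m. ?g i) = (\<Sum>i<m. c i * f_y (Suc i) l q)" by (rule sum.cong) (auto simp: fam_def)
    also have "(\<Sum>i=m..<2 * n + 1. ?g i) = (\<Sum>k\<le>2 * n - m. ?g (m + k))"
    proof -
      have "{0..<2 * n + 1 - m} = {..2 * n - m}" using mn by auto
      thus ?thesis by (subst sum.atLeastLessThan_shift_0) (simp add: add.commute)
    qed
    also have "(\<Sum>k\<le>2 * n - m. ?g (m + k)) = (\<Sum>k\<le>2 * n - m. c (m + k) * f_z k l q)"
      by (rule sum.cong) (use mn in \<open>auto simp: fam_def\<close>)
    finally have eq: "(\<Sum>i<N. ?g i) = (\<Sum>i<m. c i * f_y (Suc i) l q) + (\<Sum>k\<le>2 * n - m. c (m + k) * f_z k l q)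
      + ?g (2 * n + 1) + ?g (2 * n + 2) + ?g (2 * n + 3) + (if m = 1 then ?g (2 * n + 4) else 0)" .
    have F: "fam (2 * n + 1) = f_x" "fam (2 * n + 2) = f_s w1" "fam (2 * n + 3) = f_s w2" "fam (2 * n + 4) = f_p"
      using mn(2) by (auto simp: fam_def)
    have "(if m = 1 then c (2 * n + 4) * f_p l q else 0) = b * f_p l q" by (simp add: b_def)
    from eq[unfolded 0 F this, symmetric] show ?thesis .
  qed
  define Q where "Q = (\<lambda>l s. p + s *\<^sub>R ev l)"
  have Q: "dist (Q l s) p < \<delta>" "\<And>d. d \<in> L \<Longrightarrow> cc d (Q l s) = cc d p + (if d = l then s else 0)" if "l \<in> L" "\<bar>s\<bar> < \<delta>" for l s
  proof -
    have "norm (ev l) = 1" using ev_inner[OF that(1,1)] by (simp add: norm_eq_1)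
    thus "dist (Q l s) p < \<delta>" using that by (simp add: Q_def dist_norm)
    show "cc d (Q l s) = cc d p + (if d = l then s else 0)" if "d \<in> L" for d
      using cc_ev[OF that \<open>l \<in> L\<close>] by (simp add: Q_def cc_linear)
  qed
  have LT: "FT \<in> L" and LW: "FW n \<in> L" and LY: "FY m \<in> L" using mn by auto
  \<comment> \<open>In the \<open>x\<close>-component only the translation, the first scaling and
    the projective field occur, with coefficients 1, x and x^2.\<close>
  let ?a = "\<lambda>k. [c (2 * n + 1), c (2 * n + 2), b] ! k"
  have a: "?a k = 0" if "k \<le> 2" for k
  proof (rule polynomial_vanishes[OF \<delta>(1) _ that, of ?a "cx p"])
    fix s :: real assume s: "\<bar>s\<bar> < \<delta>"
    have "c (2 * n + 1) + c (2 * n + 2) * (cx p + s) + b * (cx p + s)\<^sup>2 = 0"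
      using split[OF LT Q(1)[OF LT s]] Q(2)[OF LT s LT] by (simp add: f_s_def)
    moreover have "(\<Sum>k\<le>2. g k) = g 0 + g 1 + g 2" for g :: "nat \<Rightarrow> real" by (simp add: numeral_2_eq_2)
    ultimately show "(\<Sum>k\<le>2. ?a k * (cx p + s) ^ k) = 0" by simp
  qed
  have c1: "c (2 * n + 1) = 0" "c (2 * n + 2) = 0" "b = 0"
    using a[of 0] a[of 1] a[of 2] by auto
  have W: "(\<Sum>k\<le>2 * n - m. c (m + k) * xm k q) + c (2 * n + 3) * cz n q = 0" if "dist q p < \<delta>" for q
    using split[OF LW that] unfolding c1 by (simp add: f_s_def)
  \<comment> \<open>Moving \<open>z\<close> alone isolates the second scaling, as all shifts of
    \<open>z\<close> depend on \<open>x\<close> only.\<close>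
  have c3: "c (2 * n + 3) = 0"
  proof -
    have s: "\<bar>\<delta> / 2\<bar> < \<delta>" using \<delta>(1) by simp
    have "xm k (Q (FW n) (\<delta> / 2)) = xm k p" for k using Q(2)[OF LW s LT] by (simp add: xm_def)
    hence "(\<Sum>k\<le>2 * n - m. c (m + k) * xm k p) + c (2 * n + 3) * (cz n p + \<delta> / 2) = 0"
      using W[OF Q(1)[OF LW s]] Q(2)[OF LW s LW] by (simp only: if_True refl)
    moreover have "(\<Sum>k\<le>2 * n - m. c (m + k) * xm k p) + c (2 * n + 3) * cz n p = 0" by (rule W) (simp add: \<delta>)
    ultimately have "c (2 * n + 3) * (cz n p + \<delta> / 2) = c (2 * n + 3) * cz n p" by linarith
    thus ?thesis using \<delta>(1) by simp
  qed
  have cz: "c (m + k) = 0" if "k \<le> 2 * n - m" for k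
  proof -
    have "c (m + k) / fact k = 0"
    proof (rule polynomial_vanishes[OF \<delta>(1) _ that, of "\<lambda>k. c (m + k) / fact k" "cx p"])
      fix s :: real assume s: "\<bar>s\<bar> < \<delta>"
      show "(\<Sum>k\<le>2 * n - m. c (m + k) / fact k * (cx p + s) ^ k) = 0"
        using W[OF Q(1)[OF LT s]] Q(2)[OF LT s LT] c3 by (simp add: xm_def)
    qed
    thus ?thesis by simp
  qed
  have cy: "c i = 0" if "i < m" for i
  proof -
    have "c (m - Suc k) / fact k = 0" if "k \<le> m - 1" for k
    proof (rule polynomial_vanishes[OF \<delta>(1) _ that, of "\<lambda>k. c (m - Suc k) / fact k" "cx p"])
      fix s :: real assume s: "\<bar>s\<bar> < \<delta>"
      have "(\<Sum>k\<le>m - 1. c (m - Suc k) / fact k * (cx p + s) ^ k) = (\<Sum>k<m. c (m - Suc k) * xm (m - Suc (m - Suc k)) (Q FT s))"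
        using mn(1) Q(2)[OF LT s LT] by (intro sum.cong) (auto simp: xm_def)
      also have "\<dots> = (\<Sum>i<m. c i * xm (m - Suc i) (Q FT s))" by (rule sum.nat_diff_reindex)
      also have "\<dots> = (\<Sum>i<m. c i * f_y (Suc i) (FY m) (Q FT s))" by (rule sum.cong) auto
      also have "\<dots> = 0"
        using split[OF LY Q(1)[OF LT s]] unfolding c1 c3 by (simp add: cz del: f_y.simps f_z.simps)
      finally show "(\<Sum>k\<le>m - 1. c (m - Suc k) / fact k * (cx p + s) ^ k) = 0" .
    qed
    from this[of "m - Suc i"] show ?thesis using that by simp
  qed
  have "i \<le> 2 * n + 3 \<or> i = 2 * n + 4 \<and> m = 1" using i by (auto split: if_splits)
  hence "i < m \<or> m \<le> i \<and> i \<le> 2 * n \<or> i = 2 * n + 1 \<or> i = 2 * n + 2 \<or> i = 2 * n + 3 \<or> i = 2 * n + 4 \<and> m = 1" by linarith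
  thus "c i = 0" using c1 c3 cy[of i] cz[of "i - m"] by (auto simp: b_def)
qed

lemma model_dim_ge: "enat N \<le> monge_sym_dim m n e UNIV (model_rhs m n e) p"
  unfolding monge_sym_dim_def sym_dim_def
  by (rule Sup_upper, rule CollectI, rule exI[of _ N], rule conjI[OF refl], rule exI[of _ "\<lambda>i. vf (fam i)"])
    (intro conjI allI impI fam_symmetry fam_independent)

end

section \<open>The dimension bound and the case of equality for an arbitrary Monge equation\<close>

context monge
begin

abbreviation "\<Delta>F \<equiv> monge_distribution m n e F"

text \<open>Each symmetry germ comes with its own domain. Finitely many of them restrict to one
  ball, whose connectedness the adapted frame needs.\<close>

lemma common_frame:
  fixes k :: nat
  assumes p: "p \<in> U" and X: "\<And>i. i < k \<Longrightarrow> X i \<in> local_symmetries U \<Delta>F p"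
  shows "\<exists>B eps. B \<subseteq> U \<and> p \<in> B \<and> adapted_frame B mframe eps m n \<and>
    (\<forall>i<k. (\<lambda>q. if q \<in> B then X i q else 0) \<in> adapted_frame.syms B mframe eps m n)"
proof -
  have "\<forall>i\<in>{..<k}. \<exists>V. open V \<and> p \<in> V \<and> V \<subseteq> U \<and> smooth_on V (X i) \<and> flow_preserves (X i) V \<Delta>F"
    using X by (auto simp: local_symmetries_def)
  then obtain V where V: "\<And>i. i < k \<Longrightarrow> open (V i) \<and> p \<in> V i \<and> V i \<subseteq> U \<and> smooth_on (V i) (X i) \<and> flow_preserves (X i) (V i) \<Delta>F"
    by (metis lessThan_iff)
  have "open (U \<inter> (\<Inter>i<k. V i))" using U V by (intro open_Int open_INT) auto
  moreover have "p \<in> U \<inter> (\<Inter>i<k. V i)" using p V by auto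
  ultimately obtain r where r: "r > 0" "ball p r \<subseteq> U \<inter> (\<Inter>i<k. V i)" by (meson open_contains_ball)
  define B where "B = ball p r"
  have B: "B \<subseteq> U" "p \<in> B" "\<And>i. i < k \<Longrightarrow> B \<subseteq> V i" using r by (auto simp: B_def)
  obtain eps where fr: "adapted_frame B mframe eps m n" using adapted_frame_exists[of B] B(1) by (auto simp: B_def)
  interpret adapted_frame B mframe eps m n by fact
  have "(\<lambda>q. if q \<in> B then X i q else 0) \<in> syms" if "i < k" for i
    using V[OF that] B(3)[OF that] by (intro flow_preserves_syms[of "V i" _ \<Delta>F] span_mframe_horizontal[symmetric]) auto
  thus ?thesis using B fr by blast
qed

lemma sym_dim_cases:
  assumes p: "p \<in> U"
  shows "monge_sym_dim m n e U F p \<le> enat (2 * n + 4 + (if m = 1 then 1 else 0))"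
    and "monge_sym_dim m n e U F p = enat (2 * n + 4 + (if m = 1 then 1 else 0))
      \<Longrightarrow> internally_equivalent_at m n e p U F UNIV (model_rhs m n e)"
proof -
  let ?N = "2 * n + 4 + (if m = 1 then 1 else 0)"
  let ?P = "\<lambda>k X. (\<forall>i<k. X i \<in> local_symmetries U \<Delta>F p) \<and> independent_germs p k X"
  have key: "k \<le> ?N \<and> (k = ?N \<longrightarrow> internally_equivalent_at m n e p U F UNIV (model_rhs m n e))" if P: "?P k X" for k X
  proof -
    obtain B eps where B: "B \<subseteq> U" "p \<in> B" and fr: "adapted_frame B mframe eps m n"
      and "\<forall>i<k. (\<lambda>q. if q \<in> B then X i q else 0) \<in> adapted_frame.syms B mframe eps m n"
      using common_frame[OF p, of k X] P by blast
    moreover define Y where "Y = (\<lambda>i q. if q \<in> B then X i q else 0)"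
    interpret adapted_frame B mframe eps m n by fact
    have Y: "Y i \<in> syms" if "i \<in> {..<k}" for i using calculation that by (simp add: Y_def)
    have ind: "\<forall>i<k. c i = 0" if "(\<Sum>i<k. c i *\<^sub>R Y i) = 0" for c
    proof -
      have "(\<Sum>i<k. c i *\<^sub>R X i q) = 0" if "q \<in> B" for q
        using fun_cong[OF \<open>(\<Sum>i<k. c i *\<^sub>R Y i) = 0\<close>, of q] that
        by (simp add: sum_fun_apply scaleR_fun_apply zero_fun_apply Y_def)
      hence "\<forall>\<^sub>F q in nhds p. (\<Sum>i<k. c i *\<^sub>R X i q) = 0" using openB B(2) by (auto simp: eventually_nhds)
      thus ?thesis using P by (simp add: independent_germs_def)
    qed
    have "k \<le> ?N"
      using dependent_syms[of "{..<k}" Y p] Y B(2) ind unfolding card_gens by fastforce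
    moreover have "maximal_symmetry B mframe eps m n p" if k: "k = ?N"
    proof (unfold_locales)
      show "p \<in> B" by fact
      fix t :: "gen \<Rightarrow> real"
      \<comment> \<open>The extra unknown of index \<open>k\<close> multiplies the target values
        \<open>t\<close>. A solution with \<open>c k \<noteq> 0\<close> rescales to a symmetry with
        the values \<open>t\<close>, and \<open>c k = 0\<close> is excluded by the independence of
        the family.\<close>
      define M where "M = (\<lambda>i j. if i < k then gen_fun j (Y i, p) else - t j)"
      obtain c where c: "\<exists>i\<in>{..k}. c i \<noteq> 0" "\<And>j. j \<in> gens \<Longrightarrow> (\<Sum>i\<le>k. c i * M i j) = 0"
        using homogeneous_solution[of gens "{..k}" M] card_gens k by auto
      define V where "V = (\<lambda>b. \<Sum>i<k. b i *\<^sub>R Y i)"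
      have V: "V b \<in> syms" "j \<in> gens \<Longrightarrow> gen_fun j (V b, p) = (\<Sum>i<k. b i * gen_fun j (Y i, p))" for b j
        unfolding V_def
        using gen_linear_sum[where c = b and X = Y, OF finite_lessThan Y Mf.zero B(2)]
          gen_linear_sum[where c = b and X = Y, OF finite_lessThan Y gen_Mf B(2)] by blast+
      have s: "gen_fun j (V c, p) = c k * t j" if "j \<in> gens" for j
        using c(2)[OF that] V(2)[OF that, of c] by (simp add: lessThan_Suc_atMost[symmetric] M_def)
      have "c k \<noteq> 0"
      proof
        assume 0: "c k = 0"
        have "V c = 0" by (rule syms_determined[OF V(1) B(2)]) (simp add: s 0)
        hence "\<forall>i<k. c i = 0" unfolding V_def by (rule ind)
        thus False using c(1) 0 by (auto simp: le_less)
      qed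
      moreover have "gen_fun j (V (\<lambda>i. c i / c k), p) = gen_fun j (V c, p) / c k" if "j \<in> gens" for j
        unfolding V(2)[OF that] by (simp add: sum_divide_distrib)
      ultimately show "\<exists>V\<in>syms. \<forall>j\<in>gens. gen_fun j (V, p) = t j"
        using V(1) s by (intro bexI[of _ "V (\<lambda>i. c i / c k)"]) auto
    qed
    ultimately show ?thesis using maximal_equivalence B(1) by blast
  qed
  let ?S = "{enat k |k. \<exists>X. ?P k X}"
  have S: "monge_sym_dim m n e U F p = Sup ?S" by (simp add: monge_sym_dim_def sym_dim_def)
  show le: "monge_sym_dim m n e U F p \<le> enat ?N" unfolding S by (rule Sup_least) (use key in auto)
  assume eq: "monge_sym_dim m n e U F p = enat ?N"
  \<comment> \<open>The supremum is attained: otherwise every member of the set would be at most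
    \<open>?N - 1\<close>.\<close>
  have "\<exists>X. ?P ?N X"
  proof (rule ccontr)
    assume no: "\<nexists>X. ?P ?N X"
    have "z \<le> enat (?N - 1)" if z: "z \<in> ?S" for z
    proof -
      obtain k X where k: "z = enat k" "?P k X" using z by blast
      hence "k \<le> ?N" "k \<noteq> ?N" using key[OF k(2)] no by blast+
      thus ?thesis using k(1) by simp
    qed
    hence "Sup ?S \<le> enat (?N - 1)" by (rule Sup_least)
    thus False using eq unfolding S by simp
  qed
  thus "internally_equivalent_at m n e p U F UNIV (model_rhs m n e)" using key by blast
qed

end

theorem theorem1:
  fixes m n :: nat and e :: "nat \<Rightarrow> 'a::euclidean_space"
  assumes "0 < m" and "m \<le> n" and "(m, n) \<noteq> (1, 1)" and "(m, n) \<noteq> (1, 2)"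
    and "jet_frame m n e"
  shows "(\<forall>p. most_symmetric_at m n e UNIV (model_rhs m n e) p)
    \<and> (\<forall>U F p. most_symmetric_at m n e U F p \<longrightarrow>
          internally_equivalent_at m n e p U F UNIV (model_rhs m n e))
    \<and> (m = 1 \<and> n > 2 \<longrightarrow>
          (\<forall>p. monge_sym_dim m n e UNIV (model_rhs m n e) p = enat (2 * n + 5)))
    \<and> (m > 1 \<longrightarrow>
          (\<forall>p. monge_sym_dim m n e UNIV (model_rhs m n e) p = enat (2 * n + 4)))"
proof -
  have mn: "1 \<le> m" "m \<le> n" "2 \<le> n" "m = 1 \<Longrightarrow> 3 \<le> n" using assms(1-4) by (cases "m = 1"; auto)+
  interpret model_equation m n e by unfold_locales (use mn assms(5) in auto)
  have M: "monge m n e U F" if "monge_equation m n e U F" for U F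
    by (rule monge.intro) (use mn assms(5) that in auto)
  have d: "monge_sym_dim m n e UNIV (model_rhs m n e) p = enat N" for p
    by (rule antisym[OF sym_dim_cases(1)[OF UNIV_I] model_dim_ge])
  have "internally_equivalent_at m n e p U F UNIV (model_rhs m n e)" if "most_symmetric_at m n e U F p" for U F p
  proof -
    have eq: "monge_equation m n e U F" "p \<in> U" "enat N \<le> monge_sym_dim m n e U F p"
      using that model_monge_equation d[of p] unfolding most_symmetric_at_def by (metis UNIV_I)+
    show ?thesis
      by (rule monge.sym_dim_cases(2)[OF M[OF eq(1)] eq(2)]) (rule antisym[OF monge.sym_dim_cases(1)[OF M[OF eq(1)] eq(2)] eq(3)])
  qed
  moreover have "most_symmetric_at m n e UNIV (model_rhs m n e) p" for p
    unfolding most_symmetric_at_def d using model_monge_equation monge.sym_dim_cases(1)[OF M] by simp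
  moreover have "monge_sym_dim m n e UNIV (model_rhs m n e) p = enat (2 * n + 5)" if "m = 1 \<and> n > 2" for p
    unfolding d using that by simp
  moreover have "monge_sym_dim m n e UNIV (model_rhs m n e) p = enat (2 * n + 4)" if "m > 1" for p
    unfolding d using that by simp
  ultimately show ?thesis by blast
qed

end
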